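(* Let $\Omega\subset\mathbb{R}^d$ be open and bounded with smooth boundary, let $\gamma>1$, let $k\in\mathbb{N}$ be fixed with $2k>\frac d2+2$, and let $\epsilon\in(0,1)$. Let $V,\phi,\xi,h\in C^\infty(\overline\Omega)$, $g\in C^\infty([0,\infty))$, $H\in C^\infty(\overline\Omega\times\mathbb{R}^d)$, with $g$ increasing, $\phi\geq 0$ in $\Omega$, and $\int_\Omega\phi\,dx=1$. Suppose that: (1) there is $C_1>0$ such that for all $(x,p)\in\Omega\times\mathbb{R}^d$: $-H(x,p)+D_pH(x,p)\cdot p\geq\frac1{C_1}|p|^\gamma-C_1$; (2) there is $C_2>0$ such that for all $(x,p)\in\Omega\times\mathbb{R}^d$: $H(x,p)\geq\frac1{C_2}|p|^\gamma-C_2$; (3) there is $C_3>0$ such that for all $(x,p)\in\Omega\times\mathbb{R}^d$: $|D_pH(x,p)|\leq C_3|p|^{\gamma-1}+C_3$; (4) for all $\delta>0$ there is $C_\delta>0$ such that for all $m\in L^1(\Omega)$ with $m\ge0$: $\max\{\int_\Omega|g(m)|\,dx,\int_\Omega m\,dx\}\leq\delta\int_\Omega m g(m)\,dx+C_\delta$; (5) there is $C_5>0$ such that for all $m\in L^1(\Omega)$ with $m\ge0$: $\int_\Omega m g(m)\,dx\geq -C_5$; (6) for all $(\eta_1,v_1),(\eta_2,v_2)\in\mathcal{A}\times H^{2k}_h(\Omega)$, $$\big\langle F[\eta_1,v_1]-F[\eta_2,v_2],\,(\eta_1,v_1)-(\eta_2,v_2)\big\rangle\geq0 .$$ Then there exists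 a unique weak solution $(m,u)\in H^{2k}(\Omega)\times H^{2k}(\Omega)$ (in the sense of (E1)–(E3) of the context) to the regularized problem $$\begin{cases}-u-H(x,Du)+g(m)-V(x)+\epsilon(m+\Delta^{2k}m)=0&\text{in }\Omega,\\ m-\operatorname{div}\big(mD_pH(x,Du)\big)-\phi+\epsilon\big(u+\xi+\Delta^{2k}(u+\xi)\big)=0&\text{in }\Omega,\\ \frac{\partial}{\partial\mathbf n}\partial^\alpha\Delta^i m=0&\text{on }\partial\Omega,\ \alpha\in\mathbb{N}_0^d,\ i\in\mathbb{N}_0,\ |\alpha|+i=2k-1,\\ \partial^\beta u=\partial^\beta h&\text{on }\partial\Omega,\ \beta\in\mathbb{N}_0^d,\ |\beta|\leq2k-1.\end{cases}$$
   Context: $\mathcal{A}:=\{m\in H^{2k}(\Omega): m\geq0\}$ and $H^{2k}_h(\Omega):=\{w\in H^{2k}(\Omega): w-h\in H^{2k}_0(\Omega)\}$. $\mathbf n$ is the outward unit normal to $\partial\Omega$; $D_pH$ is the gradient of $H$ in its second variable. For fixed $(\eta,v)\in H^{2k}(\Omega)\times H^{2k}(\Omega)$ (with $\eta\geq0$ so that $g(\eta)$ is defined), $F[\eta,v]:L^1(\Omega)\times L^1(\Omega)\to\mathbb{R}$ is $$\big\langle F[\eta,v],(w_1,w_2)\big\rangle:=\int_\Omega\big(-v-H(x,Dv)+g(\eta)-V\big)w_1\,dx+\int_\Omega\Big(\eta-\operatorname{div}\big(\eta D_pH(x,Dv)\big)-\phi\Big)w_2\,dx.$$ Weak solution: a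 pair $(m,u)\in H^{2k}(\Omega)\times H^{2k}(\Omega)$ is a weak solution to the regularized problem if, for all $w\in\mathcal{A}$ and $v\in H^{2k}_0(\Omega)$, (E1) $u\in H^{2k}_h(\Omega)$ and $m\geq0$ in $\Omega$; (E2) $\int_\Omega\big(-u-H(x,Du)+g(m)-V\big)(w-m)\,dx+\int_\Omega\big[\epsilon m(w-m)+\epsilon\sum_{|\alpha|=2k}\partial^\alpha m(\partial^\alpha w-\partial^\alpha m)\big]dx\geq0$; (E3) $\int_\Omega\big(m-\operatorname{div}(mD_pH(x,Du))-\phi\big)v\,dx+\int_\Omega\big[\epsilon\big(uv+\sum_{|\alpha|=2k}\partial^\alpha u\,\partial^\alpha v\big)+\epsilon(\xi+\Delta^{2k}\xi)v\big]dx=0$. *)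

theory Defs
  imports "HOL-Analysis.Analysis"
begin

subsection \<open>Classical partial derivatives and smooth functions\<close>

definition dir_deriv :: "'a::real_normed_vector \<Rightarrow> ('a \<Rightarrow> real) \<Rightarrow> 'a \<Rightarrow> real" where
  "dir_deriv b f x = deriv (\<lambda>t. f (x + t *\<^sub>R b)) 0"

definition dir_derivs :: "'a::real_normed_vector list \<Rightarrow> ('a \<Rightarrow> real) \<Rightarrow> 'a \<Rightarrow> real" where
  "dir_derivs bs f = foldr dir_deriv bs f"

text \<open>\<open>f \<in> C\<^sup>\<infinity>(S)\<close> for an open set \<open>S\<close>.\<close>

definition smooth_on :: "'a::euclidean_space set \<Rightarrow> ('a \<Rightarrow> real) \<Rightarrow> bool" where
  "smooth_on S f \<longleftrightarrow> (\<forall>bs. set bs \<subseteq> Basis \<longrightarrow> dir_derivs bs f differentiable_on S)"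

text \<open>\<open>f \<in> C\<^sup>\<infinity>(closure S)\<close> for an open set \<open>S\<close>: \<open>f\<close> is smooth in \<open>S\<close> and all its partial
  derivatives extend continuously to the closure; the values of \<open>f\<close> itself on the boundary are
  those of the continuous extension. Values off \<open>closure S\<close> are irrelevant.\<close>

definition smooth_on_closure :: "'a::euclidean_space set \<Rightarrow> ('a \<Rightarrow> real) \<Rightarrow> bool" where
  "smooth_on_closure S f \<longleftrightarrow>
     smooth_on S f \<and> continuous_on (closure S) f \<and>
     (\<forall>bs. set bs \<subseteq> Basis \<longrightarrow>
        (\<exists>G. continuous_on (closure S) G \<and> (\<forall>x\<in>S. G x = dir_derivs bs f x)))"

definition laplacian :: "(real ^ 'n \<Rightarrow> real) \<Rightarrow> real ^ 'n \<Rightarrow> real" where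
  "laplacian f x = (\<Sum>i\<in>UNIV. dir_derivs [axis i 1, axis i 1] f x)"

definition grad_p :: "(real ^ 'n \<Rightarrow> real ^ 'n \<Rightarrow> real) \<Rightarrow> real ^ 'n \<Rightarrow> real ^ 'n \<Rightarrow> real ^ 'n" where
  "grad_p H x p = (\<chi> i. dir_deriv (axis i 1) (H x) p)"

text \<open>Smooth boundary: near each boundary point, after relabelling and reorienting the coordinate
  axes, the set is the region above the graph of a smooth function of the remaining coordinates.
  A function of the coordinates other than the \<open>i\<close>-th is encoded as a function on the whole space
  that is constant in direction \<open>axis i 1\<close>.\<close>

definition smooth_boundary :: "(real ^ 'n) set \<Rightarrow> bool" where
  "smooth_boundary \<Omega> \<longleftrightarrow>
     (\<forall>x0 \<in> frontier \<Omega>. \<exists>r>0. \<exists>i. \<exists>\<sigma>\<in>{1, -1}. \<exists>\<theta>.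
        smooth_on UNIV \<theta> \<and> (\<forall>x t. \<theta> (x + t *\<^sub>R axis i 1) = \<theta> x) \<and>
        \<Omega> \<inter> ball x0 r = {x \<in> ball x0 r. \<sigma> * (x $ i) > \<theta> x})"


subsection \<open>Multi-indices\<close>

type_synonym 'n multi_index = "'n \<Rightarrow> nat"

definition mi_order :: "'n::finite multi_index \<Rightarrow> nat" where
  "mi_order \<alpha> = (\<Sum>i\<in>UNIV. \<alpha> i)"

definition mi_unit :: "'n \<Rightarrow> 'n multi_index" where
  "mi_unit i = (\<lambda>j. if j = i then 1 else 0)"

lemma finite_mi_order_le: "finite {\<alpha> :: 'n::finite multi_index. mi_order \<alpha> \<le> s}"
proof (rule finite_subset)
  show "{\<alpha> :: 'n multi_index. mi_order \<alpha> \<le> s} \<subseteq> PiE UNIV (\<lambda>_. {..s})"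
  proof
    fix \<alpha> :: "'n multi_index" assume "\<alpha> \<in> {\<alpha>. mi_order \<alpha> \<le> s}"
    moreover have "\<alpha> i \<le> (\<Sum>i\<in>UNIV. \<alpha> i)" for i by (rule member_le_sum) auto
    ultimately show "\<alpha> \<in> PiE UNIV (\<lambda>_. {..s})"
      unfolding mi_order_def by (auto intro: order_trans)
  qed
  show "finite (PiE (UNIV :: 'n set) (\<lambda>_. {..s}))" by (rule finite_PiE) auto
qed

lemma finite_mi_order_eq: "finite {\<alpha> :: 'n::finite multi_index. mi_order \<alpha> = s}"
  by (rule finite_subset[OF _ finite_mi_order_le[of s]]) auto

text \<open>The index type carries no order, so the order in which the \<open>\<alpha> i\<close> derivatives in direction \<open>i\<close>
  are taken is left to \<open>SOME\<close>; for the smooth functions to which this is applied it does not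
  matter.\<close>

definition mi_list :: "'n::finite multi_index \<Rightarrow> 'n list" where
  "mi_list \<alpha> = (SOME js. \<forall>i. count_list js i = \<alpha> i)"

lemma count_mi_list: "count_list (mi_list \<alpha>) i = \<alpha> i"
proof -
  have "\<exists>js. \<forall>i. count_list js i = \<alpha> i"
  proof -
    obtain xs :: "'a list" where xs: "set xs = UNIV" "distinct xs"
      using finite_distinct_list[OF finite_class.finite_UNIV] by blast
    have rep: "count_list (replicate n a) i = (if i = a then n else 0)" for n and a i :: 'a
      by (induction n) auto
    have "count_list (concat (map (\<lambda>a. replicate (\<alpha> a) a) ys)) i = (if i \<in> set ys then \<alpha> i else 0)"
      if "distinct ys" for ys i
      using that by (induction ys) (auto simp: rep)
    then show ?thesis using xs by (intro exI[of _ "concat (map (\<lambda>a. replicate (\<alpha> a) a) xs)"]) simp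
  qed
  then show ?thesis unfolding mi_list_def by (rule someI2_ex) blast
qed

definition mi_deriv :: "'n::finite multi_index \<Rightarrow> (real ^ 'n \<Rightarrow> real) \<Rightarrow> real ^ 'n \<Rightarrow> real" where
  "mi_deriv \<alpha> f = dir_derivs (map (\<lambda>j. axis j 1) (mi_list \<alpha>)) f"


subsection \<open>Weak derivatives and Sobolev spaces\<close>

text \<open>Elements of \<open>L\<^sup>p\<close> and Sobolev spaces are represented by functions on the whole
  space; only their values almost everywhere in \<open>\<Omega>\<close> matter.\<close>

definition test_fun :: "(real ^ 'n) set \<Rightarrow> (real ^ 'n \<Rightarrow> real) set" where
  "test_fun \<Omega> = {\<psi>. smooth_on UNIV \<psi> \<and> (\<exists>K. compact K \<and> K \<subseteq> \<Omega> \<and> (\<forall>x. x \<notin> K \<longrightarrow> \<psi> x = 0))}"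

definition loc_integrable :: "(real ^ 'n) set \<Rightarrow> (real ^ 'n \<Rightarrow> real) \<Rightarrow> bool" where
  "loc_integrable \<Omega> f \<longleftrightarrow> (\<forall>K. compact K \<and> K \<subseteq> \<Omega> \<longrightarrow> integrable (lebesgue_on K) f)"

definition has_weak_deriv ::
  "(real ^ 'n) set \<Rightarrow> 'n::finite multi_index \<Rightarrow> (real ^ 'n \<Rightarrow> real) \<Rightarrow> (real ^ 'n \<Rightarrow> real) \<Rightarrow> bool" where
  "has_weak_deriv \<Omega> \<alpha> u v \<longleftrightarrow>
     loc_integrable \<Omega> u \<and> loc_integrable \<Omega> v \<and>
     (\<forall>\<psi> \<in> test_fun \<Omega>. (\<integral>x. u x * mi_deriv \<alpha> \<psi> x \<partial>lebesgue_on \<Omega>)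
        = (- 1) ^ mi_order \<alpha> * (\<integral>x. v x * \<psi> x \<partial>lebesgue_on \<Omega>))"

text \<open>A representative of the weak derivative (unique up to null sets, if it exists).\<close>

definition weak_deriv ::
  "(real ^ 'n) set \<Rightarrow> 'n::finite multi_index \<Rightarrow> (real ^ 'n \<Rightarrow> real) \<Rightarrow> real ^ 'n \<Rightarrow> real" where
  "weak_deriv \<Omega> \<alpha> u = (SOME v. has_weak_deriv \<Omega> \<alpha> u v)"

definition weak_grad :: "(real ^ 'n) set \<Rightarrow> (real ^ 'n \<Rightarrow> real) \<Rightarrow> real ^ 'n \<Rightarrow> real ^ 'n" where
  "weak_grad \<Omega> u x = (\<chi> i. weak_deriv \<Omega> (mi_unit i) u x)"

definition weak_div :: "(real ^ 'n) set \<Rightarrow> (real ^ 'n \<Rightarrow> real ^ 'n) \<Rightarrow> real ^ 'n \<Rightarrow> real" where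
  "weak_div \<Omega> X x = (\<Sum>i\<in>UNIV. weak_deriv \<Omega> (mi_unit i) (\<lambda>y. X y $ i) x)"

definition L2 :: "(real ^ 'n) set \<Rightarrow> (real ^ 'n \<Rightarrow> real) set" where
  "L2 \<Omega> = {f. f \<in> borel_measurable (lebesgue_on \<Omega>) \<and> integrable (lebesgue_on \<Omega>) (\<lambda>x. (f x)\<^sup>2)}"

definition sobolev :: "nat \<Rightarrow> (real ^ 'n) set \<Rightarrow> (real ^ 'n \<Rightarrow> real) set" where
  "sobolev s \<Omega> =
     {u \<in> L2 \<Omega>. \<forall>\<alpha>. mi_order \<alpha> \<le> s \<longrightarrow> (\<exists>v \<in> L2 \<Omega>. has_weak_deriv \<Omega> \<alpha> u v)}"

definition sobolev_norm :: "nat \<Rightarrow> (real ^ 'n) set \<Rightarrow> (real ^ 'n \<Rightarrow> real) \<Rightarrow> real" where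
  "sobolev_norm s \<Omega> u =
     sqrt (\<Sum>\<alpha> | mi_order \<alpha> \<le> s. \<integral>x. (weak_deriv \<Omega> \<alpha> u x)\<^sup>2 \<partial>lebesgue_on \<Omega>)"

text \<open>The closure of the test functions in the Sobolev norm.\<close>

definition sobolev0 :: "nat \<Rightarrow> (real ^ 'n) set \<Rightarrow> (real ^ 'n \<Rightarrow> real) set" where
  "sobolev0 s \<Omega> =
     {u \<in> sobolev s \<Omega>. \<forall>e>0. \<exists>\<psi> \<in> test_fun \<Omega>. sobolev_norm s \<Omega> (\<lambda>x. u x - \<psi> x) < e}"

definition sobolev_bdry ::
  "nat \<Rightarrow> (real ^ 'n) set \<Rightarrow> (real ^ 'n \<Rightarrow> real) \<Rightarrow> (real ^ 'n \<Rightarrow> real) set" where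
  "sobolev_bdry s \<Omega> h = {w \<in> sobolev s \<Omega>. (\<lambda>x. w x - h x) \<in> sobolev0 s \<Omega>}"

definition sobolev_nonneg :: "nat \<Rightarrow> (real ^ 'n) set \<Rightarrow> (real ^ 'n \<Rightarrow> real) set" where
  "sobolev_nonneg s \<Omega> = {m \<in> sobolev s \<Omega>. AE x in lebesgue_on \<Omega>. m x \<ge> 0}"


subsection \<open>The mean-field game system\<close>

text \<open>The left-hand sides, without regularization, of the Hamilton--Jacobi and the Fokker--Planck
  equation.\<close>

definition HJ_part ::
  "(real ^ 'n) set \<Rightarrow> (real ^ 'n \<Rightarrow> real ^ 'n \<Rightarrow> real) \<Rightarrow> (real \<Rightarrow> real) \<Rightarrow> (real ^ 'n \<Rightarrow> real)
    \<Rightarrow> (real ^ 'n \<Rightarrow> real) \<Rightarrow> (real ^ 'n \<Rightarrow> real) \<Rightarrow> real ^ 'n \<Rightarrow> real" where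
  "HJ_part \<Omega> H g V m u x = - u x - H x (weak_grad \<Omega> u x) + g (m x) - V x"

definition FP_part ::
  "(real ^ 'n) set \<Rightarrow> (real ^ 'n \<Rightarrow> real ^ 'n \<Rightarrow> real) \<Rightarrow> (real ^ 'n \<Rightarrow> real)
    \<Rightarrow> (real ^ 'n \<Rightarrow> real) \<Rightarrow> (real ^ 'n \<Rightarrow> real) \<Rightarrow> real ^ 'n \<Rightarrow> real" where
  "FP_part \<Omega> H \<phi> m u x =
     m x - weak_div \<Omega> (\<lambda>y. m y *\<^sub>R grad_p H y (weak_grad \<Omega> u y)) x - \<phi> x"

text \<open>The pairing of \<open>F[\<eta>,v]\<close> with \<open>(w1, w2)\<close>.\<close>

definition F_pairing ::
  "(real ^ 'n) set \<Rightarrow> (real ^ 'n \<Rightarrow> real ^ 'n \<Rightarrow> real) \<Rightarrow> (real \<Rightarrow> real) \<Rightarrow> (real ^ 'n \<Rightarrow> real)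
    \<Rightarrow> (real ^ 'n \<Rightarrow> real) \<Rightarrow> (real ^ 'n \<Rightarrow> real) \<Rightarrow> (real ^ 'n \<Rightarrow> real)
    \<Rightarrow> (real ^ 'n \<Rightarrow> real) \<Rightarrow> (real ^ 'n \<Rightarrow> real) \<Rightarrow> real" where
  "F_pairing \<Omega> H g V \<phi> \<eta> v w1 w2 =
     (\<integral>x. HJ_part \<Omega> H g V \<eta> v x * w1 x \<partial>lebesgue_on \<Omega>)
   + (\<integral>x. FP_part \<Omega> H \<phi> \<eta> v x * w2 x \<partial>lebesgue_on \<Omega>)"

definition weak_solution ::
  "(real ^ 'n) set \<Rightarrow> nat \<Rightarrow> real \<Rightarrow> (real ^ 'n \<Rightarrow> real ^ 'n \<Rightarrow> real) \<Rightarrow> (real \<Rightarrow> real)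
    \<Rightarrow> (real ^ 'n \<Rightarrow> real) \<Rightarrow> (real ^ 'n \<Rightarrow> real) \<Rightarrow> (real ^ 'n \<Rightarrow> real) \<Rightarrow> (real ^ 'n \<Rightarrow> real)
    \<Rightarrow> (real ^ 'n \<Rightarrow> real) \<Rightarrow> (real ^ 'n \<Rightarrow> real) \<Rightarrow> bool" where
  "weak_solution \<Omega> k \<epsilon> H g V \<phi> \<xi> h m u \<longleftrightarrow>
     m \<in> sobolev (2 * k) \<Omega> \<and> u \<in> sobolev (2 * k) \<Omega> \<and>
     u \<in> sobolev_bdry (2 * k) \<Omega> h \<and> (AE x in lebesgue_on \<Omega>. m x \<ge> 0) \<and>
     (\<forall>w \<in> sobolev_nonneg (2 * k) \<Omega>.
        (\<integral>x. HJ_part \<Omega> H g V m u x * (w x - m x) \<partial>lebesgue_on \<Omega>)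
      + (\<integral>x. \<epsilon> * m x * (w x - m x)
            + \<epsilon> * (\<Sum>\<alpha> | mi_order \<alpha> = 2 * k.
                weak_deriv \<Omega> \<alpha> m x * (weak_deriv \<Omega> \<alpha> w x - weak_deriv \<Omega> \<alpha> m x))
         \<partial>lebesgue_on \<Omega>) \<ge> 0) \<and>
     (\<forall>v \<in> sobolev0 (2 * k) \<Omega>.
        (\<integral>x. FP_part \<Omega> H \<phi> m u x * v x \<partial>lebesgue_on \<Omega>)
      + (\<integral>x. \<epsilon> * (u x * v x
                + (\<Sum>\<alpha> | mi_order \<alpha> = 2 * k. weak_deriv \<Omega> \<alpha> u x * weak_deriv \<Omega> \<alpha> v x))
            + \<epsilon> * (\<xi> x + (laplacian ^^ (2 * k)) \<xi> x) * v x
         \<partial>lebesgue_on \<Omega>) = 0)"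

end

theory Submission
  imports Defs "HOL-Library.Function_Algebras"
begin

text \<open>Write \<open>u = h + v\<close>. The system is a variational inequality, on the closed convex set of pairs
  \<open>(m, v)\<close> with \<open>m \<ge> 0\<close> and \<open>v \<in> H\<^sup>2\<^sup>k\<^sub>0\<close>, for the operator given by the pairing \<open>F\<close> plus \<open>\<epsilon>\<close> times the
  inner product of \<open>L\<^sup>2\<close> and of the derivatives of order \<open>2k\<close>. Monotonicity of \<open>F\<close> makes it strongly
  monotone, which gives uniqueness; on a ball it is Lipschitz, so the inequality restricted to the
  ball is solved by a contraction, and strong monotonicity keeps the solution inside a large ball.

  The Lipschitz bound needs a Sobolev embedding. A smooth bounded domain is covered by finitely many
  patches with a cone condition, on which averages over dyadically shrinking boxes in the cone
  are compared: two consecutive averages differ by averages of the derivatives of order \<open>2k\<close>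
  only, scaled by a power of the box size. Summing up controls all lower derivatives in \<open>L\<^sup>2\<close> and, as
  \<open>2k > d/2 + 2\<close>, those of order at most two uniformly. Hence the coefficients are evaluated on bounded
  sets only and the divergence may be computed by the classical chain rule.\<close>

section \<open>Variational inequalities for strongly monotone operators\<close>

text \<open>Elements are plain functions that are equal only almost everywhere, and
  \<open>weak_deriv\<close> is an arbitrary choice. No quotient is formed: the abstract part uses a
  positive semidefinite form on a subspace, so limits and fixed points are determined only up to
  seminorm zero. The energy contains just the L2 product and the derivatives of order
  \<open>2k\<close>; all intermediate orders must be recovered from these. The averaging kernel
  comes from the truncated power \<open>t^m / m!\<close>, a primitive of order \<open>m + 1\<close>
  of a unit mass: its dyadic rescalings agree beyond 1, so their difference has compact support. The
  kernel lives on positive \<open>t\<close> away from 0, hence averages at \<open>x\<close> use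
  points of the cone at \<open>x\<close> only, and the estimates reach the boundary without an
  extension operator. Kernels are products of functions of one variable, so weak derivatives are
  tested on products, whose partial derivatives are explicit. In the pairing the divergence is moved
  onto a test function from \<open>sobolev0\<close>; the Lipschitz bound then involves first
  derivatives only, while second derivatives of \<open>u\<close> show that the flux has a weak
  divergence in L2.\<close>

instantiation "fun" :: (type, real_vector) real_vector
begin

definition scaleR_fun :: "real \<Rightarrow> ('a \<Rightarrow> 'b) \<Rightarrow> 'a \<Rightarrow> 'b"
  where "scaleR_fun r f = (\<lambda>x. r *\<^sub>R f x)"

instance
  by standard (auto simp: scaleR_fun_def fun_eq_iff algebra_simps)

end

text \<open>The form is only semidefinite because functions that agree almost everywhere need not be
  equal. The laws are required on \<open>D\<close> alone: outside the Sobolev space the chosen weak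
  derivatives obey no linearity.\<close>

locale semi_inner =
  fixes D :: "'a::real_vector set" and e :: "'a \<Rightarrow> 'a \<Rightarrow> real"
  assumes subspace_D: "subspace D"
    and e_add: "\<lbrakk>x \<in> D; y \<in> D; z \<in> D\<rbrakk> \<Longrightarrow> e (x + y) z = e x z + e y z"
    and e_scale: "\<lbrakk>x \<in> D; z \<in> D\<rbrakk> \<Longrightarrow> e (r *\<^sub>R x) z = r * e x z"
    and e_sym: "\<lbrakk>x \<in> D; y \<in> D\<rbrakk> \<Longrightarrow> e x y = e y x"
    and e_pos: "x \<in> D \<Longrightarrow> 0 \<le> e x x"
begin

definition nrm :: "'a \<Rightarrow> real" where "nrm x = sqrt (e x x)"

text \<open>The limit has to lie in \<open>K\<close>, so this expresses completeness and closedness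
  at once; in a seminorm the limit need not be unique.\<close>

definition seq_complete :: "'a set \<Rightarrow> bool" where
  "seq_complete K \<longleftrightarrow> (\<forall>s. (\<forall>n. s n \<in> K) \<and> (\<forall>r>0. \<exists>N. \<forall>m\<ge>N. \<forall>n\<ge>N. nrm (s m - s n) < r) \<longrightarrow>
     (\<exists>l\<in>K. (\<lambda>n. nrm (s n - l)) \<longlonglongrightarrow> 0))"

definition bounded_functional :: "('a \<Rightarrow> real) \<Rightarrow> real \<Rightarrow> bool" where
  "bounded_functional l C \<longleftrightarrow> (\<forall>x\<in>D. \<forall>y\<in>D. l (x + y) = l x + l y) \<and>
     (\<forall>r. \<forall>x\<in>D. l (r *\<^sub>R x) = r * l x) \<and> (\<forall>x\<in>D. \<bar>l x\<bar> \<le> C * nrm x)"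

lemma D_add: "x \<in> D \<Longrightarrow> y \<in> D \<Longrightarrow> x + y \<in> D"
  and D_scale: "x \<in> D \<Longrightarrow> r *\<^sub>R x \<in> D"
  and D_diff: "x \<in> D \<Longrightarrow> y \<in> D \<Longrightarrow> x - y \<in> D"
  using subspace_D by (auto intro: subspace_add subspace_scale subspace_diff)

lemma functional_diff:
  assumes "bounded_functional l C" "x \<in> D" "y \<in> D"
  shows "l (x - y) = l x - l y"
  using assms unfolding bounded_functional_def
  by (metis D_scale diff_conv_add_uminus mult_minus1 scaleR_minus1_left)

lemma e_add_right: "\<lbrakk>x \<in> D; y \<in> D; z \<in> D\<rbrakk> \<Longrightarrow> e x (y + z) = e x y + e x z"
  by (metis D_add e_add e_sym)

lemma e_scale_right: "\<lbrakk>x \<in> D; z \<in> D\<rbrakk> \<Longrightarrow> e x (r *\<^sub>R z) = r * e x z"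
  by (metis D_scale e_scale e_sym)

lemma e_minus_right: "\<lbrakk>x \<in> D; z \<in> D\<rbrakk> \<Longrightarrow> e x (- z) = - e x z"
  using e_scale_right[of x z "-1"] by simp

lemma e_diff: "\<lbrakk>x \<in> D; y \<in> D; z \<in> D\<rbrakk> \<Longrightarrow> e (x - y) z = e x z - e y z"
  by (metis D_scale diff_conv_add_uminus e_add e_scale mult_minus1 scaleR_minus1_left)

lemma e_diff_right: "\<lbrakk>x \<in> D; y \<in> D; z \<in> D\<rbrakk> \<Longrightarrow> e x (y - z) = e x y - e x z"
  by (metis D_diff e_diff e_sym)

lemmas e_bilinear = e_add e_add_right e_scale e_scale_right e_diff e_diff_right D_add D_scale D_diff

lemma nrm_nonneg: "x \<in> D \<Longrightarrow> 0 \<le> nrm x"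
  by (simp add: nrm_def e_pos)

lemma nrm_square: "x \<in> D \<Longrightarrow> (nrm x)\<^sup>2 = e x x"
  by (simp add: nrm_def e_pos)

lemma Cauchy_Schwarz:
  assumes "x \<in> D" "y \<in> D"
  shows "\<bar>e x y\<bar> \<le> nrm x * nrm y"
proof -
  have p: "0 \<le> e x x + 2 * t * e x y + t\<^sup>2 * e y y" for t
  proof -
    have "0 \<le> e (x + t *\<^sub>R y) (x + t *\<^sub>R y)" using assms by (intro e_pos D_add D_scale)
    also have "\<dots> = e x x + 2 * t * e x y + t\<^sup>2 * e y y"
      using assms e_sym[of x y] by (simp add: e_bilinear power2_eq_square algebra_simps)
    finally show ?thesis .
  qed
  have "(e x y)\<^sup>2 \<le> e x x * e y y"
  proof (cases "e y y = 0")
    case True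
    have "e x y = 0"
    proof (rule ccontr)
      assume n: "e x y \<noteq> 0"
      \<comment> \<open>For \<open>e y y = 0\<close> the quadratic in \<open>p\<close> is affine in
        \<open>t\<close>; at this \<open>t\<close> its value is -1.\<close>
      then show False
        using p[of "- (e x x + 1) / (2 * e x y)"] True by (simp add: field_simps)
    qed
    then show ?thesis using True by simp
  next
    case False
    then have "e y y > 0" using e_pos[OF assms(2)] by simp
    then show ?thesis using p[of "- e x y / e y y"]
      by (simp add: field_simps power2_eq_square)
  qed
  then have "sqrt ((e x y)\<^sup>2) \<le> sqrt (e x x * e y y)" by (rule real_sqrt_le_mono)
  then show ?thesis by (simp add: nrm_def real_sqrt_mult)
qed

lemma nrm_triangle:
  assumes "x \<in> D" "y \<in> D"
  shows "nrm (x + y) \<le> nrm x + nrm y"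
proof (rule power2_le_imp_le)
  have "(nrm (x + y))\<^sup>2 = e x x + 2 * e x y + e y y"
    using assms e_sym[of x y] by (simp add: nrm_square e_bilinear)
  also have "\<dots> \<le> (nrm x + nrm y)\<^sup>2"
    using Cauchy_Schwarz[OF assms] assms by (simp add: power2_sum nrm_square)
  finally show "(nrm (x + y))\<^sup>2 \<le> (nrm x + nrm y)\<^sup>2" .
qed (use assms nrm_nonneg in auto)

lemma nrm_scale: "x \<in> D \<Longrightarrow> nrm (r *\<^sub>R x) = \<bar>r\<bar> * nrm x"
  by (simp add: nrm_def e_bilinear real_sqrt_mult mult.assoc[symmetric] flip: power2_eq_square)

lemma nrm_minus: "x \<in> D \<Longrightarrow> y \<in> D \<Longrightarrow> nrm (x - y) = nrm (y - x)"
  by (simp add: nrm_def e_bilinear)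

lemma nrm_triangle_diff:
  assumes "x \<in> D" "y \<in> D" "z \<in> D"
  shows "nrm (x - z) \<le> nrm (x - y) + nrm (y - z)"
  using nrm_triangle[of "x - y" "y - z"] assms by (simp add: D_diff)

text \<open>Minimization of \<open>\<lambda>w. e w w / 2 - l w\<close>; the parallelogram law makes minimizing sequences
  Cauchy.\<close>

lemma projection_exists:
  assumes B: "B \<subseteq> D" "convex B" "B \<noteq> {}" "seq_complete B"
    and l: "bounded_functional l C"
  shows "\<exists>w\<in>B. \<forall>y\<in>B. l (y - w) \<le> e w (y - w)"
proof -
  define J where "J w = e w w / 2 - l w" for w
  have C: "\<bar>l x\<bar> \<le> C * nrm x" and l_add: "l (x + y) = l x + l y" and l_scale: "l (r *\<^sub>R x) = r * l x"
    if "x \<in> D" "y \<in> D" for x y r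
    using l that unfolding bounded_functional_def by auto
  note l_diff = functional_diff[OF l]
  have bb: "bdd_below (J ` B)"
  proof (rule bdd_belowI2)
    fix x assume "x \<in> B"
    then have x: "x \<in> D" using B by blast
    have "0 \<le> (nrm x - C)\<^sup>2 / 2" by simp
    also have "\<dots> = (nrm x)\<^sup>2 / 2 - C * nrm x + C\<^sup>2 / 2" by (simp add: power2_diff field_simps)
    finally show "- (C\<^sup>2) / 2 \<le> J x" using C[OF x x] x by (simp add: J_def nrm_square)
  qed
  define m where "m = Inf (J ` B)"
  have m: "m \<le> J x" if "x \<in> B" for x unfolding m_def using that bb by (simp add: cINF_lower)
  have "\<exists>x\<in>B. J x < m + 1 / Suc n" for n
    using cInf_lessD[of "J ` B" "m + 1 / Suc n"] B(3) by (auto simp: m_def)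
  then obtain s where s: "\<And>n. s n \<in> B" "\<And>n. J (s n) < m + 1 / Suc n" by metis
  have sD: "s n \<in> D" for n using s B by blast
  have par: "e (a - b) (a - b) \<le> 4 * (J a + J b - 2 * m)" if "a \<in> B" "b \<in> B" for a b
  proof -
    have D: "a \<in> D" "b \<in> D" using that B by auto
    have "(1/2) *\<^sub>R a + (1/2) *\<^sub>R b \<in> B" using B(2) that by (simp add: convex_def)
    then have "m \<le> J ((1/2) *\<^sub>R a + (1/2) *\<^sub>R b)" by (rule m)
    also have "\<dots> = (J a + J b) / 2 - e (a - b) (a - b) / 8"
      using D e_sym[OF D] by (simp add: J_def e_bilinear l_add l_scale field_simps)
    finally show ?thesis by (simp add: field_simps)
  qed
  have "\<exists>l\<in>B. (\<lambda>n. nrm (s n - l)) \<longlonglongrightarrow> 0"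
  proof -
    have "\<exists>N. \<forall>i\<ge>N. \<forall>j\<ge>N. nrm (s i - s j) < r" if r: "r > 0" for r
    proof -
      obtain N where N: "1 / Suc N < r\<^sup>2 / 8"
        using reals_Archimedean[of "r\<^sup>2 / 8"] r by (auto simp: inverse_eq_divide)
      have "nrm (s i - s j) < r" if ij: "i \<ge> N" "j \<ge> N" for i j
      proof (rule power_less_imp_less_base)
        have i: "1 / Suc i \<le> 1 / Suc N" "1 / Suc j \<le> 1 / Suc N" using ij by (auto intro: frac_le)
        have "(nrm (s i - s j))\<^sup>2 = e (s i - s j) (s i - s j)" by (simp add: nrm_square sD D_diff)
        also have "\<dots> \<le> 4 * (J (s i) + J (s j) - 2 * m)" by (rule par) (rule s)+
        also have "\<dots> < r\<^sup>2" using s(2)[of i] s(2)[of j] i N by argo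
        finally show "(nrm (s i - s j))\<^sup>2 < r\<^sup>2" .
      qed (use r in simp)
      then show ?thesis by blast
    qed
    then show ?thesis using B(4) s(1) unfolding seq_complete_def by blast
  qed
  then obtain w where w: "w \<in> B" "(\<lambda>n. nrm (s n - w)) \<longlonglongrightarrow> 0" by blast
  have wD: "w \<in> D" using w B by blast
  \<comment> \<open>\<open>J\<close> is continuous for the seminorm: expanding it at
    \<open>s n\<close> leaves terms that vanish with \<open>nrm (s n - w)\<close>.\<close>
  have Jw: "J w \<le> m"
  proof -
    have "J w \<le> m + 1 / Suc n + (nrm (s n - w))\<^sup>2 / 2 + (nrm w + nrm (s n - w) + C) * nrm (s n - w)" for n
    proof -
      let ?d = "w - s n"
      have dD: "?d \<in> D" by (simp add: wD sD D_diff)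
      have *: "nrm ?d = nrm (s n - w)" using nrm_minus wD sD by blast
      have "J w = J (s n) + e ?d ?d / 2 + e (s n) ?d - l ?d"
        using sD wD e_sym[OF wD sD] by (simp add: J_def e_bilinear l_diff field_simps)
      moreover have "e (s n) ?d \<le> nrm (s n) * nrm ?d" using Cauchy_Schwarz[OF sD dD] by (simp add: abs_le_iff)
      moreover have "nrm (s n) \<le> nrm w + nrm ?d"
        using nrm_triangle[OF wD D_diff[OF sD wD], of n] * by simp
      then have "nrm (s n) * nrm ?d \<le> (nrm w + nrm ?d) * nrm ?d"
        using nrm_nonneg[OF dD] by (rule mult_right_mono)
      moreover have "- l ?d \<le> C * nrm ?d" using C[OF dD dD] by (simp add: abs_le_iff)
      ultimately show ?thesis using s(2)[of n] nrm_square[OF dD] unfolding * by (simp add: algebra_simps)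
    qed
    moreover have "(\<lambda>n. m + 1 / Suc n + (nrm (s n - w))\<^sup>2 / 2 + (nrm w + nrm (s n - w) + C) * nrm (s n - w))
       \<longlonglongrightarrow> m + 0 + 0\<^sup>2 / 2 + (nrm w + 0 + C) * 0"
      by (intro tendsto_intros w LIMSEQ_Suc[OF lim_1_over_n]) simp
    ultimately show ?thesis by (intro LIMSEQ_le_const[of _ m]) auto
  qed
  have "l (y - w) \<le> e w (y - w)" if y: "y \<in> B" for y
  proof -
    have yD: "y \<in> D" using y B by blast
    define d where "d = y - w"
    have dD: "d \<in> D" unfolding d_def using D_diff yD wD by blast
    \<comment> \<open>First-order optimality: \<open>w\<close> is compared with points of the
      segment from \<open>w\<close> to \<open>y\<close>; the increment of \<open>J\<close> is
      divided by \<open>t\<close>, and then \<open>t\<close> tends to 0 from the right.\<close>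
    have "l d \<le> e w d + t / 2 * e d d" if t: "0 < t" "t < 1" for t
    proof -
      have "(1 - t) *\<^sub>R w + t *\<^sub>R y \<in> B" using B(2) w(1) y t by (simp add: convex_alt)
      then have "w + t *\<^sub>R d \<in> B" by (simp add: d_def algebra_simps)
      from m[OF this] have "0 \<le> J (w + t *\<^sub>R d) - J w" using Jw by simp
      also have "\<dots> = t * (e w d + t / 2 * e d d - l d)"
        using e_sym[OF wD dD] wD dD
        by (simp add: J_def e_add e_add_right e_scale e_scale_right D_add D_scale l_add l_scale algebra_simps)
      finally show ?thesis using t by (simp add: zero_le_mult_iff)
    qed
    then have "\<forall>\<^sub>F t in at_right 0. l d \<le> e w d + t / 2 * e d d"
      by (auto simp: eventually_at_right_field intro!: exI[of _ 1])
    moreover have "((\<lambda>t. e w d + t / 2 * e d d) \<longlongrightarrow> e w d + 0 / 2 * e d d) (at_right 0)"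
      by (intro tendsto_intros) simp_all
    ultimately have "l d \<le> e w d + 0 / 2 * e d d"
      by (intro tendsto_lowerbound) auto
    then show ?thesis by (simp add: d_def)
  qed
  then show ?thesis using w(1) by blast
qed

text \<open>The norm bound for \<open>e x - \<tau> l\<close> uses only the Riesz representative of \<open>l\<close> on the
  span of \<open>x\<close> and \<open>d\<close>.\<close>

lemma functional_perturbation:
  assumes l: "bounded_functional l (L * nrm x)" and x: "x \<in> D" and d: "d \<in> D"
    and eps: "\<epsilon> * e x x \<le> l x" and "0 \<le> \<tau>" "0 \<le> L"
  shows "\<bar>e x d - \<tau> * l d\<bar> \<le> sqrt (1 - 2 * \<tau> * \<epsilon> + \<tau>\<^sup>2 * L\<^sup>2) * nrm x * nrm d"
proof -
  have C: "\<bar>l y\<bar> \<le> L * nrm x * nrm y" and l_add: "l (y + z) = l y + l z" and l_scale: "l (r *\<^sub>R y) = r * l y"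
    if "y \<in> D" "z \<in> D" for y z r
    using l that unfolding bounded_functional_def by auto
  show ?thesis
  proof (cases "e x x = 0")
    case True
    then have "nrm x = 0" by (simp add: nrm_def)
    then show ?thesis using C[OF d d] Cauchy_Schwarz[OF x d] by simp
  next
    case False
    then have xp: "e x x > 0" using e_pos[OF x] by simp
    \<comment> \<open>\<open>d'\<close> is the component of \<open>d\<close> orthogonal to
      \<open>x\<close>. The vector \<open>a\<close> represents \<open>l\<close> on the span of
      \<open>x\<close> and \<open>d'\<close>, so the bound on \<open>l\<close> bounds
      \<open>nrm a\<close> by \<open>L * nrm x\<close>.\<close>
    define s where "s = e x d / e x x"
    define d' where "d' = d - s *\<^sub>R x"
    have d': "d' \<in> D" "d = s *\<^sub>R x + d'" unfolding d'_def using x d by (auto intro: D_diff D_scale)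
    have orth: "e x d' = 0" "e d' x = 0"
      using x d xp e_sym[OF x d] by (auto simp: d'_def e_bilinear s_def)
    define \<alpha> where "\<alpha> = l x / e x x"
    define \<beta> where "\<beta> = l d' / e d' d'"
    define a where "a = \<alpha> *\<^sub>R x + \<beta> *\<^sub>R d'"
    have aD: "a \<in> D" unfolding a_def using x d' by (auto intro: D_add D_scale)
    \<comment> \<open>If \<open>e d' d' = 0\<close>, the quotient \<open>\<beta>\<close> is 0 by the
      convention for division by zero, and \<open>l d' = 0\<close> by the bound on
      \<open>l\<close>.\<close>
    have ld': "l d' = \<beta> * e d' d'"
    proof (cases "e d' d' = 0")
      case True
      then have "nrm d' = 0" by (simp add: nrm_def)
      then show ?thesis using C[OF d'(1) d'(1)] True by simp
    qed (simp add: \<beta>_def)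
    have lx: "l x = \<alpha> * e x x" using xp by (simp add: \<alpha>_def)
    have la: "l y = e a y" if "y = r *\<^sub>R x + t *\<^sub>R d'" for y r t
      unfolding that a_def using x d'(1) orth
      by (simp add: e_add e_add_right e_scale e_scale_right D_add D_scale l_add l_scale lx ld')
    have "nrm a \<le> L * nrm x"
    proof (cases "nrm a = 0")
      case False
      have "nrm a * nrm a = l a" using la[OF a_def] nrm_square[OF aD] by (simp add: power2_eq_square)
      also have "\<dots> \<le> L * nrm x * nrm a" using C[OF aD aD] by simp
      finally show ?thesis using False nrm_nonneg[OF aD] by simp
    qed (use nrm_nonneg[OF x] \<open>0 \<le> L\<close> in simp)
    then have a2: "e a a \<le> L\<^sup>2 * e x x"
      using power_mono[of "nrm a" "L * nrm x" 2] nrm_nonneg[OF aD] nrm_square[OF aD] nrm_square[OF x]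
      by (simp add: power_mult_distrib)
    have ax: "e a x = l x" using la[of x 1 0] by simp
    \<comment> \<open>The cross term is \<open>- 2 * \<tau> * l x\<close>, which the lower bound
      \<open>eps\<close> on \<open>l x\<close> estimates by
      \<open>- 2 * \<tau> * \<epsilon> * e x x\<close>.\<close>
    have "(nrm (x - \<tau> *\<^sub>R a))\<^sup>2 = e x x - 2 * \<tau> * l x + \<tau>\<^sup>2 * e a a"
      unfolding nrm_square[OF D_diff[OF x D_scale[OF aD]]]
      using x aD ax e_sym[OF x aD] by (simp add: e_bilinear power2_eq_square algebra_simps)
    also have "\<dots> \<le> (1 - 2 * \<tau> * \<epsilon> + \<tau>\<^sup>2 * L\<^sup>2) * e x x"
      using mult_left_mono[OF eps \<open>0 \<le> \<tau>\<close>] mult_left_mono[OF a2, of "\<tau>\<^sup>2"] by (simp add: algebra_simps)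
    finally have "nrm (x - \<tau> *\<^sub>R a) \<le> sqrt ((1 - 2 * \<tau> * \<epsilon> + \<tau>\<^sup>2 * L\<^sup>2) * e x x)"
      by (rule real_le_rsqrt)
    then have n: "nrm (x - \<tau> *\<^sub>R a) \<le> sqrt (1 - 2 * \<tau> * \<epsilon> + \<tau>\<^sup>2 * L\<^sup>2) * nrm x"
      by (simp add: nrm_def real_sqrt_mult)
    have "e x d - \<tau> * l d = e (x - \<tau> *\<^sub>R a) d"
      using x aD d la[of d s 1] d'(2) by (simp add: e_diff e_scale D_scale)
    also have "\<bar>\<dots>\<bar> \<le> nrm (x - \<tau> *\<^sub>R a) * nrm d"
      using x aD d by (intro Cauchy_Schwarz D_diff D_scale)
    also have "\<dots> \<le> sqrt (1 - 2 * \<tau> * \<epsilon> + \<tau>\<^sup>2 * L\<^sup>2) * nrm x * nrm d"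
      using n nrm_nonneg[OF d] by (rule mult_right_mono)
    finally show ?thesis .
  qed
qed

text \<open>Banach iteration. Since limits are unique only up to seminorm zero, the limit is a fixed
  point in that sense, and bounded functionals see no difference.\<close>

lemma contraction_fixpoint:
  assumes B: "B \<subseteq> D" "B \<noteq> {}" "seq_complete B"
    and T: "\<And>z. z \<in> B \<Longrightarrow> T z \<in> B"
    and q: "0 \<le> q" "q < 1" "\<And>z w. z \<in> B \<Longrightarrow> w \<in> B \<Longrightarrow> nrm (T z - T w) \<le> q * nrm (z - w)"
  shows "\<exists>z\<in>B. nrm (T z - z) = 0"
proof -
  obtain z0 where z0: "z0 \<in> B" using B by blast
  define s where "s n = (T ^^ n) z0" for n
  have sB: "s n \<in> B" for n by (induction n) (auto simp: s_def z0 T)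
  then have sD: "s n \<in> D" for n using B by blast
  have step: "nrm (s (Suc n) - s n) \<le> q ^ n * nrm (s 1 - s 0)" for n
  proof (induction n)
    case (Suc n)
    have "nrm (s (Suc (Suc n)) - s (Suc n)) \<le> q * nrm (s (Suc n) - s n)"
      using q(3)[OF sB sB, of "Suc n" n] by (simp add: s_def)
    also have "\<dots> \<le> q * (q ^ n * nrm (s 1 - s 0))" using Suc q by (intro mult_left_mono)
    finally show ?case by (simp add: mult.assoc)
  qed simp
  define M where "M = nrm (s 1 - s 0)"
  have M: "0 \<le> M" unfolding M_def by (intro nrm_nonneg D_diff sD)
  have far: "nrm (s (n + k) - s n) \<le> q ^ n * M / (1 - q)" for n k
  proof -
    have "nrm (s (n + k) - s n) \<le> q ^ n * M * (\<Sum>i<k. q ^ i)"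
    proof (induction k)
      case 0
      have "s n - s n = 0 *\<^sub>R s n" by simp
      then show ?case using nrm_scale[OF sD, of 0 n] by simp
    next
      case (Suc k)
      have "nrm (s (n + Suc k) - s n) \<le> nrm (s (Suc (n + k)) - s (n + k)) + nrm (s (n + k) - s n)"
        using nrm_triangle_diff[OF sD sD sD] by simp
      also have "\<dots> \<le> q ^ (n + k) * M + q ^ n * M * (\<Sum>i<k. q ^ i)"
        using step[of "n + k"] Suc by (simp add: M_def)
      also have "\<dots> = q ^ n * M * (\<Sum>i<Suc k. q ^ i)" by (simp add: algebra_simps power_add)
      finally show ?case .
    qed
    also have "\<dots> \<le> q ^ n * M * (1 / (1 - q))"
    proof (rule mult_left_mono)
      show "(\<Sum>i<k. q ^ i) \<le> 1 / (1 - q)"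
        using sum_le_suminf[of "\<lambda>i. q ^ i" "{..<k}"] suminf_geometric[of q] summable_geometric[of q] q
        by auto
    qed (use q M in simp)
    finally show ?thesis by simp
  qed
  have lim0: "(\<lambda>n. q ^ n * M / (1 - q)) \<longlonglongrightarrow> 0"
    using tendsto_mult_right[OF LIMSEQ_realpow_zero[OF q(1,2)], of "M / (1 - q)"] by simp
  have "\<exists>N. \<forall>m\<ge>N. \<forall>n\<ge>N. nrm (s m - s n) < r" if r: "r > 0" for r
  proof -
    obtain N where N: "\<And>n. n \<ge> N \<Longrightarrow> q ^ n * M / (1 - q) < r"
      using order_tendstoD(2)[OF lim0 r] unfolding eventually_sequentially by blast
    have *: "nrm (s m - s n) < r" if "n \<ge> N" "m \<ge> n" for m n
      using far[of n "m - n"] N[OF that(1)] that by simp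
    have "nrm (s m - s n) < r" if "n \<ge> N" "m \<ge> N" for m n
      using *[of n m] *[of m n] that nrm_minus[OF sD sD, of m n] by (cases "m \<ge> n") auto
    then show ?thesis by blast
  qed
  then obtain z where z: "z \<in> B" "(\<lambda>n. nrm (s n - z)) \<longlonglongrightarrow> 0"
    using B(3) sB unfolding seq_complete_def by blast
  have zD: "z \<in> D" and TD: "T z \<in> D" using z B T by auto
  have "nrm (T z - z) \<le> q * nrm (s n - z) + nrm (s (Suc n) - z)" for n
  proof -
    have "nrm (T z - z) \<le> nrm (T z - s (Suc n)) + nrm (s (Suc n) - z)"
      by (rule nrm_triangle_diff[OF TD sD zD])
    also have "nrm (T z - s (Suc n)) \<le> q * nrm (z - s n)"
      using q(3)[OF z(1) sB, of n] by (simp add: s_def)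
    finally show ?thesis using nrm_minus[OF zD sD] by simp
  qed
  moreover have "(\<lambda>n. q * nrm (s n - z) + nrm (s (Suc n) - z)) \<longlonglongrightarrow> q * 0 + 0"
    by (intro tendsto_intros z(2) LIMSEQ_Suc[OF z(2)])
  ultimately have "nrm (T z - z) \<le> 0" by (intro LIMSEQ_le_const[of _ 0]) auto
  then show ?thesis using z(1) nrm_nonneg[OF D_diff[OF TD zD]] by force
qed

text \<open>\<open>z\<close> solves the inequality when it is the projection onto \<open>B\<close>
  of \<open>z - \<tau> A z\<close>, that is, when \<open>projection_exists\<close> for the
  functional \<open>e z - \<tau> A z\<close> returns \<open>z\<close>. The projection map contracts
  by the factor \<open>sqrt (1 - 2 \<tau> \<epsilon> + \<tau>^2 L^2)\<close>, and
  \<open>\<tau> = \<epsilon> / L^2\<close> minimizes this factor.\<close>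

lemma vi_exists_bounded:
  assumes B: "B \<subseteq> D" "convex B" "B \<noteq> {}" "seq_complete B"
    and A: "\<And>z. z \<in> B \<Longrightarrow> bounded_functional (A z) (C z)"
    and mono: "\<epsilon> > 0" "\<And>z w. z \<in> B \<Longrightarrow> w \<in> B \<Longrightarrow> \<epsilon> * e (z - w) (z - w) \<le> A z (z - w) - A w (z - w)"
    and lip: "\<And>z w d. z \<in> B \<Longrightarrow> w \<in> B \<Longrightarrow> d \<in> D \<Longrightarrow> \<bar>A z d - A w d\<bar> \<le> L * nrm (z - w) * nrm d"
  shows "\<exists>z\<in>B. \<forall>w\<in>B. 0 \<le> A z (w - z)"
proof -
  \<comment> \<open>Enlarging \<open>L\<close> to at least \<open>\<epsilon>\<close> makes
    \<open>L'\<close> positive and keeps \<open>1 - (\<epsilon> / L')^2\<close> nonnegative.\<close>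
  define L' where "L' = max L \<epsilon>"
  have L': "L \<le> L'" "\<epsilon> \<le> L'" "0 < L'" using mono by (auto simp: L'_def)
  define \<tau> where "\<tau> = \<epsilon> / L'\<^sup>2"
  define q where "q = sqrt (1 - 2 * \<tau> * \<epsilon> + \<tau>\<^sup>2 * L'\<^sup>2)"
  have \<tau>: "0 < \<tau>" using mono L' by (simp add: \<tau>_def)
  have q2: "1 - 2 * \<tau> * \<epsilon> + \<tau>\<^sup>2 * L'\<^sup>2 = 1 - (\<epsilon> / L')\<^sup>2"
    using L' by (simp add: \<tau>_def field_simps power2_eq_square)
  have "0 < \<epsilon> / L'" "\<epsilon> / L' \<le> 1" using L' mono by auto
  then have q: "0 \<le> q" "q < 1" unfolding q_def q2 by (auto simp: power_le_one)
  have Al: "A z (x + y) = A z x + A z y" "A z (r *\<^sub>R x) = r * A z x" "\<bar>A z x\<bar> \<le> C z * nrm x"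
    if "z \<in> B" "x \<in> D" "y \<in> D" for x y z r using A[OF that(1)] that unfolding bounded_functional_def by auto
  note A_diff = functional_diff[OF A]
  have "\<exists>w\<in>B. \<forall>y\<in>B. e z (y - w) - \<tau> * A z (y - w) \<le> e w (y - w)" if z: "z \<in> B" for z
  proof (rule projection_exists[OF B, where l = "\<lambda>d. e z d - \<tau> * A z d"])
    have zD: "z \<in> D" using z B by blast
    show "bounded_functional (\<lambda>d. e z d - \<tau> * A z d) (nrm z + \<tau> * C z)"
      unfolding bounded_functional_def
    proof (intro conjI ballI allI)
      fix x assume x: "x \<in> D"
      have "\<bar>e z x - \<tau> * A z x\<bar> \<le> \<bar>e z x\<bar> + \<tau> * \<bar>A z x\<bar>" using \<tau> abs_triangle_ineq4[of "e z x" "\<tau> * A z x"] by (simp add: abs_mult)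
      also have "\<dots> \<le> nrm z * nrm x + \<tau> * (C z * nrm x)"
        using Cauchy_Schwarz[OF zD x] Al(3)[OF z x x] \<tau> by (intro add_mono mult_left_mono) auto
      finally show "\<bar>e z x - \<tau> * A z x\<bar> \<le> (nrm z + \<tau> * C z) * nrm x" by (simp add: algebra_simps)
    qed (use z zD in \<open>simp_all add: Al e_bilinear algebra_simps\<close>)
  qed
  then obtain T where T: "\<And>z. z \<in> B \<Longrightarrow> T z \<in> B"
      "\<And>z y. z \<in> B \<Longrightarrow> y \<in> B \<Longrightarrow> e z (y - T z) - \<tau> * A z (y - T z) \<le> e (T z) (y - T z)" by metis
  \<comment> \<open>The inequality for \<open>T z\<close> is tested with \<open>T w\<close> and vice
    versa; their sum bounds \<open>e d d\<close> by the perturbed functional applied to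
    \<open>d\<close>.\<close>
  have contr: "nrm (T z - T w) \<le> q * nrm (z - w)" if zw: "z \<in> B" "w \<in> B" for z w
  proof -
    have D: "z \<in> D" "w \<in> D" "T z \<in> D" "T w \<in> D" using zw T B by auto
    define d where "d = T z - T w"
    have d: "d \<in> D" "z - w \<in> D" unfolding d_def using D by (auto intro: D_diff)
    have neg: "T w - T z = - d" by (simp add: d_def)
    have A_neg: "A z (- d) = - A z d" using Al(2)[OF zw(1) d(1) d(1), of "-1"] by simp
    have "- e z d + \<tau> * A z d \<le> - e (T z) d"
      using T(2)[OF zw(1) T(1)[OF zw(2)]] D d(1) zw unfolding neg by (simp add: A_neg e_minus_right)
    moreover have "e w d - \<tau> * A w d \<le> e (T w) d"
      using T(2)[OF zw(2) T(1)[OF zw(1)]] unfolding d_def by simp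
    moreover have "e d d = e (T z) d - e (T w) d" using D d e_diff[OF D(3,4) d(1)] by (simp add: d_def)
    ultimately have "e d d \<le> e (z - w) d - \<tau> * (A z d - A w d)"
      using D d by (simp add: e_diff algebra_simps)
    also have "\<dots> \<le> \<bar>e (z - w) d - \<tau> * (A z d - A w d)\<bar>" by simp
    also have "\<dots> \<le> q * nrm (z - w) * nrm d" unfolding q_def
    proof (rule functional_perturbation[where l = "\<lambda>d. A z d - A w d"])
      show "bounded_functional (\<lambda>d. A z d - A w d) (L' * nrm (z - w))"
        unfolding bounded_functional_def
      proof (intro conjI ballI allI)
        fix x assume x: "x \<in> D"
        have "\<bar>A z x - A w x\<bar> \<le> L * (nrm (z - w) * nrm x)" using lip[OF zw x] by simp
        also have "\<dots> \<le> L' * (nrm (z - w) * nrm x)"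
          using L' nrm_nonneg x d by (intro mult_right_mono) auto
        finally show "\<bar>A z x - A w x\<bar> \<le> L' * nrm (z - w) * nrm x" by simp
      qed (use zw in \<open>simp_all add: Al algebra_simps\<close>)
      show "\<epsilon> * e (z - w) (z - w) \<le> A z (z - w) - A w (z - w)" by (rule mono(2)[OF zw])
    qed (use d \<tau> L' in auto)
    finally have le: "nrm d * nrm d \<le> q * nrm (z - w) * nrm d"
      using nrm_square[OF d(1)] by (simp add: power2_eq_square)
    show ?thesis
    proof (cases "nrm d = 0")
      case True
      then show ?thesis using q nrm_nonneg[OF d(2)] by (simp add: d_def)
    next
      case False
      then show ?thesis using le nrm_nonneg[OF d(1)] by (simp add: d_def)
    qed
  qed
  obtain z where z: "z \<in> B" "nrm (T z - z) = 0"
    using contraction_fixpoint[OF B(1,3,4) T(1) q contr] by blast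
  have D: "z \<in> D" "T z \<in> D" using z T B by auto
  have n0: "nrm (z - T z) = 0" using z(2) nrm_minus[OF D] by simp
  have Cz: "0 \<le> A z (w - z)" if w: "w \<in> B" for w
  proof -
    have wD: "w \<in> D" using w B by blast
    \<comment> \<open>\<open>z\<close> and \<open>T z\<close> are at seminorm distance zero, so
      \<open>A z\<close> and the form do not distinguish them, and the inequality for
      \<open>T z\<close> passes to \<open>z\<close>.\<close>
    have Az: "A z (z - T z) = 0" using Al(3)[OF z(1) D_diff[OF D] D_diff[OF D]] n0 by simp
    have ez: "e (z - T z) (w - T z) = 0"
      using Cauchy_Schwarz[OF D_diff[OF D] D_diff[OF wD D(2)]] n0 by simp
    have "\<tau> * A z (w - T z) \<ge> e z (w - T z) - e (T z) (w - T z)"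
      using T(2)[OF z(1) w] by simp
    also have "e z (w - T z) - e (T z) (w - T z) = e (z - T z) (w - T z)"
      using D wD by (simp add: e_diff D_diff)
    finally have "A z (w - T z) \<ge> 0" using ez \<tau> by (simp add: zero_le_mult_iff)
    moreover have "A z (w - z) = A z (w - T z) - A z (z - T z)"
      using D wD z(1) by (simp add: A_diff D_diff)
    ultimately show ?thesis using Az by simp
  qed
  then show ?thesis using z(1) by blast
qed

text \<open>Testing strong monotonicity with a fixed \<open>z0\<close> shows that a solution on the
  ball satisfies \<open>nrm (z - z0) \<le> \<bar>C z0\<bar> / \<epsilon>\<close>, whatever the
  radius. The radius \<open>R\<close> exceeds the resulting bound on \<open>nrm z\<close> by 1;
  hence a short step from the solution towards any point of \<open>K\<close> stays in the ball, and
  the inequality for this step scales up.\<close>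

theorem vi_exists:
  assumes K: "K \<subseteq> D" "convex K" "K \<noteq> {}" "seq_complete K"
    and A: "\<And>z. z \<in> K \<Longrightarrow> bounded_functional (A z) (C z)"
    and mono: "\<epsilon> > 0" "\<And>z w. z \<in> K \<Longrightarrow> w \<in> K \<Longrightarrow> \<epsilon> * e (z - w) (z - w) \<le> A z (z - w) - A w (z - w)"
    and lip: "\<And>R. \<exists>L. \<forall>z\<in>K. \<forall>w\<in>K. nrm z \<le> R \<longrightarrow> nrm w \<le> R \<longrightarrow>
       (\<forall>d\<in>D. \<bar>A z d - A w d\<bar> \<le> L * nrm (z - w) * nrm d)"
  shows "\<exists>z\<in>K. \<forall>w\<in>K. 0 \<le> A z (w - z)"
proof -
  obtain z0 where z0: "z0 \<in> K" using K by blast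
  have z0D: "z0 \<in> D" using z0 K by blast
  define R where "R = nrm z0 + \<bar>C z0\<bar> / \<epsilon> + 1"
  define B where "B = {z \<in> K. nrm z \<le> R}"
  have Al: "A z (r *\<^sub>R x) = r * A z x" "\<bar>A z x\<bar> \<le> C z * nrm x"
    if "z \<in> K" "x \<in> D" for x z r using A[OF that(1)] that unfolding bounded_functional_def by auto
  have nz: "nrm z \<le> R" "nrm (z - z0) \<le> nrm z + nrm z0" if "z \<in> K" "nrm (z - z0) \<le> \<bar>C z0\<bar> / \<epsilon>" for z
  proof -
    have zD: "z \<in> D" using that K by blast
    show "nrm z \<le> R" using nrm_triangle[OF z0D D_diff[OF zD z0D]] that by (simp add: R_def)
    show "nrm (z - z0) \<le> nrm z + nrm z0"
      using nrm_triangle[OF zD D_scale[OF z0D], of "-1"] nrm_scale[OF z0D, of "-1"] by simp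
  qed
  obtain L where L: "\<And>z w d. z \<in> B \<Longrightarrow> w \<in> B \<Longrightarrow> d \<in> D \<Longrightarrow> \<bar>A z d - A w d\<bar> \<le> L * nrm (z - w) * nrm d"
    using lip[of R] unfolding B_def by blast
  have "\<exists>z\<in>B. \<forall>w\<in>B. 0 \<le> A z (w - z)"
  proof (rule vi_exists_bounded[where C = C and \<epsilon> = \<epsilon> and L = L])
    show "B \<subseteq> D" using K by (auto simp: B_def)
    show "convex B"
    proof (rule convexI)
      fix u v :: real and a b
      assume ab: "a \<in> B" "b \<in> B" and uv: "0 \<le> u" "0 \<le> v" "u + v = 1"
      have D: "a \<in> D" "b \<in> D" using ab K by (auto simp: B_def)
      have "nrm (u *\<^sub>R a + v *\<^sub>R b) \<le> u * nrm a + v * nrm b"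
        using nrm_triangle[of "u *\<^sub>R a" "v *\<^sub>R b"] D uv by (simp add: D_scale nrm_scale)
      also have "\<dots> \<le> u * R + v * R" using ab uv by (intro add_mono mult_left_mono) (auto simp: B_def)
      finally show "u *\<^sub>R a + v *\<^sub>R b \<in> B"
        using K(2) ab uv by (auto simp: B_def convex_def simp flip: distrib_right)
    qed
    show "B \<noteq> {}" using z0 mono by (auto simp: B_def R_def)
    show "seq_complete B"
      unfolding seq_complete_def
    proof (intro allI impI, elim conjE)
      fix s :: "nat \<Rightarrow> 'a" assume s: "\<forall>n. s n \<in> B" "\<forall>r>0. \<exists>N. \<forall>m\<ge>N. \<forall>n\<ge>N. nrm (s m - s n) < r"
      then obtain l where l: "l \<in> K" "(\<lambda>n. nrm (s n - l)) \<longlonglongrightarrow> 0"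
        using K(4) unfolding seq_complete_def B_def by blast
      have lD: "l \<in> D" using l K by blast
      have "nrm l \<le> R + nrm (s n - l)" for n
      proof -
        have sD: "s n \<in> D" and "nrm (s n) \<le> R" using s(1) K by (auto simp: B_def)
        then show ?thesis
          using nrm_triangle[OF sD D_diff[OF lD sD]] nrm_minus[OF lD sD] by simp
      qed
      moreover have "(\<lambda>n. R + nrm (s n - l)) \<longlonglongrightarrow> R + 0" by (intro tendsto_intros l)
      ultimately have "nrm l \<le> R" by (intro LIMSEQ_le_const[of _ R]) auto
      then show "\<exists>l\<in>B. (\<lambda>n. nrm (s n - l)) \<longlonglongrightarrow> 0" using l by (auto simp: B_def)
    qed
  qed (use A mono L in \<open>auto simp: B_def\<close>)
  then obtain z where z: "z \<in> B" "\<And>w. w \<in> B \<Longrightarrow> 0 \<le> A z (w - z)" by blast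
  have zK: "z \<in> K" and zD: "z \<in> D" using z K by (auto simp: B_def)
  have z0B: "z0 \<in> B" using z0 mono by (auto simp: B_def R_def)
  define d where "d = z - z0"
  have dD: "d \<in> D" unfolding d_def by (rule D_diff[OF zD z0D])
  have "\<epsilon> * e d d \<le> A z d - A z0 d" unfolding d_def by (rule mono(2)[OF zK z0])
  also have "A z d \<le> 0"
    using z(2)[OF z0B] Al(1)[OF zK dD, of "-1"] by (simp add: d_def)
  also have "0 - A z0 d \<le> \<bar>C z0\<bar> * nrm d"
    using Al(2)[OF z0 dD] mult_right_mono[OF abs_ge_self[of "C z0"] nrm_nonneg[OF dD]] by linarith
  finally have "\<epsilon> * (nrm d * nrm d) \<le> \<bar>C z0\<bar> * nrm d"
    using nrm_square[OF dD] by (simp add: power2_eq_square)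
  then have nd: "nrm d \<le> \<bar>C z0\<bar> / \<epsilon>"
    using mono(1) nrm_nonneg[OF dD] by (cases "nrm d = 0") (auto simp: field_simps)
  then have zR: "nrm z \<le> R - 1"
    using nrm_triangle[OF z0D dD] by (simp add: R_def d_def)
  have "0 \<le> A z (w - z)" if w: "w \<in> K" for w
  proof -
    have wD: "w \<in> D" using w K by blast
    have dw: "w - z \<in> D" by (rule D_diff[OF wD zD])
    \<comment> \<open>The step has length \<open>t * nrm (w - z) \<le> 1\<close>, which is the slack
      between \<open>R - 1\<close> and \<open>R\<close>.\<close>
    define t where "t = 1 / (1 + nrm (w - z))"
    have t: "0 < t" "t \<le> 1" "t * nrm (w - z) \<le> 1" using nrm_nonneg[OF dw] by (auto simp: t_def)
    have "(1 - t) *\<^sub>R z + t *\<^sub>R w \<in> K" using K(2) zK w t by (simp add: convex_alt)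
    then have K1: "z + t *\<^sub>R (w - z) \<in> K" by (simp add: algebra_simps)
    have "nrm (z + t *\<^sub>R (w - z)) \<le> R"
      using nrm_triangle[OF zD D_scale[OF dw, of t]] nrm_scale[OF dw, of t] zR t by simp
    with K1 have "0 \<le> A z ((z + t *\<^sub>R (w - z)) - z)" by (intro z(2)) (simp add: B_def)
    then have "0 \<le> t * A z (w - z)" using Al(1)[OF zK dw] by simp
    then show ?thesis using t by (simp add: zero_le_mult_iff)
  qed
  then show ?thesis using zK by blast
qed

end

section \<open>Smooth functions of one variable\<close>

text \<open>Finite order of smoothness by recursion on the derivative: closure under sums, products
  and affine substitutions follows by induction on the order with the functions generalized.\<close>

primrec smooth_upto :: "nat \<Rightarrow> (real \<Rightarrow> real) \<Rightarrow> bool" where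
  "smooth_upto 0 f \<longleftrightarrow> True"
| "smooth_upto (Suc n) f \<longleftrightarrow> (\<forall>x. f field_differentiable at x) \<and> smooth_upto n (deriv f)"

definition smooth_real :: "(real \<Rightarrow> real) \<Rightarrow> bool" where
  "smooth_real f \<longleftrightarrow> (\<forall>n. smooth_upto n f)"

lemma smooth_upto_SucD: "smooth_upto (Suc n) f \<Longrightarrow> smooth_upto n f"
  by (induction n arbitrary: f) auto

lemma smooth_upto_SucI:
  assumes "\<And>x. (f has_field_derivative f' x) (at x)" "smooth_upto n f'"
  shows "smooth_upto (Suc n) f"
proof -
  have "deriv f = f'" using assms(1) by (auto intro: DERIV_imp_deriv)
  then show ?thesis using assms by (auto simp: field_differentiable_def)
qed

lemma smooth_upto_DERIV: "smooth_upto (Suc n) f \<Longrightarrow> (f has_field_derivative deriv f x) (at x)"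
  by (simp add: DERIV_deriv_iff_field_differentiable)

lemma smooth_upto_const: "smooth_upto n (\<lambda>x. c)"
  by (induction n arbitrary: c) auto

lemma smooth_upto_add:
  "smooth_upto n f \<Longrightarrow> smooth_upto n g \<Longrightarrow> smooth_upto n (\<lambda>x. f x + g x)"
proof (induction n arbitrary: f g)
  case (Suc n)
  show ?case
    by (rule smooth_upto_SucI[where f' = "\<lambda>x. deriv f x + deriv g x"])
      (use Suc in \<open>auto intro!: derivative_intros simp: DERIV_deriv_iff_field_differentiable\<close>)
qed simp

lemma smooth_upto_mult:
  "smooth_upto n f \<Longrightarrow> smooth_upto n g \<Longrightarrow> smooth_upto n (\<lambda>x. f x * g x)"
proof (induction n arbitrary: f g)
  case (Suc n)
  show ?case
  proof (rule smooth_upto_SucI[where f' = "\<lambda>x. deriv f x * g x + deriv g x * f x"])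
    show "smooth_upto n (\<lambda>x. deriv f x * g x + deriv g x * f x)"
      using Suc.prems by (intro smooth_upto_add Suc.IH smooth_upto_SucD[of n f] smooth_upto_SucD[of n g]) auto
    show "((\<lambda>x. f x * g x) has_real_derivative deriv f x * g x + deriv g x * f x) (at x)" for x
      using Suc.prems by (intro DERIV_mult smooth_upto_DERIV)
  qed
qed simp

lemma smooth_upto_affine:
  "smooth_upto n f \<Longrightarrow> smooth_upto n (\<lambda>x. f (a * x + b))"
proof (induction n arbitrary: f)
  case (Suc n)
  show ?case
  proof (rule smooth_upto_SucI[where f' = "\<lambda>x. deriv f (a * x + b) * a"])
    show "smooth_upto n (\<lambda>x. deriv f (a * x + b) * a)"
      using Suc by (intro smooth_upto_mult smooth_upto_const) auto
    show "((\<lambda>x. f (a * x + b)) has_real_derivative deriv f (a * x + b) * a) (at x)" for x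
      by (rule DERIV_chain2[OF smooth_upto_DERIV[OF Suc.prems]]) (auto intro!: derivative_eq_intros)
  qed
qed simp

lemma smooth_real_const: "smooth_real (\<lambda>x. c)"
  by (simp add: smooth_real_def smooth_upto_const)

lemma smooth_real_add: "smooth_real f \<Longrightarrow> smooth_real g \<Longrightarrow> smooth_real (\<lambda>x. f x + g x)"
  by (simp add: smooth_real_def smooth_upto_add)

lemma smooth_real_mult: "smooth_real f \<Longrightarrow> smooth_real g \<Longrightarrow> smooth_real (\<lambda>x. f x * g x)"
  by (simp add: smooth_real_def smooth_upto_mult)

lemma smooth_real_diff: "smooth_real f \<Longrightarrow> smooth_real g \<Longrightarrow> smooth_real (\<lambda>x. f x - g x)"
  using smooth_real_add[of f "\<lambda>x. (-1) * g x"] smooth_real_mult[OF smooth_real_const[of "-1"], of g] by simp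

lemma smooth_real_affine: "smooth_real f \<Longrightarrow> smooth_real (\<lambda>x. f (a * x + b))"
  by (simp add: smooth_real_def smooth_upto_affine)

lemma smooth_real_deriv: "smooth_real f \<Longrightarrow> smooth_real (deriv f)"
  unfolding smooth_real_def by (metis smooth_upto.simps(2))

lemma smooth_real_DERIV: "smooth_real f \<Longrightarrow> (f has_field_derivative deriv f x) (at x)"
  unfolding smooth_real_def using smooth_upto_DERIV by blast

lemma smooth_realI:
  assumes "\<And>x. (f has_field_derivative f' x) (at x)" "smooth_real f'"
  shows "smooth_real f"
  unfolding smooth_real_def
proof
  fix n show "smooth_upto n f"
    using smooth_upto_SucI[of f f' n, OF assms(1)] assms(2) smooth_upto_SucD by (auto simp: smooth_real_def)
qed

lemma smooth_real_power: "smooth_real (\<lambda>x. x ^ m)"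
proof (induction m)
  case (Suc m)
  have "smooth_real (\<lambda>x. x)"
    by (rule smooth_realI[where f' = "\<lambda>x. 1"]) (auto intro: derivative_eq_intros smooth_real_const)
  then show ?case using smooth_real_mult Suc by simp
qed (simp add: smooth_real_const)

lemma smooth_real_iterate: "smooth_real f \<Longrightarrow> smooth_real ((deriv ^^ n) f)"
  by (induction n) (auto intro: smooth_real_deriv)

lemma smooth_real_continuous_on: "smooth_real f \<Longrightarrow> continuous_on S f"
  by (meson DERIV_continuous continuous_at_imp_continuous_on smooth_real_DERIV)

text \<open>Derivatives depend on germs only, so functions given piecewise can be differentiated by
  the formula of each piece away from the break points.\<close>

lemma iterated_deriv_eq_on_open:
  assumes "open S" "\<And>x. x \<in> S \<Longrightarrow> f x = g x" "x \<in> S"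
  shows "(deriv ^^ n) f x = (deriv ^^ n) (g :: real \<Rightarrow> real) x"
  using assms(3)
proof (induction n arbitrary: x)
  case (Suc n)
  have "\<forall>\<^sub>F y in nhds x. (deriv ^^ n) f y = (deriv ^^ n) g y"
    using Suc assms(1) eventually_nhds by blast
  then show ?case by (simp add: deriv_cong_ev)
qed (use assms in simp)

lemma iterated_deriv_affine:
  assumes "smooth_real f"
  shows "(deriv ^^ n) (\<lambda>x. c * f (a * x + b)) = (\<lambda>x. c * a ^ n * (deriv ^^ n) f (a * x + b))"
proof (induction n)
  case (Suc n)
  let ?g = "(deriv ^^ n) f"
  have "deriv (\<lambda>x. c * a ^ n * ?g (a * x + b)) x = c * a ^ n * (deriv ?g (a * x + b) * a)" for x
  proof (rule DERIV_imp_deriv, rule DERIV_cmult)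
    show "((\<lambda>x. ?g (a * x + b)) has_real_derivative deriv ?g (a * x + b) * a) (at x)"
      by (rule DERIV_chain2[OF smooth_real_DERIV[OF smooth_real_iterate[OF assms]]])
        (auto intro!: derivative_eq_intros)
  qed
  then show ?case unfolding funpow.simps comp_apply Suc by (auto simp: fun_eq_iff)
qed simp

lemma iterated_deriv_diff:
  assumes "smooth_real f" "smooth_real g"
  shows "(deriv ^^ n) (\<lambda>x. f x - g x) = (\<lambda>x. (deriv ^^ n) f x - (deriv ^^ n) g x)"
proof (induction n)
  case (Suc n)
  show ?case
    by (auto simp: Suc fun_eq_iff intro!: DERIV_imp_deriv DERIV_diff smooth_real_DERIV smooth_real_iterate assms)
qed simp

lemma iterated_deriv_power:
  "(deriv ^^ m) (\<lambda>x. c * x ^ m) = (\<lambda>x::real. c * fact m)"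
proof (induction m arbitrary: c)
  case (Suc m)
  have "deriv (\<lambda>x. c * x ^ Suc m) = (\<lambda>x::real. (c * Suc m) * x ^ m)"
    by (rule ext, rule DERIV_imp_deriv, rule DERIV_cmult[OF DERIV_pow, THEN DERIV_cong]) simp
  then show ?case by (simp only: funpow_Suc_right comp_apply Suc) (simp add: mult_ac)
qed simp

text \<open>The functions \<open>exp (- 1 / x) / x ^ n\<close>, cut off at 0, have derivatives in
  their own linear span, so smoothness follows by induction with \<open>n\<close> arbitrary. At 0
  the difference quotient from the right is \<open>y ^ Suc n / exp y\<close> at
  \<open>y = 1 / h\<close>.\<close>

lemma exp_cutoff_derivative:
  "((\<lambda>x::real. if x > 0 then exp (- 1 / x) / x ^ n else 0) has_field_derivative
     (if x > 0 then - real n * (exp (- 1 / x) / x ^ Suc n) + exp (- 1 / x) / x ^ (n + 2) else 0)) (at x)"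
proof -
  consider "x > 0" | "x < 0" | "x = 0" by linarith
  then show ?thesis
  proof cases
    case 1
    have "((\<lambda>x. exp (- 1 / x) / x ^ n) has_field_derivative
      - real n * (exp (- 1 / x) / x ^ Suc n) + exp (- 1 / x) / x ^ (n + 2)) (at x)"
      using 1 by (auto intro!: derivative_eq_intros simp: field_simps power2_eq_square)
        (cases n; simp add: field_simps)
    moreover have "\<forall>\<^sub>F y in nhds x. exp (- 1 / y) / y ^ n = (if y > 0 then exp (- 1 / y) / y ^ n else 0)"
      using eventually_gt_at_top[of 0] by (intro eventually_nhds_in_open[of "{0<..}", THEN eventually_mono]) (use 1 in auto)
    ultimately show ?thesis using 1 by (simp add: DERIV_cong_ev)
  next
    case 2
    have "((\<lambda>x. 0) has_field_derivative 0) (at x)" by simp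
    moreover have "\<forall>\<^sub>F y in nhds x. 0 = (if y > 0 then exp (- 1 / y) / y ^ n else 0)"
      by (intro eventually_nhds_in_open[of "{..<0}", THEN eventually_mono]) (use 2 in auto)
    ultimately show ?thesis using 2 by (simp add: DERIV_cong_ev)
  next
    case 3
    let ?f = "\<lambda>x::real. if x > 0 then exp (- 1 / x) / x ^ n else 0"
    have "((\<lambda>y. y ^ Suc n / exp y) \<longlongrightarrow> (0::real)) at_top" by (rule tendsto_power_div_exp_0)
    then have "((\<lambda>h. (inverse h) ^ Suc n / exp (inverse h)) \<longlongrightarrow> (0::real)) (at_right 0)"
      by (rule filterlim_compose[OF _ filterlim_inverse_at_top_right])
    then have r: "((\<lambda>h. (?f (0 + h) - ?f 0) / h) \<longlongrightarrow> 0) (at_right 0)"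
    proof (rule Lim_transform_eventually)
      show "\<forall>\<^sub>F h in at_right (0::real). (inverse h) ^ Suc n / exp (inverse h) = (?f (0 + h) - ?f 0) / h"
        by (rule eventually_at_rightI[of _ 1]) (auto simp: exp_minus field_simps)
    qed
    have "((\<lambda>h. (?f (0 + h) - ?f 0) / h) \<longlongrightarrow> 0) (at_left 0)"
      by (rule Lim_transform_eventually[OF tendsto_const]) (auto intro!: eventually_at_leftI[of "-1"])
    with r have "((\<lambda>h. (?f (0 + h) - ?f 0) / h) \<longlongrightarrow> 0) (at 0)" by (simp add: filterlim_at_split)
    then show ?thesis using 3 by (simp add: DERIV_def)
  qed
qed

lemma smooth_upto_exp_cutoff: "smooth_upto k (\<lambda>x. if x > 0 then exp (- 1 / x) / x ^ n else 0)"
proof (induction k arbitrary: n)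
  case (Suc k)
  show ?case
  proof (rule smooth_upto_SucI[OF exp_cutoff_derivative])
    have "smooth_upto k (\<lambda>x. (- real n) * (if x > 0 then exp (- 1 / x) / x ^ Suc n else 0)
        + (if x > 0 then exp (- 1 / x) / x ^ (n + 2) else 0))"
      by (intro smooth_upto_add smooth_upto_mult smooth_upto_const Suc)
    also have "(\<lambda>x. (- real n) * (if x > 0 then exp (- 1 / x) / x ^ Suc n else 0)
        + (if x > 0 then exp (- 1 / x) / x ^ (n + 2) else 0)) =
      (\<lambda>x. if x > 0 then - real n * (exp (- 1 / x) / x ^ Suc n) + exp (- 1 / x) / x ^ (n + 2) else 0)"
      by auto
    finally show "smooth_upto k \<dots>" .
  qed
qed simp

text \<open>A normalized primitive of the bump \<open>b\<close>, a product of two exponential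
  cutoffs facing each other that is positive exactly between 1/2 and 1.\<close>

lemma smooth_step_exists:
  "\<exists>\<sigma>. smooth_real \<sigma> \<and> (\<forall>t\<le>1/2. \<sigma> t = 0) \<and> (\<forall>t\<ge>1. \<sigma> t = 1) \<and> mono \<sigma>"
proof -
  define f where "f x = (if x > 0 then exp (- 1 / x) / x ^ 0 else 0)" for x :: real
  have f: "smooth_real f" using smooth_upto_exp_cutoff[of _ 0] by (simp add: smooth_real_def f_def[abs_def])
  define b where "b t = f (2 * t + (-1)) * f ((-2) * t + 2)" for t
  have b: "smooth_real b" unfolding b_def by (intro smooth_real_mult smooth_real_affine f)
  have b0: "b t = 0" if "t \<le> 1/2 \<or> t \<ge> 1" for t using that by (auto simp: b_def f_def)
  have b_nonneg: "b t \<ge> 0" for t by (simp add: b_def f_def)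
  have b_pos: "b (3/4) > 0" by (simp add: b_def f_def)
  \<comment> \<open>The lower limit 0 lies where \<open>b\<close> vanishes; for negative
    \<open>t\<close> the interval is empty, so \<open>B\<close> is 0 there as well.\<close>
  define B where "B t = integral {0..t} b" for t
  have B0: "B t = 0" if "t \<le> 1/2" for t
    unfolding B_def using that by (intro integral_unique has_integral_is_0) (auto intro: b0)
  have dB: "(B has_field_derivative b t) (at t)" for t
  proof (cases "t < 1/2")
    case True
    have "((\<lambda>t. 0) has_field_derivative 0) (at t)" by simp
    moreover have "\<forall>\<^sub>F y in nhds t. 0 = B y"
      by (intro eventually_nhds_in_open[of "{..<1/2}", THEN eventually_mono]) (use True B0 in auto)
    ultimately show ?thesis using b0[of t] True by (simp add: DERIV_cong_ev)
  next
    case False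
    have "((\<lambda>x. integral {0..x} b) has_real_derivative b t) (at t within {0..t+1})"
      by (rule integral_has_real_derivative) (use False b in \<open>auto intro: smooth_real_continuous_on\<close>)
    then have "((\<lambda>x. integral {0..x} b) has_real_derivative b t) (at t within {0<..<t+1})"
      by (rule DERIV_subset) auto
    then show ?thesis using False unfolding B_def[abs_def] by (subst (asm) at_within_open) auto
  qed
  have monoB: "mono B"
    using DERIV_nonneg_imp_nondecreasing[where f = B] dB b_nonneg by (metis monoI)
  have B1: "B t = B 1" if t: "t \<ge> 1" for t
  proof (cases "t = 1")
    case False
    then show ?thesis
      using DERIV_isconst_end[of 1 t B] t dB b0
      by (metis DERIV_continuous DERIV_isCont atLeastAtMost_iff continuous_at_imp_continuous_on less_eq_real_def)
  qed simp
  have Bpos: "B 1 > 0"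
  proof (rule ccontr)
    assume "\<not> B 1 > 0"
    moreover have "B 1 \<ge> B (3/4)" "B (3/4) \<ge> B 0" "B 0 = 0"
      using monoD[OF monoB, of "3/4" 1] monoD[OF monoB, of 0 "3/4"] B0[of 0] by auto
    ultimately have "integral {0..1} b = 0" by (simp add: B_def)
    then show False
      using integral_eq_0_iff[of 0 1 b] b_nonneg b_pos smooth_real_continuous_on[OF b] by force
  qed
  define \<sigma> where "\<sigma> t = (1 / B 1) * B t" for t
  have "smooth_real B" by (rule smooth_realI[OF dB b])
  then have "smooth_real \<sigma>" unfolding \<sigma>_def by (intro smooth_real_mult smooth_real_const)
  moreover have "\<sigma> t = 1" if "t \<ge> 1" for t using B1[OF that] Bpos by (simp add: \<sigma>_def)
  moreover have "mono \<sigma>" using monoB Bpos by (auto simp: mono_def \<sigma>_def divide_right_mono)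
  moreover have "\<sigma> t = 0" if "t \<le> 1/2" for t using B0[OF that] by (simp add: \<sigma>_def)
  ultimately show ?thesis by blast
qed

definition smooth_step :: "real \<Rightarrow> real" where
  "smooth_step = (SOME \<sigma>. smooth_real \<sigma> \<and> (\<forall>t\<le>1/2. \<sigma> t = 0) \<and> (\<forall>t\<ge>1. \<sigma> t = 1) \<and> mono \<sigma>)"

lemma smooth_step:
  shows smooth_smooth_step: "smooth_real smooth_step"
    and smooth_step_0: "t \<le> 1/2 \<Longrightarrow> smooth_step t = 0"
    and smooth_step_1: "1 \<le> t \<Longrightarrow> smooth_step t = 1"
    and mono_smooth_step: "mono smooth_step"
  using someI_ex[OF smooth_step_exists] unfolding smooth_step_def by auto

lemma smooth_step_range: "0 \<le> smooth_step t" "smooth_step t \<le> 1"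
proof -
  have "smooth_step (min t 0) \<le> smooth_step t" by (rule monoD[OF mono_smooth_step]) simp
  then show "0 \<le> smooth_step t" by (simp add: smooth_step_0)
  have "smooth_step t \<le> smooth_step (max t 1)" by (rule monoD[OF mono_smooth_step]) simp
  then show "smooth_step t \<le> 1" by (simp add: smooth_step_1)
qed

text \<open>The mollifying kernel \<open>avg_ker m\<close> has mass \<open>1\<close> and, like \<open>avg_ker_pot m\<close>, support away from
  \<open>0\<close>; the difference of two consecutive dyadic dilates of it is the \<open>(m + 1)\<close>-st derivative of the
  compactly supported \<open>avg_ker_pot m\<close>.\<close>

definition cut_power :: "nat \<Rightarrow> real \<Rightarrow> real" where
  "cut_power m t = 1 / fact m * (t ^ m * smooth_step t)"

definition avg_ker :: "nat \<Rightarrow> real \<Rightarrow> real" where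
  "avg_ker m = (deriv ^^ Suc m) (cut_power m)"

definition avg_ker_pot :: "nat \<Rightarrow> real \<Rightarrow> real" where
  "avg_ker_pot m t = (1 / 2 ^ m) * cut_power m (2 * t + 0) - cut_power m t"

lemma smooth_cut_power: "smooth_real (cut_power m)"
  unfolding cut_power_def by (intro smooth_real_mult smooth_real_const smooth_real_power smooth_smooth_step)

lemma smooth_avg_ker: "smooth_real (avg_ker m)"
  unfolding avg_ker_def by (rule smooth_real_iterate[OF smooth_cut_power])

lemma smooth_avg_ker_pot: "smooth_real (avg_ker_pot m)"
  unfolding avg_ker_pot_def
  by (intro smooth_real_mult smooth_real_const smooth_real_diff smooth_real_affine smooth_cut_power)

text \<open>Below 1/2 the truncated power vanishes; beyond 1 it is the polynomial
  \<open>t ^ m / fact m\<close>, which \<open>m + 1\<close> derivatives annihilate.\<close>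

lemma avg_ker_support: "t \<notin> {1/2..1} \<Longrightarrow> avg_ker m t = 0"
proof -
  assume "t \<notin> {1/2..1}"
  then consider "t < 1/2" | "t > 1" by fastforce
  then show ?thesis
  proof cases
    case 1
    have "(deriv ^^ Suc m) (cut_power m) t = (deriv ^^ Suc m) (\<lambda>x. 0) t"
      by (rule iterated_deriv_eq_on_open[of "{..<1/2}"]) (use 1 in \<open>auto simp: cut_power_def smooth_step_0\<close>)
    also have "(deriv ^^ Suc m) (\<lambda>x. 0) = (\<lambda>x::real. 0::real)" by (induction m) auto
    finally show ?thesis by (simp add: avg_ker_def)
  next
    case 2
    have "(deriv ^^ Suc m) (cut_power m) t = (deriv ^^ Suc m) (\<lambda>x. (1 / fact m) * x ^ m) t"
      by (rule iterated_deriv_eq_on_open[of "{1<..}"]) (use 2 in \<open>auto simp: cut_power_def smooth_step_1\<close>)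
    also have "\<dots> = 0" unfolding funpow.simps comp_apply iterated_deriv_power by simp
    finally show ?thesis by (simp add: avg_ker_def)
  qed
qed

text \<open>Beyond 1 both terms are pure powers and cancel, since
  \<open>(2 * t) ^ m / 2 ^ m = t ^ m\<close>; below 1/4 both are cut off.\<close>

lemma avg_ker_pot_support: "t \<notin> {1/4..1} \<Longrightarrow> avg_ker_pot m t = 0"
proof -
  assume "t \<notin> {1/4..1}"
  then consider "t < 1/4" | "t > 1" by fastforce
  then show ?thesis
    by cases (auto simp: avg_ker_pot_def cut_power_def smooth_step_0 smooth_step_1 power_mult_distrib)
qed

text \<open>Of the factor \<open>2 ^ (m + 1)\<close> from the chain rule, \<open>2 ^ m\<close> is
  compensated in the definition of \<open>avg_ker_pot\<close>; the remaining 2 is the one that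
  preserves mass under dilation.\<close>

lemma avg_ker_dyadic: "2 * avg_ker m (2 * t) - avg_ker m t = (deriv ^^ Suc m) (avg_ker_pot m) t"
proof -
  have "(deriv ^^ Suc m) (avg_ker_pot m) t =
      (deriv ^^ Suc m) (\<lambda>t. (1 / 2 ^ m) * cut_power m (2 * t + 0)) t - avg_ker m t"
    unfolding avg_ker_pot_def[abs_def] avg_ker_def
    by (subst iterated_deriv_diff)
      (intro smooth_real_mult smooth_real_const smooth_real_affine smooth_cut_power refl)+
  also have "(deriv ^^ Suc m) (\<lambda>t. (1 / 2 ^ m) * cut_power m (2 * t + 0)) t = 2 * avg_ker m (2 * t)"
    by (subst iterated_deriv_affine[OF smooth_cut_power]) (simp add: avg_ker_def)
  finally show ?thesis by simp
qed

lemma integrable_smooth_real: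
  assumes "smooth_real f" "\<And>t. t \<notin> {a..b} \<Longrightarrow> f t = 0"
  shows "integrable lborel f"
proof -
  have "integrable lborel (\<lambda>x. indicator {a..b} x *\<^sub>R f x)"
    by (rule borel_integrable_compact) (auto intro: smooth_real_continuous_on assms)
  also have "(\<lambda>x. indicator {a..b} x *\<^sub>R f x) = f" 
  proof
    fix x show "indicator {a..b} x *\<^sub>R f x = f x"
      using assms(2)[of x] by (cases "x \<in> {a..b}") (simp_all add: indicator_def)
  qed
  finally show ?thesis .
qed

text \<open>The \<open>m\<close>-th derivative of \<open>cut_power m\<close> is an antiderivative;
  it is 0 near 0 and equals \<open>fact m / fact m = 1\<close> beyond 1.\<close>

lemma integral_avg_ker: "(\<integral>t. avg_ker m t \<partial>lborel) = 1"
proof -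
  let ?P = "(deriv ^^ m) (cut_power m)"
  have "(\<integral>t. avg_ker m t \<partial>lborel) = (\<integral>t. indicator {0..2} t *\<^sub>R avg_ker m t \<partial>lborel)"
  proof (rule Bochner_Integration.integral_cong)
    fix t show "avg_ker m t = indicator {0..2} t *\<^sub>R avg_ker m t"
      using avg_ker_support[of t m] by (cases "t \<in> {0..2}") auto
  qed simp
  also have "\<dots> = ?P 2 - ?P 0"
  proof (rule integral_FTC_Icc)
    show "(?P has_vector_derivative avg_ker m x) (at x within {0..2})" for x
      using smooth_real_DERIV[OF smooth_real_iterate[OF smooth_cut_power]]
      by (simp add: avg_ker_def has_real_derivative_iff_has_vector_derivative has_vector_derivative_at_within)
  qed (auto intro: smooth_real_continuous_on smooth_avg_ker)
  also have "?P 0 = (deriv ^^ m) (\<lambda>x. 0) 0"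
    by (rule iterated_deriv_eq_on_open[of "{..<1/2}"]) (auto simp: cut_power_def smooth_step_0)
  also have "(deriv ^^ m) (\<lambda>x. 0) = (\<lambda>x::real. 0::real)" by (induction m) auto
  also have "?P 2 = (deriv ^^ m) (\<lambda>x. (1 / fact m) * x ^ m) 2"
    by (rule iterated_deriv_eq_on_open[of "{1<..}"]) (auto simp: cut_power_def smooth_step_1)
  finally show ?thesis unfolding iterated_deriv_power by simp
qed

section \<open>Products of functions of one variable\<close>

definition prodf :: "('n::finite \<Rightarrow> real \<Rightarrow> real) \<Rightarrow> real ^ 'n \<Rightarrow> real" where
  "prodf F x = (\<Prod>i\<in>UNIV. F i (x $ i))"

lemma dir_deriv_prodf:
  fixes F :: "'n::finite \<Rightarrow> real \<Rightarrow> real"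
  assumes "smooth_real (F j)"
  shows "dir_deriv (axis j 1) (prodf F) = prodf (F(j := deriv (F j)))"
proof
  fix x :: "real ^ 'n"
  let ?c = "\<Prod>i\<in>UNIV - {j}. F i (x $ i)"
  have eq: "prodf F (x + t *\<^sub>R axis j 1) = F j (x $ j + t) * ?c" for t
    unfolding prodf_def by (subst prod.remove[of _ j]) (auto simp: axis_def intro!: prod.cong)
  have "((\<lambda>t. F j (x $ j + t)) has_field_derivative deriv (F j) (x $ j + 0) * 1) (at 0)"
    by (rule DERIV_chain2[OF smooth_real_DERIV[OF assms]]) (auto intro!: derivative_eq_intros)
  from DERIV_cmult_right[OF this]
  have "((\<lambda>t. F j (x $ j + t) * ?c) has_field_derivative deriv (F j) (x $ j) * ?c) (at 0)" by simp
  then have "dir_deriv (axis j 1) (prodf F) x = deriv (F j) (x $ j) * ?c"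
    unfolding dir_deriv_def eq by (rule DERIV_imp_deriv)
  also have "\<dots> = prodf (F(j := deriv (F j))) x"
    unfolding prodf_def by (subst prod.remove[of UNIV j]) (auto intro!: prod.cong)
  finally show "dir_deriv (axis j 1) (prodf F) x = prodf (F(j := deriv (F j))) x" .
qed

lemma dir_derivs_prodf:
  assumes "\<And>i. smooth_real (F i)"
  shows "dir_derivs (map (\<lambda>j. axis j 1) js) (prodf F) = prodf (\<lambda>i. (deriv ^^ count_list js i) (F i))"
proof (induction js)
  case (Cons j js)
  then have "dir_derivs (map (\<lambda>j. axis j 1) (j # js)) (prodf F)
      = dir_deriv (axis j 1) (prodf (\<lambda>i. (deriv ^^ count_list js i) (F i)))"
    by (simp add: dir_derivs_def)
  also have "\<dots> = prodf ((\<lambda>i. (deriv ^^ count_list js i) (F i))(j := deriv ((deriv ^^ count_list js j) (F j))))"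
    by (rule dir_deriv_prodf) (rule smooth_real_iterate[OF assms])
  also have "(\<lambda>i. (deriv ^^ count_list js i) (F i))(j := deriv ((deriv ^^ count_list js j) (F j)))
      = (\<lambda>i. (deriv ^^ count_list (j # js) i) (F i))"
    by (auto simp: fun_eq_iff)
  finally show ?case .
qed (simp add: dir_derivs_def)

text \<open>On products only the number of derivatives in each direction matters, so the unspecified
  order chosen by \<open>mi_list\<close> has no effect.\<close>

lemma mi_deriv_prodf:
  assumes "\<And>i. smooth_real (F i)"
  shows "mi_deriv \<alpha> (prodf F) = prodf (\<lambda>i. (deriv ^^ \<alpha> i) (F i))"
  by (simp add: mi_deriv_def dir_derivs_prodf[OF assms] count_mi_list)

lemma differentiable_prodf:
  assumes "\<And>i. smooth_real (F i)"
  shows "prodf F differentiable at x"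
proof -
  have "((\<lambda>x. F i (x $ i)) has_derivative (\<lambda>h. deriv (F i) (x $ i) * (h $ i))) (at x)" for i
    using DERIV_compose_FDERIV[OF smooth_real_DERIV[OF assms[of i]]
      bounded_linear_imp_has_derivative[OF bounded_linear_vec_nth[of i]], of x UNIV] by (simp add: mult.commute)
  then have "((\<lambda>x. \<Prod>i\<in>UNIV. F i (x $ i)) has_derivative
     (\<lambda>y. \<Sum>i\<in>UNIV. (deriv (F i) (x $ i) * (y $ i)) * (\<Prod>j\<in>UNIV - {i}. F j (x $ j)))) (at x)"
    by (intro has_derivative_prod)
  then show ?thesis unfolding prodf_def[abs_def] differentiable_def by blast
qed

lemma Basis_list_axis:
  assumes "set bs \<subseteq> (Basis :: (real ^ 'n) set)"
  shows "\<exists>js. bs = map (\<lambda>j. axis j 1) js"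
  using assms
proof (induction bs)
  case (Cons b bs)
  then obtain js where "bs = map (\<lambda>j. axis j 1) js" by auto
  moreover obtain j where "b = axis j 1" using Cons.prems by (auto simp: Basis_vec_def)
  ultimately show ?case by (intro exI[of _ "j # js"]) simp
qed simp

lemma smooth_on_prodf:
  assumes "\<And>i. smooth_real (F i)"
  shows "smooth_on S (prodf F)"
  unfolding smooth_on_def
proof (intro allI impI)
  fix bs :: "(real ^ 'a) list" assume "set bs \<subseteq> Basis"
  then obtain js where js: "bs = map (\<lambda>j. axis j 1) js" using Basis_list_axis by blast
  show "dir_derivs bs (prodf F) differentiable_on S"
    unfolding js dir_derivs_prodf[OF assms]
    by (intro differentiable_at_imp_differentiable_on differentiable_prodf smooth_real_iterate assms)
qed

lemma prodf_test_fun: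
  fixes \<Omega> :: "(real ^ 'n) set"
  assumes "\<And>i. smooth_real (F i)" "\<And>i t. t \<notin> {a $ i..b $ i} \<Longrightarrow> F i t = 0" "cbox a b \<subseteq> \<Omega>"
  shows "prodf F \<in> test_fun \<Omega>"
proof -
  have "prodf F x = 0" if "x \<notin> cbox a b" for x
  proof -
    have "\<exists>i. x $ i \<notin> {a $ i..b $ i}" using that by (auto simp: mem_box_cart)
    then show ?thesis unfolding prodf_def using assms(2) by (intro prod_zero) auto
  qed
  then show ?thesis
    unfolding test_fun_def using assms smooth_on_prodf[OF assms(1)] by (auto intro!: exI[of _ "cbox a b"])
qed

section \<open>Square integrable functions\<close>

text \<open>General in the measure because both \<open>lebesgue_on \<Omega>\<close> and
  \<open>lborel\<close> occur; for the former it is membership in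
  \<open>L2 \<Omega>\<close>.\<close>

definition sq_int :: "'a measure \<Rightarrow> ('a \<Rightarrow> real) \<Rightarrow> bool" where
  "sq_int M f \<longleftrightarrow> f \<in> borel_measurable M \<and> integrable M (\<lambda>x. (f x)\<^sup>2)"

definition l2norm :: "'a measure \<Rightarrow> ('a \<Rightarrow> real) \<Rightarrow> real" where
  "l2norm M f = sqrt (\<integral>x. (f x)\<^sup>2 \<partial>M)"

lemma sq_int_measurable: "sq_int M f \<Longrightarrow> f \<in> borel_measurable M"
  by (simp add: sq_int_def)

lemma sq_int_mult:
  assumes "sq_int M f" "sq_int M g"
  shows "integrable M (\<lambda>x. f x * g x)"
proof (rule Bochner_Integration.integrable_bound)
  show "integrable M (\<lambda>x. (f x)\<^sup>2 + (g x)\<^sup>2)" using assms by (auto simp: sq_int_def)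
  show "(\<lambda>x. f x * g x) \<in> borel_measurable M" using assms by (auto simp: sq_int_def)
  have "\<bar>a * b\<bar> \<le> a\<^sup>2 + b\<^sup>2" for a b :: real
  proof -
    have "2 * \<bar>a * b\<bar> \<le> a\<^sup>2 + b\<^sup>2"
      using sum_squares_bound[of "\<bar>a\<bar>" "\<bar>b\<bar>"] by (simp add: abs_mult mult.assoc)
    then show ?thesis using abs_ge_zero[of "a * b"] by linarith
  qed
  then show "AE x in M. norm (f x * g x) \<le> norm ((f x)\<^sup>2 + (g x)\<^sup>2)" by simp
qed

lemma sq_int_cmult: "sq_int M f \<Longrightarrow> sq_int M (\<lambda>x. c * f x)"
  by (auto simp: sq_int_def power_mult_distrib)

lemma sq_int_add:
  assumes "sq_int M f" "sq_int M g"
  shows "sq_int M (\<lambda>x. f x + g x)"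
  unfolding sq_int_def
proof
  show "(\<lambda>x. f x + g x) \<in> borel_measurable M" using assms by (auto simp: sq_int_def)
  have "integrable M (\<lambda>x. (f x)\<^sup>2 + (g x)\<^sup>2 + 2 * (f x * g x))"
    using assms sq_int_mult[OF assms] by (auto simp: sq_int_def)
  then show "integrable M (\<lambda>x. (f x + g x)\<^sup>2)" by (simp add: power2_sum mult.assoc)
qed

lemma sq_int_diff: "sq_int M f \<Longrightarrow> sq_int M g \<Longrightarrow> sq_int M (\<lambda>x. f x - g x)"
  using sq_int_add[of M f "\<lambda>x. (-1) * g x"] sq_int_cmult[of M g "-1"] by simp

lemma sq_int_zero: "sq_int M (\<lambda>x. 0)"
  by (simp add: sq_int_def)

lemma sq_int_sum: "(\<And>i. i \<in> I \<Longrightarrow> sq_int M (f i)) \<Longrightarrow> sq_int M (\<lambda>x. \<Sum>i\<in>I. f i x)"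
  by (induction I rule: infinite_finite_induct) (auto intro: sq_int_add sq_int_zero)

lemma sq_int_cong_AE:
  assumes "sq_int M f" "g \<in> borel_measurable M" "AE x in M. f x = g x"
  shows "sq_int M g"
  unfolding sq_int_def
proof
  show "integrable M (\<lambda>x. (g x)\<^sup>2)"
    by (rule integrable_cong_AE_imp[of M "\<lambda>x. (f x)\<^sup>2"]) (use assms in \<open>auto simp: sq_int_def\<close>)
qed fact

lemma sq_int_bound:
  assumes "sq_int M f" "g \<in> borel_measurable M" "AE x in M. \<bar>g x\<bar> \<le> \<bar>f x\<bar>"
  shows "sq_int M g" "l2norm M g \<le> l2norm M f"
proof -
  show "sq_int M g"
    unfolding sq_int_def
  proof
    show "integrable M (\<lambda>x. (g x)\<^sup>2)"
      by (rule Bochner_Integration.integrable_bound[of M "\<lambda>x. (f x)\<^sup>2"])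
        (use assms in \<open>auto simp: sq_int_def abs_le_square_iff\<close>)
  qed fact
  then show "l2norm M g \<le> l2norm M f"
    unfolding l2norm_def using assms
    by (intro real_sqrt_le_mono integral_mono_AE) (auto simp: sq_int_def abs_le_square_iff)
qed

lemma l2norm_cong_AE:
  assumes "f \<in> borel_measurable M" "g \<in> borel_measurable M" "AE x in M. f x = g x"
  shows "l2norm M f = l2norm M g"
  unfolding l2norm_def
  by (rule arg_cong[of _ _ sqrt], rule integral_cong_AE) (use assms in auto)

text \<open>Makes the Cauchy-Schwarz and triangle inequalities of the abstract locale available for
  \<open>l2norm\<close>.\<close>

lemma semi_inner_L2: "semi_inner (Collect (sq_int M)) (\<lambda>f g. \<integral>x. f x * g x \<partial>M)"
proof
  show "subspace (Collect (sq_int M))"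
    by (auto simp: subspace_def plus_fun_def zero_fun_def scaleR_fun_def
        intro: sq_int_zero sq_int_add sq_int_cmult)
  show "(\<integral>x. f x * g x \<partial>M) = (\<integral>x. g x * f x \<partial>M)" for f g :: "'a \<Rightarrow> real" by (simp add: mult.commute)
  show "0 \<le> (\<integral>x. f x * f x \<partial>M)" for f :: "'a \<Rightarrow> real" by (rule Bochner_Integration.integral_nonneg) simp
qed (auto simp: plus_fun_def scaleR_fun_def distrib_right sq_int_mult mult.assoc)

lemma semi_inner_L2_nrm: "semi_inner.nrm (\<lambda>f g. \<integral>x. f x * g x \<partial>M) f = l2norm M f"
  by (simp add: semi_inner.nrm_def[OF semi_inner_L2] l2norm_def power2_eq_square)

lemma l2_Cauchy_Schwarz:
  assumes "sq_int M f" "sq_int M g"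
  shows "\<bar>\<integral>x. f x * g x \<partial>M\<bar> \<le> l2norm M f * l2norm M g"
  using semi_inner.Cauchy_Schwarz[OF semi_inner_L2, of f M g] assms by (simp add: semi_inner_L2_nrm)

lemma l2norm_nonneg: "0 \<le> l2norm M f"
  by (simp add: l2norm_def)

lemma l2norm_square: "(l2norm M f)\<^sup>2 = (\<integral>x. (f x)\<^sup>2 \<partial>M)"
  by (simp add: l2norm_def)

lemma l2norm_triangle:
  assumes "sq_int M f" "sq_int M g"
  shows "l2norm M (\<lambda>x. f x + g x) \<le> l2norm M f + l2norm M g"
  using semi_inner.nrm_triangle[OF semi_inner_L2, of f M g] assms
  by (simp add: semi_inner_L2_nrm plus_fun_def)

lemma l2norm_cmult: "l2norm M (\<lambda>x. c * f x) = \<bar>c\<bar> * l2norm M f"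
  by (simp add: l2norm_def power_mult_distrib real_sqrt_mult)

lemma l2norm_minus_commute: "l2norm M (\<lambda>x. f x - g x) = l2norm M (\<lambda>x. g x - f x)"
  by (simp add: l2norm_def power2_commute)

lemma l2norm_triangle_diff:
  assumes "sq_int M f" "sq_int M g" "sq_int M h"
  shows "l2norm M (\<lambda>x. f x - h x) \<le> l2norm M (\<lambda>x. f x - g x) + l2norm M (\<lambda>x. g x - h x)"
  using l2norm_triangle[of M "\<lambda>x. f x - g x" "\<lambda>x. g x - h x"] assms by (simp add: sq_int_diff)

lemma l2norm_sum:
  "finite I \<Longrightarrow> (\<And>i. i \<in> I \<Longrightarrow> sq_int M (f i)) \<Longrightarrow> l2norm M (\<lambda>x. \<Sum>i\<in>I. f i x) \<le> (\<Sum>i\<in>I. l2norm M (f i))"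
proof (induction I rule: finite_induct)
  case (insert i I)
  then show ?case
    using l2norm_triangle[of M "f i" "\<lambda>x. \<Sum>i\<in>I. f i x"] sq_int_sum[of I M f] by simp
qed (simp add: l2norm_def)

lemma l2norm_eq_0_AE:
  assumes "sq_int M f" "l2norm M f = 0"
  shows "AE x in M. f x = 0"
  using integral_nonneg_eq_0_iff_AE[of M "\<lambda>x. (f x)\<^sup>2"] assms by (simp add: sq_int_def l2norm_def)

lemma nn_integral_sq: "sq_int M f \<Longrightarrow> (\<integral>\<^sup>+x. ennreal ((f x)\<^sup>2) \<partial>M) = ennreal ((l2norm M f)\<^sup>2)"
  unfolding l2norm_square by (intro nn_integral_eq_integral) (auto simp: sq_int_def)

lemma l2norm_le_nn_integral:
  assumes "f \<in> borel_measurable M" "(\<integral>\<^sup>+x. ennreal ((f x)\<^sup>2) \<partial>M) \<le> ennreal (C\<^sup>2)" "0 \<le> C"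
  shows "sq_int M f" "l2norm M f \<le> C"
proof -
  show s: "sq_int M f"
    unfolding sq_int_def
  proof (intro conjI integrableI_bounded)
    show "(\<integral>\<^sup>+x. ennreal (norm ((f x)\<^sup>2)) \<partial>M) < \<infinity>"
      using le_less_trans[OF assms(2) ennreal_less_top] by simp
  qed (use assms(1) in auto)
  show "l2norm M f \<le> C"
  proof (rule power2_le_imp_le)
    show "(l2norm M f)\<^sup>2 \<le> C\<^sup>2"
      using assms(2) unfolding nn_integral_sq[OF s] by (subst (asm) ennreal_le_iff) simp_all
  qed fact
qed

text \<open>Applied to differences, this upgrades almost everywhere convergence to estimates in
  norm, with membership of the limit as a by-product.\<close>

lemma l2_Fatou:
  assumes s: "\<And>n. sq_int M (s n)" and C: "\<And>n. l2norm M (s n) \<le> C"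
    and f: "f \<in> borel_measurable M" and lim: "AE x in M. (\<lambda>n. s n x) \<longlonglongrightarrow> f x"
  shows "sq_int M f" "l2norm M f \<le> C"
proof -
  have C0: "0 \<le> C" using C[of 0] l2norm_nonneg order_trans by blast
  have "(\<integral>\<^sup>+x. ennreal ((f x)\<^sup>2) \<partial>M) = (\<integral>\<^sup>+x. liminf (\<lambda>n. ennreal ((s n x)\<^sup>2)) \<partial>M)"
  proof (rule nn_integral_cong_AE)
    show "AE x in M. ennreal ((f x)\<^sup>2) = liminf (\<lambda>n. ennreal ((s n x)\<^sup>2))"
      using lim
    proof eventually_elim
      case (elim x)
      then have "(\<lambda>n. ennreal ((s n x)\<^sup>2)) \<longlonglongrightarrow> ennreal ((f x)\<^sup>2)" by (intro tendsto_intros)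
      from lim_imp_Liminf[OF trivial_limit_sequentially this] show ?case by simp
    qed
  qed
  also have "\<dots> \<le> liminf (\<lambda>n. \<integral>\<^sup>+x. ennreal ((s n x)\<^sup>2) \<partial>M)"
    using s by (intro nn_integral_liminf) (auto simp: sq_int_def)
  also have "\<dots> \<le> ennreal (C\<^sup>2)"
  proof (rule Liminf_le)
    show "\<forall>\<^sub>F n in sequentially. (\<integral>\<^sup>+x. ennreal ((s n x)\<^sup>2) \<partial>M) \<le> ennreal (C\<^sup>2)"
      using C C0 by (intro always_eventually allI) (simp add: nn_integral_sq[OF s] power_mono l2norm_nonneg ennreal_leI)
  qed simp
  finally have *: "(\<integral>\<^sup>+x. ennreal ((f x)\<^sup>2) \<partial>M) \<le> ennreal (C\<^sup>2)" .
  show "sq_int M f" "l2norm M f \<le> C" by (rule l2norm_le_nn_integral[OF f * C0])+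
qed

lemma (in finite_measure) sq_int_integrable: "sq_int M f \<Longrightarrow> integrable M f"
  unfolding sq_int_def by (rule square_integrable_imp_integrable) auto

lemma (in finite_measure) sq_int_bounded:
  assumes "f \<in> borel_measurable M" "AE x in M. \<bar>f x\<bar> \<le> C"
  shows "sq_int M f" "l2norm M f \<le> \<bar>C\<bar> * l2norm M (\<lambda>_. 1)"
proof -
  have c: "sq_int M (\<lambda>_. C)" by (simp add: sq_int_def)
  have le: "AE x in M. \<bar>f x\<bar> \<le> \<bar>C\<bar>" using assms(2) by eventually_elim simp
  from sq_int_bound[OF c assms(1) le] l2norm_cmult[of M C "\<lambda>_. 1"]
  show "sq_int M f" "l2norm M f \<le> \<bar>C\<bar> * l2norm M (\<lambda>_. 1)" by auto
qed

lemma (in finite_measure) integral_abs_le_l2norm: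
  assumes "sq_int M f"
  shows "(\<integral>x. \<bar>f x\<bar> \<partial>M) \<le> l2norm M f * l2norm M (\<lambda>_. 1)"
proof -
  have a: "sq_int M (\<lambda>x. \<bar>f x\<bar>)" "l2norm M (\<lambda>x. \<bar>f x\<bar>) = l2norm M f"
    using assms by (auto simp: sq_int_def l2norm_def)
  have "sq_int M (\<lambda>_. 1)" by (simp add: sq_int_def)
  from l2_Cauchy_Schwarz[OF a(1) this] a(2) show ?thesis by simp
qed

text \<open>On a finite measure space an L2-Cauchy sequence is Cauchy in L1 and thus has an almost
  everywhere convergent subsequence; Fatou applied to \<open>s n - s (r i)\<close> gives convergence
  of the full sequence in norm.\<close>

lemma (in finite_measure) l2_complete:
  assumes s: "\<And>n. sq_int M (s n)"
    and Cauchy: "\<And>e. e > 0 \<Longrightarrow> \<exists>N. \<forall>m\<ge>N. \<forall>n\<ge>N. l2norm M (\<lambda>x. s m x - s n x) < e"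
  shows "\<exists>f. sq_int M f \<and> (\<lambda>n. l2norm M (\<lambda>x. s n x - f x)) \<longlonglongrightarrow> 0"
proof -
  define m where "m = l2norm M (\<lambda>_. 1)"
  have m: "0 \<le> m" by (simp add: m_def l2norm_nonneg)
  have [measurable]: "s n \<in> borel_measurable M" for n using s by (simp add: sq_int_def)
  obtain r where r: "strict_mono r" "AE x in M. Cauchy (\<lambda>i. s (r i) x)"
  proof (rule cauchy_L1_AE_cauchy_subseq)
    fix e :: real assume e: "e > 0"
    obtain N where N: "\<And>i j. i \<ge> N \<Longrightarrow> j \<ge> N \<Longrightarrow> l2norm M (\<lambda>x. s i x - s j x) < e / (m + 1)"
      using Cauchy[of "e / (m + 1)"] e m by auto
    have "(\<integral>x. norm (s i x - s j x) \<partial>M) < e" if "i \<ge> N" "j \<ge> N" for i j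
    proof -
      have "(\<integral>x. norm (s i x - s j x) \<partial>M) \<le> l2norm M (\<lambda>x. s i x - s j x) * m"
        using integral_abs_le_l2norm[OF sq_int_diff[OF s s]] by (simp add: m_def)
      also have "\<dots> \<le> l2norm M (\<lambda>x. s i x - s j x) * (m + 1)"
        by (intro mult_left_mono) (auto simp: l2norm_nonneg)
      also have "\<dots> < e" using N[OF that] m by (simp add: field_simps)
      finally show ?thesis .
    qed
    then show "\<exists>N. \<forall>i\<ge>N. \<forall>j\<ge>N. (\<integral>x. norm (s i x - s j x) \<partial>M) < e" by blast
  qed (use s sq_int_integrable in auto)
  define f where "f x = lim (\<lambda>i. s (r i) x)" for x
  have f[measurable]: "f \<in> borel_measurable M" unfolding f_def by measurable
  have lim: "AE x in M. (\<lambda>i. s (r i) x) \<longlonglongrightarrow> f x"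
    using r(2) by eventually_elim (simp add: f_def Cauchy_convergent_iff convergent_LIMSEQ_iff)
  have bound: "sq_int M (\<lambda>x. s n x - f x) \<and> l2norm M (\<lambda>x. s n x - f x) \<le> e"
    if N: "\<And>i. i \<ge> N \<Longrightarrow> l2norm M (\<lambda>x. s n x - s i x) < e" for N n e
  proof -
    have rN: "r (N + k) \<ge> N" for k
      using seq_suble[OF r(1), of "N + k"] by linarith
    have L: "AE x in M. (\<lambda>k. s n x - s (r (N + k)) x) \<longlonglongrightarrow> s n x - f x"
      using lim
    proof eventually_elim
      case (elim x)
      from LIMSEQ_ignore_initial_segment[OF elim, of N] show ?case
        by (intro tendsto_intros) (simp add: add.commute)
    qed
    show ?thesis
      using l2_Fatou[OF _ _ _ L, of e] sq_int_diff[OF s s] N[OF rN] by (auto simp: less_imp_le)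
  qed
  obtain N0 where "\<And>m n. m \<ge> N0 \<Longrightarrow> n \<ge> N0 \<Longrightarrow> l2norm M (\<lambda>x. s m x - s n x) < 1"
    using Cauchy[of 1] by auto
  then have "sq_int M (\<lambda>x. s N0 x - f x)" using bound[of N0 N0 1] by auto
  from sq_int_diff[OF s[of N0] this] have fs: "sq_int M f" by simp
  have "(\<lambda>n. l2norm M (\<lambda>x. s n x - f x)) \<longlonglongrightarrow> 0"
  proof (rule LIMSEQ_I)
    fix e :: real assume e: "e > 0"
    obtain N where "\<And>m n. m \<ge> N \<Longrightarrow> n \<ge> N \<Longrightarrow> l2norm M (\<lambda>x. s m x - s n x) < e / 2"
      using Cauchy[of "e / 2"] e by auto
    then have "norm (l2norm M (\<lambda>x. s n x - f x) - 0) < e" if "n \<ge> N" for n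
      using bound[of N n "e / 2"] that e l2norm_nonneg[of M "\<lambda>x. s n x - f x"] by auto
    then show "\<exists>no. \<forall>n\<ge>no. norm (l2norm M (\<lambda>x. s n x - f x) - 0) < e" by blast
  qed
  then show ?thesis using fs by blast
qed

lemma l2_limit_integral:
  assumes s: "\<And>n. sq_int M (s n)" and f: "sq_int M f" and g: "sq_int M g"
    and lim: "(\<lambda>n. l2norm M (\<lambda>x. s n x - f x)) \<longlonglongrightarrow> 0"
  shows "(\<lambda>n. \<integral>x. s n x * g x \<partial>M) \<longlonglongrightarrow> (\<integral>x. f x * g x \<partial>M)"
proof (rule LIM_zero_cancel, rule Lim_null_comparison)
  have "norm ((\<integral>x. s n x * g x \<partial>M) - (\<integral>x. f x * g x \<partial>M)) \<le> l2norm M (\<lambda>x. s n x - f x) * l2norm M g" for n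
  proof -
    have "(\<integral>x. s n x * g x \<partial>M) - (\<integral>x. f x * g x \<partial>M) = (\<integral>x. (s n x - f x) * g x \<partial>M)"
      using sq_int_mult[OF s g] sq_int_mult[OF f g] by (simp add: left_diff_distrib)
    then show ?thesis using l2_Cauchy_Schwarz[OF sq_int_diff[OF s f] g] by simp
  qed
  then show "\<forall>\<^sub>F n in sequentially. norm ((\<integral>x. s n x * g x \<partial>M) - (\<integral>x. f x * g x \<partial>M))
      \<le> l2norm M (\<lambda>x. s n x - f x) * l2norm M g" by simp
  show "(\<lambda>n. l2norm M (\<lambda>x. s n x - f x) * l2norm M g) \<longlonglongrightarrow> 0"
    using tendsto_mult_left_zero[OF lim] .
qed

text \<open>Where \<open>s n\<close> is nonnegative, the negative part of \<open>f\<close> is at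
  most \<open>\<bar>s n - f\<bar>\<close>, so its norm is 0.\<close>

lemma l2_limit_nonneg:
  assumes s: "\<And>n. sq_int M (s n)" "\<And>n. AE x in M. 0 \<le> s n x" and f: "sq_int M f"
    and lim: "(\<lambda>n. l2norm M (\<lambda>x. s n x - f x)) \<longlonglongrightarrow> 0"
  shows "AE x in M. 0 \<le> f x"
proof -
  let ?g = "\<lambda>x. max 0 (- f x)"
  have [measurable]: "f \<in> borel_measurable M" using f by (simp add: sq_int_def)
  have g: "sq_int M ?g" by (rule sq_int_bound(1)[OF f]) auto
  have "l2norm M ?g \<le> l2norm M (\<lambda>x. s n x - f x)" for n
    by (rule sq_int_bound(2)[OF sq_int_diff[OF s(1) f]])
      (measurable, use s(2)[of n] in \<open>eventually_elim, auto\<close>)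
  then have "l2norm M ?g \<le> 0" using lim by (intro LIMSEQ_le_const) auto
  then have "l2norm M ?g = 0" using l2norm_nonneg order_antisym by blast
  from l2norm_eq_0_AE[OF g this] show ?thesis by eventually_elim auto
qed

lemma L2_iff: "f \<in> L2 \<Omega> \<longleftrightarrow> sq_int (lebesgue_on \<Omega>) f"
  by (simp add: L2_def sq_int_def)

section \<open>Lebesgue measure on open sets\<close>

lemma AE_lborel_box_cbox: "AE x in (lborel :: 'a::euclidean_space measure). x \<in> cbox l u \<longrightarrow> x \<in> box l u"
proof -
  have "cbox l u - box l u \<in> null_sets (lebesgue :: 'a measure)"
    using negligible_frontier_interval negligible_iff_null_sets by blast
  then have "AE x in (lebesgue :: 'a measure). x \<in> cbox l u \<longrightarrow> x \<in> box l u"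
    by (rule AE_I') auto
  then show ?thesis unfolding AE_completion_iff by auto
qed

lemma box_Int_box_exists:
  fixes a b l u :: "'a::euclidean_space"
  shows "\<exists>c d. box a b \<inter> box l u = box c d \<and> cbox c d \<subseteq> cbox l u"
proof (intro exI conjI)
  show "box a b \<inter> box l u = box (\<Sum>i\<in>Basis. max (a \<bullet> i) (l \<bullet> i) *\<^sub>R i) (\<Sum>i\<in>Basis. min (b \<bullet> i) (u \<bullet> i) *\<^sub>R i)"
    by (auto simp: box_def)
  show "cbox (\<Sum>i\<in>Basis. max (a \<bullet> i) (l \<bullet> i) *\<^sub>R i) (\<Sum>i\<in>Basis. min (b \<bullet> i) (u \<bullet> i) *\<^sub>R i) \<subseteq> cbox l u"
    by (auto simp: cbox_def)
qed

text \<open>Boxes generate the Borel sets, so vanishing integrals over boxes propagate to all Borel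
  subsets of a fixed box.\<close>

lemma AE_zero_if_box_integrals_zero:
  fixes f :: "'a::euclidean_space \<Rightarrow> real"
  assumes f: "integrable lborel f" and W: "open W"
    and zero: "\<And>a b. cbox a b \<subseteq> W \<Longrightarrow> (\<integral>x. indicator (box a b) x * f x \<partial>lborel) = 0"
  shows "AE x in lborel. x \<in> W \<longrightarrow> f x = 0"
proof -
  have [measurable]: "f \<in> borel_measurable borel" using f by auto
  have box: "AE x in lborel. x \<in> cbox l u \<longrightarrow> f x = 0" if lu: "cbox l u \<subseteq> W" for l u
  proof -
    \<comment> \<open>Truncation to \<open>box l u\<close> makes every box integral vanish, and also
      the integral over the whole space, which the complement step of the Dynkin induction
      requires.\<close>
    define f' where "f' x = indicator (box l u) x * f x" for x
    have f': "integrable lborel f'"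
      unfolding f'_def using integrable_mult_indicator[of "box l u" lborel f] f by simp
    have ind: "(\<integral>x. indicator A x * f' x \<partial>lborel) = 0" if A: "A \<in> sigma_sets UNIV (range (\<lambda>(a, b). box a b))" for A
    proof -
      have "Int_stable (range (\<lambda>(a, b). box a b :: 'a set))"
      proof (rule Int_stableI)
        fix A B :: "'a set" assume "A \<in> range (\<lambda>(a, b). box a b)" "B \<in> range (\<lambda>(a, b). box a b)"
        then obtain a b l u where AB: "A = box a b" "B = box l u" by auto
        obtain c d where "box a b \<inter> box l u = box c d" using box_Int_box_exists by blast
        then show "A \<inter> B \<in> range (\<lambda>(a, b). box a b)" unfolding AB by (intro range_eqI[of _ _ "(c, d)"]) simp
      qed
      from this Pow_UNIV[THEN equalityD2, THEN subset_trans[OF subset_UNIV]] A show ?thesis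
    proof (induction rule: sigma_sets_induct_disjoint)
      case (basic A)
      then obtain a b where A: "A = box a b" by auto
      obtain c d where cd: "box a b \<inter> box l u = box c d" "cbox c d \<subseteq> cbox l u"
        using box_Int_box_exists by blast
      have "indicator A x * f' x = indicator (box c d) x * f x" for x
        unfolding A f'_def cd(1)[symmetric] by (simp add: indicator_def)
      then show ?case using zero[of c d] cd lu by simp
    next
      case (compl A)
      have A: "A \<in> sets borel" using compl(1) unfolding borel_eq_box by simp
      have "indicator (UNIV - A) x * f' x = f' x - indicator A x * f' x" for x
        by (simp add: indicator_def)
      moreover have "(\<integral>x. f' x \<partial>lborel) = 0" unfolding f'_def by (rule zero[OF lu])
      moreover have "integrable lborel (\<lambda>x. indicator A x * f' x)"
        using integrable_mult_indicator[of A lborel f'] f' A by simp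
      ultimately show ?case using f' compl by simp
    next
      case (union A)
      have A: "A i \<in> sets borel" for i using union(2) unfolding borel_eq_box by auto
      have "(LINT x:(\<Union>i. A i)|lborel. f' x) = (\<Sum>i. (LINT x:(A i)|lborel. f' x))"
      proof (rule lebesgue_integral_countable_add)
        show "set_integrable lborel (\<Union> (range A)) f'"
          unfolding set_integrable_def using f' A by (intro integrable_mult_indicator) auto
      qed (use A union(1) in \<open>auto simp: disjoint_family_on_def\<close>)
      then show ?case using union(3) by (simp add: set_lebesgue_integral_def)
    qed simp
    qed
    have "AE x in lborel. f' x = (\<lambda>x. 0) x"
    proof (rule density_unique_real[OF f'])
      fix A :: "'a set" assume "A \<in> sets lborel"
      then have "A \<in> sets borel" by simp
      then have "A \<in> sigma_sets UNIV (range (\<lambda>(a, b). box a b))" unfolding borel_eq_box by simp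
      then show "(LINT x:A|lborel. f' x) = (LINT x:A|lborel. 0)"
        using ind by (simp add: set_lebesgue_integral_def)
    qed simp
    then show ?thesis using AE_lborel_box_cbox[of l u] by eventually_elim (auto simp: f'_def)
  qed
  obtain \<D> where D: "countable \<D>" "\<D> \<subseteq> Pow W" "\<And>X. X \<in> \<D> \<Longrightarrow> \<exists>a b. X = cbox a b" "\<Union>\<D> = W"
    by (rule open_countable_Union_open_cbox[OF W], rule that) assumption+
  have "AE x in lborel. \<forall>X\<in>\<D>. x \<in> X \<longrightarrow> f x = 0"
    unfolding AE_ball_countable[OF D(1)]
  proof
    fix X assume "X \<in> \<D>"
    then obtain a b where "X = cbox a b" "cbox a b \<subseteq> W" using D(2,3) by blast
    then show "AE x in lborel. x \<in> X \<longrightarrow> f x = 0" using box by simp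
  qed
  then show ?thesis by eventually_elim (use D(4) in auto)
qed

text \<open>Translation, scaling and Fubini are used for \<open>lborel\<close>; a Borel function
  vanishing off \<open>\<Omega>\<close> carries integrals over \<open>lebesgue_on \<Omega>\<close>
  over to it.\<close>

lemma borel_representative:
  fixes f :: "real ^ 'n \<Rightarrow> real"
  assumes f: "f \<in> borel_measurable (lebesgue_on \<Omega>)" and O: "open \<Omega>"
  obtains f0 where "f0 \<in> borel_measurable borel" "\<And>x. x \<notin> \<Omega> \<Longrightarrow> f0 x = 0" "AE x in lebesgue_on \<Omega>. f x = f0 x"
proof -
  have "(\<lambda>x. if x \<in> \<Omega> then f x else 0) \<in> borel_measurable lebesgue"
    using f O by (intro borel_measurable_if_I) auto
  from completion_ex_borel_measurable_real[OF this]
  obtain g where g: "g \<in> borel_measurable lborel" "AE x in lborel. (if x \<in> \<Omega> then f x else 0) = g x" by blast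
  have [measurable]: "g \<in> borel_measurable borel" "\<Omega> \<in> sets borel" using g O by auto
  from AE_completion[OF g(2)] have "AE x in lebesgue_on \<Omega>. f x = indicator \<Omega> x * g x"
    using O by (subst AE_restrict_space_iff) (auto elim!: eventually_mono)
  then show ?thesis by (intro that[of "\<lambda>x. indicator \<Omega> x * g x"]) auto
qed

lemma lebesgue_on_lborel:
  fixes f f0 :: "real ^ 'n \<Rightarrow> real"
  assumes f: "f \<in> borel_measurable (lebesgue_on \<Omega>)" and O: "open \<Omega>"
    and f0: "f0 \<in> borel_measurable borel" "\<And>x. x \<notin> \<Omega> \<Longrightarrow> f0 x = 0" and AE: "AE x in lebesgue_on \<Omega>. f x = f0 x"
  shows "integrable (lebesgue_on \<Omega>) f \<longleftrightarrow> integrable lborel f0"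
    and "(\<integral>x. f x \<partial>lebesgue_on \<Omega>) = (\<integral>x. f0 x \<partial>lborel)"
proof -
  have m: "f0 \<in> borel_measurable (lebesgue_on \<Omega>)" and Om: "\<Omega> \<inter> space lebesgue \<in> sets lebesgue"
    using f0 O by (auto intro!: measurable_restrict_space1 measurable_completion)
  have eq: "(\<lambda>x. indicator \<Omega> x *\<^sub>R f0 x) = f0" using f0(2) by (auto simp: indicator_def fun_eq_iff)
  have "integrable (lebesgue_on \<Omega>) f \<longleftrightarrow> integrable (lebesgue_on \<Omega>) f0"
    by (rule integrable_cong_AE[OF f m AE])
  also have "\<dots> \<longleftrightarrow> integrable lborel f0"
    using f0 by (subst integrable_restrict_space[OF Om], subst eq) (simp add: integrable_completion)
  finally show "integrable (lebesgue_on \<Omega>) f \<longleftrightarrow> integrable lborel f0" .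
  have "(\<integral>x. f x \<partial>lebesgue_on \<Omega>) = (\<integral>x. f0 x \<partial>lebesgue_on \<Omega>)"
    by (rule integral_cong_AE[OF f m AE])
  also have "\<dots> = (\<integral>x. f0 x \<partial>lborel)"
    using f0 by (subst integral_restrict_space[OF Om], subst eq) (simp add: integral_completion)
  finally show "(\<integral>x. f x \<partial>lebesgue_on \<Omega>) = (\<integral>x. f0 x \<partial>lborel)" .
qed

lemma AE_lebesgue_on_iff_lborel:
  assumes "open \<Omega>"
  shows "(AE x in lebesgue_on \<Omega>. P x) \<longleftrightarrow> (AE x in lborel. x \<in> \<Omega> \<longrightarrow> P x)"
  using assms by (subst AE_restrict_space_iff) (auto simp: AE_completion_iff)

lemma borel_measurable_lebesgue_on: "f \<in> borel_measurable borel \<Longrightarrow> f \<in> borel_measurable (lebesgue_on S)"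
  by (auto intro!: measurable_restrict_space1 measurable_completion)

lemma sq_int_lebesgue_on:
  fixes f :: "real ^ 'n \<Rightarrow> real"
  assumes f: "sq_int lborel f" and O: "open \<Omega>"
  shows "sq_int (lebesgue_on \<Omega>) f" "l2norm (lebesgue_on \<Omega>) f \<le> l2norm lborel f"
proof -
  have [measurable]: "f \<in> borel_measurable borel" "\<Omega> \<in> sets borel" using f O by (auto simp: sq_int_def)
  let ?g = "\<lambda>x. indicator \<Omega> x * (f x)\<^sup>2"
  have int: "integrable lborel (\<lambda>x. (f x)\<^sup>2)" using f by (simp add: sq_int_def)
  then have g: "integrable lborel ?g" using integrable_mult_indicator[of \<Omega> lborel "\<lambda>x. (f x)\<^sup>2"] by simp
  have AE: "AE x in lebesgue_on \<Omega>. (f x)\<^sup>2 = ?g x"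
    unfolding AE_lebesgue_on_iff_lborel[OF O] by auto
  have m: "(\<lambda>x. (f x)\<^sup>2) \<in> borel_measurable (lebesgue_on \<Omega>)" by (rule borel_measurable_lebesgue_on) measurable
  have gm: "?g \<in> borel_measurable borel" "\<And>x. x \<notin> \<Omega> \<Longrightarrow> ?g x = 0" by auto
  note * = lebesgue_on_lborel[OF m O gm AE]
  show "sq_int (lebesgue_on \<Omega>) f" using * g by (auto simp: sq_int_def intro: borel_measurable_lebesgue_on)
  have "(\<integral>x. (f x)\<^sup>2 \<partial>lebesgue_on \<Omega>) = (\<integral>x. ?g x \<partial>lborel)" by (rule *(2))
  also have "\<dots> \<le> (\<integral>x. (f x)\<^sup>2 \<partial>lborel)"
    using g int by (intro Bochner_Integration.integral_mono) (auto simp: indicator_def)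
  finally show "l2norm (lebesgue_on \<Omega>) f \<le> l2norm lborel f" by (simp add: l2norm_def)
qed

lemma borel_representative_L2:
  fixes f :: "real ^ 'n \<Rightarrow> real"
  assumes f: "sq_int (lebesgue_on \<Omega>) f" and O: "open \<Omega>" "bounded \<Omega>"
  obtains f0 where "sq_int lborel f0" "integrable lborel f0" "\<And>x. x \<notin> \<Omega> \<Longrightarrow> f0 x = 0"
    "AE x in lebesgue_on \<Omega>. f x = f0 x" "l2norm lborel f0 = l2norm (lebesgue_on \<Omega>) f"
proof -
  interpret finite_measure "lebesgue_on \<Omega>"
    using O by (intro finite_measure_lebesgue_on lmeasurable_open)
  have m: "f \<in> borel_measurable (lebesgue_on \<Omega>)" and i: "integrable (lebesgue_on \<Omega>) f" "integrable (lebesgue_on \<Omega>) (\<lambda>x. (f x)\<^sup>2)"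
    using f sq_int_integrable[OF f] by (auto simp: sq_int_def)
  obtain f0 where f0: "f0 \<in> borel_measurable borel" "\<And>x. x \<notin> \<Omega> \<Longrightarrow> f0 x = 0" "AE x in lebesgue_on \<Omega>. f x = f0 x"
    by (rule borel_representative[OF m O(1)]) blast
  have AE2: "AE x in lebesgue_on \<Omega>. (f x)\<^sup>2 = (f0 x)\<^sup>2" using f0(3) by eventually_elim simp
  have m2: "(\<lambda>x. (f x)\<^sup>2) \<in> borel_measurable (lebesgue_on \<Omega>)" "(\<lambda>x. (f0 x)\<^sup>2) \<in> borel_measurable borel"
    using m f0 by auto
  note 1 = lebesgue_on_lborel[OF m O(1) f0]
  have 2: "integrable (lebesgue_on \<Omega>) (\<lambda>x. (f x)\<^sup>2) \<longleftrightarrow> integrable lborel (\<lambda>x. (f0 x)\<^sup>2)"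
    "(\<integral>x. (f x)\<^sup>2 \<partial>lebesgue_on \<Omega>) = (\<integral>x. (f0 x)\<^sup>2 \<partial>lborel)"
    by (rule lebesgue_on_lborel[OF m2(1) O(1) m2(2) _ AE2]; simp add: f0(2))+
  show ?thesis
    by (rule that[of f0]) (use 1 2 i f0 in \<open>auto simp: sq_int_def l2norm_def\<close>)
qed

section \<open>Scaled product kernels\<close>

text \<open>The dilation of \<open>prodf F\<close> by \<open>a\<close>, coordinate by coordinate,
  normalized to keep the integral. The components of \<open>a\<close> may be negative, as the cone
  may point in any direction; hence the absolute values.\<close>

definition kern :: "('n::finite \<Rightarrow> real \<Rightarrow> real) \<Rightarrow> real ^ 'n \<Rightarrow> real ^ 'n \<Rightarrow> real" where
  "kern F a y = (\<Prod>i\<in>UNIV. F i (y $ i / a $ i) / \<bar>a $ i\<bar>)"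

lemma prodf_continuous: "(\<And>i. smooth_real (F i)) \<Longrightarrow> continuous_on S (prodf F)"
  by (meson continuous_at_imp_continuous_on differentiable_imp_continuous_within differentiable_prodf)

lemma kern_eq_prodf:
  "kern F a y = (\<Prod>i\<in>UNIV. 1 / \<bar>a $ i\<bar>) * prodf F (\<chi> i. y $ i / a $ i)"
  by (simp add: kern_def prodf_def prod_dividef)

text \<open>Change of variables by the diagonal map \<open>T\<close>; stated for nonnegative
  integrals, so that integrability need not be known beforehand.\<close>

lemma nn_integral_scale:
  fixes G :: "real ^ 'n \<Rightarrow> ennreal"
  assumes [measurable]: "G \<in> borel_measurable borel" and a: "\<And>i. a $ i \<noteq> 0"
  shows "(\<integral>\<^sup>+y. G (\<chi> i. y $ i / a $ i) \<partial>lborel) = ennreal (\<Prod>i\<in>UNIV. \<bar>a $ i\<bar>) * (\<integral>\<^sup>+y. G y \<partial>lborel)"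
proof -
  define c where "c b = a \<bullet> b" for b
  have c: "c j \<noteq> 0" if "j \<in> Basis" for j using that a by (auto simp: c_def Basis_vec_def inner_axis)
  define T where "T x = 0 + (\<Sum>j\<in>Basis. (c j * (x \<bullet> j)) *\<^sub>R j)" for x :: "real ^ 'n"
  have T: "T x $ i = a $ i * x $ i" for x i
    using inner_sum_left_Basis[of "axis i 1" "\<lambda>j. c j * (x \<bullet> j)"]
    by (simp add: T_def c_def inner_axis axis_in_Basis_iff)
  have Tm[measurable]: "T \<in> borel_measurable borel" unfolding T_def by measurable
  have eq: "(\<chi> i. T x $ i / a $ i) = x" for x using a by (simp add: T vec_eq_iff)
  have div: "(\<lambda>y. \<chi> i. y $ i / a $ i) \<in> borel_measurable (borel :: (real ^ 'n) measure)"
    by (intro borel_measurable_continuous_onI continuous_intros) (use a in auto)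
  have [measurable]: "(\<lambda>y. G (\<chi> i. y $ i / a $ i)) \<in> borel_measurable borel"
    by (rule measurable_compose[OF div assms(1)])
  have "(\<Prod>j\<in>Basis. \<bar>c j\<bar>) = (\<Prod>i\<in>UNIV. \<bar>a $ i\<bar>)"
    unfolding c_def Basis_vec_def
    by (simp add: prod.UNION_disjoint UNION_singleton_eq_range prod.reindex inj_on_def axis_eq_axis inner_axis)
  with lborel_affine_euclidean[of c 0, OF c]
  have lb: "lborel = density (distr lborel borel T) (\<lambda>_. ennreal (\<Prod>i\<in>UNIV. \<bar>a $ i\<bar>))"
    unfolding T_def[abs_def] by simp
  have "(\<integral>\<^sup>+y. G (\<chi> i. y $ i / a $ i) \<partial>lborel) = (\<integral>\<^sup>+x. ennreal (\<Prod>i\<in>UNIV. \<bar>a $ i\<bar>) * G (\<chi> i. T x $ i / a $ i) \<partial>lborel)"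
    by (subst lb) (simp add: nn_integral_density nn_integral_distr)
  then show ?thesis unfolding eq by (simp add: nn_integral_cmult)
qed

text \<open>One constant that bounds both the L1 norm and the square of the L2 norm of the undilated
  product.\<close>

definition kern_const :: "('n::finite \<Rightarrow> real \<Rightarrow> real) \<Rightarrow> real" where
  "kern_const F = enn2real (\<integral>\<^sup>+y. ennreal \<bar>prodf F y\<bar> \<partial>lborel) + enn2real (\<integral>\<^sup>+y. ennreal ((prodf F y)\<^sup>2) \<partial>lborel)"

lemma prodf_bounds:
  fixes F :: "'n::finite \<Rightarrow> real \<Rightarrow> real"
  assumes F: "\<And>i. smooth_real (F i)" "\<And>i t. t \<notin> {l..u} \<Longrightarrow> F i t = 0"
  shows "(\<integral>\<^sup>+y. ennreal \<bar>prodf F y\<bar> \<partial>lborel) \<le> ennreal (kern_const F)"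
    and "(\<integral>\<^sup>+y. ennreal ((prodf F y)\<^sup>2) \<partial>lborel) \<le> ennreal (kern_const F)"
    and "0 \<le> kern_const F"
proof -
  let ?K = "cbox (\<chi> i. l) (\<chi> i. u) :: (real ^ 'n) set"
  have supp: "prodf F y = 0" if "y \<notin> ?K" for y
  proof -
    have "\<exists>i. y $ i \<notin> {l..u}" using that by (auto simp: mem_box_cart)
    then show ?thesis unfolding prodf_def using F(2) by (intro prod_zero) auto
  qed
  have fin: "(\<integral>\<^sup>+y. ennreal (G y) \<partial>lborel) < \<infinity>" if "continuous_on UNIV G" "\<And>y. y \<notin> ?K \<Longrightarrow> G y = 0" "\<And>y. 0 \<le> G y" for G
  proof -
    have "integrable lborel (\<lambda>x. indicator ?K x *\<^sub>R G x)"
      by (rule borel_integrable_compact) (auto intro: continuous_on_subset that)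
    also have "(\<lambda>x. indicator ?K x *\<^sub>R G x) = G"
    proof
      fix x show "indicator ?K x *\<^sub>R G x = G x" using that(2)[of x] by (cases "x \<in> ?K") (simp_all add: indicator_def)
    qed
    finally show ?thesis using that(3) by (simp add: integrable_iff_bounded)
  qed
  have "(\<integral>\<^sup>+y. ennreal \<bar>prodf F y\<bar> \<partial>lborel) < \<infinity>" "(\<integral>\<^sup>+y. ennreal ((prodf F y)\<^sup>2) \<partial>lborel) < \<infinity>"
    by (intro fin continuous_intros prodf_continuous F(1); simp add: supp)+
  then show "(\<integral>\<^sup>+y. ennreal \<bar>prodf F y\<bar> \<partial>lborel) \<le> ennreal (kern_const F)"
    "(\<integral>\<^sup>+y. ennreal ((prodf F y)\<^sup>2) \<partial>lborel) \<le> ennreal (kern_const F)"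
    by (auto simp: kern_const_def ennreal_plus[OF enn2real_nonneg enn2real_nonneg] ennreal_enn2real)
  show "0 \<le> kern_const F" by (simp add: kern_const_def)
qed

lemma kern_continuous:
  assumes "\<And>i. smooth_real (F i)" "\<And>i. a $ i \<noteq> 0"
  shows "continuous_on S (kern F a)"
  unfolding kern_eq_prodf[abs_def]
  by (intro continuous_intros continuous_on_compose2[OF prodf_continuous[of F UNIV]]) (use assms in auto)

lemma kern_measurable:
  assumes "\<And>i. smooth_real (F i)" "\<And>i. a $ i \<noteq> 0"
  shows "kern F a \<in> borel_measurable borel"
  by (intro borel_measurable_continuous_onI kern_continuous assms)

text \<open>The L1 norm is invariant under dilation, while the squared L2 norm grows by the inverse
  volume of the box. This volume is the source of the dimension in the condition for pointwise
  bounds.\<close>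

lemma kern_L1:
  fixes F :: "'n::finite \<Rightarrow> real \<Rightarrow> real"
  assumes F: "\<And>i. smooth_real (F i)" "\<And>i t. t \<notin> {l..u} \<Longrightarrow> F i t = 0" and a: "\<And>i. a $ i \<noteq> 0"
  shows "(\<integral>\<^sup>+y. ennreal \<bar>kern F a y\<bar> \<partial>lborel) \<le> ennreal (kern_const F)"
    and "(\<integral>\<^sup>+y. ennreal ((kern F a y)\<^sup>2) \<partial>lborel) \<le> ennreal (kern_const F / (\<Prod>i\<in>UNIV. \<bar>a $ i\<bar>))"
proof -
  define P where "P = (\<Prod>i\<in>UNIV. \<bar>a $ i\<bar>)"
  have P: "P > 0" "(\<Prod>i\<in>UNIV. 1 / \<bar>a $ i\<bar>) = 1 / P" using a by (auto simp: P_def prod_pos prod_dividef)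
  have m: "prodf F \<in> borel_measurable borel" by (intro borel_measurable_continuous_onI prodf_continuous F(1))
  have "(\<integral>\<^sup>+y. ennreal \<bar>kern F a y\<bar> \<partial>lborel) = (\<integral>\<^sup>+y. ennreal (1 / P * \<bar>prodf F (\<chi> i. y $ i / a $ i)\<bar>) \<partial>lborel)"
    using P by (simp add: kern_eq_prodf abs_mult)
  also have "\<dots> = (\<integral>\<^sup>+y. ennreal (1 / P * \<bar>prodf F y\<bar>) \<partial>lborel) * ennreal P"
    using nn_integral_scale[of "\<lambda>y. ennreal (1 / P * \<bar>prodf F y\<bar>)" a] m a by (simp add: P_def mult.commute)
  also have "\<dots> = (\<integral>\<^sup>+y. ennreal \<bar>prodf F y\<bar> \<partial>lborel)"
    using m P by (subst nn_integral_multc[symmetric]) (auto simp flip: ennreal_mult')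
  finally show "(\<integral>\<^sup>+y. ennreal \<bar>kern F a y\<bar> \<partial>lborel) \<le> ennreal (kern_const F)"
    using prodf_bounds(1)[OF F] by simp
  have "(\<integral>\<^sup>+y. ennreal ((kern F a y)\<^sup>2) \<partial>lborel) = (\<integral>\<^sup>+y. ennreal (1 / P\<^sup>2 * (prodf F (\<chi> i. y $ i / a $ i))\<^sup>2) \<partial>lborel)"
    using P by (simp add: kern_eq_prodf power_mult_distrib power_divide)
  also have "\<dots> = (\<integral>\<^sup>+y. ennreal (1 / P\<^sup>2 * (prodf F y)\<^sup>2) \<partial>lborel) * ennreal P"
    using nn_integral_scale[of "\<lambda>y. ennreal (1 / P\<^sup>2 * (prodf F y)\<^sup>2)" a] m a by (simp add: P_def mult.commute)
  also have "\<dots> = (\<integral>\<^sup>+y. ennreal (1 / P * (prodf F y)\<^sup>2) \<partial>lborel)"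
    using m P by (subst nn_integral_multc[symmetric]) (auto simp: power2_eq_square simp flip: ennreal_mult')
  also have "\<dots> = ennreal (1 / P) * (\<integral>\<^sup>+y. ennreal ((prodf F y)\<^sup>2) \<partial>lborel)"
    using m P by (subst nn_integral_cmult[symmetric]) (auto simp flip: ennreal_mult')
  also have "\<dots> \<le> ennreal (1 / P) * ennreal (kern_const F)"
    by (intro mult_left_mono prodf_bounds(2)[OF F]) auto
  finally show "(\<integral>\<^sup>+y. ennreal ((kern F a y)\<^sup>2) \<partial>lborel) \<le> ennreal (kern_const F / (\<Prod>i\<in>UNIV. \<bar>a $ i\<bar>))"
    using P by (simp add: P_def[symmetric] flip: ennreal_mult')
qed

text \<open>Fubini in the product representation of \<open>lborel\<close>, whose coordinates are
  indexed by basis vectors.\<close>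

lemma integral_prodf:
  fixes F :: "'n::finite \<Rightarrow> real \<Rightarrow> real"
  assumes F: "\<And>i. integrable lborel (F i)"
  shows "(\<integral>y. prodf F y \<partial>lborel) = (\<Prod>i\<in>UNIV. \<integral>t. F i t \<partial>lborel)"
proof -
  \<comment> \<open>Reindexes the factors by basis vectors; \<open>THE\<close> is well defined
    because \<open>axis i 1\<close> determines \<open>i\<close>.\<close>
  define G where "G b = F (THE i. b = axis i 1)" for b :: "real ^ 'n"
  have G: "G (axis i 1) = F i" for i by (simp add: G_def axis_eq_axis)
  have [measurable]: "F i \<in> borel_measurable borel" for i using F[of i] by auto
  have B: "(\<Prod>b\<in>Basis. h b) = (\<Prod>i\<in>UNIV. h (axis i 1 :: real ^ 'n))" for h :: "real ^ 'n \<Rightarrow> real"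
    unfolding Basis_vec_def
    by (simp add: prod.UNION_disjoint UNION_singleton_eq_range prod.reindex inj_on_def axis_eq_axis)
  interpret product_sigma_finite "\<lambda>_::real ^ 'n. lborel :: real measure" ..
  have [measurable]: "(\<lambda>x. x $ i) \<in> borel_measurable (borel :: (real ^ 'n) measure)" for i
    by (intro borel_measurable_continuous_onI continuous_intros)
  have pm: "prodf F \<in> borel_measurable borel" unfolding prodf_def[abs_def] by measurable
  have "(\<integral>y. prodf F y \<partial>lborel) = (\<integral>f. prodf F (\<Sum>b\<in>Basis. f b *\<^sub>R b) \<partial>(\<Pi>\<^sub>M b\<in>(Basis :: (real ^ 'n) set). lborel))"
    by (subst lborel_eq, subst integral_distr) (use pm in auto)
  also have "\<dots> = (\<integral>f. (\<Prod>b\<in>Basis. G b (f b)) \<partial>(\<Pi>\<^sub>M b\<in>(Basis :: (real ^ 'n) set). lborel))"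
  proof (rule Bochner_Integration.integral_cong)
    fix f :: "real ^ 'n \<Rightarrow> real"
    have "(\<Sum>b\<in>Basis. f b *\<^sub>R b) $ i = f (axis i 1)" for i
      using inner_sum_left_Basis[of "axis i 1" f] by (simp add: inner_axis axis_in_Basis_iff)
    then show "prodf F (\<Sum>b\<in>Basis. f b *\<^sub>R b) = (\<Prod>b\<in>Basis. G b (f b))"
      unfolding B prodf_def G by simp
  qed simp
  also have "\<dots> = (\<Prod>b\<in>Basis. \<integral>t. G b t \<partial>lborel)"
    by (rule product_integral_prod) (auto simp: Basis_vec_def G F)
  finally show ?thesis unfolding B G .
qed

section \<open>Correlation with a kernel\<close>

text \<open>Correlation instead of convolution: with a kernel supported in a cone at 0, the value at
  \<open>x\<close> samples \<open>f\<close> only on the cone with apex \<open>x\<close>.\<close>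

definition corr :: "('a::euclidean_space \<Rightarrow> real) \<Rightarrow> ('a \<Rightarrow> real) \<Rightarrow> 'a \<Rightarrow> real" where
  "corr f k x = (\<integral>z. f z * k (z - x) \<partial>lborel)"

lemma nn_integral_lborel_shift:
  fixes h :: "'a::euclidean_space \<Rightarrow> ennreal"
  assumes [measurable]: "h \<in> borel_measurable borel"
  shows "(\<integral>\<^sup>+z. h (z - x) \<partial>lborel) = (\<integral>\<^sup>+z. h z \<partial>lborel)"
    and "(\<integral>\<^sup>+x. h (z - x) \<partial>lborel) = (\<integral>\<^sup>+z. h z \<partial>lborel)"
proof -
  have "(\<integral>\<^sup>+z. h z \<partial>lborel) = (\<integral>\<^sup>+z. h ((-x) + 1 *\<^sub>R z) \<partial>lborel)"
    by (subst lborel_affine[of 1 "-x"]) (auto simp: nn_integral_density nn_integral_distr)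
  then show "(\<integral>\<^sup>+z. h (z - x) \<partial>lborel) = (\<integral>\<^sup>+z. h z \<partial>lborel)" by simp
  have "(\<integral>\<^sup>+z. h z \<partial>lborel) = (\<integral>\<^sup>+x. h (z + (-1) *\<^sub>R x) \<partial>lborel)"
    by (subst lborel_affine[of "-1" z]) (auto simp: nn_integral_density nn_integral_distr)
  then show "(\<integral>\<^sup>+x. h (z - x) \<partial>lborel) = (\<integral>\<^sup>+z. h z \<partial>lborel)" by simp
qed

lemma corr_integrable:
  fixes f k :: "'a::euclidean_space \<Rightarrow> real"
  assumes "integrable lborel f" "k \<in> borel_measurable borel" "\<And>y. \<bar>k y\<bar> \<le> B"
  shows "integrable lborel (\<lambda>z. f z * k (z - x))"
proof (rule Bochner_Integration.integrable_bound)
  show "integrable lborel (\<lambda>z. B * f z)" using assms(1) by simp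
  have [measurable]: "f \<in> borel_measurable borel" "k \<in> borel_measurable borel" using assms by auto
  show "(\<lambda>z. f z * k (z - x)) \<in> borel_measurable lborel" by measurable
  show "AE z in lborel. norm (f z * k (z - x)) \<le> norm (B * f z)"
  proof (rule AE_I2)
    fix z
    have "\<bar>k (z - x)\<bar> \<le> \<bar>B\<bar>" using assms(3)[of "z - x"] by simp
    from mult_left_mono[OF this, of "\<bar>f z\<bar>"] show "norm (f z * k (z - x)) \<le> norm (B * f z)"
      by (simp add: abs_mult mult.commute)
  qed
qed

lemma corr_measurable:
  fixes f k :: "'a::euclidean_space \<Rightarrow> real"
  assumes [measurable]: "f \<in> borel_measurable borel" "k \<in> borel_measurable borel"
  shows "corr f k \<in> borel_measurable borel"
  unfolding corr_def[abs_def] by measurable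

lemma corr_nn_bound:
  fixes f k :: "'a::euclidean_space \<Rightarrow> real"
  shows "ennreal \<bar>corr f k x\<bar> \<le> (\<integral>\<^sup>+z. ennreal \<bar>f z * k (z - x)\<bar> \<partial>lborel)"
proof (cases "integrable lborel (\<lambda>z. f z * k (z - x))")
  case True
  then show ?thesis using integral_norm_bound_ennreal[OF True] by (simp add: corr_def)
qed (simp add: corr_def not_integrable_integral_eq)

text \<open>Young's inequality for an L1 kernel: Cauchy-Schwarz with \<open>\<bar>k\<bar>\<close>
  split into two square roots, then Fubini; each of the two steps contributes a factor
  \<open>A\<close> to the square.\<close>

lemma corr_L2:
  fixes f k :: "'a::euclidean_space \<Rightarrow> real"
  assumes f: "sq_int lborel f" and [measurable]: "k \<in> borel_measurable borel"
    and k: "(\<integral>\<^sup>+y. ennreal \<bar>k y\<bar> \<partial>lborel) \<le> ennreal A" and A: "0 \<le> A"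
  shows "sq_int lborel (corr f k)" "l2norm lborel (corr f k) \<le> A * l2norm lborel f"
proof -
  have [measurable]: "f \<in> borel_measurable borel" using f by (simp add: sq_int_def)
  have pt: "ennreal ((corr f k x)\<^sup>2) \<le> ennreal A * (\<integral>\<^sup>+z. ennreal ((f z)\<^sup>2 * \<bar>k (z - x)\<bar>) \<partial>lborel)" for x
  proof -
    have "ennreal ((corr f k x)\<^sup>2) = (ennreal \<bar>corr f k x\<bar>)\<^sup>2" by (simp add: ennreal_power)
    also have "\<dots> \<le> (\<integral>\<^sup>+z. ennreal \<bar>f z * k (z - x)\<bar> \<partial>lborel)\<^sup>2"
      by (intro power_mono corr_nn_bound) auto
    also have "(\<integral>\<^sup>+z. ennreal \<bar>f z * k (z - x)\<bar> \<partial>lborel) =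
        (\<integral>\<^sup>+z. ennreal (\<bar>f z\<bar> * sqrt \<bar>k (z - x)\<bar>) * ennreal (sqrt \<bar>k (z - x)\<bar>) \<partial>lborel)"
      by (intro nn_integral_cong) (simp add: abs_mult flip: ennreal_mult)
    also have "\<dots>\<^sup>2 \<le> (\<integral>\<^sup>+z. (ennreal (\<bar>f z\<bar> * sqrt \<bar>k (z - x)\<bar>))\<^sup>2 \<partial>lborel) * (\<integral>\<^sup>+z. (ennreal (sqrt \<bar>k (z - x)\<bar>))\<^sup>2 \<partial>lborel)"
      by (rule Cauchy_Schwarz_nn_integral) measurable
    also have "(\<integral>\<^sup>+z. (ennreal (sqrt \<bar>k (z - x)\<bar>))\<^sup>2 \<partial>lborel) = (\<integral>\<^sup>+z. ennreal \<bar>k z\<bar> \<partial>lborel)"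
      by (subst nn_integral_lborel_shift(1)[symmetric, of _ x]) (auto simp: ennreal_power)
    also have "(\<integral>\<^sup>+z. (ennreal (\<bar>f z\<bar> * sqrt \<bar>k (z - x)\<bar>))\<^sup>2 \<partial>lborel) = (\<integral>\<^sup>+z. ennreal ((f z)\<^sup>2 * \<bar>k (z - x)\<bar>) \<partial>lborel)"
      by (simp add: ennreal_power power_mult_distrib)
    also have "(\<integral>\<^sup>+z. ennreal ((f z)\<^sup>2 * \<bar>k (z - x)\<bar>) \<partial>lborel) * (\<integral>\<^sup>+z. ennreal \<bar>k z\<bar> \<partial>lborel)
        \<le> (\<integral>\<^sup>+z. ennreal ((f z)\<^sup>2 * \<bar>k (z - x)\<bar>) \<partial>lborel) * ennreal A"
      by (intro mult_left_mono k) simp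
    finally show ?thesis by (simp add: mult.commute)
  qed
  have "(\<integral>\<^sup>+x. ennreal ((corr f k x)\<^sup>2) \<partial>lborel)
     \<le> (\<integral>\<^sup>+x. ennreal A * (\<integral>\<^sup>+z. ennreal ((f z)\<^sup>2 * \<bar>k (z - x)\<bar>) \<partial>lborel) \<partial>lborel)"
    by (intro nn_integral_mono pt)
  also have "\<dots> = ennreal A * (\<integral>\<^sup>+x. (\<integral>\<^sup>+z. ennreal ((f z)\<^sup>2 * \<bar>k (z - x)\<bar>) \<partial>lborel) \<partial>lborel)"
    by (rule nn_integral_cmult) measurable
  also have "(\<integral>\<^sup>+x. (\<integral>\<^sup>+z. ennreal ((f z)\<^sup>2 * \<bar>k (z - x)\<bar>) \<partial>lborel) \<partial>lborel)
     = (\<integral>\<^sup>+z. (\<integral>\<^sup>+x. ennreal ((f z)\<^sup>2 * \<bar>k (z - x)\<bar>) \<partial>lborel) \<partial>lborel)"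
    by (rule lborel_pair.Fubini') measurable
  also have "\<dots> = (\<integral>\<^sup>+z. ennreal ((f z)\<^sup>2) * (\<integral>\<^sup>+y. ennreal \<bar>k y\<bar> \<partial>lborel) \<partial>lborel)"
  proof (rule nn_integral_cong)
    fix z
    have "(\<integral>\<^sup>+x. ennreal ((f z)\<^sup>2 * \<bar>k (z - x)\<bar>) \<partial>lborel) = (\<integral>\<^sup>+x. ennreal ((f z)\<^sup>2) * ennreal \<bar>k (z - x)\<bar> \<partial>lborel)"
      by (simp add: ennreal_mult)
    also have "\<dots> = ennreal ((f z)\<^sup>2) * (\<integral>\<^sup>+x. ennreal \<bar>k (z - x)\<bar> \<partial>lborel)" by (rule nn_integral_cmult) measurable
    also have "(\<integral>\<^sup>+x. ennreal \<bar>k (z - x)\<bar> \<partial>lborel) = (\<integral>\<^sup>+y. ennreal \<bar>k y\<bar> \<partial>lborel)"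
      by (rule nn_integral_lborel_shift(2)) measurable
    finally show "(\<integral>\<^sup>+x. ennreal ((f z)\<^sup>2 * \<bar>k (z - x)\<bar>) \<partial>lborel) = ennreal ((f z)\<^sup>2) * (\<integral>\<^sup>+y. ennreal \<bar>k y\<bar> \<partial>lborel)" .
  qed
  also have "\<dots> = ennreal ((l2norm lborel f)\<^sup>2) * (\<integral>\<^sup>+y. ennreal \<bar>k y\<bar> \<partial>lborel)"
    using nn_integral_sq[OF f] by (subst nn_integral_multc) auto
  also have "ennreal A * (ennreal ((l2norm lborel f)\<^sup>2) * (\<integral>\<^sup>+y. ennreal \<bar>k y\<bar> \<partial>lborel))
      \<le> ennreal A * (ennreal ((l2norm lborel f)\<^sup>2) * ennreal A)"
    by (intro mult_left_mono k) auto
  also have "\<dots> = ennreal ((A * l2norm lborel f)\<^sup>2)"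
    using A by (simp add: power_mult_distrib power2_eq_square mult_ac flip: ennreal_mult)
  finally have b: "(\<integral>\<^sup>+x. ennreal ((corr f k x)\<^sup>2) \<partial>lborel) \<le> ennreal ((A * l2norm lborel f)\<^sup>2)" .
  have m: "corr f k \<in> borel_measurable lborel" using corr_measurable[of f k] by simp
  show "sq_int lborel (corr f k)" "l2norm lborel (corr f k) \<le> A * l2norm lborel f"
    using l2norm_le_nn_integral[OF m b] A by (auto simp: l2norm_nonneg)
qed

lemma corr_pointwise:
  fixes f k :: "'a::euclidean_space \<Rightarrow> real"
  assumes f: "sq_int lborel f" and [measurable]: "k \<in> borel_measurable borel"
    and k: "(\<integral>\<^sup>+y. ennreal ((k y)\<^sup>2) \<partial>lborel) \<le> ennreal A" and A: "0 \<le> A"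
  shows "\<bar>corr f k x\<bar> \<le> sqrt A * l2norm lborel f"
proof -
  have eq: "(\<integral>\<^sup>+z. ennreal ((k (z - x))\<^sup>2) \<partial>lborel) \<le> ennreal ((sqrt A)\<^sup>2)"
    using k A by (subst nn_integral_lborel_shift(1)) auto
  have m: "(\<lambda>z. k (z - x)) \<in> borel_measurable lborel" by measurable
  note * = l2norm_le_nn_integral[OF m eq real_sqrt_ge_zero[OF A]]
  have "\<bar>corr f k x\<bar> \<le> l2norm lborel f * l2norm lborel (\<lambda>z. k (z - x))"
    unfolding corr_def by (rule l2_Cauchy_Schwarz[OF f *(1)])
  also have "\<dots> \<le> l2norm lborel f * sqrt A" by (intro mult_left_mono * l2norm_nonneg)
  finally show ?thesis by (simp add: mult.commute)
qed

lemma corr_continuous: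
  fixes f k :: "'a::euclidean_space \<Rightarrow> real"
  assumes f: "integrable lborel f" and k: "continuous_on UNIV k" "\<And>y. \<bar>k y\<bar> \<le> B"
  shows "continuous_on S (corr f k)"
proof -
  have [measurable]: "f \<in> borel_measurable borel" "k \<in> borel_measurable borel"
    using f k by (auto intro: borel_measurable_continuous_onI)
  have "continuous (at x) (corr f k)" for x
    unfolding continuous_at_sequentially
  proof (intro allI impI)
    fix s :: "nat \<Rightarrow> 'a" assume s: "s \<longlonglongrightarrow> x"
    show "(corr f k \<circ> s) \<longlonglongrightarrow> corr f k x"
      unfolding corr_def comp_def
    proof (rule integral_dominated_convergence)
      show "integrable lborel (\<lambda>z. B * \<bar>f z\<bar>)" using f by simp
      show "AE z in lborel. (\<lambda>n. f z * k (z - s n)) \<longlonglongrightarrow> f z * k (z - x)"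
        using s k(1) by (auto intro!: tendsto_intros continuous_on_tendsto_compose[OF k(1)])
      show "AE z in lborel. norm (f z * k (z - s n)) \<le> B * \<bar>f z\<bar>" for n
        by (intro AE_I2) (simp add: abs_mult mult.commute[of B] mult_left_mono k(2))
    qed measurable
  qed
  then show ?thesis by (simp add: continuous_at_imp_continuous_on)
qed

text \<open>Averages of \<open>corr f (k n)\<close> over a box converge to those of \<open>f\<close> when the kernels have mass
  \<open>1\<close> and shrink to the origin.\<close>

lemma corr_box_limit:
  fixes f :: "'a::euclidean_space \<Rightarrow> real"
  assumes f: "integrable lborel f" and m[measurable]: "\<And>n. k n \<in> borel_measurable borel"
    and A: "\<And>n. (\<integral>\<^sup>+y. ennreal \<bar>k n y\<bar> \<partial>lborel) \<le> ennreal A" "0 \<le> A"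
    and mass: "\<And>n. (\<integral>y. k n y \<partial>lborel) = 1"
    and shrink: "\<And>n y. k n y \<noteq> 0 \<Longrightarrow> norm y \<le> \<rho> n" "\<rho> \<longlonglongrightarrow> 0"
  shows "(\<lambda>n. \<integral>x. indicator (box a b) x * corr f (k n) x \<partial>lborel) \<longlonglongrightarrow> (\<integral>x. indicator (box a b) x * f x \<partial>lborel)"
proof -
  have [measurable]: "f \<in> borel_measurable borel" using f by simp
  define g where "g n z = (\<integral>x. indicator (box a b) x * k n (z - x) \<partial>lborel)" for n z
  have [measurable]: "g n \<in> borel_measurable borel" for n unfolding g_def by measurable
  have kint: "integrable lborel (k n)" for n
    using le_less_trans[OF A(1) ennreal_less_top] by (auto intro!: integrableI_bounded)
  have kint': "integrable lborel (\<lambda>x. k n (z - x))" and kmass': "(\<integral>x. k n (z - x) \<partial>lborel) = 1" for n z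
  proof -
    have h: "has_bochner_integral lborel (k n) 1" using kint mass[of n] by (simp add: has_bochner_integral_iff)
    have "lborel = distr lborel borel (\<lambda>x. z + (-1) *\<^sub>R x)"
      by (subst lborel_affine[of "-1" z]) (auto simp: density_1)
    with h have "has_bochner_integral (distr lborel borel (\<lambda>x. z + (-1) *\<^sub>R x)) (k n) 1" by simp
    then have "has_bochner_integral lborel (\<lambda>x. k n (z - x)) 1"
      by (subst (asm) has_bochner_integral_iff) (simp add: integrable_distr_eq integral_distr has_bochner_integral_iff)
    then show "integrable lborel (\<lambda>x. k n (z - x))" "(\<integral>x. k n (z - x) \<partial>lborel) = 1"
      by (auto simp: has_bochner_integral_iff)
  qed
  have gb: "\<bar>g n z\<bar> \<le> A" for n z
  proof -
    have "integrable lborel (\<lambda>x. indicator (box a b) x * k n (z - x))"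
      using integrable_mult_indicator[of "box a b" lborel "\<lambda>x. k n (z - x)"] kint' by simp
    from integral_norm_bound_ennreal[OF this]
    have "ennreal \<bar>g n z\<bar> \<le> (\<integral>\<^sup>+x. norm (indicator (box a b) x * k n (z - x)) \<partial>lborel)" by (simp add: g_def)
    also have "\<dots> \<le> (\<integral>\<^sup>+x. ennreal \<bar>k n (z - x)\<bar> \<partial>lborel)"
      by (intro nn_integral_mono) (auto simp: indicator_def)
    also have "\<dots> = (\<integral>\<^sup>+y. ennreal \<bar>k n y\<bar> \<partial>lborel)" by (rule nn_integral_lborel_shift(2)) measurable
    also have "\<dots> \<le> ennreal A" by (rule A)
    finally show ?thesis using A(2) by simp
  qed
  \<comment> \<open>Fubini moves the average onto the indicator: \<open>g n\<close> is the indicator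
    of the box smoothed by \<open>k n\<close>.\<close>
  have swap: "(\<integral>x. indicator (box a b) x * corr f (k n) x \<partial>lborel) = (\<integral>z. f z * g n z \<partial>lborel)" for n
  proof -
    have "integrable (lborel \<Otimes>\<^sub>M lborel) (case_prod (\<lambda>z x. indicator (box a b) x * (f z * k n (z - x))))"
    proof (rule integrableI_bounded)
      have "(\<integral>\<^sup>+p. norm (case_prod (\<lambda>z x. indicator (box a b) x * (f z * k n (z - x))) p) \<partial>(lborel \<Otimes>\<^sub>M lborel))
         \<le> (\<integral>\<^sup>+p. (case p of (z, x) \<Rightarrow> ennreal \<bar>f z\<bar> * ennreal \<bar>k n (z - x)\<bar>) \<partial>(lborel \<Otimes>\<^sub>M lborel))"
        by (intro nn_integral_mono) (auto simp: indicator_def abs_mult ennreal_mult)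
      also have "\<dots> = (\<integral>\<^sup>+z. \<integral>\<^sup>+x. ennreal \<bar>f z\<bar> * ennreal \<bar>k n (z - x)\<bar> \<partial>lborel \<partial>lborel)"
        by (subst lborel.nn_integral_fst[symmetric]) auto
      also have "\<dots> = (\<integral>\<^sup>+z. ennreal \<bar>f z\<bar> * (\<integral>\<^sup>+y. ennreal \<bar>k n y\<bar> \<partial>lborel) \<partial>lborel)"
      proof (rule nn_integral_cong)
        fix z
        show "(\<integral>\<^sup>+x. ennreal \<bar>f z\<bar> * ennreal \<bar>k n (z - x)\<bar> \<partial>lborel) = ennreal \<bar>f z\<bar> * (\<integral>\<^sup>+y. ennreal \<bar>k n y\<bar> \<partial>lborel)"
          by (subst nn_integral_cmult) (auto intro!: arg_cong2[where f = "(*)"] nn_integral_lborel_shift(2)[where h = "\<lambda>y. ennreal \<bar>k n y\<bar>"])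
      qed
      also have "\<dots> \<le> (\<integral>\<^sup>+z. ennreal \<bar>f z\<bar> \<partial>lborel) * ennreal A"
        by (subst nn_integral_multc) (auto intro!: mult_left_mono A)
      also have "\<dots> < \<infinity>"
        using f by (simp add: integrable_iff_bounded ennreal_mult_less_top)
      finally show "(\<integral>\<^sup>+p. norm (case_prod (\<lambda>z x. indicator (box a b) x * (f z * k n (z - x))) p) \<partial>(lborel \<Otimes>\<^sub>M lborel)) < \<infinity>" .
    qed measurable
    from lborel_pair.Fubini_integral[OF this]
    have "(\<integral>x. \<integral>z. indicator (box a b) x * (f z * k n (z - x)) \<partial>lborel \<partial>lborel)
       = (\<integral>z. \<integral>x. indicator (box a b) x * (f z * k n (z - x)) \<partial>lborel \<partial>lborel)" .
    moreover have "(\<integral>z. indicator (box a b) x * (f z * k n (z - x)) \<partial>lborel) = indicator (box a b) x * corr f (k n) x" for x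
      by (simp add: corr_def)
    moreover have "(\<integral>x. indicator (box a b) x * (f z * k n (z - x)) \<partial>lborel) = f z * g n z" for z
      unfolding g_def by (simp add: mult.left_commute)
    ultimately show ?thesis by (simp only:)
  qed
  \<comment> \<open>Away from the boundary of the box, a null set, the smoothed indicator equals the
    indicator as soon as \<open>\<rho> n\<close> is below the distance to the boundary.\<close>
  have lim: "(\<lambda>n. g n z) \<longlonglongrightarrow> indicator (box a b) z" if z: "z \<notin> cbox a b - box a b" for z
  proof -
    have "\<exists>e>0. (\<forall>x. dist z x < e \<longrightarrow> indicator (box a b) x = (indicator (box a b) z :: real))"
    proof (cases "z \<in> box a b")
      case True
      then obtain e where "e > 0" "ball z e \<subseteq> box a b" using open_box openE by blast
      then show ?thesis using True by (intro exI[of _ e]) (auto simp: subset_iff)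
    next
      case False
      then have "z \<in> - cbox a b" using z by auto
      then obtain e where "e > 0" "ball z e \<subseteq> - cbox a b" using open_Compl[OF closed_cbox] openE by blast
      then show ?thesis using False box_subset_cbox[of a b]
        by (intro exI[of _ e]) (force simp: subset_iff indicator_def)
    qed
    then obtain e where e: "e > 0" "\<And>x. dist z x < e \<Longrightarrow> indicator (box a b) x = (indicator (box a b) z :: real)" by blast
    have "\<forall>\<^sub>F n in sequentially. \<rho> n < e" using shrink(2) e(1) by (rule order_tendstoD)
    then have "\<forall>\<^sub>F n in sequentially. indicator (box a b) z = g n z"
    proof eventually_elim
      case (elim n)
      have "indicator (box a b) x * k n (z - x) = indicator (box a b) z * k n (z - x)" for x
        using shrink(1)[of n "z - x"] elim e(2)[of x] by (cases "k n (z - x) = 0") (auto simp: dist_norm)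
      then have "g n z = (\<integral>x. indicator (box a b) z * k n (z - x) \<partial>lborel)" unfolding g_def by (simp only:)
      then show ?case using kmass'[of n z] by simp
    qed
    then show ?thesis by (rule Lim_transform_eventually[OF tendsto_const])
  qed
  have "(\<lambda>n. \<integral>z. f z * g n z \<partial>lborel) \<longlonglongrightarrow> (\<integral>z. f z * indicator (box a b) z \<partial>lborel)"
  proof (rule integral_dominated_convergence)
    show "integrable lborel (\<lambda>z. \<bar>f z\<bar> * A)" using f by simp
    show "AE z in lborel. (\<lambda>n. f z * g n z) \<longlonglongrightarrow> f z * indicator (box a b) z"
      using AE_lborel_box_cbox[of a b] by eventually_elim (auto intro!: tendsto_intros lim)
    show "AE z in lborel. norm (f z * g n z) \<le> \<bar>f z\<bar> * A" for n
      using gb by (auto simp: abs_mult intro!: mult_left_mono)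
  qed measurable
  then show ?thesis unfolding swap by (simp add: mult.commute)
qed

section \<open>Interior estimates on a cone patch\<close>

text \<open>The interval \<open>{1/4..1}\<close> contains the supports of \<open>avg_ker\<close>, of
  its dilate by 2 and of \<open>avg_ker_pot\<close>, and it is the range of \<open>\<tau>\<close> in
  the cone condition.\<close>

definition ker_fun :: "(real \<Rightarrow> real) \<Rightarrow> bool" where
  "ker_fun f \<longleftrightarrow> smooth_real f \<and> (\<forall>t. t \<notin> {1/4..1} \<longrightarrow> f t = 0)"

lemma ker_fun_smooth: "ker_fun f \<Longrightarrow> smooth_real f"
  and ker_fun_support: "ker_fun f \<Longrightarrow> t \<notin> {1/4..1} \<Longrightarrow> f t = 0"
  unfolding ker_fun_def by blast+

lemma ker_fun_iterate:
  assumes "ker_fun f"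
  shows "ker_fun ((deriv ^^ n) f)"
  unfolding ker_fun_def
proof (intro conjI allI impI)
  show "smooth_real ((deriv ^^ n) f)" using assms by (intro smooth_real_iterate ker_fun_smooth)
  fix t :: real assume t: "t \<notin> {1/4..1}"
  have "(deriv ^^ n) f t = (deriv ^^ n) (\<lambda>x. 0) t"
    by (rule iterated_deriv_eq_on_open[of "- {1/4..1}"])
      (use t ker_fun_support[OF assms] in \<open>auto intro: open_Compl\<close>)
  also have "(deriv ^^ n) (\<lambda>x. 0) = (\<lambda>x::real. 0::real)" by (induction n) auto
  finally show "(deriv ^^ n) f t = 0" .
qed

lemma ker_fun_avg_ker: "ker_fun (avg_ker m)"
  unfolding ker_fun_def
proof (intro conjI allI impI)
  fix t :: real assume "t \<notin> {1/4..1}"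
  then show "avg_ker m t = 0" by (intro avg_ker_support) auto
qed (rule smooth_avg_ker)

lemma ker_fun_avg_ker_double: "ker_fun (\<lambda>t. 2 * avg_ker m (2 * t + 0))"
  unfolding ker_fun_def
proof (intro conjI allI impI)
  fix t :: real assume "t \<notin> {1/4..1}"
  then have "2 * t + 0 \<notin> {1/2..1}" by auto
  from avg_ker_support[OF this, of m] show "2 * avg_ker m (2 * t + 0) = 0" by simp
qed (intro smooth_real_mult smooth_real_const smooth_real_affine smooth_avg_ker)

lemma ker_fun_avg_ker_pot: "ker_fun (avg_ker_pot m)"
  unfolding ker_fun_def using avg_ker_pot_support smooth_avg_ker_pot by blast

lemma kern_bounded:
  fixes F :: "'n::finite \<Rightarrow> real \<Rightarrow> real"
  assumes "\<And>i. ker_fun (F i)"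
  shows "\<exists>B. \<forall>y. \<bar>kern F a y\<bar> \<le> B"
proof -
  have "\<exists>b. \<forall>t. \<bar>F i t\<bar> \<le> b" for i
  proof -
    have "bounded (F i ` {1/4..1})"
      by (intro compact_imp_bounded compact_continuous_image smooth_real_continuous_on ker_fun_smooth assms) auto
    then obtain b where b: "b > 0" "\<And>t. t \<in> {1/4..1} \<Longrightarrow> \<bar>F i t\<bar> \<le> b" by (auto simp: bounded_pos)
    have "\<bar>F i t\<bar> \<le> b" for t
      using b ker_fun_support[OF assms, of t i] by (cases "t \<in> {1/4..1}") auto
    then show ?thesis by blast
  qed
  then obtain b where b: "\<And>i t. \<bar>F i t\<bar> \<le> b i" by metis
  have "\<bar>kern F a y\<bar> \<le> (\<Prod>i\<in>UNIV. b i / \<bar>a $ i\<bar>)" for y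
    unfolding kern_def abs_prod by (intro prod_mono) (auto intro!: divide_right_mono b)
  then show ?thesis by blast
qed

text \<open>Weak derivatives tested on products of functions of one variable. These suffice, since
  every kernel is such a product, and their derivatives do not involve
  \<open>mi_list\<close>.\<close>

definition weak_on_products ::
  "(real ^ 'n) set \<Rightarrow> 'n::finite multi_index \<Rightarrow> (real ^ 'n \<Rightarrow> real) \<Rightarrow> (real ^ 'n \<Rightarrow> real) \<Rightarrow> bool" where
  "weak_on_products \<Omega> \<alpha> u v \<longleftrightarrow>
     (\<forall>F a b. (\<forall>i. smooth_real (F i)) \<longrightarrow> (\<forall>i t. t \<notin> {a $ i..b $ i} \<longrightarrow> F i t = 0) \<longrightarrow> cbox a b \<subseteq> \<Omega> \<longrightarrow>
       (\<integral>x. u x * prodf (\<lambda>i. (deriv ^^ \<alpha> i) (F i)) x \<partial>lborel)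
         = (- 1) ^ mi_order \<alpha> * (\<integral>x. v x * prodf F x \<partial>lborel))"

lemma scaled_interval_iff:
  assumes "(a::real) \<noteq> 0"
  shows "s \<in> {min (x + a / 4) (x + a)..max (x + a / 4) (x + a)} \<longleftrightarrow> (s - x) / a \<in> {1/4..1}"
proof (cases "a > 0")
  case True
  then show ?thesis by (auto simp: min_def max_def field_simps)
next
  case False
  then have "a < 0" using assms by simp
  then show ?thesis by (auto simp: min_def max_def field_simps)
qed

text \<open>The dilated kernel translated to \<open>x\<close> is a product supported where
  \<open>\<tau>\<close> ranges over \<open>{1/4..1}\<close> in the cone at \<open>x\<close>, hence
  in \<open>\<Omega>\<close>. It serves as the test function, and each derivative in direction
  \<open>i\<close> costs a factor \<open>1 / a $ i\<close>.\<close>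

lemma corr_kern_weak:
  fixes F :: "'n::finite \<Rightarrow> real \<Rightarrow> real"
  assumes w: "weak_on_products \<Omega> \<alpha> u v" and F: "\<And>i. ker_fun (F i)" and a: "\<And>i. a $ i \<noteq> 0"
    and cone: "\<And>\<tau>. (\<And>i. \<tau> $ i \<in> {1/4..1}) \<Longrightarrow> x + (\<chi> i. a $ i * \<tau> $ i) \<in> \<Omega>"
  shows "(\<Prod>i\<in>UNIV. (1 / a $ i) ^ \<alpha> i) * corr u (kern (\<lambda>i. (deriv ^^ \<alpha> i) (F i)) a) x
     = (- 1) ^ mi_order \<alpha> * corr v (kern F a) x"
proof -
  define F' where "F' i s = (1 / \<bar>a $ i\<bar>) * F i ((1 / a $ i) * s + (- x $ i / a $ i))" for i s
  have smooth: "smooth_real (F' i)" for i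
    unfolding F'_def by (intro smooth_real_mult smooth_real_const smooth_real_affine ker_fun_smooth F)
  have arg: "(1 / a $ i) * s + (- x $ i / a $ i) = (s - x $ i) / a $ i" for i s by (simp add: diff_divide_distrib)
  define l where "l = (\<chi> i. min (x $ i + a $ i / 4) (x $ i + a $ i))"
  define r where "r = (\<chi> i. max (x $ i + a $ i / 4) (x $ i + a $ i))"
  have supp: "F' i s = 0" if "s \<notin> {l $ i..r $ i}" for i s
  proof -
    have "(s - x $ i) / a $ i \<notin> {1/4..1}"
      using that unfolding l_def r_def vec_lambda_beta scaled_interval_iff[OF a[of i]] .
    then show ?thesis unfolding F'_def arg using ker_fun_support[OF F] by simp
  qed
  have sub: "cbox l r \<subseteq> \<Omega>"
  proof
    fix z assume z: "z \<in> cbox l r"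
    define \<tau> where "\<tau> = (\<chi> i. (z $ i - x $ i) / a $ i)"
    have "\<tau> $ i \<in> {1/4..1}" for i
    proof -
      have "z $ i \<in> {l $ i..r $ i}" using z by (simp add: mem_box_cart)
      then show ?thesis unfolding l_def r_def \<tau>_def vec_lambda_beta scaled_interval_iff[OF a[of i]] .
    qed
    from cone[OF this] have "x + (\<chi> i. a $ i * \<tau> $ i) \<in> \<Omega>" .
    also have "x + (\<chi> i. a $ i * \<tau> $ i) = z" using a by (simp add: vec_eq_iff \<tau>_def)
    finally show "z \<in> \<Omega>" .
  qed
  have dF: "(deriv ^^ \<alpha> i) (F' i) = (\<lambda>s. (1 / \<bar>a $ i\<bar>) * (1 / a $ i) ^ \<alpha> i * (deriv ^^ \<alpha> i) (F i) ((s - x $ i) / a $ i))" for i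
  proof -
    have "F' i = (\<lambda>s. (1 / \<bar>a $ i\<bar>) * F i ((1 / a $ i) * s + (- x $ i / a $ i)))" by (rule ext) (simp only: F'_def)
    then show ?thesis unfolding arg[symmetric] by (simp only: iterated_deriv_affine[OF ker_fun_smooth[OF F]])
  qed
  have 1: "(\<integral>z. u z * prodf (\<lambda>i. (deriv ^^ \<alpha> i) (F' i)) z \<partial>lborel) = (- 1) ^ mi_order \<alpha> * (\<integral>z. v z * prodf F' z \<partial>lborel)"
    using w smooth supp sub unfolding weak_on_products_def by blast
  have 2: "prodf F' z = kern F a (z - x)" for z
    unfolding prodf_def kern_def F'_def arg by simp
  have 3: "prodf (\<lambda>i. (deriv ^^ \<alpha> i) (F' i)) z = (\<Prod>i\<in>UNIV. (1 / a $ i) ^ \<alpha> i) * kern (\<lambda>i. (deriv ^^ \<alpha> i) (F i)) a (z - x)" for z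
    unfolding prodf_def kern_def dF by (simp add: prod.distrib[symmetric] mult_ac)
  have "(\<Prod>i\<in>UNIV. (1 / a $ i) ^ \<alpha> i) * corr u (kern (\<lambda>i. (deriv ^^ \<alpha> i) (F i)) a) x
      = (\<integral>z. u z * prodf (\<lambda>i. (deriv ^^ \<alpha> i) (F' i)) z \<partial>lborel)"
    unfolding 3 corr_def by (subst mult.left_commute) simp
  also have "\<dots> = (- 1) ^ mi_order \<alpha> * corr v (kern F a) x" unfolding 1 2 corr_def ..
  finally show ?thesis .
qed

text \<open>Factors are exchanged one at a time; \<open>s j i\<close> tells whether factor
  \<open>i\<close> is taken from \<open>A\<close> or from \<open>B\<close> while \<open>j\<close> is
  exchanged. The index type has no order, so \<open>s\<close> comes from induction over the set. It
  is chosen before \<open>A\<close> and \<open>B\<close>, so that the kernels built from it do not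
  depend on the point of evaluation.\<close>

lemma prod_diff_telescope:
  assumes "finite S"
  shows "\<exists>s. \<forall>A B::'i \<Rightarrow> real. (\<Prod>i\<in>S. A i) - (\<Prod>i\<in>S. B i) =
    (\<Sum>j\<in>S. \<Prod>i\<in>S. if i = j then A i - B i else if s j i then A i else B i)"
  using assms
proof (induction S rule: finite_induct)
  case (insert x S)
  then obtain s where s: "\<And>A B::'i \<Rightarrow> real. (\<Prod>i\<in>S. A i) - (\<Prod>i\<in>S. B i) =
    (\<Sum>j\<in>S. \<Prod>i\<in>S. if i = j then A i - B i else if s j i then A i else B i)" by blast
  define s' where "s' j i = (if j = x then False else if i = x then True else s j i)" for j i
  have "(\<Prod>i\<in>insert x S. A i) - (\<Prod>i\<in>insert x S. B i) =
    (\<Sum>j\<in>insert x S. \<Prod>i\<in>insert x S. if i = j then A i - B i else if s' j i then A i else B i)" for A B :: "'i \<Rightarrow> real"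
  proof -
    have 1: "(\<Prod>i\<in>insert x S. if i = x then A i - B i else if s' x i then A i else B i) = (A x - B x) * (\<Prod>i\<in>S. B i)"
      using insert(1,2) by (auto simp: s'_def intro!: prod.cong)
    have 2: "(\<Prod>i\<in>insert x S. if i = j then A i - B i else if s' j i then A i else B i)
        = A x * (\<Prod>i\<in>S. if i = j then A i - B i else if s j i then A i else B i)" if "j \<in> S" for j
    proof -
      have "(\<Prod>i\<in>S. if i = j then A i - B i else if s' j i then A i else B i)
          = (\<Prod>i\<in>S. if i = j then A i - B i else if s j i then A i else B i)"
        using insert(2) that by (intro prod.cong) (auto simp: s'_def)
      moreover have "x \<noteq> j" using insert(2) that by auto
      ultimately show ?thesis using insert(1,2) by (simp add: s'_def)
    qed
    have "(\<Sum>j\<in>insert x S. \<Prod>i\<in>insert x S. if i = j then A i - B i else if s' j i then A i else B i)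
      = (A x - B x) * (\<Prod>i\<in>S. B i) + (\<Sum>j\<in>S. A x * (\<Prod>i\<in>S. if i = j then A i - B i else if s j i then A i else B i))"
      using insert(1,2) 1 2 by (simp del: prod.insert)
    also have "\<dots> = (A x - B x) * (\<Prod>i\<in>S. B i) + A x * ((\<Prod>i\<in>S. A i) - (\<Prod>i\<in>S. B i))"
      by (simp add: s sum_distrib_left[symmetric])
    finally show ?thesis using insert(1,2) by (simp add: algebra_simps)
  qed
  then show ?case by blast
qed simp

text \<open>The telescoping sum of the increments is dominated by a geometric series, whose sum is
  the last term of the bound.\<close>

lemma (in finite_measure) l2_geometric:
  assumes s: "\<And>n. sq_int M (s n)" and \<rho>: "0 \<le> \<rho>" "\<rho> < 1"
    and step: "\<And>n. l2norm M (\<lambda>x. s (Suc n) x - s n x) \<le> D * \<rho> ^ n"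
  shows "\<exists>f. sq_int M f \<and> (\<lambda>n. l2norm M (\<lambda>x. s n x - f x)) \<longlonglongrightarrow> 0 \<and> l2norm M f \<le> l2norm M (s 0) + D / (1 - \<rho>)"
proof -
  have D: "0 \<le> D" using step[of 0] l2norm_nonneg[of M "\<lambda>x. s (Suc 0) x - s 0 x"] by simp
  have far: "l2norm M (\<lambda>x. s (n + k) x - s n x) \<le> \<rho> ^ n * (D / (1 - \<rho>))" for n k
  proof -
    have "l2norm M (\<lambda>x. s (n + k) x - s n x) \<le> \<rho> ^ n * D * (\<Sum>i<k. \<rho> ^ i)"
    proof (induction k)
      case (Suc k)
      have "l2norm M (\<lambda>x. s (n + Suc k) x - s n x)
          \<le> l2norm M (\<lambda>x. s (Suc (n + k)) x - s (n + k) x) + l2norm M (\<lambda>x. s (n + k) x - s n x)"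
        using l2norm_triangle_diff[OF s s s] by simp
      also have "\<dots> \<le> D * \<rho> ^ (n + k) + \<rho> ^ n * D * (\<Sum>i<k. \<rho> ^ i)"
        by (intro add_mono step Suc)
      also have "\<dots> = \<rho> ^ n * D * (\<Sum>i<Suc k. \<rho> ^ i)" by (simp add: algebra_simps power_add)
      finally show ?case .
    qed (simp add: l2norm_def)
    also have "\<dots> \<le> \<rho> ^ n * D * (1 / (1 - \<rho>))"
    proof (rule mult_left_mono)
      show "(\<Sum>i<k. \<rho> ^ i) \<le> 1 / (1 - \<rho>)"
        using sum_le_suminf[of "\<lambda>i. \<rho> ^ i" "{..<k}"] suminf_geometric[of \<rho>] summable_geometric[of \<rho>] \<rho>
        by auto
    qed (use \<rho> D in simp)
    finally show ?thesis by simp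
  qed
  have lim0: "(\<lambda>n. \<rho> ^ n * (D / (1 - \<rho>))) \<longlonglongrightarrow> 0"
    using tendsto_mult_left_zero[OF LIMSEQ_realpow_zero[OF \<rho>]] .
  have "\<exists>N. \<forall>i\<ge>N. \<forall>j\<ge>N. l2norm M (\<lambda>x. s i x - s j x) < r" if r: "r > 0" for r
  proof -
    obtain N where N: "\<And>n. n \<ge> N \<Longrightarrow> \<rho> ^ n * (D / (1 - \<rho>)) < r"
      using order_tendstoD(2)[OF lim0 r] unfolding eventually_sequentially by blast
    have *: "l2norm M (\<lambda>x. s i x - s j x) < r" if "j \<ge> N" "i \<ge> j" for i j
      using far[of j "i - j"] N[OF that(1)] that by simp
    have "l2norm M (\<lambda>x. s i x - s j x) < r" if "j \<ge> N" "i \<ge> N" for i j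
      using *[of j i] *[of i j] that l2norm_minus_commute[of M "s i" "s j"] by (cases "i \<ge> j") auto
    then show ?thesis by blast
  qed
  from l2_complete[OF s this] obtain f
    where f: "sq_int M f" "(\<lambda>n. l2norm M (\<lambda>x. s n x - f x)) \<longlonglongrightarrow> 0" by blast
  have "l2norm M f \<le> l2norm M (s 0) + D / (1 - \<rho>) + l2norm M (\<lambda>x. s n x - f x)" for n
  proof -
    have "l2norm M f \<le> l2norm M (\<lambda>x. f x - s n x) + l2norm M (s n)"
      using l2norm_triangle[OF sq_int_diff[OF f(1) s[of n]] s[of n]] by simp
    moreover have "l2norm M (s n) \<le> l2norm M (\<lambda>x. s n x - s 0 x) + l2norm M (s 0)"
      using l2norm_triangle[OF sq_int_diff[OF s[of n] s[of 0]] s[of 0]] by simp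
    ultimately show ?thesis using far[of 0 n] l2norm_minus_commute[of M f "s n"] by simp
  qed
  moreover have "(\<lambda>n. l2norm M (s 0) + D / (1 - \<rho>) + l2norm M (\<lambda>x. s n x - f x)) \<longlonglongrightarrow> l2norm M (s 0) + D / (1 - \<rho>) + 0"
    by (intro tendsto_intros f(2))
  ultimately have "l2norm M f \<le> l2norm M (s 0) + D / (1 - \<rho>) + 0"
    by (intro LIMSEQ_le_const) auto
  with f show ?thesis by auto
qed

text \<open>\<open>m + 1\<close> is the top order and \<open>\<beta>\<close> the derivative to be
  estimated on \<open>W\<close>. From every point of \<open>W\<close> the boxes spanned by
  \<open>2^-n c\<close> and \<open>\<tau>\<close> lie in \<open>\<Omega>\<close> for all
  \<open>n\<close>, so the averages see no values outside the domain.\<close>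

locale cone_patch =
  fixes \<Omega> W :: "(real ^ 'n) set" and c :: "real ^ 'n" and m :: nat and \<beta> :: "'n multi_index"
  assumes c_nz: "\<And>i. c $ i \<noteq> 0"
    and cone: "\<And>x t \<tau>. \<lbrakk>x \<in> W; 0 < t; t \<le> 1; \<And>i. \<tau> $ i \<in> {1/4..1}\<rbrakk> \<Longrightarrow> x + (\<chi> i. t * c $ i * \<tau> $ i) \<in> \<Omega>"
    and W: "open W" "bounded W"
begin

definition sc :: "nat \<Rightarrow> real ^ 'n" where "sc n = (1 / 2) ^ n *\<^sub>R c"

definition avg :: "nat \<Rightarrow> real ^ 'n \<Rightarrow> real" where "avg n = kern (\<lambda>_. avg_ker m) (sc n)"

text \<open>The kernel for \<open>u\<close> that replaces \<open>avg 0\<close> once the derivatives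
  \<open>\<beta>\<close> have been moved from \<open>v\<close> onto the kernel.\<close>

definition avg0 :: "real ^ 'n \<Rightarrow> real" where "avg0 = kern (\<lambda>i. (deriv ^^ \<beta> i) (avg_ker m)) (sc 0)"

definition tele :: "'n \<Rightarrow> 'n \<Rightarrow> bool" where
  "tele = (SOME s. \<forall>A B::'n \<Rightarrow> real. (\<Prod>i\<in>UNIV. A i) - (\<Prod>i\<in>UNIV. B i) =
    (\<Sum>j\<in>UNIV. \<Prod>i\<in>UNIV. if i = j then A i - B i else if s j i then A i else B i))"

text \<open>Factors of the \<open>j\<close>-th summand in the telescoped difference of
  \<open>avg (Suc n)\<close> and \<open>avg n\<close>, with the exchanged factor replaced by its
  potential; the \<open>(m + 1)\<close>-st derivative in direction \<open>j\<close> is still to be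
  applied.\<close>

definition pot :: "'n \<Rightarrow> 'n \<Rightarrow> real \<Rightarrow> real" where
  "pot j i = (if i = j then avg_ker_pot m else if tele j i then (\<lambda>t. 2 * avg_ker m (2 * t + 0)) else avg_ker m)"

definition inc_ker :: "nat \<Rightarrow> 'n \<Rightarrow> real ^ 'n \<Rightarrow> real" where
  "inc_ker n j = kern (\<lambda>i. (deriv ^^ \<beta> i) (pot j i)) (sc n)"

text \<open>Moving \<open>\<beta>\<close> from \<open>v\<close> to the kernel yields the negative
  powers of \<open>sc n\<close>, moving \<open>m + 1\<close> derivatives from the kernel back to
  \<open>u\<close> the positive ones.\<close>

definition coef :: "nat \<Rightarrow> 'n \<Rightarrow> real" where
  "coef n j = (\<Prod>i\<in>UNIV. (1 / sc n $ i) ^ \<beta> i) * sc n $ j ^ Suc m"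

lemma tele: "(\<Prod>i\<in>UNIV. A i) - (\<Prod>i\<in>UNIV. B i) =
    (\<Sum>j\<in>UNIV. \<Prod>i\<in>UNIV. if i = j then A i - B i else if tele j i then A i else (B i :: real))"
proof -
  have "\<exists>s. \<forall>A B::'n \<Rightarrow> real. (\<Prod>i\<in>UNIV. A i) - (\<Prod>i\<in>UNIV. B i) =
    (\<Sum>j\<in>UNIV. \<Prod>i\<in>UNIV. if i = j then A i - B i else if s j i then A i else B i)"
    by (rule prod_diff_telescope) simp
  from someI_ex[OF this] show ?thesis unfolding tele_def by blast
qed

lemma sc_nz: "sc n $ i \<noteq> 0"
  by (simp add: sc_def c_nz)

lemma sc_cone:
  assumes "x \<in> W" "\<And>i. \<tau> $ i \<in> {1/4..1}"
  shows "x + (\<chi> i. sc n $ i * \<tau> $ i) \<in> \<Omega>"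
  using cone[OF assms(1) _ _ assms(2), of "(1 / 2) ^ n"] by (simp add: sc_def power_le_one)

lemma ker_fun_pot: "ker_fun (pot j i)"
  by (simp add: pot_def ker_fun_avg_ker ker_fun_avg_ker_pot ker_fun_avg_ker_double del: add_0_right)

lemma ker_fun_pot_deriv: "ker_fun ((deriv ^^ n) (pot j i))"
  by (rule ker_fun_iterate[OF ker_fun_pot])

text \<open>At half the scale the kernel factor is \<open>2 * avg_ker m (2 * t)\<close>, so
  \<open>avg_ker_dyadic\<close> turns the exchanged factor of each telescoped summand into an
  \<open>(m + 1)\<close>-st derivative.\<close>

lemma avg_diff:
  "avg (Suc n) y - avg n y = (\<Sum>j\<in>UNIV. kern (\<lambda>i. (deriv ^^ (if i = j then Suc m else 0)) (pot j i)) (sc n) y)"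
proof -
  let ?r2 = "\<lambda>t. 2 * avg_ker m (2 * t + 0)"
  have 1: "avg (Suc n) y = (\<Prod>i\<in>UNIV. ?r2 (y $ i / sc n $ i) / \<bar>sc n $ i\<bar>)"
    unfolding avg_def kern_def
  proof (rule prod.cong)
    fix i
    have half: "sc (Suc n) $ i = sc n $ i / 2" by (simp add: sc_def)
    show "avg_ker m (y $ i / sc (Suc n) $ i) / \<bar>sc (Suc n) $ i\<bar> = ?r2 (y $ i / sc n $ i) / \<bar>sc n $ i\<bar>"
      unfolding half by (simp add: mult.commute)
  qed simp
  have d: "?r2 t - avg_ker m t = (deriv ^^ Suc m) (avg_ker_pot m) t" for t
    using avg_ker_dyadic[of m t] by simp
  show ?thesis
    unfolding 1 unfolding avg_def kern_def tele
  proof (intro sum.cong prod.cong refl)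
    fix i j
    show "(if i = j then ?r2 (y $ i / sc n $ i) / \<bar>sc n $ i\<bar> - avg_ker m (y $ i / sc n $ i) / \<bar>sc n $ i\<bar>
        else if tele j i then ?r2 (y $ i / sc n $ i) / \<bar>sc n $ i\<bar> else avg_ker m (y $ i / sc n $ i) / \<bar>sc n $ i\<bar>)
       = (deriv ^^ (if i = j then Suc m else 0)) (pot j i) (y $ i / sc n $ i) / \<bar>sc n $ i\<bar>"
      by (auto simp: pot_def d[symmetric] diff_divide_distrib simp del: funpow.simps(2))
  qed
qed

text \<open>Start of the series: with all of \<open>\<beta>\<close> on the kernel, the first average
  of \<open>v\<close> is controlled by \<open>u\<close> alone.\<close>

lemma corr_avg_0:
  assumes w: "weak_on_products \<Omega> \<beta> u v" and x: "x \<in> W"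
  shows "corr v (avg 0) x = (- 1) ^ mi_order \<beta> * ((\<Prod>i\<in>UNIV. (1 / sc 0 $ i) ^ \<beta> i) * corr u avg0 x)"
  using corr_kern_weak[where F = "\<lambda>_. avg_ker m" and a = "sc 0", OF w ker_fun_avg_ker sc_nz sc_cone[OF x]]
  by (simp add: avg_def avg0_def mult.assoc[symmetric] flip: power_mult_distrib)

text \<open>Integration by parts twice. The derivatives \<open>\<beta>\<close> go from
  \<open>v\<close> to the kernel, leaving \<open>u\<close>; the kernel still is an
  \<open>(m + 1)\<close>-st derivative in direction \<open>j\<close>, which then goes back to
  \<open>u\<close> and yields \<open>w j\<close>. Therefore only the pure derivatives of top order
  enter the increments.\<close>

lemma corr_avg_step:
  assumes v: "integrable lborel v" and w: "weak_on_products \<Omega> \<beta> u v"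
    and wj: "\<And>j. weak_on_products \<Omega> (\<lambda>i. if i = j then Suc m else 0) u (w j)" and x: "x \<in> W"
  shows "corr v (avg (Suc n)) x - corr v (avg n) x
     = (- 1) ^ (mi_order \<beta> + Suc m) * (\<Sum>j\<in>UNIV. coef n j * corr (w j) (inc_ker n j) x)"
proof -
  let ?F = "\<lambda>j i. (deriv ^^ (if i = j then Suc m else 0)) (pot j i)"
  have sgn: "(- 1) ^ k * ((- 1) ^ k * y) = (y::real)" for k y
    by (simp add: mult.assoc[symmetric] flip: power_mult_distrib)
  have comm: "(deriv ^^ a) ((deriv ^^ b) f) = (deriv ^^ b) ((deriv ^^ a) f)" for a b and f :: "real \<Rightarrow> real"
    by (metis add.commute comp_apply funpow_add)
  have int: "integrable lborel (\<lambda>z. v z * kern F (sc l) (z - x))" if F: "\<And>i. ker_fun (F i)" for F l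
  proof -
    obtain B where "\<And>y. \<bar>kern F (sc l) y\<bar> \<le> B" using kern_bounded[of F "sc l", OF F] by blast
    then show ?thesis by (intro corr_integrable[OF v] kern_measurable ker_fun_smooth F sc_nz)
  qed
  have "corr v (avg (Suc n)) x - corr v (avg n) x = (\<integral>z. v z * (avg (Suc n) (z - x) - avg n (z - x)) \<partial>lborel)"
    unfolding corr_def avg_def using int[of "\<lambda>_. avg_ker m"] ker_fun_avg_ker
    by (simp add: right_diff_distrib)
  also have "\<dots> = (\<integral>z. (\<Sum>j\<in>UNIV. v z * kern (?F j) (sc n) (z - x)) \<partial>lborel)"
    unfolding avg_diff by (simp only: sum_distrib_left)
  also have "\<dots> = (\<Sum>j\<in>UNIV. corr v (kern (?F j) (sc n)) x)"
    unfolding corr_def by (rule Bochner_Integration.integral_sum) (intro int ker_fun_pot_deriv)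
  also have "\<dots> = (\<Sum>j\<in>UNIV. (- 1) ^ (mi_order \<beta> + Suc m) * (coef n j * corr (w j) (inc_ker n j) x))"
  proof (rule sum.cong)
    fix j
    let ?P = "\<Prod>i\<in>UNIV. (1 / sc n $ i) ^ \<beta> i"
    let ?D = "kern (\<lambda>i. (deriv ^^ \<beta> i) (?F j i)) (sc n)"
    have "?P * corr u ?D x = (- 1) ^ mi_order \<beta> * corr v (kern (?F j) (sc n)) x"
      by (rule corr_kern_weak[OF w ker_fun_pot_deriv sc_nz sc_cone[OF x]])
    then have 1: "corr v (kern (?F j) (sc n)) x = (- 1) ^ mi_order \<beta> * (?P * corr u ?D x)" by (simp only: sgn)
    have D: "?D = kern (\<lambda>i. (deriv ^^ (if i = j then Suc m else 0)) ((deriv ^^ \<beta> i) (pot j i))) (sc n)"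
      by (rule arg_cong[where f = "\<lambda>F. kern F (sc n)"], rule ext, rule comm)
    have o: "mi_order (\<lambda>i. if i = j then Suc m else 0) = Suc m" by (simp add: mi_order_def)
    have p: "(\<Prod>i\<in>UNIV. (1 / sc n $ i) ^ (if i = j then Suc m else 0)) = (1 / sc n $ j) ^ Suc m"
      by (subst prod.remove[of _ j]) auto
    have "(1 / sc n $ j) ^ Suc m * corr u ?D x = (- 1) ^ Suc m * corr (w j) (inc_ker n j) x"
      unfolding D inc_ker_def using corr_kern_weak[where F = "\<lambda>i. (deriv ^^ \<beta> i) (pot j i)" and a = "sc n", OF wj ker_fun_pot_deriv sc_nz sc_cone[OF x], of j] unfolding o p .
    then have "sc n $ j ^ Suc m * ((1 / sc n $ j) ^ Suc m * corr u ?D x) = sc n $ j ^ Suc m * ((- 1) ^ Suc m * corr (w j) (inc_ker n j) x)"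
      by simp
    moreover have "sc n $ j ^ Suc m * (1 / sc n $ j) ^ Suc m = 1"
      using sc_nz[of n j] by (simp flip: power_mult_distrib)
    ultimately have "corr u ?D x = sc n $ j ^ Suc m * ((- 1) ^ Suc m * corr (w j) (inc_ker n j) x)"
      by (simp only: mult.assoc[symmetric] mult_1)
    then show "corr v (kern (?F j) (sc n)) x = (- 1) ^ (mi_order \<beta> + Suc m) * (coef n j * corr (w j) (inc_ker n j) x)"
      unfolding 1 coef_def by (simp only: power_add mult_ac)
  qed simp
  finally show ?thesis by (simp only: sum_distrib_left)
qed

end

text \<open>Fatou bounds the norm of \<open>f - v\<close> by every positive number.\<close>

lemma l2_limit_AE_eq:
  assumes s: "\<And>n. sq_int M (s n)" and v: "sq_int M v" and lim: "(\<lambda>n. l2norm M (\<lambda>x. s n x - v x)) \<longlonglongrightarrow> 0"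
    and f: "f \<in> borel_measurable M" and pt: "AE x in M. (\<lambda>n. s n x) \<longlonglongrightarrow> f x"
  shows "AE x in M. f x = v x"
proof -
  have [measurable]: "v \<in> borel_measurable M" using v by (simp add: sq_int_def)
  have b: "sq_int M (\<lambda>x. f x - v x) \<and> l2norm M (\<lambda>x. f x - v x) \<le> e" if e: "e > 0" for e
  proof -
    obtain N where N: "\<And>n. n \<ge> N \<Longrightarrow> l2norm M (\<lambda>x. s n x - v x) < e"
      using order_tendstoD(2)[OF lim e] unfolding eventually_sequentially by blast
    have "AE x in M. (\<lambda>n. s (n + N) x - v x) \<longlonglongrightarrow> f x - v x"
      using pt by eventually_elim (intro tendsto_intros LIMSEQ_ignore_initial_segment)
    moreover have "sq_int M (\<lambda>x. s (n + N) x - v x)" "l2norm M (\<lambda>x. s (n + N) x - v x) \<le> e" for n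
      using N[of "n + N"] by (auto intro!: sq_int_diff s v)
    moreover have "(\<lambda>x. f x - v x) \<in> borel_measurable M" using f by measurable
    ultimately show ?thesis using l2_Fatou[of M "\<lambda>n x. s (n + N) x - v x" e "\<lambda>x. f x - v x"] by blast
  qed
  have "l2norm M (\<lambda>x. f x - v x) \<le> 0" by (rule field_le_epsilon) (use b in auto)
  then have "l2norm M (\<lambda>x. f x - v x) = 0" using l2norm_nonneg order_antisym by blast
  from l2norm_eq_0_AE[OF _ this] b[of 1] show ?thesis by auto
qed

lemma l2norm_cong: "(\<And>x. x \<in> space M \<Longrightarrow> f x = g x) \<Longrightarrow> l2norm M f = l2norm M g"
  unfolding l2norm_def by (rule arg_cong[of _ _ sqrt], rule Bochner_Integration.integral_cong) auto

lemma kern_bounds: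
  fixes F :: "'n::finite \<Rightarrow> real \<Rightarrow> real"
  assumes F: "\<And>i. ker_fun (F i)" and a: "\<And>i. a $ i \<noteq> 0"
  shows "(\<integral>\<^sup>+y. ennreal \<bar>kern F a y\<bar> \<partial>lborel) \<le> ennreal (kern_const F)"
    and "(\<integral>\<^sup>+y. ennreal ((kern F a y)\<^sup>2) \<partial>lborel) \<le> ennreal (kern_const F / (\<Prod>i\<in>UNIV. \<bar>a $ i\<bar>))"
    and "0 \<le> kern_const F"
proof -
  have s: "\<And>i. smooth_real (F i)" "\<And>i t. t \<notin> {1/4..1} \<Longrightarrow> F i t = 0"
    using F by (auto simp: ker_fun_def)
  show "(\<integral>\<^sup>+y. ennreal \<bar>kern F a y\<bar> \<partial>lborel) \<le> ennreal (kern_const F)"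
    "(\<integral>\<^sup>+y. ennreal ((kern F a y)\<^sup>2) \<partial>lborel) \<le> ennreal (kern_const F / (\<Prod>i\<in>UNIV. \<bar>a $ i\<bar>))"
    by (rule kern_L1[OF s a]; assumption)+
  show "0 \<le> kern_const F" by (rule prodf_bounds(3)[OF s])
qed

lemma integral_kern:
  fixes F :: "'n::finite \<Rightarrow> real \<Rightarrow> real"
  assumes F: "\<And>i. ker_fun (F i)" and a: "\<And>i. a $ i \<noteq> 0"
  shows "(\<integral>y. kern F a y \<partial>lborel) = (\<Prod>i\<in>UNIV. \<integral>t. F i t \<partial>lborel)"
proof -
  have int: "integrable lborel (F i)" for i
    by (rule integrable_smooth_real[of _ "1/4" 1]) (use F in \<open>auto simp: ker_fun_def\<close>)
  have aff: "integrable lborel (\<lambda>s. F i (s / a $ i) / \<bar>a $ i\<bar>)" "(\<integral>s. F i (s / a $ i) / \<bar>a $ i\<bar> \<partial>lborel) = (\<integral>t. F i t \<partial>lborel)" for i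
    using lborel_integrable_real_affine[OF int[of i], of "1 / a $ i" 0] lborel_integral_real_affine[of "1 / a $ i" "F i" 0] a[of i]
    by (auto simp: field_simps)
  have "(\<integral>y. kern F a y \<partial>lborel) = (\<integral>y. prodf (\<lambda>i s. F i (s / a $ i) / \<bar>a $ i\<bar>) y \<partial>lborel)"
    by (simp add: kern_def prodf_def)
  also have "\<dots> = (\<Prod>i\<in>UNIV. \<integral>s. F i (s / a $ i) / \<bar>a $ i\<bar> \<partial>lborel)"
    by (rule integral_prodf) (rule aff(1))
  finally show ?thesis unfolding aff(2) .
qed

context cone_patch
begin

definition data :: "(real ^ 'n \<Rightarrow> real) \<Rightarrow> (real ^ 'n \<Rightarrow> real) \<Rightarrow> ('n \<Rightarrow> real ^ 'n \<Rightarrow> real) \<Rightarrow> bool" where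
  "data u v w \<longleftrightarrow> (\<forall>f\<in>{u, v} \<union> range w. sq_int lborel f \<and> integrable lborel f) \<and>
     weak_on_products \<Omega> \<beta> u v \<and> (\<forall>j. weak_on_products \<Omega> (\<lambda>i. if i = j then Suc m else 0) u (w j))"

definition energy :: "(real ^ 'n \<Rightarrow> real) \<Rightarrow> ('n \<Rightarrow> real ^ 'n \<Rightarrow> real) \<Rightarrow> real" where
  "energy u w = l2norm lborel u + (\<Sum>j\<in>UNIV. l2norm lborel (w j))"

definition inc_const :: "'n \<Rightarrow> real" where
  "inc_const j = kern_const (\<lambda>i. (deriv ^^ \<beta> i) (pot j i))"

lemma energy_ge: "l2norm lborel u \<le> energy u w" "l2norm lborel (w j) \<le> energy u w" "0 \<le> energy u w"
proof -
  have s: "0 \<le> (\<Sum>j\<in>UNIV. l2norm lborel (w j))" by (intro sum_nonneg l2norm_nonneg)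
  then show "l2norm lborel u \<le> energy u w" "0 \<le> energy u w"
    using l2norm_nonneg[of lborel u] by (auto simp: energy_def)
  have "l2norm lborel (w j) \<le> (\<Sum>j\<in>UNIV. l2norm lborel (w j))"
    by (rule member_le_sum) (auto simp: l2norm_nonneg)
  then show "l2norm lborel (w j) \<le> energy u w"
    using l2norm_nonneg[of lborel u] by (auto simp: energy_def)
qed

lemma inc_const_nonneg: "0 \<le> inc_const j"
  unfolding inc_const_def by (rule kern_bounds(3)[OF ker_fun_pot_deriv sc_nz])

lemma inc_ker_measurable: "inc_ker n j \<in> borel_measurable borel"
  unfolding inc_ker_def by (intro kern_measurable ker_fun_smooth ker_fun_pot_deriv sc_nz)

lemma inc_ker_L1: "(\<integral>\<^sup>+y. ennreal \<bar>inc_ker n j y\<bar> \<partial>lborel) \<le> ennreal (inc_const j)"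
  and inc_ker_L2: "(\<integral>\<^sup>+y. ennreal ((inc_ker n j y)\<^sup>2) \<partial>lborel) \<le> ennreal (inc_const j / (\<Prod>i\<in>UNIV. \<bar>sc n $ i\<bar>))"
  unfolding inc_ker_def inc_const_def
  by (rule kern_bounds[OF ker_fun_pot_deriv sc_nz])+

lemma avg0_measurable: "avg0 \<in> borel_measurable borel"
  unfolding avg0_def by (intro kern_measurable ker_fun_smooth ker_fun_iterate ker_fun_avg_ker sc_nz)

lemma avg_measurable: "avg n \<in> borel_measurable borel"
  unfolding avg_def by (intro kern_measurable ker_fun_smooth ker_fun_avg_ker sc_nz)

lemma coef_scaling:
  assumes "mi_order \<beta> \<le> Suc m"
  shows "\<bar>coef n j\<bar> = ((1 / 2) ^ n) ^ (Suc m - mi_order \<beta>) * \<bar>coef 0 j\<bar>"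
proof -
  define q :: real where "q = (1 / 2) ^ n"
  have q: "q > 0" by (simp add: q_def)
  have s: "sc n $ i = q * c $ i" "sc 0 $ i = c $ i" for i by (simp_all add: sc_def q_def)
  have "(\<Prod>i\<in>UNIV. (1 / (q * c $ i)) ^ \<beta> i) = (\<Prod>i\<in>UNIV. (1 / q) ^ \<beta> i * (1 / c $ i) ^ \<beta> i)"
    by (intro prod.cong refl) (simp add: power_mult_distrib power_divide)
  also have "\<dots> = (1 / q) ^ mi_order \<beta> * (\<Prod>i\<in>UNIV. (1 / c $ i) ^ \<beta> i)"
    by (simp add: prod.distrib mi_order_def power_sum)
  finally have "coef n j = (q ^ Suc m * (1 / q) ^ mi_order \<beta>) * coef 0 j"
    unfolding coef_def s by (simp only: power_mult_distrib mult_ac)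
  also have "q ^ Suc m * (1 / q) ^ mi_order \<beta> = q ^ (Suc m - mi_order \<beta>)"
    using q assms by (simp add: power_diff power_divide)
  finally show ?thesis using q by (simp add: abs_mult q_def)
qed

text \<open>Integrals over boxes inside \<open>W\<close> identify the limit: norm convergence gives
  those of \<open>f\<close>, and \<open>corr_box_limit\<close> gives those of
  \<open>v\<close>.\<close>

lemma L2_limit_eq:
  assumes v: "sq_int lborel v" "integrable lborel v" and f: "sq_int (lebesgue_on W) f"
    and lim: "(\<lambda>n. l2norm (lebesgue_on W) (\<lambda>x. corr v (avg n) x - f x)) \<longlonglongrightarrow> 0"
  shows "AE x in lebesgue_on W. f x = v x"
proof -
  interpret finite_measure "lebesgue_on W"
    using W by (intro finite_measure_lebesgue_on lmeasurable_open)
  let ?A = "kern_const (\<lambda>_::'n. avg_ker m)"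
  have A: "(\<integral>\<^sup>+y. ennreal \<bar>avg n y\<bar> \<partial>lborel) \<le> ennreal ?A" "0 \<le> ?A" for n
    unfolding avg_def
    by (rule kern_bounds[OF ker_fun_avg_ker sc_nz])+
  have cs: "sq_int lborel (corr v (avg n))" for n
    by (rule corr_L2(1)[OF v(1) avg_measurable A])
  then have csW: "sq_int (lebesgue_on W) (corr v (avg n))" for n
    using sq_int_lebesgue_on(1) W by blast
  obtain f0 where f0: "sq_int lborel f0" "integrable lborel f0" "\<And>x. x \<notin> W \<Longrightarrow> f0 x = 0" "AE x in lebesgue_on W. f x = f0 x"
    by (rule borel_representative_L2[OF f W]) blast
  have fm: "f \<in> borel_measurable (lebesgue_on W)" using f by (simp add: sq_int_def)
  have [measurable]: "f0 \<in> borel_measurable borel" "v \<in> borel_measurable borel" "avg n \<in> borel_measurable borel" for n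
    using f0 v avg_measurable by (auto simp: sq_int_def)
  note [measurable] = corr_measurable[of v "avg n" for n]
  have box0: "(\<integral>x. indicator (box a b) x * (f0 x - v x) \<partial>lborel) = 0" if ab: "cbox a b \<subseteq> W" for a b
  proof -
    let ?I = "indicator (box a b) :: real ^ 'n \<Rightarrow> real"
    have bW: "box a b \<subseteq> W" using ab box_subset_cbox by blast
    have Im: "?I \<in> borel_measurable (lebesgue_on W)" by (rule borel_measurable_lebesgue_on) measurable
    have I: "sq_int (lebesgue_on W) ?I" by (rule sq_int_bounded(1)[OF Im, of 1]) (auto simp: indicator_def)
    have to: "(\<integral>x. g x * ?I x \<partial>lebesgue_on W) = (\<integral>x. ?I x * g0 x \<partial>lborel)"
      if g: "g \<in> borel_measurable (lebesgue_on W)" and g0[measurable]: "g0 \<in> borel_measurable borel" and "AE x in lebesgue_on W. g x = g0 x" for g g0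
    proof (rule lebesgue_on_lborel(2)[OF _ W(1)])
      show "(\<lambda>x. g x * ?I x) \<in> borel_measurable (lebesgue_on W)" using g Im by auto
      show "AE x in lebesgue_on W. g x * ?I x = ?I x * g0 x" using that(3) by eventually_elim (simp add: mult.commute)
    qed (use bW in \<open>auto simp: indicator_def\<close>)
    have "(\<lambda>n. \<integral>x. corr v (avg n) x * ?I x \<partial>lebesgue_on W) \<longlonglongrightarrow> (\<integral>x. f x * ?I x \<partial>lebesgue_on W)"
      by (rule l2_limit_integral[OF csW f I lim])
    also have "(\<lambda>n. \<integral>x. corr v (avg n) x * ?I x \<partial>lebesgue_on W) = (\<lambda>n. \<integral>x. ?I x * corr v (avg n) x \<partial>lborel)"
      using csW by (intro ext to) (auto simp: sq_int_def)
    also have "(\<integral>x. f x * ?I x \<partial>lebesgue_on W) = (\<integral>x. ?I x * f0 x \<partial>lborel)"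
      by (intro to fm f0(4)) measurable
    finally have l1: "(\<lambda>n. \<integral>x. ?I x * corr v (avg n) x \<partial>lborel) \<longlonglongrightarrow> (\<integral>x. ?I x * f0 x \<partial>lborel)" .
    have l2: "(\<lambda>n. \<integral>x. ?I x * corr v (avg n) x \<partial>lborel) \<longlonglongrightarrow> (\<integral>x. ?I x * v x \<partial>lborel)"
    proof (rule corr_box_limit[OF v(2) avg_measurable A])
      show "(\<integral>y. avg n y \<partial>lborel) = 1" for n
        unfolding avg_def by (subst integral_kern) (auto simp: ker_fun_avg_ker sc_nz integral_avg_ker)
      show "norm y \<le> (1 / 2) ^ n * (\<Sum>i\<in>UNIV. \<bar>c $ i\<bar>)" if "avg n y \<noteq> 0" for n y
      proof -
        have "\<bar>y $ i\<bar> \<le> (1 / 2) ^ n * \<bar>c $ i\<bar>" for i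
        proof -
          have "avg_ker m (y $ i / sc n $ i) \<noteq> 0" using that by (auto simp: avg_def kern_def)
          then have "y $ i / sc n $ i \<in> {1/4..1}" using ker_fun_support[OF ker_fun_avg_ker] by blast
          then have "\<bar>y $ i / sc n $ i\<bar> \<le> 1" by auto
          then have "\<bar>y $ i\<bar> \<le> \<bar>sc n $ i\<bar>" using sc_nz[of n i] by simp
          then show ?thesis by (simp add: sc_def abs_mult)
        qed
        then have "(\<Sum>i\<in>UNIV. \<bar>y $ i\<bar>) \<le> (\<Sum>i\<in>UNIV. (1 / 2) ^ n * \<bar>c $ i\<bar>)" by (intro sum_mono)
        then show ?thesis using norm_le_l1_cart[of y] by (simp only: sum_distrib_left)
      qed
      show "(\<lambda>n. (1 / 2) ^ n * (\<Sum>i\<in>UNIV. \<bar>c $ i\<bar>)) \<longlonglongrightarrow> 0"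
        by (intro tendsto_mult_left_zero LIMSEQ_realpow_zero) auto
    qed
    have "(\<integral>x. ?I x * f0 x \<partial>lborel) = (\<integral>x. ?I x * v x \<partial>lborel)" by (rule LIMSEQ_unique[OF l1 l2])
    moreover have "integrable lborel (\<lambda>x. ?I x * f0 x)" "integrable lborel (\<lambda>x. ?I x * v x)"
      using integrable_mult_indicator[of "box a b" lborel f0] integrable_mult_indicator[of "box a b" lborel v] f0(2) v(2) by auto
    ultimately show ?thesis by (simp add: right_diff_distrib)
  qed
  have "AE x in lborel. x \<in> W \<longrightarrow> f0 x - v x = 0"
    by (rule AE_zero_if_box_integrals_zero[OF _ W(1) box0]) (use f0 v in auto)
  then have "AE x in lebesgue_on W. f0 x - v x = 0" using AE_lebesgue_on_iff_lborel W(1) by blast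
  with f0(4) show ?thesis by eventually_elim simp
qed

text \<open>The L1 norms of the kernels \<open>inc_ker\<close> are bounded uniformly in
  \<open>n\<close>, so an increment has the size of \<open>coef n\<close>, that is
  \<open>2^(-n (m + 1 - |\<beta>|))\<close>. As \<open>|\<beta>| \<le> m\<close>, this decays at
  least like \<open>2^-n\<close>, and the increments add up to the term \<open>2 * S\<close> of the
  constant.\<close>

lemma L2_estimate:
  assumes \<beta>: "mi_order \<beta> < Suc m"
  shows "\<exists>C\<ge>0. \<forall>u v w. data u v w \<longrightarrow> l2norm (lebesgue_on W) v \<le> C * energy u w \<and>
     (\<lambda>n. l2norm (lebesgue_on W) (\<lambda>x. corr v (avg n) x - v x)) \<longlonglongrightarrow> 0"
proof -
  interpret finite_measure "lebesgue_on W"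
    using W by (intro finite_measure_lebesgue_on lmeasurable_open)
  let ?l2 = "l2norm (lebesgue_on W)"
  define P where "P = \<bar>\<Prod>i\<in>UNIV. (1 / sc 0 $ i) ^ \<beta> i\<bar>"
  define A where "A = kern_const (\<lambda>i. (deriv ^^ \<beta> i) (avg_ker m))"
  have A: "(\<integral>\<^sup>+y. ennreal \<bar>avg0 y\<bar> \<partial>lborel) \<le> ennreal A" "0 \<le> A"
    unfolding avg0_def A_def
    by (rule kern_bounds[OF ker_fun_iterate[OF ker_fun_avg_ker] sc_nz])+
  define S where "S = (\<Sum>j\<in>UNIV. \<bar>coef 0 j\<bar> * inc_const j)"
  have S: "0 \<le> S" unfolding S_def by (intro sum_nonneg mult_nonneg_nonneg inc_const_nonneg) auto
  have P: "0 \<le> P" by (simp add: P_def)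
  have "?l2 v \<le> (P * A + 2 * S) * energy u w \<and> (\<lambda>n. ?l2 (\<lambda>x. corr v (avg n) x - v x)) \<longlonglongrightarrow> 0"
    if d: "data u v w" for u v w
  proof -
    have sq: "sq_int lborel u" "sq_int lborel v" "sq_int lborel (w j)" "integrable lborel v"
      and wk: "weak_on_products \<Omega> \<beta> u v" "weak_on_products \<Omega> (\<lambda>i. if i = j then Suc m else 0) u (w j)" for j
      using d unfolding data_def by auto
    have cs: "sq_int (lebesgue_on W) (corr v (avg n))" for n
    proof -
      have "sq_int lborel (corr v (avg n))"
        unfolding avg_def
        by (intro corr_L2(1)[OF sq(2) _ kern_bounds(1)[OF ker_fun_avg_ker sc_nz] kern_bounds(3)[OF ker_fun_avg_ker sc_nz]]
            kern_measurable ker_fun_smooth ker_fun_avg_ker sc_nz)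
      then show ?thesis using sq_int_lebesgue_on(1) W by blast
    qed
    have step: "?l2 (\<lambda>x. corr v (avg (Suc n)) x - corr v (avg n) x) \<le> (S * energy u w) * (1 / 2) ^ n" for n
    proof -
      have ws: "sq_int lborel (corr (w j) (inc_ker n j))" "l2norm lborel (corr (w j) (inc_ker n j)) \<le> inc_const j * l2norm lborel (w j)" for j
        by (rule corr_L2[OF sq(3) inc_ker_measurable inc_ker_L1 inc_const_nonneg])+
      note wW = sq_int_lebesgue_on[OF ws(1) W(1)]
      have "?l2 (\<lambda>x. corr v (avg (Suc n)) x - corr v (avg n) x)
          = ?l2 (\<lambda>x. (- 1) ^ (mi_order \<beta> + Suc m) * (\<Sum>j\<in>UNIV. coef n j * corr (w j) (inc_ker n j) x))"
        using corr_avg_step[OF sq(4) wk] by (intro l2norm_cong) (simp add: space_restrict_space)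
      also have "\<dots> = ?l2 (\<lambda>x. \<Sum>j\<in>UNIV. coef n j * corr (w j) (inc_ker n j) x)"
        unfolding l2norm_cmult by (simp add: power_abs)
      also have "\<dots> \<le> (\<Sum>j\<in>UNIV. ?l2 (\<lambda>x. coef n j * corr (w j) (inc_ker n j) x))"
        by (rule l2norm_sum) (auto intro!: sq_int_cmult wW)
      also have "\<dots> \<le> (\<Sum>j\<in>UNIV. (\<bar>coef 0 j\<bar> * inc_const j) * (energy u w * (1 / 2) ^ n))"
      proof (rule sum_mono)
        fix j
        have "?l2 (\<lambda>x. coef n j * corr (w j) (inc_ker n j) x) \<le> \<bar>coef n j\<bar> * (inc_const j * energy u w)"
          unfolding l2norm_cmult
        proof (rule mult_left_mono)
          have "?l2 (corr (w j) (inc_ker n j)) \<le> inc_const j * l2norm lborel (w j)" using wW(2) ws(2) by (rule order_trans)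
          also have "\<dots> \<le> inc_const j * energy u w" by (intro mult_left_mono energy_ge inc_const_nonneg)
          finally show "?l2 (corr (w j) (inc_ker n j)) \<le> inc_const j * energy u w" .
        qed simp
        also have "\<bar>coef n j\<bar> \<le> \<bar>coef 0 j\<bar> * (1 / 2) ^ n"
        proof -
          have "((1 / 2) ^ n) ^ (Suc m - mi_order \<beta>) \<le> ((1 / 2 :: real) ^ n) ^ 1"
            by (rule power_decreasing) (use \<beta> in \<open>auto simp: power_le_one\<close>)
          then show ?thesis using coef_scaling[of n j] \<beta> by (simp add: mult.commute mult_left_mono)
        qed
        then have "\<bar>coef n j\<bar> * (inc_const j * energy u w) \<le> (\<bar>coef 0 j\<bar> * (1 / 2) ^ n) * (inc_const j * energy u w)"
          by (intro mult_right_mono mult_nonneg_nonneg inc_const_nonneg energy_ge)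
        finally show "?l2 (\<lambda>x. coef n j * corr (w j) (inc_ker n j) x) \<le> (\<bar>coef 0 j\<bar> * inc_const j) * (energy u w * (1 / 2) ^ n)"
          by (simp only: mult_ac)
      qed
      finally have "?l2 (\<lambda>x. corr v (avg (Suc n)) x - corr v (avg n) x) \<le> S * (energy u w * (1 / 2) ^ n)"
        unfolding S_def sum_distrib_right[symmetric] .
      then show ?thesis by (simp only: mult.assoc)
    qed
    obtain f where f: "sq_int (lebesgue_on W) f" "(\<lambda>n. ?l2 (\<lambda>x. corr v (avg n) x - f x)) \<longlonglongrightarrow> 0"
      "?l2 f \<le> ?l2 (corr v (avg 0)) + (S * energy u w) / (1 - 1 / 2)"
      using l2_geometric[OF cs _ _ step] by auto
    have AE: "AE x in lebesgue_on W. f x = v x" by (rule L2_limit_eq[OF sq(2,4) f(1,2)])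
    have vm: "v \<in> borel_measurable (lebesgue_on W)" using sq by (intro borel_measurable_lebesgue_on) (simp add: sq_int_def)
    have fm: "f \<in> borel_measurable (lebesgue_on W)" using f by (simp add: sq_int_def)
    have "?l2 (corr v (avg 0)) = ?l2 (\<lambda>x. ((- 1) ^ mi_order \<beta> * (\<Prod>i\<in>UNIV. (1 / sc 0 $ i) ^ \<beta> i)) * corr u avg0 x)"
      using corr_avg_0[OF wk(1)] by (intro l2norm_cong) (simp add: space_restrict_space)
    also have "\<dots> = P * ?l2 (corr u avg0)" unfolding l2norm_cmult by (simp add: abs_mult power_abs P_def)
    also have "?l2 (corr u avg0) \<le> A * energy u w"
    proof -
      have "?l2 (corr u avg0) \<le> l2norm lborel (corr u avg0)"
        using sq_int_lebesgue_on(2)[OF corr_L2(1)[OF sq(1) avg0_measurable A] W(1)] .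
      also have "\<dots> \<le> A * l2norm lborel u" by (rule corr_L2(2)[OF sq(1) avg0_measurable A])
      also have "\<dots> \<le> A * energy u w" by (intro mult_left_mono energy_ge A)
      finally show ?thesis .
    qed
    finally have "?l2 (corr v (avg 0)) \<le> P * (A * energy u w)" using P by (simp add: mult_left_mono)
    then have "?l2 f \<le> (P * A + 2 * S) * energy u w" using f(3) by (simp add: algebra_simps)
    moreover have "?l2 f = ?l2 v" by (rule l2norm_cong_AE[OF fm vm AE])
    moreover have "?l2 (\<lambda>x. corr v (avg n) x - f x) = ?l2 (\<lambda>x. corr v (avg n) x - v x)" for n
    proof (intro l2norm_cong_AE borel_measurable_diff fm vm sq_int_measurable[OF cs])
      show "AE x in lebesgue_on W. corr v (avg n) x - f x = corr v (avg n) x - v x"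
        using AE by eventually_elim simp
    qed
    ultimately show ?thesis using f(2) by simp
  qed
  moreover have "0 \<le> P * A + 2 * S" using P A S by simp
  ultimately show ?thesis by blast
qed

text \<open>Pointwise, an increment is bounded through the L2 norm of its kernel, which grows like
  \<open>2^(n d / 2)\<close>. The assumption makes \<open>m + 1 - |\<beta>| - d / 2\<close> at least
  1/2, so the increments decay like \<open>sqrt (1 / 2) ^ n\<close> uniformly on \<open>W\<close>,
  and the limit is continuous.\<close>

lemma continuous_estimate:
  assumes \<beta>: "2 * mi_order \<beta> + CARD('n) < 2 * Suc m"
  shows "\<exists>C\<ge>0. \<forall>u v w. data u v w \<longrightarrow> (\<exists>f. continuous_on W f \<and> (AE x in lebesgue_on W. v x = f x) \<and>
     (\<forall>x\<in>W. \<bar>f x\<bar> \<le> C * energy u w))"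
proof -
  interpret finite_measure "lebesgue_on W"
    using W by (intro finite_measure_lebesgue_on lmeasurable_open)
  let ?l2 = "l2norm (lebesgue_on W)"
  have "2 * mi_order \<beta> < 2 * Suc m" using le_less_trans[OF le_add1 \<beta>] .
  then have \<beta>1: "mi_order \<beta> < Suc m" by simp
  define P where "P = \<bar>\<Prod>i\<in>UNIV. (1 / sc 0 $ i) ^ \<beta> i\<bar>"
  define Q where "Q = (\<Prod>i\<in>UNIV. \<bar>c $ i\<bar>)"
  have Q: "0 < Q" unfolding Q_def using c_nz by (intro prod_pos) auto
  define A where "A = kern_const (\<lambda>i. (deriv ^^ \<beta> i) (avg_ker m)) / (\<Prod>i\<in>UNIV. \<bar>sc 0 $ i\<bar>)"
  have A: "(\<integral>\<^sup>+y. ennreal ((avg0 y)\<^sup>2) \<partial>lborel) \<le> ennreal A"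
    unfolding avg0_def A_def
    by (rule kern_bounds(2)[OF ker_fun_iterate[OF ker_fun_avg_ker] sc_nz])
  have A0: "0 \<le> A" unfolding A_def
    by (intro divide_nonneg_nonneg prod_nonneg kern_bounds(3)[OF ker_fun_iterate[OF ker_fun_avg_ker] sc_nz]) auto
  define S where "S = (\<Sum>j\<in>UNIV. \<bar>coef 0 j\<bar> * sqrt (inc_const j / Q))"
  have S: "0 \<le> S" unfolding S_def using inc_const_nonneg Q by (intro sum_nonneg mult_nonneg_nonneg) auto
  define \<rho> where "\<rho> = sqrt (1 / 2)"
  have \<rho>: "0 \<le> \<rho>" "\<rho> < 1" by (auto simp: \<rho>_def real_sqrt_divide)
  have P: "0 \<le> P" by (simp add: P_def)
  have rate: "((1 / 2) ^ n) ^ (Suc m - mi_order \<beta>) * sqrt (inc_const j / (\<Prod>i\<in>UNIV. \<bar>sc n $ i\<bar>)) \<le> sqrt (inc_const j / Q) * \<rho> ^ n" for n j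
  proof -
    define q :: real where "q = (1 / 2) ^ n"
    have q: "0 < q" "q \<le> 1" by (auto simp: q_def power_le_one)
    define e where "e = Suc m - mi_order \<beta>"
    \<comment> \<open>The exponent left over is at least 1; this is where the strict inequality of
      the assumption enters.\<close>
    have e: "2 * e = CARD('n) + Suc (2 * e - CARD('n) - 1)" using \<beta> by (auto simp: e_def)
    have "(\<Prod>i\<in>UNIV. \<bar>sc n $ i\<bar>) = (\<Prod>i\<in>UNIV. q * \<bar>c $ i\<bar>)" by (simp add: sc_def abs_mult q_def)
    also have "\<dots> = q ^ CARD('n) * Q" by (simp add: prod.distrib Q_def)
    finally have s: "(\<Prod>i\<in>UNIV. \<bar>sc n $ i\<bar>) = q ^ CARD('n) * Q" .
    have "q ^ e * sqrt (inc_const j / (q ^ CARD('n) * Q)) = sqrt (q ^ (2 * e)) * sqrt (inc_const j / (q ^ CARD('n) * Q))"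
      using q by (simp add: power_mult[of q 2 e, symmetric] real_sqrt_power_even power_even_eq)
    also have "\<dots> = sqrt (q ^ (2 * e) * (inc_const j / (q ^ CARD('n) * Q)))" by (rule real_sqrt_mult[symmetric])
    also have "q ^ (2 * e) * (inc_const j / (q ^ CARD('n) * Q)) = q ^ Suc (2 * e - CARD('n) - 1) * (inc_const j / Q)"
      by (subst e) (use q in \<open>simp add: power_add\<close>)
    also have "sqrt \<dots> \<le> sqrt (q * (inc_const j / Q))"
      using q Q inc_const_nonneg[of j] power_decreasing[of 1 "Suc (2 * e - CARD('n) - 1)" q]
      by (intro real_sqrt_le_mono mult_right_mono) auto
    also have "\<dots> = sqrt (inc_const j / Q) * \<rho> ^ n"
      unfolding real_sqrt_mult[of q] by (simp only: q_def \<rho>_def real_sqrt_power mult.commute)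
    finally show ?thesis unfolding s e_def q_def .
  qed
  have "\<exists>f. continuous_on W f \<and> (AE x in lebesgue_on W. v x = f x) \<and> (\<forall>x\<in>W. \<bar>f x\<bar> \<le> (P * sqrt A + S / (1 - \<rho>)) * energy u w)"
    if d: "data u v w" for u v w
  proof -
    have sq: "sq_int lborel u" "sq_int lborel v" "sq_int lborel (w j)" "integrable lborel v" "integrable lborel u"
      and wk: "weak_on_products \<Omega> \<beta> u v" "weak_on_products \<Omega> (\<lambda>i. if i = j then Suc m else 0) u (w j)" for j
      using d unfolding data_def by auto
    define D where "D n x = corr v (avg (Suc n)) x - corr v (avg n) x" for n x
    have Db: "norm (D n x) \<le> (S * energy u w) * \<rho> ^ n" if x: "x \<in> W" for n x
    proof -
      have "\<bar>D n x\<bar> = \<bar>\<Sum>j\<in>UNIV. coef n j * corr (w j) (inc_ker n j) x\<bar>"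
        unfolding D_def corr_avg_step[OF sq(4) wk x] by (simp add: abs_mult power_abs)
      also have "\<dots> \<le> (\<Sum>j\<in>UNIV. \<bar>coef n j * corr (w j) (inc_ker n j) x\<bar>)" by (rule sum_abs)
      also have "\<dots> \<le> (\<Sum>j\<in>UNIV. (\<bar>coef 0 j\<bar> * sqrt (inc_const j / Q)) * (energy u w * \<rho> ^ n))"
      proof (rule sum_mono)
        fix j
        let ?s = "sqrt (inc_const j / (\<Prod>i\<in>UNIV. \<bar>sc n $ i\<bar>))"
        have s0: "0 \<le> inc_const j / (\<Prod>i\<in>UNIV. \<bar>sc n $ i\<bar>)"
          by (intro divide_nonneg_nonneg prod_nonneg inc_const_nonneg) auto
        have "\<bar>corr (w j) (inc_ker n j) x\<bar> \<le> ?s * l2norm lborel (w j)"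
          by (rule corr_pointwise[OF sq(3) inc_ker_measurable inc_ker_L2 s0])
        also have "\<dots> \<le> ?s * energy u w" using s0 by (intro mult_left_mono energy_ge) auto
        finally have "\<bar>coef n j\<bar> * \<bar>corr (w j) (inc_ker n j) x\<bar> \<le> \<bar>coef n j\<bar> * (?s * energy u w)"
          by (rule mult_left_mono) simp
        also have "\<dots> = \<bar>coef 0 j\<bar> * energy u w * (((1 / 2) ^ n) ^ (Suc m - mi_order \<beta>) * ?s)"
          using coef_scaling[of n j] \<beta>1 by (simp add: mult_ac)
        also have "\<dots> \<le> \<bar>coef 0 j\<bar> * energy u w * (sqrt (inc_const j / Q) * \<rho> ^ n)"
          by (intro mult_left_mono rate mult_nonneg_nonneg energy_ge) auto
        finally show "\<bar>coef n j * corr (w j) (inc_ker n j) x\<bar> \<le> (\<bar>coef 0 j\<bar> * sqrt (inc_const j / Q)) * (energy u w * \<rho> ^ n)"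
          by (simp add: abs_mult mult_ac)
      qed
      finally have "norm (D n x) \<le> S * (energy u w * \<rho> ^ n)"
        unfolding S_def sum_distrib_right[symmetric] by simp
      then show ?thesis by (simp only: mult.assoc)
    qed
    have sm: "summable (\<lambda>n. (S * energy u w) * \<rho> ^ n)"
      using \<rho> by (intro summable_mult summable_geometric) auto
    have ul: "uniform_limit W (\<lambda>n x. \<Sum>i<n. D i x) (\<lambda>x. suminf (\<lambda>i. D i x)) sequentially"
      using Db sm by (rule Weierstrass_m_test)
    have tel: "(\<Sum>i<n. D i x) = corr v (avg n) x - corr v (avg 0) x" for n x
      unfolding D_def by (rule sum_lessThan_telescope)
    have ca: "continuous_on W (corr v (avg n))" for n
    proof -
      have "\<exists>B. \<forall>y. \<bar>avg n y\<bar> \<le> B" unfolding avg_def by (rule kern_bounded) (rule ker_fun_avg_ker)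
      then obtain B where "\<And>y. \<bar>avg n y\<bar> \<le> B" by blast
      moreover have "continuous_on UNIV (avg n)"
        unfolding avg_def by (intro kern_continuous ker_fun_smooth ker_fun_avg_ker sc_nz)
      ultimately show ?thesis by (intro corr_continuous[OF sq(4)])
    qed
    define f where "f x = corr v (avg 0) x + suminf (\<lambda>i. D i x)" for x
    have cf: "continuous_on W f"
      unfolding f_def
      by (intro continuous_intros ca uniform_limit_theorem[OF _ ul]) (auto simp: tel intro!: always_eventually continuous_intros ca)
    have pt: "(\<lambda>n. corr v (avg n) x) \<longlonglongrightarrow> f x" if x: "x \<in> W" for x
    proof -
      have "(\<lambda>n. corr v (avg 0) x + (\<Sum>i<n. D i x)) \<longlonglongrightarrow> f x"
        unfolding f_def by (intro tendsto_intros tendsto_uniform_limitI[OF ul x])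
      then show ?thesis by (simp add: tel)
    qed
    have bound: "\<bar>f x\<bar> \<le> (P * sqrt A + S / (1 - \<rho>)) * energy u w" if x: "x \<in> W" for x
    proof -
      have "\<bar>corr v (avg 0) x\<bar> = P * \<bar>corr u avg0 x\<bar>"
        unfolding corr_avg_0[OF wk(1) x] P_def by (simp add: abs_mult power_abs)
      also have "\<dots> \<le> P * (sqrt A * energy u w)"
      proof (rule mult_left_mono[OF _ P])
        have "\<bar>corr u avg0 x\<bar> \<le> sqrt A * l2norm lborel u" by (rule corr_pointwise[OF sq(1) avg0_measurable A A0])
        also have "\<dots> \<le> sqrt A * energy u w" using A0 by (intro mult_left_mono energy_ge) auto
        finally show "\<bar>corr u avg0 x\<bar> \<le> sqrt A * energy u w" .
      qed
      finally have 1: "\<bar>corr v (avg 0) x\<bar> \<le> P * (sqrt A * energy u w)" .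
      have "norm (suminf (\<lambda>i. D i x)) \<le> (\<Sum>i. (S * energy u w) * \<rho> ^ i)"
        by (rule norm_suminf_le[OF Db[OF x] sm])
      also have "\<dots> = S * energy u w * (1 / (1 - \<rho>))"
        using \<rho> by (subst suminf_mult) (auto simp: suminf_geometric intro: summable_geometric)
      finally show ?thesis using 1 unfolding f_def by (simp add: algebra_simps)
    qed
    have fm: "f \<in> borel_measurable (lebesgue_on W)"
      using cf W by (intro continuous_imp_measurable_on_sets_lebesgue) auto
    have vs: "sq_int (lebesgue_on W) v" by (rule sq_int_lebesgue_on(1)[OF sq(2) W(1)])
    have cs: "sq_int (lebesgue_on W) (corr v (avg n))" for n
    proof -
      have "sq_int lborel (corr v (avg n))"
        unfolding avg_def
        by (intro corr_L2(1)[OF sq(2) _ kern_bounds(1)[OF ker_fun_avg_ker sc_nz] kern_bounds(3)[OF ker_fun_avg_ker sc_nz]]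
            kern_measurable ker_fun_smooth ker_fun_avg_ker sc_nz)
      then show ?thesis using sq_int_lebesgue_on(1) W by blast
    qed
    have lim: "(\<lambda>n. ?l2 (\<lambda>x. corr v (avg n) x - v x)) \<longlonglongrightarrow> 0"
      using L2_estimate[OF \<beta>1] d by blast
    have "AE x in lebesgue_on W. f x = v x"
      by (rule l2_limit_AE_eq[OF cs vs lim fm]) (auto intro!: AE_I2 pt simp: space_restrict_space)
    then have "AE x in lebesgue_on W. v x = f x" by eventually_elim simp
    then show ?thesis using cf bound by blast
  qed
  moreover have "0 \<le> P * sqrt A + S / (1 - \<rho>)" using P A0 S \<rho> by simp
  ultimately show ?thesis by blast
qed

end

section \<open>Classical partial derivatives\<close>

lemma has_derivative_dir_deriv:
  fixes F :: "'a::euclidean_space \<Rightarrow> real"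
  assumes "F differentiable (at x)"
  shows "(F has_derivative (\<lambda>h. \<Sum>b\<in>Basis. (h \<bullet> b) * dir_deriv b F x)) (at x)"
proof -
  obtain F' where F': "(F has_derivative F') (at x)" using assms by (auto simp: differentiable_def)
  interpret bounded_linear F' using F' by (rule has_derivative_bounded_linear)
  have d: "dir_deriv b F x = F' b" for b
  proof -
    have "((\<lambda>t. x + t *\<^sub>R b) has_derivative (\<lambda>t. t *\<^sub>R b)) (at 0)" by (auto intro!: derivative_eq_intros)
    from diff_chain_at[OF this, of F F'] F'
    have "((\<lambda>t. F (x + t *\<^sub>R b)) has_derivative (\<lambda>t. F' (t *\<^sub>R b))) (at 0)" by (simp add: comp_def)
    moreover have "(\<lambda>t. F' (t *\<^sub>R b)) = (\<lambda>t. t * F' b)" by (simp add: scaleR)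
    ultimately have "((\<lambda>t. F (x + t *\<^sub>R b)) has_field_derivative F' b) (at 0)"
      by (simp add: has_field_derivative_def mult.commute[of _ "F' b"])
    then show ?thesis unfolding dir_deriv_def by (rule DERIV_imp_deriv)
  qed
  have "F' = (\<lambda>h. \<Sum>b\<in>Basis. (h \<bullet> b) * dir_deriv b F x)"
  proof
    fix h
    have "F' h = F' (\<Sum>b\<in>Basis. (h \<bullet> b) *\<^sub>R b)" by (simp add: euclidean_representation)
    also have "\<dots> = (\<Sum>b\<in>Basis. (h \<bullet> b) * dir_deriv b F x)" by (simp add: sum scaleR d)
    finally show "F' h = (\<Sum>b\<in>Basis. (h \<bullet> b) * dir_deriv b F x)" .
  qed
  then show ?thesis using F' by simp
qed

lemma smooth_on_differentiable:
  assumes "smooth_on S f" "set bs \<subseteq> Basis" "open S" "x \<in> S"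
  shows "dir_derivs bs f differentiable (at x)"
  using assms unfolding smooth_on_def by (simp add: differentiable_on_eq_differentiable_at)

lemma smooth_on_continuous:
  assumes "smooth_on S f" "set bs \<subseteq> Basis"
  shows "continuous_on S (dir_derivs bs f)"
  using assms unfolding smooth_on_def by (simp add: differentiable_imp_continuous_on)

lemma smooth_on_dir_deriv:
  assumes "smooth_on S f" "b \<in> Basis"
  shows "smooth_on S (dir_deriv b f)"
  unfolding smooth_on_def
proof (intro allI impI)
  fix bs :: "'a list" assume "set bs \<subseteq> Basis"
  then have "set (bs @ [b]) \<subseteq> Basis" using assms by simp
  then have "dir_derivs (bs @ [b]) f differentiable_on S" using assms(1) unfolding smooth_on_def by blast
  then show "dir_derivs bs (dir_deriv b f) differentiable_on S" by (simp add: dir_derivs_def)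
qed

lemma smooth_on_has_derivative:
  assumes "smooth_on S f" "open S" "x \<in> S"
  shows "(f has_derivative (\<lambda>h. \<Sum>b\<in>Basis. (h \<bullet> b) * dir_deriv b f x)) (at x)"
  using smooth_on_differentiable[OF assms(1), of "[]"] assms
  by (intro has_derivative_dir_deriv) (simp add: dir_derivs_def)

lemma sum_inner_mult_le_norm:
  fixes h :: "'a::euclidean_space"
  shows "\<bar>\<Sum>b\<in>Basis. (h \<bullet> b) * g b\<bar> \<le> (\<Sum>b\<in>Basis. \<bar>g b\<bar>) * norm h"
proof -
  have "\<bar>\<Sum>b\<in>Basis. (h \<bullet> b) * g b\<bar> \<le> (\<Sum>b\<in>Basis. \<bar>(h \<bullet> b) * g b\<bar>)" by (rule sum_abs)
  also have "\<dots> \<le> (\<Sum>b\<in>Basis. norm h * \<bar>g b\<bar>)"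
    unfolding abs_mult by (intro sum_mono mult_right_mono Basis_le_norm) auto
  finally show ?thesis by (simp add: sum_distrib_left mult.commute)
qed

lemma Lipschitz_by_partials:
  fixes f :: "'a::euclidean_space \<Rightarrow> real"
  assumes S: "convex S" and d: "\<And>x. x \<in> S \<Longrightarrow> (f has_derivative (\<lambda>h. \<Sum>b\<in>Basis. (h \<bullet> b) * g b x)) (at x)"
    and M: "\<And>x. x \<in> S \<Longrightarrow> (\<Sum>b\<in>Basis. \<bar>g b x\<bar>) \<le> M" and xy: "x \<in> S" "y \<in> S"
  shows "\<bar>f x - f y\<bar> \<le> M * norm (x - y)"
proof -
  have "norm (f y - f x) \<le> M * norm (y - x)"
  proof (rule differentiable_bound[OF S])
    show "(f has_derivative (\<lambda>h. \<Sum>b\<in>Basis. (h \<bullet> b) * g b x)) (at x within S)" if "x \<in> S" for x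
      using d[OF that] by (rule has_derivative_at_withinI)
    show "onorm (\<lambda>h. \<Sum>b\<in>Basis. (h \<bullet> b) * g b x) \<le> M" if "x \<in> S" for x
    proof (rule onorm_le)
      fix h :: 'a
      show "norm (\<Sum>b\<in>Basis. (h \<bullet> b) * g b x) \<le> M * norm h"
        using sum_inner_mult_le_norm[of h "\<lambda>b. g b x"] mult_right_mono[OF M[OF that] norm_ge_zero[of h]] by simp
    qed
  qed fact+
  then show ?thesis by (simp add: norm_minus_commute abs_minus_commute)
qed

lemma smooth_locally_Lipschitz:
  fixes f :: "'a::euclidean_space \<Rightarrow> real"
  assumes f: "smooth_on UNIV f"
  shows "\<exists>M\<ge>0. \<forall>x\<in>cball x0 r. \<forall>y\<in>cball x0 r. \<bar>f x - f y\<bar> \<le> M * norm (x - y)"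
proof -
  have "continuous_on (cball x0 r) (\<lambda>x. \<Sum>b\<in>Basis. \<bar>dir_deriv b f x\<bar>)"
  proof (intro continuous_intros)
    fix b :: 'a assume "b \<in> Basis"
    then show "continuous_on (cball x0 r) (dir_deriv b f)"
      using smooth_on_continuous[OF f, of "[b]"] by (auto simp: dir_derivs_def intro: continuous_on_subset)
  qed
  then have "bounded ((\<lambda>x. \<Sum>b\<in>Basis. \<bar>dir_deriv b f x\<bar>) ` cball x0 r)"
    by (intro compact_imp_bounded compact_continuous_image compact_cball)
  then obtain M where M: "M > 0" "\<And>x. x \<in> cball x0 r \<Longrightarrow> (\<Sum>b\<in>Basis. \<bar>dir_deriv b f x\<bar>) \<le> M"
    unfolding bounded_pos by (auto simp: abs_le_iff)
  have "\<bar>f x - f y\<bar> \<le> M * norm (x - y)" if "x \<in> cball x0 r" "y \<in> cball x0 r" for x y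
    by (rule Lipschitz_by_partials[OF convex_cball _ M(2) that]) (use smooth_on_has_derivative[OF f] in auto)
  then show ?thesis using M(1) less_imp_le by blast
qed

section \<open>Smooth domains satisfy a cone condition\<close>

text \<open>A box-shaped cone: all components of \<open>c\<close> are nonzero because the averaging
  boxes are dilated by \<open>c\<close> in every coordinate. Only base points inside
  \<open>\<Omega>\<close> count, so \<open>U\<close> may reach across the boundary.\<close>

definition cone_at :: "(real ^ 'n) set \<Rightarrow> (real ^ 'n) set \<Rightarrow> real ^ 'n \<Rightarrow> bool" where
  "cone_at \<Omega> U c \<longleftrightarrow> open U \<and> (\<forall>i. c $ i \<noteq> 0) \<and>
     (\<forall>x\<in>U \<inter> \<Omega>. \<forall>t \<tau>. 0 < t \<longrightarrow> t \<le> 1 \<longrightarrow> (\<forall>i. \<tau> $ i \<in> {1/4..1}) \<longrightarrow> x + (\<chi> i. t * c $ i * \<tau> $ i) \<in> \<Omega>)"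

lemma cone_at_interior:
  fixes \<Omega> :: "(real ^ 'n) set"
  assumes "open \<Omega>" "x0 \<in> \<Omega>"
  shows "\<exists>U c. x0 \<in> U \<and> cone_at \<Omega> U c"
proof -
  obtain r where r: "r > 0" "ball x0 r \<subseteq> \<Omega>" using assms openE by blast
  \<comment> \<open>Makes the sum of the absolute components of every cone vector at most
    \<open>r / 4\<close>.\<close>
  define \<kappa> where "\<kappa> = r / (4 * CARD('n))"
  have \<kappa>: "\<kappa> > 0" "CARD('n) * \<kappa> = r / 4" using r by (auto simp: \<kappa>_def)
  have "x + (\<chi> i. t * (\<chi> i. \<kappa>) $ i * \<tau> $ i) \<in> \<Omega>"
    if x: "x \<in> ball x0 (r / 2)" and t: "0 < t" "t \<le> 1" and \<tau>: "\<And>i. \<tau> $ i \<in> {1/4..1}" for x t \<tau>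
  proof -
    let ?v = "\<chi> i. t * \<kappa> * \<tau> $ i"
    have "\<bar>?v $ i\<bar> \<le> \<kappa>" for i
    proof -
      have "t * \<tau> $ i \<le> 1 * 1" using t \<tau>[of i] by (intro mult_mono) auto
      then have "\<kappa> * (t * \<tau> $ i) \<le> \<kappa> * 1" using \<kappa>(1) by (intro mult_left_mono) auto
      then show ?thesis using \<kappa> t \<tau>[of i] by (simp add: abs_mult mult_ac)
    qed
    then have "norm ?v \<le> (\<Sum>i\<in>(UNIV :: 'n set). \<kappa>)" by (intro order_trans[OF norm_le_l1_cart] sum_mono)
    then have "norm ?v \<le> r / 4" using \<kappa>(2) by simp
    then have "x + ?v \<in> ball x0 r"
      using x r norm_triangle_ineq[of "x - x0" ?v] by (simp add: dist_norm norm_minus_commute algebra_simps)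
    then show ?thesis using r by auto
  qed
  then have "cone_at \<Omega> (ball x0 (r / 2)) (\<chi> i. \<kappa>)" using \<kappa>(1) by (simp add: cone_at_def)
  moreover have "x0 \<in> ball x0 (r / 2)" using r by simp
  ultimately show ?thesis by blast
qed

text \<open>The cone points into the region above the graph of \<open>\<theta>\<close>, mainly along
  \<open>\<sigma>\<close> times the \<open>i\<close>-th axis. Its other components are nonzero but
  so small relative to the Lipschitz constant of \<open>\<theta>\<close> that the graph rises less
  than the \<open>i\<close>-th coordinate gains.\<close>

lemma cone_at_frontier:
  fixes \<Omega> :: "(real ^ 'n) set"
  assumes "smooth_boundary \<Omega>" "x0 \<in> frontier \<Omega>"
  shows "\<exists>U c. x0 \<in> U \<and> cone_at \<Omega> U c"
proof -
  obtain r i \<sigma> \<theta> where r: "r > 0" and \<sigma>: "\<sigma> = 1 \<or> \<sigma> = -1" and \<theta>: "smooth_on UNIV \<theta>"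
    and inv: "\<And>x t. \<theta> (x + t *\<^sub>R axis i 1) = \<theta> x"
    and \<Omega>: "\<Omega> \<inter> ball x0 r = {x \<in> ball x0 r. \<sigma> * (x $ i) > \<theta> x}"
    using assms unfolding smooth_boundary_def by blast
  obtain M where M: "0 \<le> M" "\<And>x y. x \<in> cball x0 r \<Longrightarrow> y \<in> cball x0 r \<Longrightarrow> \<bar>\<theta> x - \<theta> y\<bar> \<le> M * norm (x - y)"
    using smooth_locally_Lipschitz[OF \<theta>] by blast
  define d where "d = real CARD('n)"
  have d: "d \<ge> 1" by (simp add: d_def Suc_leI)
  \<comment> \<open>Chosen so that \<open>M * (d * \<kappa>) \<le> 1/4\<close>, matching the lower
    bound 1/4 of \<open>\<tau> $ i\<close>; \<open>M + 1\<close> avoids a division by zero for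
    \<open>M = 0\<close>.\<close>
  define \<kappa> where "\<kappa> = 1 / (4 * d * (M + 1))"
  define b where "b = r / 8"
  have b: "b > 0" using r by (simp add: b_def)
  have \<kappa>: "\<kappa> > 0" "d * \<kappa> = 1 / (4 * (M + 1))" using d M by (auto simp: \<kappa>_def)
  have \<kappa>1: "d * \<kappa> \<le> 1" "M * (d * \<kappa>) \<le> 1 / 4" unfolding \<kappa>(2) using M by (simp_all add: field_simps)
  define c where "c = (\<chi> l. if l = i then \<sigma> * b else b * \<kappa>)"
  have "x + (\<chi> l. t * c $ l * \<tau> $ l) \<in> \<Omega>"
    if x: "x \<in> ball x0 (r / 4)" "x \<in> \<Omega>" and t: "0 < t" "t \<le> 1" and \<tau>: "\<And>i. \<tau> $ i \<in> {1/4..1}" for x t \<tau>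
  proof -
    define v where "v = (\<chi> l. t * c $ l * \<tau> $ l)"
    define v' where "v' = (\<chi> l. if l = i then 0 else v $ l)"
    have t\<tau>: "0 \<le> t * \<tau> $ l" "t * \<tau> $ l \<le> t" "t / 4 \<le> t * \<tau> $ l" for l
      using t \<tau>[of l] mult_left_mono[of "\<tau> $ l" 1 t] mult_left_mono[of "1/4" "\<tau> $ l" t] by auto
    have "norm v' \<le> (\<Sum>l\<in>UNIV. \<bar>v' $ l\<bar>)" by (rule norm_le_l1_cart)
    also have "\<dots> \<le> (\<Sum>l\<in>(UNIV :: 'n set). b * \<kappa> * t)"
    proof (rule sum_mono)
      fix l
      have "b * \<kappa> * (t * \<tau> $ l) \<le> b * \<kappa> * t" using b \<kappa> t\<tau> by (intro mult_left_mono) auto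
      then show "\<bar>v' $ l\<bar> \<le> b * \<kappa> * t"
        using b \<kappa> t\<tau>[of l] t by (auto simp: v'_def v_def c_def abs_mult mult_ac)
    qed
    also have "\<dots> = b * t * (d * \<kappa>)" by (simp add: d_def mult_ac)
    finally have nv': "norm v' \<le> b * t * (d * \<kappa>)" .
    have vv': "v = v' + (v $ i) *\<^sub>R axis i 1" by (simp add: vec_eq_iff v'_def axis_def)
    have vi: "\<sigma> * v $ i = b * (t * \<tau> $ i)" "\<bar>v $ i\<bar> = b * (t * \<tau> $ i)"
      using \<sigma> b t\<tau>[of i] t \<tau>[of i] by (auto simp: v_def c_def abs_mult)
    have bt: "b * t \<le> b" using b t by simp
    have "b * t * (d * \<kappa>) \<le> b * 1" using bt \<kappa>1(1) \<kappa>(1) d b by (intro mult_mono) auto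
    then have nv1: "norm v' \<le> b" using nv' by simp
    moreover have "\<bar>v $ i\<bar> \<le> b"
    proof -
      have "b * (t * \<tau> $ i) \<le> b * 1" using b order_trans[OF t\<tau>(2)[of i] t(2)] by (intro mult_left_mono) auto
      then show ?thesis using vi by simp
    qed
    ultimately have nv: "norm v \<le> r / 4"
      using norm_triangle_ineq[of v' "(v $ i) *\<^sub>R axis i 1"] vv' by (simp add: b_def norm_axis_1)
    have in1: "x + v \<in> ball x0 r" "x + v' \<in> cball x0 r" "x \<in> cball x0 r" "x \<in> ball x0 r"
      using x nv nv1 r norm_triangle_ineq[of "x - x0" v] norm_triangle_ineq[of "x - x0" v']
      by (auto simp: dist_norm norm_minus_commute algebra_simps b_def)
    \<comment> \<open>\<open>\<theta>\<close> is constant in direction \<open>i\<close>, so only the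
      small transversal part \<open>v'\<close> can change it.\<close>
    have "\<theta> (x + v) = \<theta> (x + v')" using inv[of "x + v'" "v $ i"] vv' by (simp add: add.assoc)
    also have "\<dots> \<le> \<theta> x + M * norm v'" using M(2)[OF in1(2,3)] by simp
    also have "\<dots> \<le> \<theta> x + b * t * (1 / 4)"
    proof -
      have "M * norm v' \<le> M * (b * t * (d * \<kappa>))" by (rule mult_left_mono[OF nv' M(1)])
      also have "\<dots> = b * t * (M * (d * \<kappa>))" by simp
      also have "\<dots> \<le> b * t * (1 / 4)" using b t \<kappa>1(2) by (intro mult_left_mono) auto
      finally show ?thesis by simp
    qed
    also have "\<dots> < \<sigma> * x $ i + b * t * (1 / 4)"
    proof -
      have "x \<in> \<Omega> \<inter> ball x0 r" using x(2) in1(4) by blast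
      from this[unfolded \<Omega>] show ?thesis by simp
    qed
    also have "b * t * (1 / 4) \<le> \<sigma> * v $ i" unfolding vi(1) using b t\<tau>(3)[of i] by simp
    finally have "\<theta> (x + v) < \<sigma> * (x + v) $ i" by (simp add: algebra_simps)
    then have "x + v \<in> \<Omega> \<inter> ball x0 r" unfolding \<Omega> using in1(1) by blast
    then have "x + v \<in> \<Omega>" by blast
    then show ?thesis by (simp add: v_def)
  qed
  moreover have "c $ l \<noteq> 0" for l using \<sigma> b \<kappa>(1) by (auto simp: c_def)
  ultimately have "cone_at \<Omega> (ball x0 (r / 4)) c" by (auto simp: cone_at_def)
  moreover have "x0 \<in> ball x0 (r / 4)" using r by simp
  ultimately show ?thesis by blast
qed

lemma cone_cover:
  fixes \<Omega> :: "(real ^ 'n) set"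
  assumes O: "open \<Omega>" "bounded \<Omega>" "smooth_boundary \<Omega>"
  shows "\<exists>I. finite I \<and> \<Omega> \<subseteq> (\<Union>(U, c)\<in>I. U) \<and> (\<forall>(U, c)\<in>I. cone_at \<Omega> U c)"
proof -
  define J where "J = {(U, c). cone_at \<Omega> U c}"
  have "compact (closure \<Omega>)" using O by simp
  moreover have "\<forall>p\<in>J. open (fst p)" by (auto simp: J_def cone_at_def)
  moreover have "closure \<Omega> \<subseteq> (\<Union>p\<in>J. fst p)"
  proof
    fix x assume x: "x \<in> closure \<Omega>"
    have "\<exists>U c. x \<in> U \<and> cone_at \<Omega> U c"
    proof (cases "x \<in> \<Omega>")
      case True
      then show ?thesis using cone_at_interior O by blast
    next
      case False
      then have "x \<in> frontier \<Omega>" using x O by (simp add: frontier_def interior_open)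
      then show ?thesis using cone_at_frontier O by blast
    qed
    then show "x \<in> (\<Union>p\<in>J. fst p)" by (force simp: J_def)
  qed
  ultimately obtain I where I: "I \<subseteq> J" "finite I" "closure \<Omega> \<subseteq> (\<Union>p\<in>I. fst p)"
    by (metis (no_types) compactE_image)
  have "\<Omega> \<subseteq> (\<Union>(U, c)\<in>I. U)" using I(3) closure_subset[of \<Omega>] by (force simp: case_prod_beta)
  with I show ?thesis by (intro exI[of _ I]) (auto simp: J_def)
qed

section \<open>Weak derivatives\<close>

lemma lebesgue_on_subset_integral:
  fixes f :: "real ^ 'n \<Rightarrow> real"
  assumes "U \<subseteq> S" "U \<in> sets lebesgue" "S \<in> sets lebesgue" "\<And>x. x \<in> S \<Longrightarrow> x \<notin> U \<Longrightarrow> f x = 0"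
  shows "integrable (lebesgue_on S) f \<longleftrightarrow> integrable (lebesgue_on U) f"
    and "(\<integral>x. f x \<partial>lebesgue_on S) = (\<integral>x. f x \<partial>lebesgue_on U)"
proof -
  have "(\<lambda>x. indicator S x *\<^sub>R f x) = (\<lambda>x. indicator U x *\<^sub>R f x)"
    using assms by (auto simp: fun_eq_iff indicator_def)
  then show "integrable (lebesgue_on S) f \<longleftrightarrow> integrable (lebesgue_on U) f"
    "(\<integral>x. f x \<partial>lebesgue_on S) = (\<integral>x. f x \<partial>lebesgue_on U)"
    using assms by (simp_all add: integrable_restrict_space integral_restrict_space)
qed

lemma integrable_lebesgue_on_cong:
  fixes f :: "real ^ 'n \<Rightarrow> real"
  shows "(\<And>x. x \<in> S \<Longrightarrow> f x = g x) \<Longrightarrow> integrable (lebesgue_on S) f \<longleftrightarrow> integrable (lebesgue_on S) g"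
  by (rule Bochner_Integration.integrable_cong) (auto simp: space_restrict_space)

lemma test_fun_properties:
  assumes "\<psi> \<in> test_fun \<Omega>"
  shows "smooth_on UNIV \<psi>" "continuous_on S \<psi>" "\<exists>B. \<forall>x. \<bar>\<psi> x\<bar> \<le> B" "\<psi> \<in> borel_measurable borel"
proof -
  obtain K where s: "smooth_on UNIV \<psi>" and K: "compact K" "K \<subseteq> \<Omega>" "\<And>x. x \<notin> K \<Longrightarrow> \<psi> x = 0"
    using assms unfolding test_fun_def by blast
  have c: "continuous_on UNIV \<psi>" using smooth_on_continuous[OF s, of "[]"] by (simp add: dir_derivs_def)
  have "bounded (\<psi> ` K)" using K c by (intro compact_imp_bounded compact_continuous_image) (auto intro: continuous_on_subset)
  then obtain B where "B > 0" "\<And>x. x \<in> K \<Longrightarrow> \<bar>\<psi> x\<bar> \<le> B" by (auto simp: bounded_pos)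
  then have "\<bar>\<psi> x\<bar> \<le> B" for x using K(3)[of x] by (cases "x \<in> K") auto
  then show "smooth_on UNIV \<psi>" "continuous_on S \<psi>" "\<exists>B. \<forall>x. \<bar>\<psi> x\<bar> \<le> B" "\<psi> \<in> borel_measurable borel"
    using s c by (auto intro: continuous_on_subset borel_measurable_continuous_onI)
qed

lemma test_fun_dir_deriv:
  assumes "\<psi> \<in> test_fun \<Omega>" "b \<in> Basis"
  shows "dir_deriv b \<psi> \<in> test_fun \<Omega>"
proof -
  obtain K where s: "smooth_on UNIV \<psi>" and K: "compact K" "K \<subseteq> \<Omega>" "\<And>x. x \<notin> K \<Longrightarrow> \<psi> x = 0"
    using assms unfolding test_fun_def by blast
  have "dir_deriv b \<psi> x = 0" if x: "x \<notin> K" for x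
  proof -
    have oK: "open (- K)" using K by (simp add: compact_imp_closed open_Compl)
    have "((\<lambda>t::real. x + t *\<^sub>R b) \<longlongrightarrow> x + 0 *\<^sub>R b) (nhds 0)"
      by (intro tendsto_intros filterlim_ident)
    then have t: "((\<lambda>t::real. x + t *\<^sub>R b) \<longlongrightarrow> x) (nhds 0)" by simp
    have "\<forall>\<^sub>F t in nhds 0. x + t *\<^sub>R b \<in> - K" using topological_tendstoD[OF t oK] x by simp
    then have "\<forall>\<^sub>F t in nhds 0. \<psi> (x + t *\<^sub>R b) = 0" by eventually_elim (simp add: K(3))
    then have "dir_deriv b \<psi> x = deriv (\<lambda>t. 0) 0" unfolding dir_deriv_def by (intro deriv_cong_ev) auto
    then show ?thesis by simp
  qed
  then show ?thesis using smooth_on_dir_deriv[OF s assms(2)] K unfolding test_fun_def by blast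
qed

lemma test_fun_dir_derivs:
  "\<psi> \<in> test_fun \<Omega> \<Longrightarrow> set bs \<subseteq> Basis \<Longrightarrow> dir_derivs bs \<psi> \<in> test_fun \<Omega>"
  by (induction bs) (auto simp: dir_derivs_def test_fun_dir_deriv)

lemma test_fun_mi_deriv: "\<psi> \<in> test_fun \<Omega> \<Longrightarrow> mi_deriv \<alpha> \<psi> \<in> test_fun \<Omega>"
  unfolding mi_deriv_def by (rule test_fun_dir_derivs) (auto simp: axis_in_Basis_iff)

text \<open>The fundamental lemma of the calculus of variations; products of smooth steps approximate the
  indicator functions of boxes.\<close>

lemma AE_zero_if_orthogonal_to_tests:
  fixes \<Omega> :: "(real ^ 'n) set"
  assumes O: "open \<Omega>" and d: "loc_integrable \<Omega> d"
    and orth: "\<And>\<psi>. \<psi> \<in> test_fun \<Omega> \<Longrightarrow> (\<integral>x. d x * \<psi> x \<partial>lebesgue_on \<Omega>) = 0"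
  shows "AE x in lebesgue_on \<Omega>. d x = 0"
proof -
  have box: "AE x in lborel. x \<in> cbox l u \<longrightarrow> d x = 0" if lu: "cbox l u \<subseteq> \<Omega>" for l u
  proof -
    \<comment> \<open>\<open>d\<close> is integrable on compact subsets only; its restriction to a
      box with closure in \<open>\<Omega>\<close> has a Borel representative that is integrable over
      the whole space.\<close>
    let ?U = "box l u"
    have UO: "?U \<subseteq> \<Omega>" using lu box_subset_cbox by blast
    have "integrable (lebesgue_on (cbox l u)) d" using d lu by (simp add: loc_integrable_def)
    then have "integrable (lebesgue_on (cbox l u)) (\<lambda>x. indicator ?U x * d x)"
      using integrable_mult_indicator[of ?U "lebesgue_on (cbox l u)" d] box_subset_cbox[of l u]
      by (auto simp: sets_restrict_space_iff)
    then have "integrable (lebesgue_on ?U) (\<lambda>x. indicator ?U x * d x)"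
      using box_subset_cbox by (subst (asm) lebesgue_on_subset_integral(1)[of ?U]) auto
    then have dU: "integrable (lebesgue_on ?U) d"
      by (subst (asm) integrable_lebesgue_on_cong[where g = d]) auto
    obtain d0 where d0: "d0 \<in> borel_measurable borel" "\<And>x. x \<notin> ?U \<Longrightarrow> d0 x = 0" "AE x in lebesgue_on ?U. d x = d0 x"
      by (rule borel_representative[of d ?U]) (use dU in auto)
    have d0i: "integrable lborel d0" using lebesgue_on_lborel(1)[OF _ open_box d0] dU by auto
    note [measurable] = d0(1)
    have "(\<integral>x. indicator (box a b) x * d0 x \<partial>lborel) = 0" if ab: "cbox a b \<subseteq> ?U" for a b
    proof -
      \<comment> \<open>Two ramps in each coordinate: their product is 0 outside the interval and 1
        at points whose distance from both end points is at least \<open>1 / n\<close>.\<close>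
      define F where "F n i s = smooth_step (real n * s + (- real n * a $ i)) * smooth_step ((- real n) * s + real n * b $ i)" for n i s
      have Fs: "smooth_real (F n i)" for n i
        unfolding F_def by (intro smooth_real_mult smooth_real_affine smooth_smooth_step)
      have F0: "F n i s = 0" if s: "s \<notin> {a $ i..b $ i}" for n i s
      proof -
        consider "s < a $ i" | "s > b $ i" using s by fastforce
        then show ?thesis
        proof cases
          case 1
          then have "real n * s \<le> real n * a $ i" by (intro mult_left_mono) auto
          then show ?thesis by (simp add: F_def smooth_step_0)
        next
          case 2
          then have "real n * b $ i \<le> real n * s" by (intro mult_left_mono) auto
          then show ?thesis by (simp add: F_def smooth_step_0)
        qed
      qed
      have F01: "0 \<le> F n i s" "F n i s \<le> 1" for n i s
        unfolding F_def by (auto intro!: mult_nonneg_nonneg mult_le_one smooth_step_range)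
      have step1: "\<forall>\<^sub>F n in sequentially. smooth_step (real n * r) = 1" if r: "r > 0" for r
      proof -
        obtain N where N: "1 < real N * r" using reals_Archimedean3[OF r] by blast
        have "1 \<le> real n * r" if "n \<ge> N" for n
        proof -
          have "real N * r \<le> real n * r" using that r by (intro mult_right_mono) auto
          then show ?thesis using N by simp
        qed
        then show ?thesis unfolding eventually_sequentially by (auto intro!: smooth_step_1 exI[of _ N])
      qed
      have lim: "(\<lambda>n. prodf (F n) x) \<longlonglongrightarrow> indicator (box a b) x" for x
      proof (cases "x \<in> box a b")
        case True
        have "\<forall>\<^sub>F n in sequentially. F n i (x $ i) = 1" for i
        proof -
          have "0 < x $ i - a $ i" "0 < b $ i - x $ i" using True by (auto simp: mem_box_cart)
          from step1[OF this(1)] step1[OF this(2)] show ?thesis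
            by eventually_elim (simp add: F_def algebra_simps)
        qed
        then have "\<forall>\<^sub>F n in sequentially. \<forall>i. F n i (x $ i) = 1" by (rule eventually_all_finite)
        then have "\<forall>\<^sub>F n in sequentially. indicator (box a b) x = prodf (F n) x"
          by eventually_elim (simp add: prodf_def True)
        then show ?thesis by (rule Lim_transform_eventually[OF tendsto_const])
      next
        case False
        then obtain i where "x $ i \<le> a $ i \<or> b $ i \<le> x $ i" by (auto simp: mem_box_cart not_less)
        then have "F n i (x $ i) = 0" for n
        proof
          assume "x $ i \<le> a $ i"
          then have "real n * x $ i \<le> real n * a $ i" by (intro mult_left_mono) auto
          then show ?thesis by (simp add: F_def smooth_step_0)
        next
          assume "b $ i \<le> x $ i"
          then have "real n * b $ i \<le> real n * x $ i" by (intro mult_left_mono) auto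
          then show ?thesis by (simp add: F_def smooth_step_0)
        qed
        then have "prodf (F n) x = 0" for n unfolding prodf_def by (intro prod_zero) auto
        then show ?thesis using False by simp
      qed
      have pm[measurable]: "prodf (F n) \<in> borel_measurable borel" for n
        by (intro borel_measurable_continuous_onI prodf_continuous Fs)
      have supp: "prodf (F n) x = 0" if "x \<notin> cbox a b" for n x
      proof -
        have "\<exists>i. x $ i \<notin> {a $ i..b $ i}" using that by (auto simp: mem_box_cart)
        then show ?thesis unfolding prodf_def using F0 by (intro prod_zero) auto
      qed
      have zero: "(\<integral>x. prodf (F n) x * d0 x \<partial>lborel) = 0" for n
      proof -
        have "prodf (F n) \<in> test_fun \<Omega>" using ab UO by (intro prodf_test_fun[OF Fs F0]) auto
        then have "(\<integral>x. d x * prodf (F n) x \<partial>lebesgue_on \<Omega>) = 0" by (rule orth)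
        also have "(\<integral>x. d x * prodf (F n) x \<partial>lebesgue_on \<Omega>) = (\<integral>x. d x * prodf (F n) x \<partial>lebesgue_on ?U)"
          using O UO supp ab by (intro lebesgue_on_subset_integral) auto
        also have "\<dots> = (\<integral>x. prodf (F n) x * d0 x \<partial>lborel)"
        proof (rule lebesgue_on_lborel(2)[OF _ open_box])
          show "(\<lambda>x. d x * prodf (F n) x) \<in> borel_measurable (lebesgue_on ?U)"
            using dU borel_measurable_lebesgue_on[OF pm, of n ?U] by auto
          show "AE x in lebesgue_on ?U. d x * prodf (F n) x = prodf (F n) x * d0 x"
            using d0(3) by eventually_elim simp
        qed (use d0 in auto)
        finally show ?thesis by simp
      qed
      have "(\<lambda>n. \<integral>x. prodf (F n) x * d0 x \<partial>lborel) \<longlonglongrightarrow> (\<integral>x. indicator (box a b) x * d0 x \<partial>lborel)"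
      proof (rule integral_dominated_convergence)
        show "integrable lborel (\<lambda>x. \<bar>d0 x\<bar>)" using d0i by simp
        show "AE x in lborel. (\<lambda>n. prodf (F n) x * d0 x) \<longlonglongrightarrow> indicator (box a b) x * d0 x"
          by (intro AE_I2 tendsto_intros lim)
        show "AE x in lborel. norm (prodf (F n) x * d0 x) \<le> \<bar>d0 x\<bar>" for n
        proof (rule AE_I2)
          fix x
          have "\<bar>prodf (F n) x\<bar> \<le> 1" unfolding prodf_def abs_prod using F01 by (intro prod_le_1) auto
          then show "norm (prodf (F n) x * d0 x) \<le> \<bar>d0 x\<bar>" by (simp add: abs_mult mult_left_le_one_le)
        qed
      qed measurable
      then show ?thesis unfolding zero by (simp add: LIMSEQ_const_iff)
    qed
    then have "AE x in lborel. x \<in> ?U \<longrightarrow> d0 x = 0"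
      by (intro AE_zero_if_box_integrals_zero d0i open_box) auto
    moreover have "AE x in lborel. x \<in> ?U \<longrightarrow> d x = d0 x" using d0(3) unfolding AE_lebesgue_on_iff_lborel[OF open_box] .
    ultimately show ?thesis using AE_lborel_box_cbox[of l u] by eventually_elim auto
  qed
  obtain \<D> where D: "countable \<D>" "\<D> \<subseteq> Pow \<Omega>" "\<And>X. X \<in> \<D> \<Longrightarrow> \<exists>a b. X = cbox a b" "\<Union>\<D> = \<Omega>"
    by (rule open_countable_Union_open_cbox[OF O], rule that) assumption+
  have "AE x in lborel. \<forall>X\<in>\<D>. x \<in> X \<longrightarrow> d x = 0"
    unfolding AE_ball_countable[OF D(1)]
  proof
    fix X assume "X \<in> \<D>"
    then obtain a b where "X = cbox a b" "cbox a b \<subseteq> \<Omega>" using D(2,3) by blast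
    then show "AE x in lborel. x \<in> X \<longrightarrow> d x = 0" using box by simp
  qed
  then show ?thesis unfolding AE_lebesgue_on_iff_lborel[OF O] by eventually_elim (use D(4) in auto)
qed

lemma loc_integrable_test_integrable:
  fixes \<Omega> :: "(real ^ 'n) set"
  assumes O: "open \<Omega>" and u: "loc_integrable \<Omega> u" and \<psi>: "\<psi> \<in> test_fun \<Omega>"
  shows "integrable (lebesgue_on \<Omega>) (\<lambda>x. u x * \<psi> x)"
proof -
  obtain K where K: "compact K" "K \<subseteq> \<Omega>" "\<And>x. x \<notin> K \<Longrightarrow> \<psi> x = 0" using \<psi> unfolding test_fun_def by blast
  obtain B where B: "\<And>x. \<bar>\<psi> x\<bar> \<le> B" using test_fun_properties(3)[OF \<psi>] by blast
  have uK: "integrable (lebesgue_on K) u" using u K unfolding loc_integrable_def by blast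
  have "integrable (lebesgue_on K) (\<lambda>x. u x * \<psi> x)"
  proof (rule Bochner_Integration.integrable_bound)
    show "integrable (lebesgue_on K) (\<lambda>x. B * u x)" using uK by simp
    show "(\<lambda>x. u x * \<psi> x) \<in> borel_measurable (lebesgue_on K)"
      using uK borel_measurable_lebesgue_on[OF test_fun_properties(4)[OF \<psi>], of K] by auto
    show "AE x in lebesgue_on K. norm (u x * \<psi> x) \<le> norm (B * u x)"
    proof (rule AE_I2)
      fix x
      have "\<bar>\<psi> x\<bar> \<le> \<bar>B\<bar>" using B[of x] by simp
      from mult_left_mono[OF this, of "\<bar>u x\<bar>"] show "norm (u x * \<psi> x) \<le> norm (B * u x)"
        by (simp add: abs_mult mult.commute)
    qed
  qed
  then show ?thesis
    using K O by (subst lebesgue_on_subset_integral(1)[of K]) (auto simp: compact_imp_closed lmeasurable_compact fmeasurableD)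
qed

lemma has_weak_derivD:
  "has_weak_deriv \<Omega> \<alpha> u v \<Longrightarrow> \<psi> \<in> test_fun \<Omega> \<Longrightarrow>
     (\<integral>x. u x * mi_deriv \<alpha> \<psi> x \<partial>lebesgue_on \<Omega>) = (- 1) ^ mi_order \<alpha> * (\<integral>x. v x * \<psi> x \<partial>lebesgue_on \<Omega>)"
  by (simp add: has_weak_deriv_def)

text \<open>Lets the choice made in \<open>weak_deriv\<close> be replaced, almost everywhere, by any
  weak derivative at hand.\<close>

lemma weak_deriv_unique:
  fixes \<Omega> :: "(real ^ 'n) set"
  assumes O: "open \<Omega>" and v: "has_weak_deriv \<Omega> \<alpha> u v" and w: "has_weak_deriv \<Omega> \<alpha> u w"
  shows "AE x in lebesgue_on \<Omega>. v x = w x"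
proof -
  have l: "loc_integrable \<Omega> v" "loc_integrable \<Omega> w" using v w by (auto simp: has_weak_deriv_def)
  have "AE x in lebesgue_on \<Omega>. v x - w x = 0"
  proof (rule AE_zero_if_orthogonal_to_tests[OF O])
    show "loc_integrable \<Omega> (\<lambda>x. v x - w x)" using l by (auto simp: loc_integrable_def)
    fix \<psi> assume \<psi>: "\<psi> \<in> test_fun \<Omega>"
    have "(- 1) ^ mi_order \<alpha> * (\<integral>x. v x * \<psi> x \<partial>lebesgue_on \<Omega>) = (- 1) ^ mi_order \<alpha> * (\<integral>x. w x * \<psi> x \<partial>lebesgue_on \<Omega>)"
      using has_weak_derivD[OF v \<psi>] has_weak_derivD[OF w \<psi>] by (rule trans[OF sym])
    then have "(\<integral>x. v x * \<psi> x \<partial>lebesgue_on \<Omega>) = (\<integral>x. w x * \<psi> x \<partial>lebesgue_on \<Omega>)" by simp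
    then show "(\<integral>x. (v x - w x) * \<psi> x \<partial>lebesgue_on \<Omega>) = 0"
      using loc_integrable_test_integrable[OF O _ \<psi>] l by (simp add: left_diff_distrib)
  qed
  then show ?thesis by eventually_elim simp
qed

section \<open>Calculus of square integrable weak derivatives on a bounded open set\<close>

locale bounded_open =
  fixes \<Omega> :: "(real ^ 'n) set"
  assumes open_dom: "open \<Omega>" and bounded_dom: "bounded \<Omega>"
begin

abbreviation \<mu> :: "(real ^ 'n) measure" where "\<mu> \<equiv> lebesgue_on \<Omega>"

abbreviation wd :: "'n multi_index \<Rightarrow> (real ^ 'n \<Rightarrow> real) \<Rightarrow> real ^ 'n \<Rightarrow> real" where "wd \<equiv> weak_deriv \<Omega>"

lemma finite_dom: "finite_measure \<mu>"
  using open_dom bounded_dom by (intro finite_measure_lebesgue_on lmeasurable_open)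

lemma sq_int_loc_integrable:
  assumes "sq_int \<mu> f"
  shows "loc_integrable \<Omega> f"
  unfolding loc_integrable_def
proof (intro allI impI)
  fix K assume K: "compact K \<and> K \<subseteq> \<Omega>"
  then have Km: "K \<in> sets lebesgue" by (simp add: lmeasurable_compact fmeasurableD)
  have i: "integrable \<mu> f" using finite_measure.sq_int_integrable[OF finite_dom assms] .
  have "integrable \<mu> (\<lambda>x. indicator K x * f x)"
    using integrable_mult_indicator[of K \<mu> f] i K Km open_dom by (auto simp: sets_restrict_space_iff)
  then have "integrable (lebesgue_on K) (\<lambda>x. indicator K x * f x)"
    using K Km open_dom by (subst (asm) lebesgue_on_subset_integral(1)[of K]) auto
  then show "integrable (lebesgue_on K) f"
    by (subst (asm) integrable_lebesgue_on_cong[where g = f]) auto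
qed

lemma test_sq_int: "\<psi> \<in> test_fun \<Omega> \<Longrightarrow> sq_int \<mu> \<psi>"
proof -
  assume \<psi>: "\<psi> \<in> test_fun \<Omega>"
  obtain B where "\<And>x. \<bar>\<psi> x\<bar> \<le> B" using test_fun_properties(3)[OF \<psi>] by blast
  then show ?thesis
    by (intro finite_measure.sq_int_bounded(1)[OF finite_dom, of _ B] borel_measurable_lebesgue_on
        test_fun_properties(4)[OF \<psi>] AE_I2)
qed

lemma has_weak_derivI:
  assumes "sq_int \<mu> u" "sq_int \<mu> v"
    and "\<And>\<psi>. \<psi> \<in> test_fun \<Omega> \<Longrightarrow> (\<integral>x. u x * mi_deriv \<alpha> \<psi> x \<partial>\<mu>) = (- 1) ^ mi_order \<alpha> * (\<integral>x. v x * \<psi> x \<partial>\<mu>)"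
  shows "has_weak_deriv \<Omega> \<alpha> u v"
  using assms sq_int_loc_integrable by (simp add: has_weak_deriv_def)

lemma has_weak_deriv_add:
  assumes "sq_int \<mu> u" "sq_int \<mu> u'" "sq_int \<mu> v" "sq_int \<mu> v'" "has_weak_deriv \<Omega> \<alpha> u v" "has_weak_deriv \<Omega> \<alpha> u' v'"
  shows "has_weak_deriv \<Omega> \<alpha> (\<lambda>x. u x + u' x) (\<lambda>x. v x + v' x)"
proof (rule has_weak_derivI)
  fix \<psi> assume \<psi>: "\<psi> \<in> test_fun \<Omega>"
  have i: "integrable \<mu> (\<lambda>x. f x * \<psi> x)" "integrable \<mu> (\<lambda>x. f x * mi_deriv \<alpha> \<psi> x)" if "sq_int \<mu> f" for f
    by (rule sq_int_mult[OF that test_sq_int[OF \<psi>]], rule sq_int_mult[OF that test_sq_int[OF test_fun_mi_deriv[OF \<psi>]]])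
  show "(\<integral>x. (u x + u' x) * mi_deriv \<alpha> \<psi> x \<partial>\<mu>) = (- 1) ^ mi_order \<alpha> * (\<integral>x. (v x + v' x) * \<psi> x \<partial>\<mu>)"
    using has_weak_derivD[OF assms(5) \<psi>] has_weak_derivD[OF assms(6) \<psi>] i assms
    by (simp add: distrib_right distrib_left)
qed (use assms sq_int_add in auto)

lemma has_weak_deriv_cmult:
  assumes "sq_int \<mu> u" "sq_int \<mu> v" "has_weak_deriv \<Omega> \<alpha> u v"
  shows "has_weak_deriv \<Omega> \<alpha> (\<lambda>x. c * u x) (\<lambda>x. c * v x)"
  by (rule has_weak_derivI) (use assms in \<open>auto simp: sq_int_cmult mult.assoc has_weak_derivD\<close>)

lemma has_weak_deriv_cong_AE:
  assumes "sq_int \<mu> u" "sq_int \<mu> u'" "sq_int \<mu> v" "sq_int \<mu> v'" "has_weak_deriv \<Omega> \<alpha> u v"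
    "AE x in \<mu>. u x = u' x" "AE x in \<mu>. v x = v' x"
  shows "has_weak_deriv \<Omega> \<alpha> u' v'"
proof (rule has_weak_derivI)
  fix \<psi> assume \<psi>: "\<psi> \<in> test_fun \<Omega>"
  have m: "\<psi> \<in> borel_measurable \<mu>" "mi_deriv \<alpha> \<psi> \<in> borel_measurable \<mu>"
    using test_sq_int \<psi> test_fun_mi_deriv sq_int_measurable by blast+
  note f = sq_int_measurable[OF assms(1)] sq_int_measurable[OF assms(2)] sq_int_measurable[OF assms(3)] sq_int_measurable[OF assms(4)]
  have "(\<integral>x. u' x * mi_deriv \<alpha> \<psi> x \<partial>\<mu>) = (\<integral>x. u x * mi_deriv \<alpha> \<psi> x \<partial>\<mu>)"
    by (intro integral_cong_AE borel_measurable_times m f) (use assms(6) in \<open>eventually_elim, simp\<close>)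
  also have "\<dots> = (- 1) ^ mi_order \<alpha> * (\<integral>x. v x * \<psi> x \<partial>\<mu>)" by (rule has_weak_derivD[OF assms(5) \<psi>])
  also have "(\<integral>x. v x * \<psi> x \<partial>\<mu>) = (\<integral>x. v' x * \<psi> x \<partial>\<mu>)"
    by (intro integral_cong_AE borel_measurable_times m f) (use assms(7) in \<open>eventually_elim, simp\<close>)
  finally show "(\<integral>x. u' x * mi_deriv \<alpha> \<psi> x \<partial>\<mu>) = (- 1) ^ mi_order \<alpha> * (\<integral>x. v' x * \<psi> x \<partial>\<mu>)" .
qed (use assms in auto)

lemma has_weak_deriv_limit:
  assumes s: "\<And>n. sq_int \<mu> (s n)" "\<And>n. sq_int \<mu> (t n)" "\<And>n. has_weak_deriv \<Omega> \<alpha> (s n) (t n)"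
    and u: "sq_int \<mu> u" "(\<lambda>n. l2norm \<mu> (\<lambda>x. s n x - u x)) \<longlonglongrightarrow> 0"
    and v: "sq_int \<mu> v" "(\<lambda>n. l2norm \<mu> (\<lambda>x. t n x - v x)) \<longlonglongrightarrow> 0"
  shows "has_weak_deriv \<Omega> \<alpha> u v"
proof (rule has_weak_derivI[OF u(1) v(1)])
  fix \<psi> assume \<psi>: "\<psi> \<in> test_fun \<Omega>"
  have "(\<lambda>n. \<integral>x. s n x * mi_deriv \<alpha> \<psi> x \<partial>\<mu>) \<longlonglongrightarrow> (\<integral>x. u x * mi_deriv \<alpha> \<psi> x \<partial>\<mu>)"
    by (rule l2_limit_integral[OF s(1) u(1) test_sq_int[OF test_fun_mi_deriv[OF \<psi>]] u(2)])
  then have "(\<lambda>n. (- 1) ^ mi_order \<alpha> * (\<integral>x. t n x * \<psi> x \<partial>\<mu>)) \<longlonglongrightarrow> (\<integral>x. u x * mi_deriv \<alpha> \<psi> x \<partial>\<mu>)"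
    unfolding has_weak_derivD[OF s(3) \<psi>] .
  moreover have "(\<lambda>n. (- 1) ^ mi_order \<alpha> * (\<integral>x. t n x * \<psi> x \<partial>\<mu>)) \<longlonglongrightarrow> (- 1) ^ mi_order \<alpha> * (\<integral>x. v x * \<psi> x \<partial>\<mu>)"
    by (intro tendsto_intros l2_limit_integral[OF s(2) v(1) test_sq_int[OF \<psi>] v(2)])
  ultimately show "(\<integral>x. u x * mi_deriv \<alpha> \<psi> x \<partial>\<mu>) = (- 1) ^ mi_order \<alpha> * (\<integral>x. v x * \<psi> x \<partial>\<mu>)"
    by (rule LIMSEQ_unique)
qed

text \<open>Holds by completeness of Lebesgue measure. It makes the chosen weak derivative
  measurable by comparison with a measurable one that is equal to it almost everywhere.\<close>

lemma AE_measurable: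
  assumes "f \<in> borel_measurable \<mu>" "AE x in \<mu>. f x = g x"
  shows "(g :: real ^ 'n \<Rightarrow> real) \<in> borel_measurable \<mu>"
proof -
  have "(\<lambda>x. if x \<in> \<Omega> then f x else 0) \<in> borel_measurable lebesgue"
    using assms(1) open_dom by (intro borel_measurable_if_I) auto
  moreover have "AE x in lebesgue. (if x \<in> \<Omega> then f x else 0) = (if x \<in> \<Omega> then g x else 0)"
    using assms(2) open_dom by (subst (asm) AE_restrict_space_iff) (auto elim!: eventually_mono)
  ultimately have "(\<lambda>x. if x \<in> \<Omega> then g x else 0) \<in> borel_measurable lebesgue" by (rule borel_measurable_AE)
  then show ?thesis by (rule borel_measurable_if_D)
qed

lemma weak_deriv_eq:
  assumes "has_weak_deriv \<Omega> \<alpha> u v"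
  shows "has_weak_deriv \<Omega> \<alpha> u (wd \<alpha> u)" "AE x in \<mu>. wd \<alpha> u x = v x"
proof -
  show 1: "has_weak_deriv \<Omega> \<alpha> u (wd \<alpha> u)" unfolding weak_deriv_def using assms by (rule someI[where P = "has_weak_deriv \<Omega> \<alpha> u"])
  show "AE x in \<mu>. wd \<alpha> u x = v x" by (rule weak_deriv_unique[OF open_dom 1 assms])
qed

lemma weak_deriv_sq_int:
  assumes "has_weak_deriv \<Omega> \<alpha> u v" "sq_int \<mu> v"
  shows "sq_int \<mu> (wd \<alpha> u)"
proof -
  have ae: "AE x in \<mu>. v x = wd \<alpha> u x"
    using weak_deriv_eq(2)[OF assms(1)] by eventually_elim simp
  show ?thesis
    by (rule sq_int_cong_AE[OF assms(2) AE_measurable[OF sq_int_measurable[OF assms(2)] ae] ae])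
qed

lemma sobolevD:
  assumes "u \<in> sobolev s \<Omega>"
  shows "sq_int \<mu> u" "mi_order \<alpha> \<le> s \<Longrightarrow> has_weak_deriv \<Omega> \<alpha> u (wd \<alpha> u)"
    "mi_order \<alpha> \<le> s \<Longrightarrow> sq_int \<mu> (wd \<alpha> u)"
proof -
  show "sq_int \<mu> u" using assms by (simp add: sobolev_def L2_iff)
  assume "mi_order \<alpha> \<le> s"
  then obtain v where "sq_int \<mu> v" "has_weak_deriv \<Omega> \<alpha> u v" using assms by (auto simp: sobolev_def L2_iff)
  then show "has_weak_deriv \<Omega> \<alpha> u (wd \<alpha> u)" "sq_int \<mu> (wd \<alpha> u)"
    using weak_deriv_eq(1) weak_deriv_sq_int by blast+
qed

lemma sobolevI:
  assumes "sq_int \<mu> u" "\<And>\<alpha>. mi_order \<alpha> \<le> s \<Longrightarrow> \<exists>v. sq_int \<mu> v \<and> has_weak_deriv \<Omega> \<alpha> u v"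
  shows "u \<in> sobolev s \<Omega>"
  using assms L2_iff unfolding sobolev_def by blast

lemma weak_deriv_add:
  assumes "u \<in> sobolev s \<Omega>" "v \<in> sobolev s \<Omega>" "mi_order \<alpha> \<le> s"
  shows "AE x in \<mu>. wd \<alpha> (\<lambda>x. u x + v x) x = wd \<alpha> u x + wd \<alpha> v x"
  by (rule weak_deriv_eq(2)[OF has_weak_deriv_add]) (use assms sobolevD in blast)+

lemma weak_deriv_cmult:
  assumes "u \<in> sobolev s \<Omega>" "mi_order \<alpha> \<le> s"
  shows "AE x in \<mu>. wd \<alpha> (\<lambda>x. c * u x) x = c * wd \<alpha> u x"
  by (rule weak_deriv_eq(2)[OF has_weak_deriv_cmult]) (use assms sobolevD in blast)+

lemma sobolev_add:
  assumes "u \<in> sobolev s \<Omega>" "v \<in> sobolev s \<Omega>"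
  shows "(\<lambda>x. u x + v x) \<in> sobolev s \<Omega>"
proof (rule sobolevI)
  show "sq_int \<mu> (\<lambda>x. u x + v x)" using assms by (intro sq_int_add sobolevD(1))
  fix \<alpha> :: "'n multi_index" assume a: "mi_order \<alpha> \<le> s"
  note U = sobolevD(1)[OF assms(1)] sobolevD(2)[OF assms(1) a] sobolevD(3)[OF assms(1) a]
  note V = sobolevD(1)[OF assms(2)] sobolevD(2)[OF assms(2) a] sobolevD(3)[OF assms(2) a]
  show "\<exists>w. sq_int \<mu> w \<and> has_weak_deriv \<Omega> \<alpha> (\<lambda>x. u x + v x) w"
    using has_weak_deriv_add[OF U(1) V(1) U(3) V(3) U(2) V(2)] sq_int_add[OF U(3) V(3)] by blast
qed

lemma sobolev_cmult:
  assumes "u \<in> sobolev s \<Omega>"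
  shows "(\<lambda>x. c * u x) \<in> sobolev s \<Omega>"
proof (rule sobolevI)
  show "sq_int \<mu> (\<lambda>x. c * u x)" using assms by (intro sq_int_cmult sobolevD(1))
  fix \<alpha> :: "'n multi_index" assume a: "mi_order \<alpha> \<le> s"
  note U = sobolevD(1)[OF assms(1)] sobolevD(2)[OF assms(1) a] sobolevD(3)[OF assms(1) a]
  show "\<exists>w. sq_int \<mu> w \<and> has_weak_deriv \<Omega> \<alpha> (\<lambda>x. c * u x) w"
    using has_weak_deriv_cmult[OF U(1) U(3) U(2)] sq_int_cmult[OF U(3)] by blast
qed

lemma sobolev_diff:
  assumes "u \<in> sobolev s \<Omega>" "v \<in> sobolev s \<Omega>"
  shows "(\<lambda>x. u x - v x) \<in> sobolev s \<Omega>"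
  using sobolev_add[OF assms(1) sobolev_cmult[OF assms(2), of "-1"]] by simp

lemma weak_deriv_diff:
  assumes "u \<in> sobolev s \<Omega>" "v \<in> sobolev s \<Omega>" "mi_order \<alpha> \<le> s"
  shows "AE x in \<mu>. wd \<alpha> (\<lambda>x. u x - v x) x = wd \<alpha> u x - wd \<alpha> v x"
proof -
  have "AE x in \<mu>. wd \<alpha> (\<lambda>x. u x + (-1) * v x) x = wd \<alpha> u x + wd \<alpha> (\<lambda>x. (-1) * v x) x"
    by (rule weak_deriv_add[OF assms(1) sobolev_cmult[OF assms(2)] assms(3)])
  moreover have "AE x in \<mu>. wd \<alpha> (\<lambda>x. (-1) * v x) x = (-1) * wd \<alpha> v x"
    by (rule weak_deriv_cmult[OF assms(2,3)])
  ultimately show ?thesis by eventually_elim simp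
qed

lemma sobolev_norm_l2: "sobolev_norm s \<Omega> u = sqrt (\<Sum>\<alpha> | mi_order \<alpha> \<le> s. (l2norm \<mu> (wd \<alpha> u))\<^sup>2)"
  by (simp add: sobolev_norm_def l2norm_square)

end

section \<open>Sobolev embedding\<close>

text \<open>The set where two continuous functions differ is open, and a negligible open set is
  empty.\<close>

lemma continuous_AE_eq:
  fixes f g :: "real ^ 'n \<Rightarrow> real"
  assumes S: "open S" and f: "continuous_on S f" and g: "continuous_on S g"
    and AE: "AE x in lebesgue_on S. f x = g x" and x: "x \<in> S"
  shows "f x = g x"
proof (rule ccontr)
  assume ne: "f x \<noteq> g x"
  let ?N = "S \<inter> (\<lambda>x. f x - g x) -` (- {0})"
  have o: "open ?N" by (rule continuous_open_preimage) (use S f g in \<open>auto intro!: continuous_intros\<close>)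
  have ae: "AE x in lebesgue. x \<notin> ?N"
    using AE S by (subst (asm) AE_restrict_space_iff) (auto elim!: eventually_mono)
  have "?N \<in> sets lebesgue" using o by auto
  from AE_iff_null_sets[OF this] ae have "?N \<in> null_sets lebesgue" by (rule iffD2)
  then have "negligible ?N" by (simp add: negligible_iff_null_sets)
  moreover have "x \<in> ?N" using ne x by simp
  ultimately show False using open_not_negligible[OF o] by blast
qed

text \<open>On overlaps the local representatives agree almost everywhere, hence everywhere by
  continuity.\<close>

lemma glue_continuous:
  fixes v :: "real ^ 'n \<Rightarrow> real"
  assumes I: "finite I" and W: "\<And>i. i \<in> I \<Longrightarrow> open (W i)" "\<Omega> = (\<Union>i\<in>I. W i)"
    and f: "\<And>i. i \<in> I \<Longrightarrow> continuous_on (W i) (f i)" "\<And>i. i \<in> I \<Longrightarrow> AE x in lebesgue_on (W i). v x = f i x"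
  shows "\<exists>F. continuous_on \<Omega> F \<and> (AE x in lebesgue_on \<Omega>. v x = F x) \<and> (\<forall>x\<in>\<Omega>. \<exists>i\<in>I. x \<in> W i \<and> F x = f i x)"
proof -
  define F where "F x = f (SOME i. i \<in> I \<and> x \<in> W i) x" for x
  have some: "(SOME i. i \<in> I \<and> x \<in> W i) \<in> I \<and> x \<in> W (SOME i. i \<in> I \<and> x \<in> W i)" if "x \<in> \<Omega>" for x
    by (rule someI_ex) (use that W(2) in auto)
  have agree: "f i x = f j x" if ij: "i \<in> I" "j \<in> I" "x \<in> W i" "x \<in> W j" for i j x
  proof (rule continuous_AE_eq[of "W i \<inter> W j"])
    show "open (W i \<inter> W j)" using W ij by auto
    have "AE x in lborel. x \<in> W i \<longrightarrow> v x = f i x" "AE x in lborel. x \<in> W j \<longrightarrow> v x = f j x"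
      using f(2)[OF ij(1)] f(2)[OF ij(2)] AE_lebesgue_on_iff_lborel[OF W(1)[OF ij(1)]] AE_lebesgue_on_iff_lborel[OF W(1)[OF ij(2)]] by simp_all
    then have "AE x in lborel. x \<in> W i \<inter> W j \<longrightarrow> f i x = f j x" by eventually_elim auto
    then show "AE x in lebesgue_on (W i \<inter> W j). f i x = f j x"
      using AE_lebesgue_on_iff_lborel[OF \<open>open (W i \<inter> W j)\<close>] by simp
  qed (use f(1) ij in \<open>auto intro: continuous_on_subset\<close>)
  have Feq: "F x = f i x" if "i \<in> I" "x \<in> W i" for i x
    unfolding F_def using some[of x] that W(2) by (intro agree) auto
  have "continuous_on (W i) F" if "i \<in> I" for i
    using f(1)[OF that] Feq[OF that] by (subst continuous_on_cong[OF refl]) auto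
  then have cont: "continuous_on \<Omega> F" unfolding W(2) using W(1) by (intro continuous_on_open_Union) auto
  have "AE x in lborel. \<forall>i\<in>I. x \<in> W i \<longrightarrow> v x = f i x"
    unfolding AE_ball_countable[OF countable_finite[OF I]]
    using f(2) AE_lebesgue_on_iff_lborel[OF W(1)] by simp
  then have ae: "AE x in lborel. x \<in> \<Omega> \<longrightarrow> v x = F x" by eventually_elim (use W(2) Feq in auto)
  have "open \<Omega>" unfolding W(2) using W(1) by auto
  from ae have "AE x in lebesgue_on \<Omega>. v x = F x" unfolding AE_lebesgue_on_iff_lborel[OF \<open>open \<Omega>\<close>] .
  moreover have "\<exists>i\<in>I. x \<in> W i \<and> F x = f i x" if "x \<in> \<Omega>" for x
    using some[OF that] by (intro bexI[of _ "SOME i. i \<in> I \<and> x \<in> W i"]) (simp_all add: F_def)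
  ultimately show ?thesis using cont by blast
qed

context bounded_open
begin

text \<open>A choice of a Borel representative on the whole space, to which the estimates of
  \<open>cone_patch\<close> apply.\<close>

definition rep :: "(real ^ 'n \<Rightarrow> real) \<Rightarrow> real ^ 'n \<Rightarrow> real" where
  "rep f = (SOME f0. sq_int lborel f0 \<and> integrable lborel f0 \<and> (\<forall>x. x \<notin> \<Omega> \<longrightarrow> f0 x = 0) \<and>
     (AE x in \<mu>. f x = f0 x) \<and> l2norm lborel f0 = l2norm \<mu> f)"

lemma rep:
  assumes "sq_int \<mu> f"
  shows "sq_int lborel (rep f)" "integrable lborel (rep f)" "x \<notin> \<Omega> \<Longrightarrow> rep f x = 0"
    "AE x in \<mu>. f x = rep f x" "l2norm lborel (rep f) = l2norm \<mu> f"
proof -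
  obtain f0 where "sq_int lborel f0" "integrable lborel f0" "\<And>x. x \<notin> \<Omega> \<Longrightarrow> f0 x = 0"
    "AE x in \<mu>. f x = f0 x" "l2norm lborel f0 = l2norm \<mu> f"
    by (rule borel_representative_L2[OF assms open_dom bounded_dom]) blast
  then have "\<exists>f0. sq_int lborel f0 \<and> integrable lborel f0 \<and> (\<forall>x. x \<notin> \<Omega> \<longrightarrow> f0 x = 0) \<and>
     (AE x in \<mu>. f x = f0 x) \<and> l2norm lborel f0 = l2norm \<mu> f" by blast
  from someI_ex[OF this, folded rep_def]
  show "sq_int lborel (rep f)" "integrable lborel (rep f)" "x \<notin> \<Omega> \<Longrightarrow> rep f x = 0"
    "AE x in \<mu>. f x = rep f x" "l2norm lborel (rep f) = l2norm \<mu> f" by blast+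
qed

lemma rep_measurable: "sq_int \<mu> f \<Longrightarrow> rep f \<in> borel_measurable borel"
  using rep(1) by (simp add: sq_int_def)

lemma integral_rep:
  assumes f: "sq_int \<mu> f" and \<psi>: "\<psi> \<in> borel_measurable borel"
  shows "(\<integral>x. f x * \<psi> x \<partial>\<mu>) = (\<integral>x. rep f x * \<psi> x \<partial>lborel)"
proof (rule lebesgue_on_lborel(2)[OF _ open_dom])
  show "(\<lambda>x. f x * \<psi> x) \<in> borel_measurable \<mu>"
    using sq_int_measurable[OF f] borel_measurable_lebesgue_on[OF \<psi>] by (rule borel_measurable_times)
  show "(\<lambda>x. rep f x * \<psi> x) \<in> borel_measurable borel"
    using rep_measurable[OF f] \<psi> by (rule borel_measurable_times)
  show "AE x in \<mu>. f x * \<psi> x = rep f x * \<psi> x" using rep(4)[OF f] by eventually_elim simp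
qed (simp add: rep(3)[OF f])

lemma weak_on_products_rep:
  assumes u: "sq_int \<mu> u" and v: "sq_int \<mu> v" and w: "has_weak_deriv \<Omega> \<alpha> u v"
  shows "weak_on_products \<Omega> \<alpha> (rep u) (rep v)"
  unfolding weak_on_products_def
proof (intro allI impI)
  fix F :: "'n \<Rightarrow> real \<Rightarrow> real" and a b :: "real ^ 'n"
  assume F: "\<forall>i. smooth_real (F i)" "\<forall>i t. t \<notin> {a $ i..b $ i} \<longrightarrow> F i t = 0" and ab: "cbox a b \<subseteq> \<Omega>"
  have \<psi>: "prodf F \<in> test_fun \<Omega>" using F ab by (intro prodf_test_fun) auto
  have d: "mi_deriv \<alpha> (prodf F) = prodf (\<lambda>i. (deriv ^^ \<alpha> i) (F i))" using F by (intro mi_deriv_prodf) auto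
  show "(\<integral>x. rep u x * prodf (\<lambda>i. (deriv ^^ \<alpha> i) (F i)) x \<partial>lborel) = (- 1) ^ mi_order \<alpha> * (\<integral>x. rep v x * prodf F x \<partial>lborel)"
    using has_weak_derivD[OF w \<psi>]
    unfolding d[symmetric] integral_rep[OF u test_fun_properties(4)[OF test_fun_mi_deriv[OF \<psi>]]]
      integral_rep[OF v test_fun_properties(4)[OF \<psi>]] .
qed

definition pure :: "nat \<Rightarrow> 'n \<Rightarrow> 'n multi_index" where
  "pure p j = (\<lambda>i. if i = j then p else 0)"

lemma mi_order_pure: "mi_order (pure p j) = p"
  by (simp add: mi_order_def pure_def)

text \<open>Intermediate orders are absent on purpose: the embedding lemmas bound them by this
  quantity.\<close>

definition top_sum :: "nat \<Rightarrow> (real ^ 'n \<Rightarrow> real) \<Rightarrow> real" where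
  "top_sum p u = l2norm \<mu> u + (\<Sum>\<alpha> | mi_order \<alpha> = p. l2norm \<mu> (wd \<alpha> u))"

lemma top_sum_nonneg: "0 \<le> top_sum p u"
  unfolding top_sum_def by (intro add_nonneg_nonneg sum_nonneg l2norm_nonneg)

text \<open>The patch estimates involve the pure derivatives of order \<open>m + 1\<close> only; as
  \<open>pure\<close> is injective, their norms form a part of \<open>top_sum\<close>.\<close>

lemma patch_data:
  assumes C: "cone_at \<Omega> U c" and u: "u \<in> sobolev (Suc m) \<Omega>" and \<beta>: "mi_order \<beta> \<le> Suc m"
  shows "cone_patch \<Omega> (U \<inter> \<Omega>) c"
    and "cone_patch.data \<Omega> m \<beta> (rep u) (rep (wd \<beta> u)) (\<lambda>j. rep (wd (pure (Suc m) j) u))"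
    and "cone_patch.energy (rep u) (\<lambda>j. rep (wd (pure (Suc m) j) u)) \<le> top_sum (Suc m) u"
proof -
  show cp: "cone_patch \<Omega> (U \<inter> \<Omega>) c"
  proof
    show "open (U \<inter> \<Omega>)" "bounded (U \<inter> \<Omega>)" using C open_dom bounded_dom by (auto simp: cone_at_def)
  qed (use C in \<open>auto simp: cone_at_def\<close>)
  have s: "sq_int \<mu> u" "sq_int \<mu> (wd \<beta> u)" "sq_int \<mu> (wd (pure (Suc m) j) u)" for j
    using sobolevD[OF u] \<beta> mi_order_pure by auto
  have w: "has_weak_deriv \<Omega> \<beta> u (wd \<beta> u)" "has_weak_deriv \<Omega> (pure (Suc m) j) u (wd (pure (Suc m) j) u)" for j
    using sobolevD(2)[OF u] \<beta> mi_order_pure by auto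
  show "cone_patch.data \<Omega> m \<beta> (rep u) (rep (wd \<beta> u)) (\<lambda>j. rep (wd (pure (Suc m) j) u))"
    unfolding cone_patch.data_def[OF cp]
    using rep(1,2)[OF s(1)] rep(1,2)[OF s(2)] rep(1,2)[OF s(3)] weak_on_products_rep[OF s(1,2) w(1)] weak_on_products_rep[OF s(1,3) w(2)]
    by (auto simp: pure_def)
  have inj: "inj (pure (Suc m) :: 'n \<Rightarrow> 'n multi_index)"
  proof (rule injI)
    fix i j :: 'n assume "pure (Suc m) i = pure (Suc m) j"
    then have "pure (Suc m) i i = pure (Suc m) j i" by simp
    then show "i = j" by (simp add: pure_def split: if_splits)
  qed
  have "(\<Sum>j\<in>UNIV. l2norm lborel (rep (wd (pure (Suc m) j) u)))
      = (\<Sum>\<alpha>\<in>range (pure (Suc m)). l2norm \<mu> (wd \<alpha> u))"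
    by (subst sum.reindex[OF inj]) (simp add: rep(5)[OF s(3)])
  also have "\<dots> \<le> (\<Sum>\<alpha> | mi_order \<alpha> = Suc m. l2norm \<mu> (wd \<alpha> u))"
    by (rule sum_mono2) (auto simp: finite_mi_order_eq mi_order_pure l2norm_nonneg)
  finally show "cone_patch.energy (rep u) (\<lambda>j. rep (wd (pure (Suc m) j) u)) \<le> top_sum (Suc m) u"
    unfolding cone_patch.energy_def[OF cp] top_sum_def rep(5)[OF s(1)] by simp
qed

text \<open>No partition of unity is involved: \<open>\<bar>v\<bar>\<close> is at most the sum of
  its restrictions to the patches.\<close>

lemma l2norm_cover:
  assumes I: "finite I" and W: "\<And>i. i \<in> I \<Longrightarrow> open (W i)" "\<Omega> = (\<Union>i\<in>I. W i)" and v: "sq_int lborel v"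
  shows "l2norm \<mu> v \<le> (\<Sum>i\<in>I. l2norm (lebesgue_on (W i)) v)"
proof -
  have [measurable]: "v \<in> borel_measurable borel" using v by (simp add: sq_int_def)
  let ?g = "\<lambda>i x. indicator (W i) x * \<bar>v x\<bar>"
  have vs: "sq_int \<mu> v" by (rule sq_int_lebesgue_on(1)[OF v open_dom])
  have gm: "?g i \<in> borel_measurable \<mu>" if "i \<in> I" for i
    using W(1)[OF that] by (intro borel_measurable_lebesgue_on) measurable
  have gs: "sq_int \<mu> (?g i)" if "i \<in> I" for i
    by (rule sq_int_bound(1)[OF vs gm[OF that]]) (auto simp: indicator_def)
  have gn: "l2norm \<mu> (?g i) = l2norm (lebesgue_on (W i)) v" if "i \<in> I" for i
  proof -
    have "l2norm \<mu> (?g i) = l2norm (lebesgue_on (W i)) (?g i)"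
      unfolding l2norm_def
      using W that open_dom by (subst lebesgue_on_subset_integral(2)[of "W i" \<Omega>]) (auto simp: indicator_def)
    also have "\<dots> = l2norm (lebesgue_on (W i)) v"
      unfolding l2norm_def by (intro arg_cong[of _ _ sqrt] Bochner_Integration.integral_cong) (auto simp: space_restrict_space)
    finally show ?thesis .
  qed
  have "l2norm \<mu> v \<le> l2norm \<mu> (\<lambda>x. \<Sum>i\<in>I. ?g i x)"
  proof (rule sq_int_bound(2)[OF sq_int_sum[OF gs]])
    show "AE x in \<mu>. \<bar>v x\<bar> \<le> \<bar>\<Sum>i\<in>I. ?g i x\<bar>"
    proof (rule AE_I2)
      fix x assume "x \<in> space \<mu>"
      then obtain i where i: "i \<in> I" "x \<in> W i" using W(2) by (auto simp: space_restrict_space)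
      have "?g i x \<le> (\<Sum>i\<in>I. ?g i x)" using I i by (intro member_le_sum) auto
      then show "\<bar>v x\<bar> \<le> \<bar>\<Sum>i\<in>I. ?g i x\<bar>" using i by simp
    qed
  qed (use vs in \<open>auto simp: sq_int_def\<close>)
  also have "\<dots> \<le> (\<Sum>i\<in>I. l2norm \<mu> (?g i))" by (rule l2norm_sum[OF I gs])
  also have "\<dots> = (\<Sum>i\<in>I. l2norm (lebesgue_on (W i)) v)" using gn by simp
  finally show ?thesis .
qed

end

locale smooth_domain = bounded_open \<Omega> for \<Omega> :: "(real ^ 'n) set" +
  assumes smooth_dom: "smooth_boundary \<Omega>"
begin

lemma cover:
  obtains I where "finite I" "\<Omega> = (\<Union>p\<in>I. fst p \<inter> \<Omega>)" "\<And>p. p \<in> I \<Longrightarrow> cone_at \<Omega> (fst p) (snd p)"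
    "\<And>p. p \<in> I \<Longrightarrow> open (fst p \<inter> \<Omega>)"
proof -
  obtain I where I: "finite I" "\<Omega> \<subseteq> (\<Union>(U, c)\<in>I. U)" "\<forall>(U, c)\<in>I. cone_at \<Omega> U c"
    using cone_cover[OF open_dom bounded_dom smooth_dom] by blast
  show ?thesis
  proof (rule that[OF I(1)])
    show "\<Omega> = (\<Union>p\<in>I. fst p \<inter> \<Omega>)" using I(2) by (force simp: case_prod_beta)
    show ca: "cone_at \<Omega> (fst p) (snd p)" if "p \<in> I" for p using I(3) that by (auto simp: case_prod_beta)
    show "open (fst p \<inter> \<Omega>)" if "p \<in> I" for p
      using ca[OF that] open_dom unfolding cone_at_def by (intro open_Int) auto
  qed
qed

text \<open>At top order the norm is itself a summand of \<open>top_sum\<close>; at lower order the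
  patch estimates are added over the finite cover.\<close>

lemma embedding_L2_single:
  assumes \<beta>: "mi_order \<beta> \<le> Suc m"
  shows "\<exists>C\<ge>0. \<forall>u\<in>sobolev (Suc m) \<Omega>. l2norm \<mu> (wd \<beta> u) \<le> C * top_sum (Suc m) u"
proof (cases "mi_order \<beta> = Suc m")
  case True
  have "l2norm \<mu> (wd \<beta> u) \<le> (\<Sum>\<alpha> | mi_order \<alpha> = Suc m. l2norm \<mu> (wd \<alpha> u))" for u
    using True by (intro member_le_sum) (auto simp: finite_mi_order_eq l2norm_nonneg)
  then have "l2norm \<mu> (wd \<beta> u) \<le> 1 * top_sum (Suc m) u" for u
    unfolding top_sum_def using l2norm_nonneg[of \<mu> u] by (metis add_increasing mult_1)
  then show ?thesis by (intro exI[of _ 1]) auto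
next
  case False
  then have \<beta>': "mi_order \<beta> < Suc m" using \<beta> by simp
  obtain I where I: "finite I" "\<Omega> = (\<Union>p\<in>I. fst p \<inter> \<Omega>)" "\<And>p. p \<in> I \<Longrightarrow> cone_at \<Omega> (fst p) (snd p)"
    "\<And>p. p \<in> I \<Longrightarrow> open (fst p \<inter> \<Omega>)" by (rule cover) blast
  have "\<exists>C\<ge>0. \<forall>u\<in>sobolev (Suc m) \<Omega>. l2norm (lebesgue_on (fst p \<inter> \<Omega>)) (rep (wd \<beta> u)) \<le> C * top_sum (Suc m) u"
    if p: "p \<in> I" for p
  \<comment> \<open>\<open>patch_data\<close> yields the locale only in the presence of some Sobolev
    function; without one the bound is vacuous.\<close>
  proof (cases "sobolev (Suc m) \<Omega> = {}")
    case False
    then obtain u0 where "u0 \<in> sobolev (Suc m) \<Omega>" by blast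
    note cp = patch_data(1)[OF I(3)[OF p] this \<beta>]
    obtain C where C: "C \<ge> 0" "\<And>u v w. cone_patch.data \<Omega> m \<beta> u v w \<Longrightarrow> l2norm (lebesgue_on (fst p \<inter> \<Omega>)) v \<le> C * cone_patch.energy u w"
      using cone_patch.L2_estimate[OF cp \<beta>'] by blast
    have "l2norm (lebesgue_on (fst p \<inter> \<Omega>)) (rep (wd \<beta> u)) \<le> C * top_sum (Suc m) u" if u: "u \<in> sobolev (Suc m) \<Omega>" for u
      using C(2)[OF patch_data(2)[OF I(3)[OF p] u \<beta>]] mult_left_mono[OF patch_data(3)[OF I(3)[OF p] u \<beta>] C(1)] by (rule order_trans)
    then show ?thesis using C(1) by blast
  qed auto
  then obtain C where C: "\<And>p. p \<in> I \<Longrightarrow> C p \<ge> 0"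
    "\<And>p u. p \<in> I \<Longrightarrow> u \<in> sobolev (Suc m) \<Omega> \<Longrightarrow> l2norm (lebesgue_on (fst p \<inter> \<Omega>)) (rep (wd \<beta> u)) \<le> C p * top_sum (Suc m) u"
    by metis
  have "l2norm \<mu> (wd \<beta> u) \<le> (\<Sum>p\<in>I. C p) * top_sum (Suc m) u" if u: "u \<in> sobolev (Suc m) \<Omega>" for u
  proof -
    have s: "sq_int \<mu> (wd \<beta> u)" using sobolevD(3)[OF u \<beta>] .
    have "l2norm \<mu> (wd \<beta> u) = l2norm \<mu> (rep (wd \<beta> u))"
      using sq_int_measurable[OF s] borel_measurable_lebesgue_on[OF rep_measurable[OF s]] rep(4)[OF s] by (rule l2norm_cong_AE)
    also have "\<dots> \<le> (\<Sum>p\<in>I. l2norm (lebesgue_on (fst p \<inter> \<Omega>)) (rep (wd \<beta> u)))"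
      by (rule l2norm_cover[OF I(1) I(4) I(2) rep(1)[OF s]])
    also have "\<dots> \<le> (\<Sum>p\<in>I. C p * top_sum (Suc m) u)" by (intro sum_mono C(2) u)
    finally show ?thesis by (simp add: sum_distrib_right)
  qed
  then show ?thesis using C(1) by (intro exI[of _ "\<Sum>p\<in>I. C p"]) (auto intro: sum_nonneg)
qed

lemma embedding_continuous:
  assumes \<beta>: "2 * mi_order \<beta> + CARD('n) < 2 * Suc m"
  shows "\<exists>C\<ge>0. \<forall>u\<in>sobolev (Suc m) \<Omega>. \<exists>f. continuous_on \<Omega> f \<and> (AE x in \<mu>. wd \<beta> u x = f x) \<and>
     (\<forall>x\<in>\<Omega>. \<bar>f x\<bar> \<le> C * top_sum (Suc m) u)"
proof -
  have "2 * mi_order \<beta> < 2 * Suc m" using le_less_trans[OF le_add1 \<beta>] .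
  then have \<beta>': "mi_order \<beta> \<le> Suc m" by simp
  obtain I where I: "finite I" "\<Omega> = (\<Union>p\<in>I. fst p \<inter> \<Omega>)" "\<And>p. p \<in> I \<Longrightarrow> cone_at \<Omega> (fst p) (snd p)"
    "\<And>p. p \<in> I \<Longrightarrow> open (fst p \<inter> \<Omega>)" by (rule cover) blast
  define Q where "Q p K u f \<longleftrightarrow> continuous_on (fst p \<inter> \<Omega>) f \<and>
      (AE x in lebesgue_on (fst p \<inter> \<Omega>). rep (wd \<beta> u) x = f x) \<and> (\<forall>x\<in>fst p \<inter> \<Omega>. \<bar>f x\<bar> \<le> K * top_sum (Suc m) u)"
    for p :: "(real ^ 'n) set \<times> (real ^ 'n)" and K u f
  have "\<exists>C\<ge>0. \<forall>u\<in>sobolev (Suc m) \<Omega>. \<exists>f. continuous_on (fst p \<inter> \<Omega>) f \<and>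
      (AE x in lebesgue_on (fst p \<inter> \<Omega>). rep (wd \<beta> u) x = f x) \<and> (\<forall>x\<in>fst p \<inter> \<Omega>. \<bar>f x\<bar> \<le> C * top_sum (Suc m) u)"
    if p: "p \<in> I" for p
  proof (cases "sobolev (Suc m) \<Omega> = {}")
    case False
    then obtain u0 where "u0 \<in> sobolev (Suc m) \<Omega>" by blast
    note cp = patch_data(1)[OF I(3)[OF p] this \<beta>']
    obtain C where C: "C \<ge> 0" "\<And>u v w. cone_patch.data \<Omega> m \<beta> u v w \<Longrightarrow> \<exists>f. continuous_on (fst p \<inter> \<Omega>) f \<and>
        (AE x in lebesgue_on (fst p \<inter> \<Omega>). v x = f x) \<and> (\<forall>x\<in>fst p \<inter> \<Omega>. \<bar>f x\<bar> \<le> C * cone_patch.energy u w)"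
      using cone_patch.continuous_estimate[OF cp \<beta>] by blast
    have "\<exists>f. continuous_on (fst p \<inter> \<Omega>) f \<and>
      (AE x in lebesgue_on (fst p \<inter> \<Omega>). rep (wd \<beta> u) x = f x) \<and> (\<forall>x\<in>fst p \<inter> \<Omega>. \<bar>f x\<bar> \<le> C * top_sum (Suc m) u)"
      if u: "u \<in> sobolev (Suc m) \<Omega>" for u
      using C(2)[OF patch_data(2)[OF I(3)[OF p] u \<beta>']] mult_left_mono[OF patch_data(3)[OF I(3)[OF p] u \<beta>'] C(1)] order_trans by blast
    then show ?thesis using C(1) by blast
  qed auto
  then have "\<forall>p\<in>I. \<exists>C. 0 \<le> C \<and> (\<forall>u\<in>sobolev (Suc m) \<Omega>. \<exists>f. Q p C u f)" unfolding Q_def by blast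
  from bchoice[OF this] obtain C where C: "\<And>p. p \<in> I \<Longrightarrow> C p \<ge> 0"
    "\<And>p u. p \<in> I \<Longrightarrow> u \<in> sobolev (Suc m) \<Omega> \<Longrightarrow> \<exists>f. Q p (C p) u f" by blast
  have "\<exists>f. continuous_on \<Omega> f \<and> (AE x in \<mu>. wd \<beta> u x = f x) \<and> (\<forall>x\<in>\<Omega>. \<bar>f x\<bar> \<le> (\<Sum>p\<in>I. C p) * top_sum (Suc m) u)"
    if u: "u \<in> sobolev (Suc m) \<Omega>" for u
  proof -
    have s: "sq_int \<mu> (wd \<beta> u)" using sobolevD(3)[OF u \<beta>'] .
    have "\<forall>p\<in>I. \<exists>f. Q p (C p) u f" using C(2) u by blast
    from bchoice[OF this] obtain f where Q: "\<And>p. p \<in> I \<Longrightarrow> Q p (C p) u (f p)" by blast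
    have f: "\<And>p. p \<in> I \<Longrightarrow> continuous_on (fst p \<inter> \<Omega>) (f p)"
      "\<And>p. p \<in> I \<Longrightarrow> AE x in lebesgue_on (fst p \<inter> \<Omega>). rep (wd \<beta> u) x = f p x"
      "\<And>p x. p \<in> I \<Longrightarrow> x \<in> fst p \<inter> \<Omega> \<Longrightarrow> \<bar>f p x\<bar> \<le> C p * top_sum (Suc m) u"
      using Q unfolding Q_def by blast+
    obtain F where F: "continuous_on \<Omega> F" "AE x in \<mu>. rep (wd \<beta> u) x = F x"
        "\<And>x. x \<in> \<Omega> \<Longrightarrow> \<exists>p\<in>I. x \<in> fst p \<inter> \<Omega> \<and> F x = f p x"
      using glue_continuous[OF I(1) I(4) I(2) f(1,2)] by blast
    have "\<bar>F x\<bar> \<le> (\<Sum>p\<in>I. C p) * top_sum (Suc m) u" if x: "x \<in> \<Omega>" for x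
    proof -
      obtain p where p: "p \<in> I" "x \<in> fst p \<inter> \<Omega>" "F x = f p x" using F(3)[OF x] by blast
      have "\<bar>F x\<bar> \<le> C p * top_sum (Suc m) u" using f(3)[OF p(1,2)] p(3) by simp
      also have "\<dots> \<le> (\<Sum>p\<in>I. C p) * top_sum (Suc m) u"
        using C(1) p(1) I(1) by (intro mult_right_mono top_sum_nonneg member_le_sum) auto
      finally show ?thesis .
    qed
    moreover have "AE x in \<mu>. wd \<beta> u x = F x" using rep(4)[OF s] F(2) by eventually_elim simp
    ultimately show ?thesis using F(1) by blast
  qed
  then show ?thesis using C(1) by (intro exI[of _ "\<Sum>p\<in>I. C p"]) (auto intro: sum_nonneg)
qed

end

section \<open>Classical and weak partial derivatives\<close>

text \<open>A classical derivative along one axis is enough for integration by parts, and it can be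
  read off from continuous weak derivatives.\<close>

definition has_partial :: "(real ^ 'n) set \<Rightarrow> 'n \<Rightarrow> (real ^ 'n \<Rightarrow> real) \<Rightarrow> (real ^ 'n \<Rightarrow> real) \<Rightarrow> bool" where
  "has_partial S i f g \<longleftrightarrow> (\<forall>x\<in>S. ((\<lambda>t. f (x + t *\<^sub>R axis i 1)) has_real_derivative g x) (at 0))"

lemma DERIV_line:
  fixes F :: "'a::real_normed_vector \<Rightarrow> real"
  assumes "F differentiable (at x)"
  shows "((\<lambda>t. F (x + t *\<^sub>R b)) has_real_derivative dir_deriv b F x) (at 0)"
proof -
  have "(\<lambda>t::real. x + t *\<^sub>R b) differentiable (at 0)" by (auto intro!: derivative_intros)
  from differentiable_chain_at[OF this, of F] assms
  have "(\<lambda>t. F (x + t *\<^sub>R b)) differentiable (at 0)" by (simp add: comp_def)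
  then show ?thesis unfolding dir_deriv_def DERIV_deriv_iff_real_differentiable .
qed

lemma DERIV_line_shift:
  fixes G D :: "'a::real_normed_vector \<Rightarrow> real"
  assumes "((\<lambda>s. G ((x + t *\<^sub>R e) + s *\<^sub>R e)) has_real_derivative d) (at 0)"
  shows "((\<lambda>s. G (x + s *\<^sub>R e)) has_real_derivative d) (at t)"
  using assms DERIV_shift[of "\<lambda>s. G (x + s *\<^sub>R e)" d 0 t] by (simp add: algebra_simps)

lemma integrable_compact_support:
  fixes f :: "'a::euclidean_space \<Rightarrow> real"
  assumes "f \<in> borel_measurable borel" "compact K" "\<And>x. \<bar>f x\<bar> \<le> B" "\<And>x. x \<notin> K \<Longrightarrow> f x = 0"
  shows "integrable lborel f"
  by (rule integrableI_bounded_set[of K _ _ B]) (use assms emeasure_compact_finite in \<open>auto simp: borel_compact\<close>)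

lemma integral_translate:
  fixes f :: "'a::euclidean_space \<Rightarrow> real"
  assumes [measurable]: "f \<in> borel_measurable borel"
  shows "integrable lborel (\<lambda>x. f (x + t)) \<longleftrightarrow> integrable lborel f" "(\<integral>x. f (x + t) \<partial>lborel) = (\<integral>x. f x \<partial>lborel)"
proof -
  have l: "lborel = distr lborel borel (\<lambda>x. t + 1 *\<^sub>R x)"
    by (subst lborel_affine[of 1 t]) (auto simp: density_1)
  have "integrable lborel f \<longleftrightarrow> integrable (distr lborel borel (\<lambda>x. t + 1 *\<^sub>R x)) f" using l by simp
  also have "\<dots> \<longleftrightarrow> integrable lborel (\<lambda>x. f (t + 1 *\<^sub>R x))" by (rule integrable_distr_eq) auto
  finally show "integrable lborel (\<lambda>x. f (x + t)) \<longleftrightarrow> integrable lborel f" by (simp add: add.commute)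
  have "(\<integral>x. f x \<partial>lborel) = (\<integral>x. f x \<partial>distr lborel borel (\<lambda>x. t + 1 *\<^sub>R x))" using l by simp
  also have "\<dots> = (\<integral>x. f (t + 1 *\<^sub>R x) \<partial>lborel)" by (rule integral_distr) auto
  finally show "(\<integral>x. f (x + t) \<partial>lborel) = (\<integral>x. f x \<partial>lborel)" by (simp add: add.commute)
qed

text \<open>Translation invariance and dominated convergence for the difference quotients.\<close>

lemma integral_line_derivative_zero:
  fixes G D :: "'a::euclidean_space \<Rightarrow> real"
  assumes [measurable]: "G \<in> borel_measurable borel" "D \<in> borel_measurable borel"
    and d: "\<And>x. ((\<lambda>t. G (x + t *\<^sub>R e)) has_real_derivative D x) (at 0)"
    and K: "compact K" "\<And>x. x \<notin> K \<Longrightarrow> G x = 0" and B: "\<And>x. \<bar>D x\<bar> \<le> B" "\<And>x. \<bar>G x\<bar> \<le> B'"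
    and e: "norm e \<le> 1"
  shows "(\<integral>x. D x \<partial>lborel) = 0"
proof -
  define h where "h n = 1 / real (Suc n)" for n
  have h: "0 < h n" "h n \<le> 1" for n by (auto simp: h_def)
  have h0: "h \<longlonglongrightarrow> 0" unfolding h_def by (rule LIMSEQ_Suc[OF lim_1_over_n])
  have h0': "filterlim h (at 0) sequentially"
    unfolding filterlim_at using h0 h by (auto simp: less_imp_neq[symmetric] intro!: always_eventually)
  define q where "q n x = (G (x + h n *\<^sub>R e) - G x) / h n" for n x
  obtain R where R: "\<And>x. x \<in> K \<Longrightarrow> norm x \<le> R" using compact_imp_bounded[OF K(1)] by (auto simp: bounded_iff)
  have Gi: "integrable lborel G" by (rule integrable_compact_support[OF assms(1) K(1) B(2) K(2)])
  have q0: "(\<integral>x. q n x \<partial>lborel) = 0" for n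
    unfolding q_def using Gi integral_translate[OF assms(1), of "h n *\<^sub>R e"] by simp
  have "(\<lambda>n. \<integral>x. q n x \<partial>lborel) \<longlonglongrightarrow> (\<integral>x. D x \<partial>lborel)"
  proof (rule integral_dominated_convergence)
    show "integrable lborel (\<lambda>x::'a. \<bar>B\<bar> * indicator (cball 0 (R + 1)) x)"
      by (intro integrable_mult_right integrable_real_indicator)
        (use emeasure_compact_finite[OF compact_cball, of "0 :: 'a" "R + 1"] in auto)
    show "AE x in lborel. (\<lambda>n. q n x) \<longlonglongrightarrow> D x"
    proof (rule AE_I2)
      fix x
      have "((\<lambda>h. (G (x + (0 + h) *\<^sub>R e) - G (x + 0 *\<^sub>R e)) / h) \<longlongrightarrow> D x) (at 0)"
        using d[of x] unfolding DERIV_def .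
      from filterlim_compose[OF this h0'] show "(\<lambda>n. q n x) \<longlonglongrightarrow> D x" by (simp add: q_def)
    qed
    show "AE x in lborel. norm (q n x) \<le> \<bar>B\<bar> * indicator (cball 0 (R + 1)) x" for n
    proof (rule AE_I2)
      fix x
      \<comment> \<open>By the mean value theorem each difference quotient is a value of
        \<open>D\<close> on the segment, hence bounded by \<open>B\<close>. As the shifts have
        length at most 1, the quotients vanish outside the ball of radius
        \<open>R + 1\<close>.\<close>
      have "((\<lambda>s. G (x + s *\<^sub>R e)) has_real_derivative D (x + s *\<^sub>R e)) (at s)" for s
        by (rule DERIV_line_shift[OF d])
      then obtain z where "G (x + h n *\<^sub>R e) - G (x + 0 *\<^sub>R e) = (h n - 0) * D (x + z *\<^sub>R e)"
        using MVT2[OF h(1)[of n], of "\<lambda>s. G (x + s *\<^sub>R e)" "\<lambda>s. D (x + s *\<^sub>R e)"] by blast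
      then have "q n x = D (x + z *\<^sub>R e)" using h(1)[of n] by (simp add: q_def)
      then have 1: "\<bar>q n x\<bar> \<le> \<bar>B\<bar>" using B(1)[of "x + z *\<^sub>R e"] by simp
      have 2: "q n x = 0" if x: "x \<notin> cball 0 (R + 1)"
      proof -
        have "norm (h n *\<^sub>R e) \<le> 1" using e h[of n] by (simp add: mult_le_one)
        then have "norm (x + h n *\<^sub>R e) > R" "norm x > R"
          using x norm_triangle_ineq4[of "x + h n *\<^sub>R e" "h n *\<^sub>R e"] by auto
        then have "x \<notin> K" "x + h n *\<^sub>R e \<notin> K" using R by force+
        then show ?thesis using K(2) by (simp add: q_def)
      qed
      show "norm (q n x) \<le> \<bar>B\<bar> * indicator (cball 0 (R + 1)) x"
        using 1 2 by (cases "x \<in> cball 0 (R + 1)") auto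
    qed
  qed (unfold q_def, measurable)
  then show ?thesis unfolding q0 by (simp add: LIMSEQ_const_iff)
qed

text \<open>The product \<open>X \<psi>\<close>, extended by 0, has a classical derivative along the
  axis at every point, because near each point off \<open>\<Omega>\<close> it vanishes; the integral
  of this derivative is 0.\<close>

lemma integral_by_parts:
  fixes \<Omega> :: "(real ^ 'n) set"
  assumes O: "open \<Omega>" and X: "continuous_on \<Omega> X" and Y: "continuous_on \<Omega> Y" and p: "has_partial \<Omega> i X Y"
    and \<psi>: "\<psi> \<in> test_fun \<Omega>"
  shows "(\<integral>x. X x * dir_deriv (axis i 1) \<psi> x \<partial>lebesgue_on \<Omega>) = - (\<integral>x. Y x * \<psi> x \<partial>lebesgue_on \<Omega>)"
proof -
  define e :: "real ^ 'n" where "e = axis i 1"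
  define \<psi>' where "\<psi>' = dir_deriv e \<psi>"
  have \<psi>': "\<psi>' \<in> test_fun \<Omega>" unfolding \<psi>'_def e_def by (rule test_fun_dir_deriv[OF \<psi>]) (simp add: axis_in_Basis_iff)
  obtain K1 where K1: "compact K1" "K1 \<subseteq> \<Omega>" "\<And>x. x \<notin> K1 \<Longrightarrow> \<psi> x = 0" using \<psi> unfolding test_fun_def by blast
  obtain K2 where K2: "compact K2" "K2 \<subseteq> \<Omega>" "\<And>x. x \<notin> K2 \<Longrightarrow> \<psi>' x = 0" using \<psi>' unfolding test_fun_def by blast
  define K where "K = K1 \<union> K2"
  have K: "compact K" "K \<subseteq> \<Omega>" "\<And>x. x \<notin> K \<Longrightarrow> \<psi> x = 0" "\<And>x. x \<notin> K \<Longrightarrow> \<psi>' x = 0"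
    using K1 K2 by (auto simp: K_def)
  have Ob: "\<Omega> \<in> sets borel" using O by simp
  note c = test_fun_properties(2)[OF \<psi>] test_fun_properties(2)[OF \<psi>']
  define G where "G x = indicator \<Omega> x *\<^sub>R (X x * \<psi> x)" for x
  define D1 where "D1 x = indicator \<Omega> x *\<^sub>R (X x * \<psi>' x)" for x
  define D2 where "D2 x = indicator \<Omega> x *\<^sub>R (Y x * \<psi> x)" for x
  have m[measurable]: "G \<in> borel_measurable borel" "D1 \<in> borel_measurable borel" "D2 \<in> borel_measurable borel"
    unfolding G_def D1_def D2_def
    by (intro borel_measurable_continuous_on_indicator Ob continuous_intros X Y c)+
  have bnd: "\<exists>B. \<forall>x. \<bar>indicator \<Omega> x *\<^sub>R (f x * g x)\<bar> \<le> B"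
    if f: "continuous_on \<Omega> f" and g: "continuous_on \<Omega> g" "\<And>x. x \<notin> K \<Longrightarrow> g x = 0" for f g :: "real ^ 'n \<Rightarrow> real"
  proof -
    have "bounded ((\<lambda>x. f x * g x) ` K)"
      using K f g(1) by (intro compact_imp_bounded compact_continuous_image continuous_intros) (auto intro: continuous_on_subset)
    then obtain B where B: "B > 0" "\<And>x. x \<in> K \<Longrightarrow> \<bar>f x * g x\<bar> \<le> B" by (auto simp: bounded_pos)
    have "\<bar>indicator \<Omega> x *\<^sub>R (f x * g x)\<bar> \<le> B" for x
      using B g(2)[of x] by (cases "x \<in> K") (auto simp: indicator_def)
    then show ?thesis by blast
  qed
  obtain BG where BG: "\<And>x. \<bar>G x\<bar> \<le> BG" using bnd[OF X c(1) K(3)] unfolding G_def by blast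
  obtain B1 where B1: "\<And>x. \<bar>D1 x\<bar> \<le> B1" using bnd[OF X c(2) K(4)] unfolding D1_def by blast
  obtain B2 where B2: "\<And>x. \<bar>D2 x\<bar> \<le> B2" using bnd[OF Y c(1) K(3)] unfolding D2_def by blast
  have i: "integrable lborel D1" "integrable lborel D2"
    by (rule integrable_compact_support[OF m(2) K(1) B1], simp add: D1_def K(4))
      (rule integrable_compact_support[OF m(3) K(1) B2], simp add: D2_def K(3))
  have line: "((\<lambda>t::real. x + t *\<^sub>R e) \<longlongrightarrow> x) (nhds 0)" for x
  proof -
    have "((\<lambda>t::real. x + t *\<^sub>R e) \<longlongrightarrow> x + 0 *\<^sub>R e) (nhds 0)" by (intro tendsto_intros filterlim_ident)
    then show ?thesis by simp
  qed
  have d: "((\<lambda>t. G (x + t *\<^sub>R e)) has_real_derivative D1 x + D2 x) (at 0)" for x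
  proof (cases "x \<in> \<Omega>")
    case True
    have "((\<lambda>t. \<psi> (x + t *\<^sub>R e)) has_real_derivative \<psi>' x) (at 0)"
      using smooth_on_differentiable[OF test_fun_properties(1)[OF \<psi>], of "[]" x]
      unfolding \<psi>'_def by (intro DERIV_line) (simp add: dir_derivs_def)
    moreover have "((\<lambda>t. X (x + t *\<^sub>R e)) has_real_derivative Y x) (at 0)" using p True by (simp add: has_partial_def e_def)
    ultimately have "((\<lambda>t. X (x + t *\<^sub>R e) * \<psi> (x + t *\<^sub>R e)) has_real_derivative Y x * \<psi> (x + 0 *\<^sub>R e) + \<psi>' x * X (x + 0 *\<^sub>R e)) (at 0)"
      by (rule DERIV_mult[rotated])
    moreover have "\<forall>\<^sub>F t in nhds 0. X (x + t *\<^sub>R e) * \<psi> (x + t *\<^sub>R e) = G (x + t *\<^sub>R e)"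
      using topological_tendstoD[OF line O True] by eventually_elim (simp add: G_def)
    ultimately have "((\<lambda>t. G (x + t *\<^sub>R e)) has_real_derivative Y x * \<psi> (x + 0 *\<^sub>R e) + \<psi>' x * X (x + 0 *\<^sub>R e)) (at 0)"
      by (subst (asm) DERIV_cong_ev[OF refl _ refl])
    then show ?thesis using True by (simp add: D1_def D2_def algebra_simps)
  next
    case False
    then have "x \<in> - K" "open (- K)" using K by (auto simp: compact_imp_closed open_Compl)
    from topological_tendstoD[OF line this(2,1)]
    have "\<forall>\<^sub>F t in nhds 0. 0 = G (x + t *\<^sub>R e)" by eventually_elim (simp add: G_def K(3))
    moreover have "((\<lambda>t::real. 0::real) has_real_derivative 0) (at 0)" by simp
    ultimately have "((\<lambda>t. G (x + t *\<^sub>R e)) has_real_derivative 0) (at 0)"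
      by (subst (asm) DERIV_cong_ev[OF refl _ refl])
    then show ?thesis using False by (simp add: D1_def D2_def)
  qed
  have "(\<integral>x. D1 x + D2 x \<partial>lborel) = 0"
  proof (rule integral_line_derivative_zero[OF m(1) _ d K(1)])
    show "G x = 0" if "x \<notin> K" for x using that by (simp add: G_def K(3))
    show "\<bar>D1 x + D2 x\<bar> \<le> B1 + B2" for x using B1[of x] B2[of x] by linarith
    show "norm e \<le> 1" by (simp add: e_def)
  qed (use BG in auto)
  then have "(\<integral>x. D1 x \<partial>lborel) = - (\<integral>x. D2 x \<partial>lborel)" using i by simp
  moreover have "(\<integral>x. X x * \<psi>' x \<partial>lebesgue_on \<Omega>) = (\<integral>x. D1 x \<partial>lborel)" "(\<integral>x. Y x * \<psi> x \<partial>lebesgue_on \<Omega>) = (\<integral>x. D2 x \<partial>lborel)"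
  proof -
    have cm: "f \<in> borel_measurable (lebesgue_on \<Omega>)" if "continuous_on \<Omega> f" for f :: "real ^ 'n \<Rightarrow> real"
      using that O by (intro continuous_imp_measurable_on_sets_lebesgue) auto
    show "(\<integral>x. X x * \<psi>' x \<partial>lebesgue_on \<Omega>) = (\<integral>x. D1 x \<partial>lborel)"
      by (rule lebesgue_on_lborel(2)[OF cm O m(2)])
        (auto intro!: continuous_intros X c AE_I2 simp: D1_def space_restrict_space)
    show "(\<integral>x. Y x * \<psi> x \<partial>lebesgue_on \<Omega>) = (\<integral>x. D2 x \<partial>lborel)"
      by (rule lebesgue_on_lborel(2)[OF cm O m(3)])
        (auto intro!: continuous_intros Y c AE_I2 simp: D2_def space_restrict_space)
  qed
  ultimately show ?thesis by (simp add: \<psi>'_def e_def)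
qed

lemma mi_order_unit: "mi_order (mi_unit i) = 1"
  by (simp add: mi_order_def mi_unit_def)

lemma length_mi_list: "length (mi_list \<alpha>) = mi_order \<alpha>"
proof -
  have "(\<Sum>i\<in>UNIV. count_list (mi_list \<alpha>) i) = length (mi_list \<alpha>)" by (rule sum_count_set) auto
  then show ?thesis by (simp add: count_mi_list mi_order_def)
qed

lemma mi_deriv_unit: "mi_deriv (mi_unit i) \<psi> = dir_deriv (axis i 1) \<psi>"
proof -
  have "length (mi_list (mi_unit i)) = 1" by (simp add: length_mi_list mi_order_unit)
  then obtain j where j: "mi_list (mi_unit i) = [j]" by (auto simp: length_Suc_conv)
  have "count_list [j] i = 1" using count_mi_list[of "mi_unit i" i] unfolding j by (simp add: mi_unit_def)
  then have "j = i" by (simp split: if_splits)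
  then show ?thesis by (simp add: mi_deriv_def j dir_derivs_def)
qed

lemma smooth_on_has_partial:
  assumes "smooth_on \<Omega> f" "open \<Omega>"
  shows "has_partial \<Omega> i f (dir_deriv (axis i 1) f)"
  unfolding has_partial_def
  using smooth_on_differentiable[OF assms(1), of "[]"] assms(2) by (auto simp: dir_derivs_def intro!: DERIV_line)

text \<open>Derivatives leave \<open>\<psi>\<close> from the outside in and thus reach
  \<open>f\<close> in reversed order; keeping the reversed list avoids an appeal to the symmetry of
  mixed derivatives.\<close>

lemma integral_by_parts_iterated:
  fixes \<Omega> :: "(real ^ 'n) set"
  assumes "open \<Omega>" "\<psi> \<in> test_fun \<Omega>" "smooth_on \<Omega> f"
  shows "(\<integral>x. f x * dir_derivs (map (\<lambda>j. axis j 1) js) \<psi> x \<partial>lebesgue_on \<Omega>)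
    = (- 1) ^ length js * (\<integral>x. dir_derivs (rev (map (\<lambda>j. axis j 1) js)) f x * \<psi> x \<partial>lebesgue_on \<Omega>)"
  using assms(3)
proof (induction js arbitrary: f)
  case (Cons j js)
  let ?A = "map (\<lambda>j. axis j 1) :: 'n list \<Rightarrow> (real ^ 'n) list"
  have A: "set (?A js) \<subseteq> Basis" "axis j 1 \<in> (Basis :: (real ^ 'n) set)" by (auto simp: axis_in_Basis_iff)
  have s': "smooth_on \<Omega> (dir_deriv (axis j 1) f)" using Cons.prems A(2) by (rule smooth_on_dir_deriv)
  have "(\<integral>x. f x * dir_derivs (?A (j # js)) \<psi> x \<partial>lebesgue_on \<Omega>)
      = (\<integral>x. f x * dir_deriv (axis j 1) (dir_derivs (?A js) \<psi>) x \<partial>lebesgue_on \<Omega>)" by (simp add: dir_derivs_def)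
  also have "\<dots> = - (\<integral>x. dir_deriv (axis j 1) f x * dir_derivs (?A js) \<psi> x \<partial>lebesgue_on \<Omega>)"
  proof (rule integral_by_parts[OF assms(1)])
    show "continuous_on \<Omega> f" using smooth_on_continuous[OF Cons.prems, of "[]"] by (simp add: dir_derivs_def)
    show "continuous_on \<Omega> (dir_deriv (axis j 1) f)" using smooth_on_continuous[OF s', of "[]"] by (simp add: dir_derivs_def)
  qed (use smooth_on_has_partial[OF Cons.prems assms(1)] test_fun_dir_derivs[OF assms(2) A(1)] in auto)
  also have "\<dots> = (- 1) ^ length (j # js) * (\<integral>x. dir_derivs (rev (?A js)) (dir_deriv (axis j 1) f) x * \<psi> x \<partial>lebesgue_on \<Omega>)"
    using Cons.IH[OF s'] by simp
  also have "dir_derivs (rev (?A js)) (dir_deriv (axis j 1) f) = dir_derivs (rev (?A (j # js))) f"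
    by (simp add: dir_derivs_def)
  finally show ?case .
qed (simp add: dir_derivs_def)

text \<open>The consequence of \<open>smooth_on_closure\<close> that puts a function into every
  Sobolev space; test functions share it, and the Laplacian preserves it.\<close>

definition bounded_smooth :: "(real ^ 'n) set \<Rightarrow> (real ^ 'n \<Rightarrow> real) \<Rightarrow> bool" where
  "bounded_smooth \<Omega> f \<longleftrightarrow> smooth_on \<Omega> f \<and> (\<forall>bs. set bs \<subseteq> Basis \<longrightarrow> (\<exists>B. \<forall>x\<in>\<Omega>. \<bar>dir_derivs bs f x\<bar> \<le> B))"

lemma bounded_smooth_closure:
  fixes \<Omega> :: "(real ^ 'n) set"
  assumes "bounded \<Omega>" "smooth_on_closure \<Omega> f"
  shows "bounded_smooth \<Omega> f"
  unfolding bounded_smooth_def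
proof (intro conjI allI impI)
  show "smooth_on \<Omega> f" using assms(2) by (simp add: smooth_on_closure_def)
  fix bs :: "(real ^ 'n) list" assume "set bs \<subseteq> Basis"
  then obtain G where G: "continuous_on (closure \<Omega>) G" "\<And>x. x \<in> \<Omega> \<Longrightarrow> G x = dir_derivs bs f x"
    using assms(2) unfolding smooth_on_closure_def by blast
  have "bounded (G ` closure \<Omega>)" using assms(1) G(1) by (intro compact_imp_bounded compact_continuous_image) auto
  then obtain B where "\<And>x. x \<in> closure \<Omega> \<Longrightarrow> \<bar>G x\<bar> \<le> B" by (auto simp: bounded_pos)
  then have "\<bar>dir_derivs bs f x\<bar> \<le> B" if "x \<in> \<Omega>" for x using G(2)[OF that] closure_subset that by force
  then show "\<exists>B. \<forall>x\<in>\<Omega>. \<bar>dir_derivs bs f x\<bar> \<le> B" by blast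
qed

lemma bounded_smooth_test:
  assumes "\<psi> \<in> test_fun \<Omega>"
  shows "bounded_smooth \<Omega> \<psi>"
  unfolding bounded_smooth_def
proof (intro conjI allI impI)
  show "smooth_on \<Omega> \<psi>"
    using test_fun_properties(1)[OF assms] unfolding smooth_on_def by (meson differentiable_on_subset subset_UNIV)
  fix bs :: "(real ^ 'a) list" assume "set bs \<subseteq> Basis"
  then show "\<exists>B. \<forall>x\<in>\<Omega>. \<bar>dir_derivs bs \<psi> x\<bar> \<le> B"
    using test_fun_properties(3)[OF test_fun_dir_derivs[OF assms]] by blast
qed

context bounded_open
begin

lemma continuous_bounded_sq_int:
  assumes "continuous_on \<Omega> f" "\<And>x. x \<in> \<Omega> \<Longrightarrow> \<bar>f x\<bar> \<le> B"
  shows "sq_int \<mu> f"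
proof (rule finite_measure.sq_int_bounded(1)[OF finite_dom])
  show "f \<in> borel_measurable \<mu>" using assms(1) open_dom by (intro continuous_imp_measurable_on_sets_lebesgue) auto
  show "AE x in \<mu>. \<bar>f x\<bar> \<le> B" using assms(2) by (intro AE_I2) (auto simp: space_restrict_space)
qed

lemma bounded_smooth_derivs_sq_int:
  assumes "bounded_smooth \<Omega> f" "set bs \<subseteq> Basis"
  shows "sq_int \<mu> (dir_derivs bs f)"
proof -
  obtain B where "\<And>x. x \<in> \<Omega> \<Longrightarrow> \<bar>dir_derivs bs f x\<bar> \<le> B" using assms unfolding bounded_smooth_def by blast
  moreover have "continuous_on \<Omega> (dir_derivs bs f)"
    using assms by (intro smooth_on_continuous) (auto simp: bounded_smooth_def)
  ultimately show ?thesis by (rule continuous_bounded_sq_int[rotated])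
qed

lemma bounded_smooth_sobolev:
  assumes "bounded_smooth \<Omega> f"
  shows "f \<in> sobolev s \<Omega>"
proof (rule sobolevI)
  show f: "sq_int \<mu> f" using bounded_smooth_derivs_sq_int[OF assms, of "[]"] by (simp add: dir_derivs_def)
  fix \<alpha> :: "'n multi_index"
  let ?D = "dir_derivs (rev (map (\<lambda>j. axis j 1) (mi_list \<alpha>))) f"
  have D: "sq_int \<mu> ?D" by (rule bounded_smooth_derivs_sq_int[OF assms]) (auto simp: axis_in_Basis_iff)
  have "has_weak_deriv \<Omega> \<alpha> f ?D"
    using integral_by_parts_iterated[OF open_dom _ , of _ f "mi_list \<alpha>"] assms
    by (intro has_weak_derivI[OF f D]) (auto simp: mi_deriv_def length_mi_list bounded_smooth_def)
  then show "\<exists>v. sq_int \<mu> v \<and> has_weak_deriv \<Omega> \<alpha> f v" using D by blast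
qed

lemma has_weak_deriv_classical:
  assumes "continuous_on \<Omega> X" "continuous_on \<Omega> Y" "has_partial \<Omega> i X Y"
    and "\<And>x. x \<in> \<Omega> \<Longrightarrow> \<bar>X x\<bar> \<le> B" "\<And>x. x \<in> \<Omega> \<Longrightarrow> \<bar>Y x\<bar> \<le> C"
  shows "has_weak_deriv \<Omega> (mi_unit i) X Y"
  using assms integral_by_parts[OF open_dom assms(1-3)]
  by (intro has_weak_derivI continuous_bounded_sq_int) (auto simp: mi_deriv_unit mi_order_unit)

end

section \<open>From continuous weak derivatives to classical partial derivatives\<close>

lemma cut_power_0: "cut_power 0 = smooth_step"
  by (auto simp: cut_power_def fun_eq_iff)

lemma deriv_smooth_step: "deriv smooth_step = avg_ker 0"
  by (simp add: avg_ker_def cut_power_0)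

lemma avg_ker_0_nonneg: "0 \<le> avg_ker 0 t"
proof -
  have "mono_on UNIV smooth_step" using mono_smooth_step by (simp add: mono_on_def mono_def)
  from mono_on_imp_deriv_nonneg[OF this smooth_real_DERIV[OF smooth_smooth_step], of t]
  show ?thesis by (simp add: deriv_smooth_step)
qed

text \<open>A mollifier, nonnegative since \<open>avg_ker 0\<close> is the derivative of the
  monotone \<open>smooth_step\<close>. The explicit antiderivative is what
  \<open>weak_increment\<close> exploits.\<close>

definition bump :: "nat \<Rightarrow> real ^ 'n \<Rightarrow> real" where
  "bump n = kern (\<lambda>_. avg_ker 0) (\<chi> _. (1 / 2) ^ n)"

lemma bump_properties:
  shows bump_measurable: "(bump n :: real ^ 'n \<Rightarrow> real) \<in> borel_measurable borel"
    and bump_nonneg: "0 \<le> bump n (y :: real ^ 'n)"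
    and bump_integrable: "integrable lborel (bump n :: real ^ 'n \<Rightarrow> real)"
    and bump_mass: "(\<integral>y. bump n (y :: real ^ 'n) \<partial>lborel) = 1"
    and bump_support: "bump n (y :: real ^ 'n) \<noteq> 0 \<Longrightarrow> norm y \<le> CARD('n) * (1 / 2) ^ n"
proof -
  have nz: "(\<chi> _. (1 / 2) ^ n :: real ^ 'n) $ i \<noteq> 0" for i by simp
  show m: "(bump n :: real ^ 'n \<Rightarrow> real) \<in> borel_measurable borel"
    unfolding bump_def by (intro kern_measurable ker_fun_smooth ker_fun_avg_ker nz)
  show "0 \<le> bump n (y :: real ^ 'n)"
    unfolding bump_def kern_def by (intro prod_nonneg) (auto intro!: divide_nonneg_nonneg avg_ker_0_nonneg)
  have "(\<integral>\<^sup>+y. ennreal \<bar>bump n (y :: real ^ 'n)\<bar> \<partial>lborel) \<le> ennreal (kern_const (\<lambda>_::'n. avg_ker 0))"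
    unfolding bump_def by (rule kern_bounds(1)[OF ker_fun_avg_ker nz])
  then show "integrable lborel (bump n :: real ^ 'n \<Rightarrow> real)"
    using m by (intro integrableI_bounded) (auto intro: le_less_trans[OF _ ennreal_less_top])
  show "(\<integral>y. bump n (y :: real ^ 'n) \<partial>lborel) = 1"
    unfolding bump_def by (subst integral_kern[OF ker_fun_avg_ker nz]) (simp add: integral_avg_ker)
  show "norm y \<le> CARD('n) * (1 / 2) ^ n" if b: "bump n (y :: real ^ 'n) \<noteq> 0"
  proof -
    have "\<bar>y $ i\<bar> \<le> (1 / 2) ^ n" for i
    proof -
      have "avg_ker 0 (y $ i / (1 / 2) ^ n) \<noteq> 0" using b by (auto simp: bump_def kern_def)
      then have "y $ i / (1 / 2) ^ n \<in> {1/4..1}" using ker_fun_support[OF ker_fun_avg_ker] by blast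
      then have "\<bar>y $ i / (1 / 2) ^ n\<bar> \<le> 1" by auto
      then show ?thesis by (simp add: field_simps)
    qed
    then have "(\<Sum>i\<in>UNIV. \<bar>y $ i\<bar>) \<le> (\<Sum>i\<in>(UNIV :: 'n set). (1 / 2) ^ n)" by (intro sum_mono)
    then show ?thesis using norm_le_l1_cart[of y] by simp
  qed
qed

lemma bump_scale_limit: "(\<lambda>n. c * (1 / 2 :: real) ^ n) \<longlonglongrightarrow> 0"
  by (intro tendsto_mult_right_zero LIMSEQ_realpow_zero) auto

text \<open>\<open>\<phi>\<close> is only continuous on \<open>\<Omega>\<close> and may be unbounded
  there, so integrability is claimed just for large \<open>n\<close>, when the support of the
  shifted bump lies in a small ball around \<open>y\<close>.\<close>

lemma bump_limit:
  fixes \<phi> :: "real ^ 'n \<Rightarrow> real"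
  assumes O: "open \<Omega>" and c: "continuous_on \<Omega> \<phi>" and y: "y \<in> \<Omega>"
  shows "\<forall>\<^sub>F n in sequentially. integrable lborel (\<lambda>z. indicator \<Omega> z * \<phi> z * bump n (z - y))"
    and "(\<lambda>n. \<integral>z. indicator \<Omega> z * \<phi> z * bump n (z - y) \<partial>lborel) \<longlonglongrightarrow> \<phi> y"
proof -
  have Ob: "\<Omega> \<in> sets borel" using O by simp
  have [measurable]: "(\<lambda>z. indicator \<Omega> z * \<phi> z) \<in> borel_measurable borel"
    using borel_measurable_continuous_on_indicator[OF Ob c] by simp
  note [measurable] = bump_measurable
  have bi: "integrable lborel (\<lambda>z. bump n (z - y))" "(\<integral>z. bump n (z - y) \<partial>lborel) = 1" for n
    using integral_translate[OF bump_measurable, of n "- y"] bump_integrable[of n] bump_mass[of n] by auto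
  have near: "\<forall>\<^sub>F n in sequentially. integrable lborel (\<lambda>z. indicator \<Omega> z * \<phi> z * bump n (z - y)) \<and>
      \<bar>(\<integral>z. indicator \<Omega> z * \<phi> z * bump n (z - y) \<partial>lborel) - \<phi> y\<bar> \<le> e" if e: "e > 0" for e
  proof -
    obtain r where r: "r > 0" "ball y r \<subseteq> \<Omega>" using O y openE by blast
    obtain s where s: "s > 0" "\<And>z. z \<in> \<Omega> \<Longrightarrow> dist z y < s \<Longrightarrow> dist (\<phi> z) (\<phi> y) < e"
      using c y e unfolding continuous_on_iff by blast
    have "\<forall>\<^sub>F n in sequentially. CARD('n) * (1 / 2 :: real) ^ n < min r s"
      using r(1) s(1) by (intro order_tendstoD(2)[OF bump_scale_limit]) auto
    then show ?thesis
    proof eventually_elim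
      case (elim n)
      have b: "bump n (z - y) \<noteq> 0 \<Longrightarrow> z \<in> \<Omega> \<and> \<bar>\<phi> z - \<phi> y\<bar> \<le> e" for z
      proof -
        assume "bump n (z - y) \<noteq> 0"
        from bump_support[OF this] elim have "dist z y < min r s" by (simp add: dist_norm)
        then have "z \<in> \<Omega>" "dist z y < s" using r(2) by (auto simp: dist_commute subset_iff)
        then show ?thesis using s(2)[of z] by (simp add: dist_real_def less_imp_le)
      qed
      have eq: "\<bar>(indicator \<Omega> z * \<phi> z - \<phi> y) * bump n (z - y)\<bar> \<le> e * bump n (z - y)" for z
        using b[of z] bump_nonneg[of n "z - y"] by (cases "bump n (z - y) = 0") (auto simp: abs_mult intro!: mult_right_mono)
      have i1: "integrable lborel (\<lambda>z. (indicator \<Omega> z * \<phi> z - \<phi> y) * bump n (z - y))"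
      proof (rule Bochner_Integration.integrable_bound[of _ "\<lambda>z. e * bump n (z - y)"])
        show "AE z in lborel. norm ((indicator \<Omega> z * \<phi> z - \<phi> y) * bump n (z - y)) \<le> norm (e * bump n (z - y))"
        proof (rule AE_I2)
          fix z
          have "norm (e * bump n (z - y)) = e * bump n (z - y)" using e bump_nonneg[of n "z - y"] by simp
          then show "norm ((indicator \<Omega> z * \<phi> z - \<phi> y) * bump n (z - y)) \<le> norm (e * bump n (z - y))"
            using eq[of z] by (simp only: real_norm_def)
        qed
      qed (use bi in auto)
      have "integrable lborel (\<lambda>z. (indicator \<Omega> z * \<phi> z - \<phi> y) * bump n (z - y) + \<phi> y * bump n (z - y))"
        using i1 bi by (intro Bochner_Integration.integrable_add integrable_mult_right) auto
      then have i2: "integrable lborel (\<lambda>z. indicator \<Omega> z * \<phi> z * bump n (z - y))" by (simp add: algebra_simps)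
      have "(\<integral>z. indicator \<Omega> z * \<phi> z * bump n (z - y) \<partial>lborel) - \<phi> y * (\<integral>z. bump n (z - y) \<partial>lborel)
          = (\<integral>z. (indicator \<Omega> z * \<phi> z - \<phi> y) * bump n (z - y) \<partial>lborel)"
        using i2 bi(1)[of n] by (simp add: left_diff_distrib)
      also have "\<bar>\<dots>\<bar> \<le> (\<integral>z. \<bar>(indicator \<Omega> z * \<phi> z - \<phi> y) * bump n (z - y)\<bar> \<partial>lborel)" by (rule integral_abs_bound)
      also have "\<dots> \<le> (\<integral>z. e * bump n (z - y) \<partial>lborel)"
        using i1 bi(1)[of n] eq by (intro Bochner_Integration.integral_mono) auto
      finally show ?case using i2 bi(2)[of n] by simp
    qed
  qed
  show "\<forall>\<^sub>F n in sequentially. integrable lborel (\<lambda>z. indicator \<Omega> z * \<phi> z * bump n (z - y))"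
    using near[of 1] by (auto elim: eventually_mono)
  show "(\<lambda>n. \<integral>z. indicator \<Omega> z * \<phi> z * bump n (z - y) \<partial>lborel) \<longlonglongrightarrow> \<phi> y"
  proof (rule tendstoI)
    fix e :: real assume "e > 0"
    then show "\<forall>\<^sub>F n in sequentially. dist (\<integral>z. indicator \<Omega> z * \<phi> z * bump n (z - y) \<partial>lborel) (\<phi> y) < e"
      using near[of "e / 2"] by (auto elim!: eventually_mono simp: dist_real_def)
  qed
qed

lemma weak_on_products_classical:
  fixes \<Omega> :: "(real ^ 'n) set"
  assumes O: "open \<Omega>" and X: "continuous_on \<Omega> X" and Y: "continuous_on \<Omega> Y" and p: "has_partial \<Omega> i X Y"
  shows "weak_on_products \<Omega> (mi_unit i) (\<lambda>x. indicator \<Omega> x * X x) (\<lambda>x. indicator \<Omega> x * Y x)"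
  unfolding weak_on_products_def
proof (intro allI impI)
  fix F :: "'n \<Rightarrow> real \<Rightarrow> real" and a b :: "real ^ 'n"
  assume F: "\<forall>i. smooth_real (F i)" "\<forall>i t. t \<notin> {a $ i..b $ i} \<longrightarrow> F i t = 0" and ab: "cbox a b \<subseteq> \<Omega>"
  have Ob: "\<Omega> \<in> sets borel" using O by simp
  have \<psi>: "prodf F \<in> test_fun \<Omega>" using F ab by (intro prodf_test_fun) auto
  have d: "prodf (\<lambda>l. (deriv ^^ mi_unit i l) (F l)) = dir_deriv (axis i 1) (prodf F)"
    using F mi_deriv_prodf[of F "mi_unit i"] by (simp add: mi_deriv_unit)
  have to: "(\<integral>x. f x * g x \<partial>lebesgue_on \<Omega>) = (\<integral>x. indicator \<Omega> x * f x * g x \<partial>lborel)"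
    if f: "continuous_on \<Omega> f" and g: "g \<in> test_fun \<Omega>" for f g
  proof (rule lebesgue_on_lborel(2)[OF _ O])
    note c = continuous_on_mult[OF f test_fun_properties(2)[OF g]]
    show "(\<lambda>x. f x * g x) \<in> borel_measurable (lebesgue_on \<Omega>)"
      using c O by (intro continuous_imp_measurable_on_sets_lebesgue) auto
    show "(\<lambda>x. indicator \<Omega> x * f x * g x) \<in> borel_measurable borel"
      using borel_measurable_continuous_on_indicator[OF Ob c] by (simp add: mult.assoc)
  qed (auto intro!: AE_I2 simp: space_restrict_space)
  show "(\<integral>x. indicator \<Omega> x * X x * prodf (\<lambda>l. (deriv ^^ mi_unit i l) (F l)) x \<partial>lborel)
      = (- 1) ^ mi_order (mi_unit i) * (\<integral>x. indicator \<Omega> x * Y x * prodf F x \<partial>lborel)"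
    unfolding d to[OF X test_fun_dir_deriv[OF \<psi>, of "axis i 1"], symmetric] to[OF Y \<psi>, symmetric] mi_order_unit
    using integral_by_parts[OF O X Y p \<psi>] to[OF X test_fun_dir_deriv[OF \<psi>, of "axis i 1"]]
    by (simp add: axis_in_Basis_iff)
qed

text \<open>Testing the weak derivative with \<open>bump n\<close> integrated along a segment compares the increment of
  \<open>f\<close> along the segment with the average of \<open>g\<close>.\<close>

lemma weak_increment:
  fixes \<Omega> :: "(real ^ 'n) set" and t :: real
  assumes O: "open \<Omega>" and f: "continuous_on \<Omega> f" and g: "continuous_on \<Omega> g"
    and w: "weak_on_products \<Omega> (mi_unit i) (\<lambda>x. indicator \<Omega> x * f x) (\<lambda>x. indicator \<Omega> x * g x)"
    and B: "ball x r \<subseteq> \<Omega>" "\<And>z. z \<in> ball x r \<Longrightarrow> \<bar>g z - G\<bar> \<le> e" and e: "0 \<le> e"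
    and t: "0 < t" and y: "dist x y + CARD('n) * t < r"
  shows "\<bar>f (y + t *\<^sub>R axis i 1) - f y - G * t\<bar> \<le> e * t"
proof -
  define E :: "real ^ 'n" where "E = axis i 1"
  have yO: "y \<in> \<Omega>" "y + t *\<^sub>R E \<in> \<Omega>"
  proof -
    have "t \<le> CARD('n) * t" using t by (simp add: Suc_leI)
    then have "dist x y + t < r" using y by simp
    moreover have "dist x (y + t *\<^sub>R E) \<le> dist x y + t"
      using dist_triangle[of x "y + t *\<^sub>R E" y] t by (simp add: E_def dist_norm)
    ultimately show "y \<in> \<Omega>" "y + t *\<^sub>R E \<in> \<Omega>" using B(1) t by (auto simp: subset_iff)
  qed
  \<comment> \<open>The coordinate function has weak derivative 1. Comparing \<open>f\<close> with
    \<open>G * h\<close> avoids evaluating the mass of the test function \<open>P n\<close>, which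
    is \<open>- A h n\<close>.\<close>
  define h where "h z = z $ i" for z :: "real ^ 'n"
  have hc: "continuous_on \<Omega> h" unfolding h_def by (intro continuous_intros)
  have wh: "weak_on_products \<Omega> (mi_unit i) (\<lambda>x. indicator \<Omega> x * h x) (\<lambda>x. indicator \<Omega> x * 1)"
  proof (rule weak_on_products_classical[OF O hc])
    show "has_partial \<Omega> i h (\<lambda>x. 1)"
      unfolding has_partial_def h_def by (auto simp: axis_def intro!: derivative_eq_intros)
  qed simp
  define a where "a n = (1 / 2 :: real) ^ n" for n :: nat
  have a: "0 < a n" for n by (simp add: a_def)
  \<comment> \<open>In direction \<open>i\<close> a difference of two smooth steps, whose derivative
    is the difference of the one-dimensional bumps at \<open>y\<close> and at
    \<open>y + t E\<close>; in the other directions the bump itself. The product is the bump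
    integrated along the segment.\<close>
  define F where "F n l = (if l = i then (\<lambda>s. 1 * smooth_step ((1 / a n) * s + (- y $ i / a n)) - 1 * smooth_step ((1 / a n) * s + (- (y $ i + t) / a n)))
      else (\<lambda>s. (1 / a n) * avg_ker 0 ((1 / a n) * s + (- y $ l / a n))))" for n l
  have arg: "(1 / a n) * s + (- c / a n) = (s - c) / a n" for n s c by (simp add: diff_divide_distrib)
  have Fs: "smooth_real (F n l)" for n l
  proof (cases "l = i")
    case True
    show ?thesis unfolding F_def if_P[OF True]
      by (intro smooth_real_diff smooth_real_mult smooth_real_const smooth_real_affine smooth_smooth_step)
  next
    case False
    show ?thesis unfolding F_def if_not_P[OF False]
      by (intro smooth_real_mult smooth_real_const smooth_real_affine smooth_avg_ker)
  qed
  define lo where "lo = y"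
  define hi where "hi n = (\<chi> l. y $ l + a n + t)" for n
  have F0: "F n l s = 0" if s: "s \<notin> {lo $ l..hi n $ l}" for n l s
  proof -
    have s': "s < y $ l \<or> y $ l + a n + t < s" using s by (auto simp: lo_def hi_def)
    show ?thesis
    proof (cases "l = i")
      case True
      from s' show ?thesis
      proof
        assume "s < y $ l"
        then have "(s - y $ i) / a n \<le> 1/2" "(s - (y $ i + t)) / a n \<le> 1/2"
          using True a[of n] t by (auto simp: field_simps)
        then show ?thesis unfolding F_def arg using True by (simp add: smooth_step_0)
      next
        assume "y $ l + a n + t < s"
        then have "(s - y $ i) / a n \<ge> 1" "(s - (y $ i + t)) / a n \<ge> 1"
          using True a[of n] t by (auto simp: field_simps)
        then show ?thesis unfolding F_def arg using True by (simp add: smooth_step_1)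
      qed
    next
      case False
      have "(s - y $ l) / a n \<notin> {1/2..1}" using s' a[of n] t by (auto simp: field_simps)
      from avg_ker_support[OF this] show ?thesis unfolding F_def arg using False by simp
    qed
  qed
  have Fnn: "0 \<le> F n l s" for n l s
  proof (cases "l = i")
    case True
    have "smooth_step ((s - (y $ i + t)) / a n) \<le> smooth_step ((s - y $ i) / a n)"
      using a[of n] t by (intro monoD[OF mono_smooth_step] divide_right_mono) auto
    then show ?thesis unfolding F_def arg using True by simp
  next
    case False
    then show ?thesis using a[of n] avg_ker_0_nonneg by (auto simp: F_def intro!: mult_nonneg_nonneg divide_nonneg_nonneg)
  qed
  define P where "P n = prodf (F n)" for n
  have Pnn: "0 \<le> P n z" for n z unfolding P_def prodf_def by (intro prod_nonneg) (auto intro: Fnn)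
  have Pm: "P n \<in> borel_measurable borel" for n
    unfolding P_def by (intro borel_measurable_continuous_onI prodf_continuous Fs)
  have dF: "deriv (F n i) s = avg_ker 0 ((s - y $ i) / a n) / a n - avg_ker 0 ((s - (y $ i + t)) / a n) / a n" for n s
  proof -
    have "(deriv ^^ 1) (F n i) = (\<lambda>s. 1 * (1 / a n) ^ 1 * (deriv ^^ 1) smooth_step ((1 / a n) * s + (- y $ i / a n))
        - 1 * (1 / a n) ^ 1 * (deriv ^^ 1) smooth_step ((1 / a n) * s + (- (y $ i + t) / a n)))"
      unfolding F_def if_P[OF refl]
      by (subst iterated_deriv_diff)
        (intro smooth_real_mult smooth_real_const smooth_real_affine smooth_smooth_step,
         intro smooth_real_mult smooth_real_const smooth_real_affine smooth_smooth_step,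
         simp only: iterated_deriv_affine[OF smooth_smooth_step])
    then have "deriv (F n i) s = (1 / a n) * avg_ker 0 ((s - y $ i) / a n) - (1 / a n) * avg_ker 0 ((s - (y $ i + t)) / a n)"
      unfolding arg by (simp add: deriv_smooth_step)
    then show ?thesis by simp
  qed
  have dP: "prodf (\<lambda>l. (deriv ^^ mi_unit i l) (F n l)) z = bump n (z - y) - bump n (z - (y + t *\<^sub>R E))" for n z
  proof -
    let ?R = "\<Prod>l\<in>UNIV - {i}. avg_ker 0 ((z $ l - y $ l) / a n) / a n"
    have 1: "prodf (\<lambda>l. (deriv ^^ mi_unit i l) (F n l)) z = deriv (F n i) (z $ i) * ?R"
    proof -
      have "(\<Prod>l\<in>UNIV - {i}. (deriv ^^ mi_unit i l) (F n l) (z $ l)) = ?R"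
        by (intro prod.cong refl) (auto simp: mi_unit_def F_def diff_divide_distrib)
      then show ?thesis unfolding prodf_def by (subst prod.remove[of UNIV i]) (auto simp: mi_unit_def)
    qed
    have 2: "bump n (z - y) = avg_ker 0 ((z $ i - y $ i) / a n) / a n * ?R"
      unfolding bump_def kern_def by (subst prod.remove[of UNIV i]) (auto simp: a_def)
    have 3: "bump n (z - (y + t *\<^sub>R E)) = avg_ker 0 ((z $ i - (y $ i + t)) / a n) / a n * ?R"
      unfolding bump_def kern_def
      by (subst prod.remove[of UNIV i]) (auto simp: a_def E_def axis_def intro!: prod.cong)
    show ?thesis unfolding 1 2 3 dF by (simp add: left_diff_distrib)
  qed
  let ?I = "indicator \<Omega> :: real ^ 'n \<Rightarrow> real"
  define A where "A \<phi> n = (\<integral>z. ?I z * \<phi> z * (bump n (z - y) - bump n (z - (y + t *\<^sub>R E))) \<partial>lborel)" for \<phi> n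
  have Alim: "A \<phi> \<longlonglongrightarrow> \<phi> y - \<phi> (y + t *\<^sub>R E)" if c: "continuous_on \<Omega> \<phi>" for \<phi>
  proof -
    note l1 = bump_limit[OF O c yO(1)] and l2 = bump_limit[OF O c yO(2)]
    have "\<forall>\<^sub>F n in sequentially. (\<integral>z. ?I z * \<phi> z * bump n (z - y) \<partial>lborel) - (\<integral>z. ?I z * \<phi> z * bump n (z - (y + t *\<^sub>R E)) \<partial>lborel) = A \<phi> n"
      using l1(1) l2(1) by eventually_elim (simp add: A_def right_diff_distrib)
    from Lim_transform_eventually[OF tendsto_diff[OF l1(2) l2(2)] this] show ?thesis .
  qed
  have box: "cbox lo (hi n) \<subseteq> ball x r" if n: "dist x y + CARD('n) * (a n + t) < r" for n
  proof
    fix z assume "z \<in> cbox lo (hi n)"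
    then have yz: "y $ l \<le> z $ l \<and> z $ l \<le> y $ l + a n + t" for l by (auto simp: mem_box_cart lo_def hi_def)
    have "\<bar>(z - y) $ l\<bar> \<le> a n + t" for l using yz[of l] by simp
    then have "(\<Sum>l\<in>UNIV. \<bar>(z - y) $ l\<bar>) \<le> (\<Sum>l\<in>(UNIV :: 'n set). a n + t)" by (intro sum_mono)
    then have "norm (z - y) \<le> CARD('n) * (a n + t)" using norm_le_l1_cart[of "z - y"] by simp
    then show "z \<in> ball x r" using n dist_triangle[of x z y] by (simp add: dist_norm norm_minus_commute)
  qed
  have "(\<lambda>n. dist x y + CARD('n) * (a n + t)) \<longlonglongrightarrow> dist x y + CARD('n) * (0 + t)"
    unfolding a_def by (intro tendsto_intros LIMSEQ_realpow_zero) auto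
  then have "\<forall>\<^sub>F n in sequentially. dist x y + CARD('n) * (a n + t) < r"
    using y by (intro order_tendstoD(2)) auto
  \<comment> \<open>After passing to the weak derivatives, the left side is the absolute integral of
    \<open>(G - g) P n\<close> over a box in \<open>ball x r\<close>, where
    \<open>\<bar>g - G\<bar> \<le> e\<close> and \<open>P n \<ge> 0\<close>.\<close>
  then have ev: "\<forall>\<^sub>F n in sequentially. \<bar>A f n - G * A h n\<bar> \<le> e * (- A h n)"
  proof eventually_elim
    case (elim n)
    note bx = box[OF elim]
    then have bO: "cbox lo (hi n) \<subseteq> \<Omega>" using B(1) by blast
    have P0: "P n z = 0" if z: "z \<notin> cbox lo (hi n)" for z
    proof -
      have "\<exists>l. z $ l \<notin> {lo $ l..hi n $ l}" using z by (auto simp: mem_box_cart)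
      then show ?thesis unfolding P_def prodf_def using F0 by (intro prod_zero) auto
    qed
    have weak: "A u n = - (\<integral>z. ?I z * v z * P n z \<partial>lborel)"
      if "weak_on_products \<Omega> (mi_unit i) (\<lambda>x. ?I x * u x) (\<lambda>x. ?I x * v x)" for u v
    proof -
      have "(\<integral>z. ?I z * u z * prodf (\<lambda>l. (deriv ^^ mi_unit i l) (F n l)) z \<partial>lborel)
          = (- 1) ^ mi_order (mi_unit i) * (\<integral>z. ?I z * v z * prodf (F n) z \<partial>lborel)"
        using that Fs F0 bO unfolding weak_on_products_def by blast
      then show ?thesis unfolding A_def dP P_def by (simp add: mi_order_unit)
    qed
    have Pi: "integrable lborel (\<lambda>z. ?I z * v z * P n z)" if v: "continuous_on \<Omega> v" for v
    proof -
      have "integrable lborel (\<lambda>z. indicator (cbox lo (hi n)) z *\<^sub>R (v z * P n z))"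
        unfolding P_def
        by (intro borel_integrable_compact continuous_on_mult continuous_on_subset[OF v bO] prodf_continuous Fs) auto
      also have "(\<lambda>z. indicator (cbox lo (hi n)) z *\<^sub>R (v z * P n z)) = (\<lambda>z. ?I z * v z * P n z)"
      proof
        fix z show "indicator (cbox lo (hi n)) z *\<^sub>R (v z * P n z) = ?I z * v z * P n z"
          using P0[of z] bO by (cases "z \<in> cbox lo (hi n)") (auto simp: subset_iff)
      qed
      finally show ?thesis .
    qed
    have i1: "integrable lborel (\<lambda>z. ?I z * 1 * P n z)" by (rule Pi) simp
    note ig = Pi[OF g]
    have "A f n - G * A h n = (\<integral>z. G * (?I z * 1 * P n z) - ?I z * g z * P n z \<partial>lborel)"
      unfolding weak[OF w] weak[OF wh] using i1 ig by simp
    also have "\<bar>\<dots>\<bar> \<le> (\<integral>z. \<bar>G * (?I z * 1 * P n z) - ?I z * g z * P n z\<bar> \<partial>lborel)" by (rule integral_abs_bound)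
    also have "\<dots> \<le> (\<integral>z. e * (?I z * 1 * P n z) \<partial>lborel)"
    proof (rule Bochner_Integration.integral_mono)
      fix z
      show "\<bar>G * (?I z * 1 * P n z) - ?I z * g z * P n z\<bar> \<le> e * (?I z * 1 * P n z)"
      proof (cases "z \<in> cbox lo (hi n)")
        case True
        then have z: "z \<in> \<Omega>" "\<bar>g z - G\<bar> \<le> e" using bx B by auto
        have "G * (?I z * 1 * P n z) - ?I z * g z * P n z = (G - g z) * P n z" using z by (simp add: left_diff_distrib)
        then show ?thesis using z Pnn[of n z] by (auto simp: abs_mult abs_minus_commute intro!: mult_right_mono)
      next
        case False
        then show ?thesis using P0 by simp
      qed
    qed (use i1 ig in auto)
    also have "\<dots> = e * (- A h n)" unfolding weak[OF wh] using i1 by simp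
    finally show ?case .
  qed
  have "(\<lambda>n. \<bar>A f n - G * A h n\<bar>) \<longlonglongrightarrow> \<bar>(f y - f (y + t *\<^sub>R E)) - G * (h y - h (y + t *\<^sub>R E))\<bar>"
    by (intro tendsto_intros Alim f hc)
  moreover have "(\<lambda>n. e * (- A h n)) \<longlonglongrightarrow> e * (- (h y - h (y + t *\<^sub>R E)))"
    by (intro tendsto_intros Alim hc)
  ultimately have "\<bar>(f y - f (y + t *\<^sub>R E)) - G * (h y - h (y + t *\<^sub>R E))\<bar> \<le> e * (- (h y - h (y + t *\<^sub>R E)))"
    using ev by (intro tendsto_le[OF sequentially_bot])
  moreover have ht: "h y - h (y + t *\<^sub>R E) = - t" by (simp add: h_def E_def axis_def)
  ultimately have "\<bar>f y - f (y + t *\<^sub>R E) + G * t\<bar> \<le> e * t" unfolding ht by simp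
  then show ?thesis by (simp add: E_def)
qed

lemma has_partial_if_weak:
  fixes \<Omega> :: "(real ^ 'n) set"
  assumes O: "open \<Omega>" and f: "continuous_on \<Omega> f" and g: "continuous_on \<Omega> g"
    and w: "weak_on_products \<Omega> (mi_unit i) (\<lambda>x. indicator \<Omega> x * f x) (\<lambda>x. indicator \<Omega> x * g x)"
  shows "has_partial \<Omega> i f g"
  unfolding has_partial_def
proof
  fix x assume x: "x \<in> \<Omega>"
  let ?E = "axis i 1 :: real ^ 'n"
  show "((\<lambda>t. f (x + t *\<^sub>R ?E)) has_real_derivative g x) (at 0)"
    unfolding DERIV_def
  proof (rule LIM_I)
    fix e :: real assume e: "e > 0"
    obtain r1 where r1: "r1 > 0" "ball x r1 \<subseteq> \<Omega>" using O x openE by blast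
    obtain r2 where r2: "r2 > 0" "\<And>z. z \<in> \<Omega> \<Longrightarrow> dist z x < r2 \<Longrightarrow> dist (g z) (g x) < e / 2"
      using g x e unfolding continuous_on_iff by (metis half_gt_zero)
    define r where "r = min r1 r2"
    have r: "r > 0" "ball x r \<subseteq> \<Omega>" "\<And>z. z \<in> ball x r \<Longrightarrow> \<bar>g z - g x\<bar> \<le> e / 2"
      using r1 r2 by (auto simp: r_def dist_commute dist_real_def subset_iff intro!: less_imp_le)
    define d where "d = real CARD('n)"
    have d: "d \<ge> 1" by (simp add: d_def Suc_leI)
    have "norm ((f (x + (0 + t) *\<^sub>R ?E) - f (x + 0 *\<^sub>R ?E)) / t - g x) < e" if t: "t \<noteq> 0" "norm (t - 0) < r / (1 + d)" for t
    proof -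
      \<comment> \<open>Covers both signs of \<open>t\<close>: the base point is at distance at most
        \<open>\<bar>t\<bar>\<close> from \<open>x\<close>, and \<open>weak_increment\<close> needs
        room for another \<open>d * \<bar>t\<bar>\<close>.\<close>
      have tr: "\<bar>t\<bar> + d * \<bar>t\<bar> < r" using t(2) d by (simp add: field_simps)
      have "\<bar>f (x + t *\<^sub>R ?E) - f x - g x * t\<bar> \<le> e / 2 * \<bar>t\<bar>"
      proof (cases "t > 0")
        case True
        then show ?thesis
          using weak_increment[OF O f g w r(2,3), of t x] e tr by (simp add: d_def)
      next
        \<comment> \<open>For negative \<open>t\<close> the increment is taken from
          \<open>x + t E\<close> back to \<open>x\<close>.\<close>
        case False
        then have "t < 0" using t by simp
        then show ?thesis
          using weak_increment[OF O f g w r(2,3), of "- t" "x + t *\<^sub>R ?E"] e tr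
          by (simp add: d_def dist_norm abs_minus_commute algebra_simps)
      qed
      then have "\<bar>f (x + t *\<^sub>R ?E) - f x - g x * t\<bar> / \<bar>t\<bar> \<le> e / 2" using t(1) by (simp add: divide_le_eq)
      moreover have "(f (x + t *\<^sub>R ?E) - f x) / t - g x = (f (x + t *\<^sub>R ?E) - f x - g x * t) / t"
        using t(1) by (simp add: field_simps)
      ultimately have "norm ((f (x + t *\<^sub>R ?E) - f x) / t - g x) \<le> e / 2" by (simp only: real_norm_def abs_divide)
      then show ?thesis using e by simp
    qed
    then show "\<exists>s>0. \<forall>t. t \<noteq> 0 \<and> norm (t - 0) < s \<longrightarrow>
        norm ((f (x + (0 + t) *\<^sub>R ?E) - f (x + 0 *\<^sub>R ?E)) / t - g x) < e"
      using r(1) d by (intro exI[of _ "r / (1 + d)"]) auto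
  qed
qed

section \<open>The Hilbert space structure\<close>

lemma dir_deriv_linear:
  fixes f g :: "'a::real_normed_vector \<Rightarrow> real"
  assumes "f differentiable (at x)" "g differentiable (at x)"
  shows "dir_deriv b (\<lambda>x. c * f x + d * g x) x = c * dir_deriv b f x + d * dir_deriv b g x"
proof -
  have "((\<lambda>t. c * f (x + t *\<^sub>R b) + d * g (x + t *\<^sub>R b)) has_real_derivative c * dir_deriv b f x + d * dir_deriv b g x) (at 0)"
    by (intro DERIV_add DERIV_cmult DERIV_line assms)
  then show ?thesis unfolding dir_deriv_def[of b "\<lambda>x. c * f x + d * g x"] by (rule DERIV_imp_deriv)
qed

lemma dir_derivs_linear:
  fixes f g :: "'a::euclidean_space \<Rightarrow> real"
  assumes "smooth_on UNIV f" "smooth_on UNIV g" "set bs \<subseteq> Basis"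
  shows "dir_derivs bs (\<lambda>x. c * f x + d * g x) = (\<lambda>x. c * dir_derivs bs f x + d * dir_derivs bs g x)"
  using assms(3)
proof (induction bs)
  case (Cons b bs)
  then have IH: "dir_derivs bs (\<lambda>x. c * f x + d * g x) = (\<lambda>x. c * dir_derivs bs f x + d * dir_derivs bs g x)" by simp
  have "dir_derivs bs f differentiable (at x)" "dir_derivs bs g differentiable (at x)" for x
    using Cons.prems assms smooth_on_differentiable[of UNIV _ bs x] by auto
  from dir_deriv_linear[OF this]
  have "dir_deriv b (\<lambda>x. c * dir_derivs bs f x + d * dir_derivs bs g x) = (\<lambda>x. c * dir_deriv b (dir_derivs bs f) x + d * dir_deriv b (dir_derivs bs g) x)"
    by (rule ext)
  then show ?case using IH by (simp add: dir_derivs_def)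
qed (simp add: dir_derivs_def)

lemma test_fun_linear:
  fixes \<Omega> :: "(real ^ 'n) set"
  assumes "\<phi> \<in> test_fun \<Omega>" "\<psi> \<in> test_fun \<Omega>"
  shows "(\<lambda>x. c * \<phi> x + d * \<psi> x) \<in> test_fun \<Omega>"
proof -
  obtain K L where s: "smooth_on UNIV \<phi>" "smooth_on UNIV \<psi>" and KL: "compact K" "K \<subseteq> \<Omega>" "\<And>x. x \<notin> K \<Longrightarrow> \<phi> x = 0"
    "compact L" "L \<subseteq> \<Omega>" "\<And>x. x \<notin> L \<Longrightarrow> \<psi> x = 0"
    using assms unfolding test_fun_def by blast
  have "smooth_on UNIV (\<lambda>x. c * \<phi> x + d * \<psi> x)"
    unfolding smooth_on_def
  proof (intro allI impI)
    fix bs :: "(real ^ 'n) list" assume bs: "set bs \<subseteq> Basis"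
    then show "dir_derivs bs (\<lambda>x. c * \<phi> x + d * \<psi> x) differentiable_on UNIV"
      unfolding dir_derivs_linear[OF s bs]
      using s by (intro differentiable_on_add differentiable_on_mult differentiable_on_const) (auto simp: smooth_on_def)
  qed
  moreover have "\<exists>K. compact K \<and> K \<subseteq> \<Omega> \<and> (\<forall>x. x \<notin> K \<longrightarrow> c * \<phi> x + d * \<psi> x = 0)"
    using KL by (intro exI[of _ "K \<union> L"]) auto
  ultimately show ?thesis by (simp add: test_fun_def)
qed

lemma test_fun_zero: "(\<lambda>x. 0) \<in> test_fun (\<Omega> :: (real ^ 'n) set)"
proof -
  have d: "dir_derivs bs (\<lambda>x. 0) = (\<lambda>x::real ^ 'n. 0)" for bs
    by (induction bs) (auto simp: dir_derivs_def dir_deriv_def fun_eq_iff)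
  have "smooth_on UNIV (\<lambda>x::real ^ 'n. 0)" unfolding smooth_on_def d by simp
  then show ?thesis by (auto simp: test_fun_def intro!: exI[of _ "{}"])
qed

context bounded_open
begin

lemma zero_sobolev: "(\<lambda>x. 0) \<in> sobolev s \<Omega>"
  by (rule bounded_smooth_sobolev[OF bounded_smooth_test[OF test_fun_zero]])

lemma test_sobolev: "\<psi> \<in> test_fun \<Omega> \<Longrightarrow> \<psi> \<in> sobolev s \<Omega>"
  by (rule bounded_smooth_sobolev[OF bounded_smooth_test])

lemma sobolev_norm_L2_set: "sobolev_norm s \<Omega> u = L2_set (\<lambda>\<alpha>. l2norm \<mu> (wd \<alpha> u)) {\<alpha>. mi_order \<alpha> \<le> s}"
  by (simp add: sobolev_norm_l2 L2_set_def)

lemma l2norm_weak_deriv_add: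
  assumes "u \<in> sobolev s \<Omega>" "v \<in> sobolev s \<Omega>" "mi_order \<alpha> \<le> s"
  shows "l2norm \<mu> (wd \<alpha> (\<lambda>x. u x + v x)) \<le> l2norm \<mu> (wd \<alpha> u) + l2norm \<mu> (wd \<alpha> v)"
proof -
  note U = sobolevD(3)[OF assms(1,3)] and V = sobolevD(3)[OF assms(2,3)]
  have "l2norm \<mu> (wd \<alpha> (\<lambda>x. u x + v x)) = l2norm \<mu> (\<lambda>x. wd \<alpha> u x + wd \<alpha> v x)"
    by (rule l2norm_cong_AE[OF sq_int_measurable[OF sobolevD(3)[OF sobolev_add[OF assms(1,2)] assms(3)]]
      sq_int_measurable[OF sq_int_add[OF U V]] weak_deriv_add[OF assms]])
  then show ?thesis using l2norm_triangle[OF U V] by simp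
qed

lemma l2norm_weak_deriv_cmult:
  assumes "u \<in> sobolev s \<Omega>" "mi_order \<alpha> \<le> s"
  shows "l2norm \<mu> (wd \<alpha> (\<lambda>x. c * u x)) = \<bar>c\<bar> * l2norm \<mu> (wd \<alpha> u)"
proof -
  have "l2norm \<mu> (wd \<alpha> (\<lambda>x. c * u x)) = l2norm \<mu> (\<lambda>x. c * wd \<alpha> u x)"
    by (rule l2norm_cong_AE[OF sq_int_measurable[OF sobolevD(3)[OF sobolev_cmult[OF assms(1)] assms(2)]]
      sq_int_measurable[OF sq_int_cmult[OF sobolevD(3)[OF assms]]] weak_deriv_cmult[OF assms]])
  then show ?thesis by (simp add: l2norm_cmult)
qed

lemma l2norm_weak_deriv_diff:
  assumes "u \<in> sobolev s \<Omega>" "v \<in> sobolev s \<Omega>" "mi_order \<alpha> \<le> s"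
  shows "l2norm \<mu> (wd \<alpha> (\<lambda>x. u x - v x)) = l2norm \<mu> (\<lambda>x. wd \<alpha> u x - wd \<alpha> v x)"
  by (rule l2norm_cong_AE[OF sq_int_measurable[OF sobolevD(3)[OF sobolev_diff[OF assms(1,2)] assms(3)]]
      sq_int_measurable[OF sq_int_diff[OF sobolevD(3)[OF assms(1,3)] sobolevD(3)[OF assms(2,3)]]] weak_deriv_diff[OF assms]])

lemma sobolev_norm_add:
  assumes "u \<in> sobolev s \<Omega>" "v \<in> sobolev s \<Omega>"
  shows "sobolev_norm s \<Omega> (\<lambda>x. u x + v x) \<le> sobolev_norm s \<Omega> u + sobolev_norm s \<Omega> v"
proof -
  have "sobolev_norm s \<Omega> (\<lambda>x. u x + v x) \<le> L2_set (\<lambda>\<alpha>. l2norm \<mu> (wd \<alpha> u) + l2norm \<mu> (wd \<alpha> v)) {\<alpha>. mi_order \<alpha> \<le> s}"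
    unfolding sobolev_norm_L2_set
    using l2norm_weak_deriv_add[OF assms] by (intro L2_set_mono) (auto simp: l2norm_nonneg)
  also have "\<dots> \<le> sobolev_norm s \<Omega> u + sobolev_norm s \<Omega> v"
    unfolding sobolev_norm_L2_set by (rule L2_set_triangle_ineq)
  finally show ?thesis .
qed

lemma sobolev_norm_cmult:
  assumes "u \<in> sobolev s \<Omega>"
  shows "sobolev_norm s \<Omega> (\<lambda>x. c * u x) = \<bar>c\<bar> * sobolev_norm s \<Omega> u"
proof -
  have "(\<Sum>\<alpha> | mi_order \<alpha> \<le> s. (l2norm \<mu> (wd \<alpha> (\<lambda>x. c * u x)))\<^sup>2) = (\<Sum>\<alpha> | mi_order \<alpha> \<le> s. c\<^sup>2 * (l2norm \<mu> (wd \<alpha> u))\<^sup>2)"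
    using l2norm_weak_deriv_cmult[OF assms] by (intro sum.cong) (auto simp: power_mult_distrib)
  then show ?thesis by (simp add: sobolev_norm_l2 sum_distrib_left[symmetric] real_sqrt_mult)
qed

lemma l2norm_le_sobolev_norm:
  assumes "mi_order \<alpha> \<le> s"
  shows "l2norm \<mu> (wd \<alpha> u) \<le> sobolev_norm s \<Omega> u"
  unfolding sobolev_norm_L2_set
  by (rule member_le_L2_set) (use assms in \<open>auto simp: finite_mi_order_le\<close>)

lemma sobolev0D: "u \<in> sobolev0 s \<Omega> \<Longrightarrow> u \<in> sobolev s \<Omega>"
  by (simp add: sobolev0_def)

lemma sobolev0_approx:
  assumes "u \<in> sobolev0 s \<Omega>" "e > 0"
  obtains \<psi> where "\<psi> \<in> test_fun \<Omega>" "sobolev_norm s \<Omega> (\<lambda>x. u x - \<psi> x) < e"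
  using assms by (auto simp: sobolev0_def)

lemma sobolev0_add:
  assumes u: "u \<in> sobolev0 s \<Omega>" and v: "v \<in> sobolev0 s \<Omega>"
  shows "(\<lambda>x. u x + v x) \<in> sobolev0 s \<Omega>"
  unfolding sobolev0_def
proof (intro CollectI conjI allI impI)
  show "(\<lambda>x. u x + v x) \<in> sobolev s \<Omega>" by (intro sobolev_add sobolev0D u v)
  fix e :: real assume e: "e > 0"
  obtain \<phi> where \<phi>: "\<phi> \<in> test_fun \<Omega>" "sobolev_norm s \<Omega> (\<lambda>x. u x - \<phi> x) < e / 2"
    using sobolev0_approx[OF u, of "e / 2"] e by auto
  obtain \<psi> where \<psi>: "\<psi> \<in> test_fun \<Omega>" "sobolev_norm s \<Omega> (\<lambda>x. v x - \<psi> x) < e / 2"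
    using sobolev0_approx[OF v, of "e / 2"] e by auto
  have "sobolev_norm s \<Omega> (\<lambda>x. (u x - \<phi> x) + (v x - \<psi> x)) < e"
    using sobolev_norm_add[OF sobolev_diff[OF sobolev0D[OF u] test_sobolev[OF \<phi>(1)]] sobolev_diff[OF sobolev0D[OF v] test_sobolev[OF \<psi>(1)]]]
      \<phi>(2) \<psi>(2) by simp
  moreover have "(\<lambda>x. \<phi> x + \<psi> x) \<in> test_fun \<Omega>" using test_fun_linear[OF \<phi>(1) \<psi>(1), of 1 1] by simp
  ultimately show "\<exists>\<psi>\<in>test_fun \<Omega>. sobolev_norm s \<Omega> (\<lambda>x. u x + v x - \<psi> x) < e"
    by (intro bexI[of _ "\<lambda>x. \<phi> x + \<psi> x"]) (simp_all add: algebra_simps)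
qed

lemma zero_sobolev0: "(\<lambda>x. 0) \<in> sobolev0 s \<Omega>"
proof -
  have "sobolev_norm s \<Omega> (\<lambda>x. 0 * (\<lambda>x. 0) x) = \<bar>0\<bar> * sobolev_norm s \<Omega> (\<lambda>x. 0)"
    by (rule sobolev_norm_cmult[OF zero_sobolev])
  then have "sobolev_norm s \<Omega> (\<lambda>x. 0) = 0" by simp
  then show ?thesis
    by (auto simp: sobolev0_def zero_sobolev intro!: bexI[of _ "\<lambda>x. 0"] test_fun_zero)
qed

lemma sobolev0_cmult:
  assumes u: "u \<in> sobolev0 s \<Omega>"
  shows "(\<lambda>x. c * u x) \<in> sobolev0 s \<Omega>"
proof (cases "c = 0")
  case True
  then show ?thesis using zero_sobolev0 by simp
next
  case False
  show ?thesis
    unfolding sobolev0_def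
  proof (intro CollectI conjI allI impI)
    show "(\<lambda>x. c * u x) \<in> sobolev s \<Omega>" by (intro sobolev_cmult sobolev0D u)
    fix e :: real assume e: "e > 0"
    obtain \<phi> where \<phi>: "\<phi> \<in> test_fun \<Omega>" "sobolev_norm s \<Omega> (\<lambda>x. u x - \<phi> x) < e / \<bar>c\<bar>"
      using sobolev0_approx[OF u, of "e / \<bar>c\<bar>"] e False by auto
    have "sobolev_norm s \<Omega> (\<lambda>x. c * (u x - \<phi> x)) < e"
      using sobolev_norm_cmult[OF sobolev_diff[OF sobolev0D[OF u] test_sobolev[OF \<phi>(1)]], of c] \<phi>(2) False
      by (simp add: field_simps)
    moreover have "(\<lambda>x. c * \<phi> x) \<in> test_fun \<Omega>" using test_fun_linear[OF \<phi>(1) \<phi>(1), of c 0] by simp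
    ultimately show "\<exists>\<psi>\<in>test_fun \<Omega>. sobolev_norm s \<Omega> (\<lambda>x. c * u x - \<psi> x) < e"
      by (intro bexI[of _ "\<lambda>x. c * \<phi> x"]) (simp_all add: algebra_simps)
  qed
qed

lemma sobolev0_diff:
  "u \<in> sobolev0 s \<Omega> \<Longrightarrow> v \<in> sobolev0 s \<Omega> \<Longrightarrow> (\<lambda>x. u x - v x) \<in> sobolev0 s \<Omega>"
  using sobolev0_add[of u s "\<lambda>x. (-1) * v x"] sobolev0_cmult[of v s "-1"] by simp

lemma weak_deriv_zero_index:
  assumes "sq_int \<mu> u"
  shows "has_weak_deriv \<Omega> (\<lambda>_. 0) u u"
proof (rule has_weak_derivI[OF assms assms])
  fix \<psi> assume "\<psi> \<in> test_fun \<Omega>"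
  have o0: "mi_order (\<lambda>_. 0 :: nat) = 0" by (simp add: mi_order_def)
  have "length (mi_list (\<lambda>_. 0) :: 'n list) = 0" unfolding length_mi_list o0 ..
  then have "mi_deriv (\<lambda>_. 0) \<psi> = \<psi>" by (simp add: mi_deriv_def dir_derivs_def)
  then show "(\<integral>x. u x * mi_deriv (\<lambda>_. 0) \<psi> x \<partial>\<mu>) = (- 1) ^ mi_order (\<lambda>_::'n. 0 :: nat) * (\<integral>x. u x * \<psi> x \<partial>\<mu>)"
    by (simp add: o0)
qed

text \<open>Both sides are continuous in \<open>v\<close> for the Sobolev norm, so the identity
  extends from test functions to their closure.\<close>

lemma weak_deriv_sobolev0:
  assumes XY: "sq_int \<mu> X" "sq_int \<mu> Y" "has_weak_deriv \<Omega> (mi_unit i) X Y"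
    and v: "v \<in> sobolev0 s \<Omega>" and s: "1 \<le> s"
  shows "(\<integral>x. Y x * v x \<partial>\<mu>) = - (\<integral>x. X x * wd (mi_unit i) v x \<partial>\<mu>)"
proof -
  have vs: "v \<in> sobolev s \<Omega>" by (rule sobolev0D[OF v])
  have o: "mi_order (mi_unit i) \<le> s" using s by (simp add: mi_order_unit)
  have "\<exists>\<psi>. \<psi> \<in> test_fun \<Omega> \<and> sobolev_norm s \<Omega> (\<lambda>x. v x - \<psi> x) < 1 / real (Suc n)" for n
    using sobolev0_approx[OF v, of "1 / real (Suc n)"] by auto
  then obtain \<psi> where \<psi>: "\<And>n. \<psi> n \<in> test_fun \<Omega>" "\<And>n. sobolev_norm s \<Omega> (\<lambda>x. v x - \<psi> n x) < 1 / real (Suc n)" by metis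
  have lim: "(\<lambda>n. l2norm \<mu> (\<lambda>x. wd \<alpha> (\<psi> n) x - wd \<alpha> v x)) \<longlonglongrightarrow> 0" if \<alpha>: "mi_order \<alpha> \<le> s" for \<alpha>
  proof (rule tendsto_sandwich[OF _ _ tendsto_const LIMSEQ_Suc[OF lim_1_over_n]])
    have "l2norm \<mu> (\<lambda>x. wd \<alpha> (\<psi> n) x - wd \<alpha> v x) \<le> 1 / real (Suc n)" for n
    proof -
      have "l2norm \<mu> (\<lambda>x. wd \<alpha> (\<psi> n) x - wd \<alpha> v x) = l2norm \<mu> (wd \<alpha> (\<lambda>x. v x - \<psi> n x))"
        using l2norm_weak_deriv_diff[OF vs test_sobolev[OF \<psi>(1)] \<alpha>] by (simp add: l2norm_minus_commute)
      also have "\<dots> \<le> sobolev_norm s \<Omega> (\<lambda>x. v x - \<psi> n x)" by (rule l2norm_le_sobolev_norm[OF \<alpha>])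
      finally show ?thesis using \<psi>(2)[of n] by simp
    qed
    then show "\<forall>\<^sub>F n in sequentially. l2norm \<mu> (\<lambda>x. wd \<alpha> (\<psi> n) x - wd \<alpha> v x) \<le> 1 / real (Suc n)" by simp
  qed (simp add: l2norm_nonneg)
  have o0: "mi_order (\<lambda>_::'n. 0 :: nat) \<le> s" by (simp add: mi_order_def)
  \<comment> \<open>\<open>sobolev_norm\<close> sees a function through its weak derivative of order
    zero, which agrees with the function only almost everywhere.\<close>
  have c0: "(\<integral>x. Z x * wd (\<lambda>_. 0) w x \<partial>\<mu>) = (\<integral>x. Z x * w x \<partial>\<mu>)" if "sq_int \<mu> Z" "w \<in> sobolev s \<Omega>" for Z w
  proof -
    have "AE x in \<mu>. wd (\<lambda>_. 0) w x = w x" by (rule weak_deriv_eq(2)[OF weak_deriv_zero_index[OF sobolevD(1)[OF that(2)]]])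
    then show ?thesis
      using sq_int_measurable[OF that(1)] sq_int_measurable[OF sobolevD(1)[OF that(2)]] sq_int_measurable[OF sobolevD(3)[OF that(2) o0]]
      by (intro integral_cong_AE borel_measurable_times) (auto elim: eventually_mono)
  qed
  have "(\<integral>x. Y x * \<psi> n x \<partial>\<mu>) = - (\<integral>x. X x * wd (mi_unit i) (\<psi> n) x \<partial>\<mu>)" for n
  proof -
    have sm: "smooth_on \<Omega> (\<psi> n)" using bounded_smooth_test[OF \<psi>(1)] by (simp add: bounded_smooth_def)
    have dt: "dir_deriv (axis i 1) (\<psi> n) \<in> test_fun \<Omega>" by (rule test_fun_dir_deriv[OF \<psi>(1)]) (simp add: axis_in_Basis_iff)
    obtain B where B: "\<And>x. \<bar>\<psi> n x\<bar> \<le> B" using test_fun_properties(3)[OF \<psi>(1)] by blast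
    obtain C where C: "\<And>x. \<bar>dir_deriv (axis i 1) (\<psi> n) x\<bar> \<le> C" using test_fun_properties(3)[OF dt] by blast
    have "has_weak_deriv \<Omega> (mi_unit i) (\<psi> n) (dir_deriv (axis i 1) (\<psi> n))"
      by (rule has_weak_deriv_classical[OF test_fun_properties(2)[OF \<psi>(1)] test_fun_properties(2)[OF dt] smooth_on_has_partial[OF sm open_dom]])
        (use B C in auto)
    from weak_deriv_eq(2)[OF this]
    have "(\<integral>x. X x * wd (mi_unit i) (\<psi> n) x \<partial>\<mu>) = (\<integral>x. X x * mi_deriv (mi_unit i) (\<psi> n) x \<partial>\<mu>)"
      unfolding mi_deriv_unit
      using sq_int_measurable[OF XY(1)] sq_int_measurable[OF sobolevD(3)[OF test_sobolev[OF \<psi>(1)[of n]] o]] sq_int_measurable[OF test_sq_int[OF dt]]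
      by (intro integral_cong_AE borel_measurable_times) (auto elim: eventually_mono)
    also have "\<dots> = - (\<integral>x. Y x * \<psi> n x \<partial>\<mu>)" using has_weak_derivD[OF XY(3) \<psi>(1)] by (simp add: mi_order_unit)
    finally show ?thesis by simp
  qed
  moreover have "(\<lambda>n. \<integral>x. Y x * \<psi> n x \<partial>\<mu>) \<longlonglongrightarrow> (\<integral>x. Y x * v x \<partial>\<mu>)"
  proof -
    have "(\<lambda>n. \<integral>x. wd (\<lambda>_. 0) (\<psi> n) x * Y x \<partial>\<mu>) \<longlonglongrightarrow> (\<integral>x. wd (\<lambda>_. 0) v x * Y x \<partial>\<mu>)"
      by (rule l2_limit_integral[OF sobolevD(3)[OF test_sobolev[OF \<psi>(1)] o0] sobolevD(3)[OF vs o0] XY(2) lim[OF o0]])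
    then show ?thesis using c0[OF XY(2) vs] c0[OF XY(2) test_sobolev[OF \<psi>(1)]] by (simp add: mult.commute)
  qed
  moreover have "(\<lambda>n. - (\<integral>x. X x * wd (mi_unit i) (\<psi> n) x \<partial>\<mu>)) \<longlonglongrightarrow> - (\<integral>x. X x * wd (mi_unit i) v x \<partial>\<mu>)"
  proof -
    have "(\<lambda>n. \<integral>x. wd (mi_unit i) (\<psi> n) x * X x \<partial>\<mu>) \<longlonglongrightarrow> (\<integral>x. wd (mi_unit i) v x * X x \<partial>\<mu>)"
      by (rule l2_limit_integral[OF sobolevD(3)[OF test_sobolev[OF \<psi>(1)] o] sobolevD(3)[OF vs o] XY(1) lim[OF o]])
    then show ?thesis by (intro tendsto_minus) (simp add: mult.commute)
  qed
  ultimately show ?thesis using LIMSEQ_unique by simp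
qed

end

lemma weak_on_products_cong_AE:
  assumes "weak_on_products \<Omega> \<alpha> u v" "u \<in> borel_measurable borel" "u' \<in> borel_measurable borel"
    "v \<in> borel_measurable borel" "v' \<in> borel_measurable borel"
    "AE x in lborel. u x = u' x" "AE x in lborel. v x = v' x"
  shows "weak_on_products \<Omega> \<alpha> u' v'"
  unfolding weak_on_products_def
proof (intro allI impI)
  fix F and a b :: "real ^ 'a"
  assume F: "\<forall>i. smooth_real (F i)" "\<forall>i t. t \<notin> {a $ i..b $ i} \<longrightarrow> F i t = 0" and ab: "cbox a b \<subseteq> \<Omega>"
  have m: "prodf G \<in> borel_measurable lborel" if "\<And>i. smooth_real (G i)" for G :: "'a \<Rightarrow> real \<Rightarrow> real"
    using borel_measurable_continuous_onI[OF prodf_continuous[of G UNIV]] that by simp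
  have m1: "prodf F \<in> borel_measurable lborel" by (rule m) (use F(1) in blast)
  have m2: "prodf (\<lambda>i. (deriv ^^ \<alpha> i) (F i)) \<in> borel_measurable lborel"
    by (rule m) (use F(1) in \<open>blast intro: smooth_real_iterate\<close>)
  have "(\<integral>x. u' x * prodf (\<lambda>i. (deriv ^^ \<alpha> i) (F i)) x \<partial>lborel) = (\<integral>x. u x * prodf (\<lambda>i. (deriv ^^ \<alpha> i) (F i)) x \<partial>lborel)"
    using assms by (intro integral_cong_AE borel_measurable_times m1 m2) (auto elim: eventually_mono)
  also have "\<dots> = (- 1) ^ mi_order \<alpha> * (\<integral>x. v x * prodf F x \<partial>lborel)"
    using assms(1) F ab unfolding weak_on_products_def by blast
  also have "(\<integral>x. v x * prodf F x \<partial>lborel) = (\<integral>x. v' x * prodf F x \<partial>lborel)"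
    using assms by (intro integral_cong_AE borel_measurable_times m1 m2) (auto elim: eventually_mono)
  finally show "(\<integral>x. u' x * prodf (\<lambda>i. (deriv ^^ \<alpha> i) (F i)) x \<partial>lborel) = (- 1) ^ mi_order \<alpha> * (\<integral>x. v' x * prodf F x \<partial>lborel)" .
qed

section \<open>The energy norm of order \<open>p\<close> and its completeness\<close>

locale sobolev_space = smooth_domain \<Omega> for \<Omega> :: "(real ^ 'n) set" +
  fixes p :: nat
  assumes p_pos: "0 < p"
begin

abbreviation top :: "'n multi_index set" where "top \<equiv> {\<alpha>. mi_order \<alpha> = p}"

abbreviation W :: "(real ^ 'n \<Rightarrow> real) set" where "W \<equiv> sobolev p \<Omega>"

abbreviation W0 :: "(real ^ 'n \<Rightarrow> real) set" where "W0 \<equiv> sobolev0 p \<Omega>"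

text \<open>The bilinear form of the regularizing terms in \<open>weak_solution\<close>, without the
  factor \<open>\<epsilon>\<close>.\<close>

definition eform :: "(real ^ 'n \<Rightarrow> real) \<Rightarrow> (real ^ 'n \<Rightarrow> real) \<Rightarrow> real" where
  "eform u v = (\<integral>x. u x * v x \<partial>\<mu>) + (\<Sum>\<alpha>\<in>top. \<integral>x. wd \<alpha> u x * wd \<alpha> v x \<partial>\<mu>)"

definition en :: "(real ^ 'n \<Rightarrow> real) \<Rightarrow> real" where "en u = sqrt (eform u u)"

lemma finite_top: "finite top"
  by (rule finite_mi_order_eq)

lemma top_sq_int: "u \<in> W \<Longrightarrow> \<alpha> \<in> top \<Longrightarrow> sq_int \<mu> (wd \<alpha> u)"
  using sobolevD(3)[of u p \<alpha>] by simp

lemma eform_self: "eform u u = (l2norm \<mu> u)\<^sup>2 + (\<Sum>\<alpha>\<in>top. (l2norm \<mu> (wd \<alpha> u))\<^sup>2)"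
  by (simp add: eform_def l2norm_square power2_eq_square[symmetric])

lemma eform_nonneg: "0 \<le> eform u u"
  unfolding eform_self by (intro add_nonneg_nonneg sum_nonneg) auto

lemma en_nonneg: "0 \<le> en u"
  by (simp add: en_def eform_nonneg)

lemma eform_sym: "eform u v = eform v u"
  by (simp add: eform_def mult.commute)

lemma eform_linear:
  assumes u: "u \<in> W" and w: "w \<in> W" and v: "v \<in> W"
  shows "eform (\<lambda>x. a * u x + b * w x) v = a * eform u v + b * eform w v"
proof -
  let ?l = "\<lambda>x. a * u x + b * w x"
  have l: "?l \<in> W" by (intro sobolev_add sobolev_cmult u w)
  have 1: "(\<integral>x. ?l x * v x \<partial>\<mu>) = a * (\<integral>x. u x * v x \<partial>\<mu>) + b * (\<integral>x. w x * v x \<partial>\<mu>)"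
    using sq_int_mult[OF sobolevD(1)[OF u] sobolevD(1)[OF v]] sq_int_mult[OF sobolevD(1)[OF w] sobolevD(1)[OF v]]
    by (simp add: distrib_right mult.assoc)
  have 2: "(\<integral>x. wd \<alpha> ?l x * wd \<alpha> v x \<partial>\<mu>)
      = a * (\<integral>x. wd \<alpha> u x * wd \<alpha> v x \<partial>\<mu>) + b * (\<integral>x. wd \<alpha> w x * wd \<alpha> v x \<partial>\<mu>)"
    if \<alpha>: "\<alpha> \<in> top" for \<alpha>
  proof -
    have \<alpha>': "mi_order \<alpha> \<le> p" using \<alpha> by simp
    note s = top_sq_int[OF u \<alpha>] top_sq_int[OF w \<alpha>] top_sq_int[OF v \<alpha>] top_sq_int[OF l \<alpha>]
    note m = s[THEN sq_int_measurable]
    have "AE x in \<mu>. wd \<alpha> ?l x = a * wd \<alpha> u x + b * wd \<alpha> w x"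
      using weak_deriv_add[OF sobolev_cmult[OF u] sobolev_cmult[OF w] \<alpha>', of a b] weak_deriv_cmult[OF u \<alpha>', of a] weak_deriv_cmult[OF w \<alpha>', of b]
      by eventually_elim simp
    then have "(\<integral>x. wd \<alpha> ?l x * wd \<alpha> v x \<partial>\<mu>)
        = (\<integral>x. (a * wd \<alpha> u x + b * wd \<alpha> w x) * wd \<alpha> v x \<partial>\<mu>)"
      using m by (intro integral_cong_AE borel_measurable_times borel_measurable_add borel_measurable_const) (auto elim: eventually_mono)
    also have "\<dots> = a * (\<integral>x. wd \<alpha> u x * wd \<alpha> v x \<partial>\<mu>) + b * (\<integral>x. wd \<alpha> w x * wd \<alpha> v x \<partial>\<mu>)"
      using sq_int_mult[OF s(1,3)] sq_int_mult[OF s(2,3)] by (simp add: distrib_right mult.assoc)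
    finally show ?thesis .
  qed
  have "(\<Sum>\<alpha>\<in>top. \<integral>x. wd \<alpha> ?l x * wd \<alpha> v x \<partial>\<mu>)
      = a * (\<Sum>\<alpha>\<in>top. \<integral>x. wd \<alpha> u x * wd \<alpha> v x \<partial>\<mu>) + b * (\<Sum>\<alpha>\<in>top. \<integral>x. wd \<alpha> w x * wd \<alpha> v x \<partial>\<mu>)"
    by (simp only: sum_distrib_left sum.distrib[symmetric] 2 cong: sum.cong)
  then show ?thesis unfolding eform_def 1 by (simp only: distrib_left add_ac)
qed

lemma l2norm_le_en: "l2norm \<mu> u \<le> en u" "\<alpha> \<in> top \<Longrightarrow> l2norm \<mu> (wd \<alpha> u) \<le> en u"
proof -
  show "l2norm \<mu> u \<le> en u"
    unfolding en_def eform_self by (intro real_le_rsqrt) (simp add: sum_nonneg)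
  assume "\<alpha> \<in> top"
  then have "(l2norm \<mu> (wd \<alpha> u))\<^sup>2 \<le> (\<Sum>\<alpha>\<in>top. (l2norm \<mu> (wd \<alpha> u))\<^sup>2)"
    using finite_top by (intro member_le_sum) auto
  then show "l2norm \<mu> (wd \<alpha> u) \<le> en u"
    unfolding en_def eform_self by (intro real_le_rsqrt) (simp add: add_increasing)
qed

lemma top_sum_le_en: "top_sum p u \<le> (1 + real (card top)) * en u"
proof -
  have "(\<Sum>\<alpha>\<in>top. l2norm \<mu> (wd \<alpha> u)) \<le> (\<Sum>\<alpha>\<in>top. en u)" by (intro sum_mono l2norm_le_en(2))
  then show ?thesis using l2norm_le_en(1)[of u] by (simp add: top_sum_def distrib_right)
qed

definition continuous_rep :: "'n multi_index \<Rightarrow> (real ^ 'n \<Rightarrow> real) \<Rightarrow> real \<Rightarrow> (real ^ 'n \<Rightarrow> real) \<Rightarrow> bool" where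
  "continuous_rep \<beta> u b f \<longleftrightarrow> continuous_on \<Omega> f \<and> (AE x in \<mu>. wd \<beta> u x = f x) \<and> (\<forall>x\<in>\<Omega>. \<bar>f x\<bar> \<le> b)"

text \<open>A single constant for all orders at once, so that it can be fixed as \<open>emb\<close>;
  the pointwise part covers the orders with \<open>|\<beta>| + d / 2 < p\<close>.\<close>

definition embeds :: "real \<Rightarrow> bool" where
  "embeds C \<longleftrightarrow> 0 \<le> C \<and> (\<forall>u\<in>W. (\<forall>\<beta>. mi_order \<beta> \<le> p \<longrightarrow> l2norm \<mu> (wd \<beta> u) \<le> C * en u) \<and>
     (\<forall>\<beta>. 2 * mi_order \<beta> + CARD('n) < 2 * p \<longrightarrow> (\<exists>f. continuous_rep \<beta> u (C * en u) f)))"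

lemma embedding_exists: "\<exists>C. embeds C"
proof -
  obtain m where m: "p = Suc m" using p_pos gr0_implies_Suc by blast
  let ?B = "{\<beta> :: 'n multi_index. mi_order \<beta> \<le> p}"
  have fB: "finite ?B" by (rule finite_mi_order_le)
  have "\<forall>\<beta>\<in>?B. \<exists>C. 0 \<le> C \<and> (\<forall>u\<in>W. l2norm \<mu> (wd \<beta> u) \<le> C * top_sum p u)"
    using embedding_L2_single[of _ m] unfolding m by blast
  from bchoice[OF this] obtain C1 where C1: "\<And>\<beta>. \<beta> \<in> ?B \<Longrightarrow> 0 \<le> C1 \<beta>"
    "\<And>\<beta> u. \<beta> \<in> ?B \<Longrightarrow> u \<in> W \<Longrightarrow> l2norm \<mu> (wd \<beta> u) \<le> C1 \<beta> * top_sum p u" by blast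
  define Q where "Q \<beta> K u \<longleftrightarrow> (\<exists>f. continuous_rep \<beta> u (K * top_sum p u) f)" for \<beta> K u
  let ?B2 = "{\<beta> :: 'n multi_index. 2 * mi_order \<beta> + CARD('n) < 2 * p}"
  have B2: "?B2 \<subseteq> ?B" by auto
  have "\<forall>\<beta>\<in>?B2. \<exists>C. 0 \<le> C \<and> (\<forall>u\<in>W. Q \<beta> C u)"
    using embedding_continuous[of _ m] unfolding m Q_def continuous_rep_def by blast
  from bchoice[OF this] obtain C2 where C2: "\<And>\<beta>. \<beta> \<in> ?B2 \<Longrightarrow> 0 \<le> C2 \<beta>"
    "\<And>\<beta> u. \<beta> \<in> ?B2 \<Longrightarrow> u \<in> W \<Longrightarrow> Q \<beta> (C2 \<beta>) u" by blast
  define S where "S = (\<Sum>\<beta>\<in>?B. C1 \<beta>) + (\<Sum>\<beta>\<in>?B2. C2 \<beta>)"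
  have S1: "C1 \<beta> \<le> S" if "\<beta> \<in> ?B" for \<beta>
    using member_le_sum[of \<beta> ?B C1] that C1(1) fB sum_nonneg[of ?B2 C2] C2(1) unfolding S_def by fastforce
  have S2: "C2 \<beta> \<le> S" if "\<beta> \<in> ?B2" for \<beta>
    using member_le_sum[of \<beta> ?B2 C2] that C2(1) finite_subset[OF B2 fB] sum_nonneg[of ?B C1] C1(1) unfolding S_def by fastforce
  have S0: "0 \<le> S" unfolding S_def by (intro add_nonneg_nonneg sum_nonneg C1(1) C2(1))
  define C where "C = S * (1 + real (card top))"
  have C: "K * top_sum p u \<le> C * en u" if "K \<le> S" for K u
  proof -
    have "K * top_sum p u \<le> S * top_sum p u" by (rule mult_right_mono[OF that top_sum_nonneg])
    also have "\<dots> \<le> S * ((1 + real (card top)) * en u)" by (rule mult_left_mono[OF top_sum_le_en S0])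
    finally show ?thesis by (simp add: C_def mult.assoc)
  qed
  have 1: "l2norm \<mu> (wd \<beta> u) \<le> C * en u" if "u \<in> W" "mi_order \<beta> \<le> p" for u \<beta>
    using C1(2)[of \<beta> u] C[OF S1, of \<beta> u] that by simp
  have 2: "\<exists>f. continuous_rep \<beta> u (C * en u) f" if "u \<in> W" "\<beta> \<in> ?B2" for u \<beta>
    using C2(2)[OF that(2,1)] C[OF S2[OF that(2)], of u] order_trans unfolding Q_def continuous_rep_def by blast
  have "0 \<le> C" using S0 by (simp add: C_def)
  then show ?thesis using 1 2 by (intro exI[of _ C]) (simp add: embeds_def)
qed

definition emb :: real where "emb = (SOME C. embeds C)"

definition crep :: "'n multi_index \<Rightarrow> (real ^ 'n \<Rightarrow> real) \<Rightarrow> real ^ 'n \<Rightarrow> real" where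
  "crep \<beta> u = (SOME f. continuous_rep \<beta> u (emb * en u) f)"

lemma emb:
  shows emb_nonneg: "0 \<le> emb"
    and emb_L2: "u \<in> W \<Longrightarrow> mi_order \<beta> \<le> p \<Longrightarrow> l2norm \<mu> (wd \<beta> u) \<le> emb * en u"
    and emb_crep: "u \<in> W \<Longrightarrow> 2 * mi_order \<beta> + CARD('n) < 2 * p \<Longrightarrow>
      continuous_on \<Omega> (crep \<beta> u) \<and> (AE x in \<mu>. wd \<beta> u x = crep \<beta> u x) \<and> (\<forall>x\<in>\<Omega>. \<bar>crep \<beta> u x\<bar> \<le> emb * en u)"
proof -
  have e: "embeds emb" unfolding emb_def by (rule someI_ex[OF embedding_exists])
  then show "0 \<le> emb" "u \<in> W \<Longrightarrow> mi_order \<beta> \<le> p \<Longrightarrow> l2norm \<mu> (wd \<beta> u) \<le> emb * en u"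
    unfolding embeds_def by blast+
  assume "u \<in> W" "2 * mi_order \<beta> + CARD('n) < 2 * p"
  then have "\<exists>f. continuous_rep \<beta> u (emb * en u) f" using e unfolding embeds_def by blast
  from someI_ex[OF this, folded crep_def]
  show "continuous_on \<Omega> (crep \<beta> u) \<and> (AE x in \<mu>. wd \<beta> u x = crep \<beta> u x) \<and> (\<forall>x\<in>\<Omega>. \<bar>crep \<beta> u x\<bar> \<le> emb * en u)"
    unfolding continuous_rep_def .
qed

text \<open>Weakly, \<open>D^(\<alpha> + e_j) u\<close> is the \<open>j\<close>-th derivative of
  \<open>D^\<alpha> u\<close>, since on products the derivatives of the test function compose and
  the signs of order \<open>\<alpha>\<close> cancel. Both have continuous representatives, so the
  derivative is classical.\<close>

lemma crep_partial:
  assumes u: "u \<in> W" and \<alpha>: "2 * (mi_order \<alpha> + 1) + CARD('n) < 2 * p"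
  shows "has_partial \<Omega> j (crep \<alpha> u) (crep (\<lambda>l. \<alpha> l + mi_unit j l) u)"
proof -
  let ?\<beta> = "\<lambda>l. \<alpha> l + mi_unit j l"
  have o: "mi_order ?\<beta> = mi_order \<alpha> + 1" using mi_order_unit[of j] by (simp add: mi_order_def sum.distrib)
  have le: "mi_order \<alpha> \<le> p" "mi_order ?\<beta> \<le> p" using \<alpha> unfolding o by auto
  note s = sobolevD(3)[OF u le(1)] sobolevD(3)[OF u le(2)] and w = sobolevD(2)[OF u le(1)] sobolevD(2)[OF u le(2)]
  have c1: "continuous_on \<Omega> (crep \<alpha> u)" "AE x in \<mu>. wd \<alpha> u x = crep \<alpha> u x"
    using emb_crep[OF u, of \<alpha>] \<alpha> by auto
  have c2: "continuous_on \<Omega> (crep ?\<beta> u)" "AE x in \<mu>. wd ?\<beta> u x = crep ?\<beta> u x"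
    using emb_crep[OF u, of ?\<beta>] \<alpha> unfolding o by auto
  have w0: "weak_on_products \<Omega> (mi_unit j) (rep (wd \<alpha> u)) (rep (wd ?\<beta> u))"
    unfolding weak_on_products_def
  proof (intro allI impI)
    fix F :: "'n \<Rightarrow> real \<Rightarrow> real" and a b :: "real ^ 'n"
    assume F: "\<forall>i. smooth_real (F i)" "\<forall>i t. t \<notin> {a $ i..b $ i} \<longrightarrow> F i t = 0" and ab: "cbox a b \<subseteq> \<Omega>"
    define G where "G i = (deriv ^^ mi_unit j i) (F i)" for i
    have \<psi>: "prodf F \<in> test_fun \<Omega>" using F ab by (intro prodf_test_fun) auto
    have G: "prodf G = mi_deriv (mi_unit j) (prodf F)" unfolding G_def using F by (intro mi_deriv_prodf[symmetric]) auto
    have \<psi>': "prodf G \<in> test_fun \<Omega>" unfolding G by (rule test_fun_mi_deriv[OF \<psi>])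
    have "mi_deriv \<alpha> (prodf G) = prodf (\<lambda>i. (deriv ^^ \<alpha> i) (G i))"
      using F by (intro mi_deriv_prodf) (auto simp: G_def intro: smooth_real_iterate)
    also have "\<dots> = prodf (\<lambda>i. (deriv ^^ ?\<beta> i) (F i))" by (simp add: G_def funpow_add)
    also have "\<dots> = mi_deriv ?\<beta> (prodf F)" using F by (intro mi_deriv_prodf[symmetric]) auto
    finally have d: "mi_deriv \<alpha> (prodf G) = mi_deriv ?\<beta> (prodf F)" .
    have "(- 1) ^ mi_order \<alpha> * (\<integral>x. wd \<alpha> u x * prodf G x \<partial>\<mu>) = (- 1) ^ mi_order ?\<beta> * (\<integral>x. wd ?\<beta> u x * prodf F x \<partial>\<mu>)"
      using has_weak_derivD[OF w(1) \<psi>'] has_weak_derivD[OF w(2) \<psi>] unfolding d by (rule trans[OF sym])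
    then have "(\<integral>x. wd \<alpha> u x * prodf G x \<partial>\<mu>) = - (\<integral>x. wd ?\<beta> u x * prodf F x \<partial>\<mu>)"
      unfolding o power_add power_one_right mult.assoc mult_minus1
      by (rule mult_left_cancel[THEN iffD1, rotated]) simp
    then show "(\<integral>x. rep (wd \<alpha> u) x * prodf (\<lambda>i. (deriv ^^ mi_unit j i) (F i)) x \<partial>lborel)
        = (- 1) ^ mi_order (mi_unit j) * (\<integral>x. rep (wd ?\<beta> u) x * prodf F x \<partial>lborel)"
      unfolding G_def[symmetric] mi_order_unit
      using integral_rep[OF s(1) test_fun_properties(4)[OF \<psi>']] integral_rep[OF s(2) test_fun_properties(4)[OF \<psi>]] by simp
  qed
  have bm: "(\<lambda>x. indicator \<Omega> x * f x) \<in> borel_measurable borel" if "continuous_on \<Omega> f" for f :: "real ^ 'n \<Rightarrow> real"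
    using borel_measurable_continuous_on_indicator[OF _ that] open_dom by simp
  have ae: "AE x in lborel. rep v x = indicator \<Omega> x * f x" if v: "sq_int \<mu> v" and "AE x in \<mu>. v x = f x" for v f
  proof -
    have "AE x in \<mu>. rep v x = f x" using rep(4)[OF v] that(2) by eventually_elim simp
    then show ?thesis unfolding AE_lebesgue_on_iff_lborel[OF open_dom]
      by eventually_elim (auto simp: indicator_def rep(3)[OF v])
  qed
  have "weak_on_products \<Omega> (mi_unit j) (\<lambda>x. indicator \<Omega> x * crep \<alpha> u x) (\<lambda>x. indicator \<Omega> x * crep ?\<beta> u x)"
    by (rule weak_on_products_cong_AE[OF w0 rep_measurable[OF s(1)] bm[OF c1(1)] rep_measurable[OF s(2)] bm[OF c2(1)] ae[OF s(1) c1(2)] ae[OF s(2) c2(2)]])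
  then show ?thesis by (rule has_partial_if_weak[OF open_dom c1(1) c2(1)])
qed

text \<open>Membership in the Sobolev space demands weak derivatives of all orders up to
  \<open>p\<close>, while the energy contains only the orders 0 and \<open>p\<close>;
  \<open>emb_L2\<close> makes the intermediate ones Cauchy as well.\<close>

lemma sobolev_complete:
  assumes s: "\<And>n. s n \<in> W"
    and Cauchy: "\<And>e. e > 0 \<Longrightarrow> \<exists>N. \<forall>i\<ge>N. \<forall>j\<ge>N. en (\<lambda>x. s i x - s j x) < e"
  shows "\<exists>u\<in>W. (\<lambda>n. en (\<lambda>x. s n x - u x)) \<longlonglongrightarrow> 0"
proof -
  have sd: "(\<lambda>x. s i x - s j x) \<in> W" for i j by (intro sobolev_diff s)
  have lim: "\<exists>f. sq_int \<mu> f \<and> (\<lambda>n. l2norm \<mu> (\<lambda>x. t n x - f x)) \<longlonglongrightarrow> 0"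
    if t: "\<And>n. sq_int \<mu> (t n)" "\<And>i j. l2norm \<mu> (\<lambda>x. t i x - t j x) \<le> K * en (\<lambda>x. s i x - s j x)" and K: "0 \<le> K" for t K
  proof (rule finite_measure.l2_complete[OF finite_dom t(1)])
    fix e :: real assume e: "e > 0"
    obtain N where N: "\<And>i j. i \<ge> N \<Longrightarrow> j \<ge> N \<Longrightarrow> en (\<lambda>x. s i x - s j x) < e / (K + 1)"
      using Cauchy[of "e / (K + 1)"] e K by auto
    have "l2norm \<mu> (\<lambda>x. t i x - t j x) < e" if "i \<ge> N" "j \<ge> N" for i j
    proof -
      have "K * en (\<lambda>x. s i x - s j x) \<le> (K + 1) * en (\<lambda>x. s i x - s j x)" using en_nonneg by (intro mult_right_mono) auto
      also have "\<dots> < e" using N[OF that] K by (simp add: field_simps)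
      finally show ?thesis using t(2)[of i j] by simp
    qed
    then show "\<exists>N. \<forall>i\<ge>N. \<forall>j\<ge>N. l2norm \<mu> (\<lambda>x. t i x - t j x) < e" by blast
  qed
  obtain u where u: "sq_int \<mu> u" "(\<lambda>n. l2norm \<mu> (\<lambda>x. s n x - u x)) \<longlonglongrightarrow> 0"
    using lim[of s 1] sobolevD(1)[OF s] l2norm_le_en(1) by auto
  have ex: "\<exists>v. sq_int \<mu> v \<and> has_weak_deriv \<Omega> \<alpha> u v \<and> (\<lambda>n. l2norm \<mu> (\<lambda>x. wd \<alpha> (s n) x - v x)) \<longlonglongrightarrow> 0"
    if \<alpha>: "mi_order \<alpha> \<le> p" for \<alpha>
  proof -
    have "l2norm \<mu> (\<lambda>x. wd \<alpha> (s i) x - wd \<alpha> (s j) x) \<le> emb * en (\<lambda>x. s i x - s j x)" for i j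
      using emb_L2[OF sd \<alpha>] l2norm_weak_deriv_diff[OF s s \<alpha>] by simp
    from lim[of "\<lambda>n. wd \<alpha> (s n)", OF sobolevD(3)[OF s \<alpha>] this emb_nonneg]
    obtain v where v: "sq_int \<mu> v" "(\<lambda>n. l2norm \<mu> (\<lambda>x. wd \<alpha> (s n) x - v x)) \<longlonglongrightarrow> 0" by blast
    have "has_weak_deriv \<Omega> \<alpha> u v"
      by (rule has_weak_deriv_limit[OF sobolevD(1)[OF s] sobolevD(3)[OF s \<alpha>] sobolevD(2)[OF s \<alpha>] u v])
    then show ?thesis using v by blast
  qed
  have us: "u \<in> W" using ex by (intro sobolevI u(1)) blast
  have lim\<alpha>: "(\<lambda>n. l2norm \<mu> (wd \<alpha> (\<lambda>x. s n x - u x))) \<longlonglongrightarrow> 0" if \<alpha>: "mi_order \<alpha> \<le> p" for \<alpha>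
  proof -
    obtain v where v: "sq_int \<mu> v" "has_weak_deriv \<Omega> \<alpha> u v" "(\<lambda>n. l2norm \<mu> (\<lambda>x. wd \<alpha> (s n) x - v x)) \<longlonglongrightarrow> 0"
      using ex[OF \<alpha>] by blast
    have "l2norm \<mu> (wd \<alpha> (\<lambda>x. s n x - u x)) = l2norm \<mu> (\<lambda>x. wd \<alpha> (s n) x - v x)" for n
      unfolding l2norm_weak_deriv_diff[OF s us \<alpha>]
    proof (rule l2norm_cong_AE)
      show "AE x in \<mu>. wd \<alpha> (s n) x - wd \<alpha> u x = wd \<alpha> (s n) x - v x"
        using weak_deriv_eq(2)[OF v(2)] by eventually_elim simp
    qed (intro borel_measurable_diff sq_int_measurable sobolevD(3)[OF s \<alpha>] sobolevD(3)[OF us \<alpha>] v(1))+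
    then show ?thesis using v(3) by simp
  qed
  have "(\<lambda>n. sqrt ((l2norm \<mu> (\<lambda>x. s n x - u x))\<^sup>2 + (\<Sum>\<alpha>\<in>top. (l2norm \<mu> (wd \<alpha> (\<lambda>x. s n x - u x)))\<^sup>2)))
      \<longlonglongrightarrow> sqrt (0\<^sup>2 + (\<Sum>\<alpha>\<in>top. 0\<^sup>2))"
    by (intro tendsto_intros u(2) lim\<alpha>) simp
  then have "(\<lambda>n. en (\<lambda>x. s n x - u x)) \<longlonglongrightarrow> 0" by (simp add: en_def eform_self)
  then show ?thesis using us by blast
qed

text \<open>\<open>sobolev0\<close> is a closure in the norm with all orders; this comparison makes
  it closed for the energy norm.\<close>

lemma sobolev_norm_le_en:
  assumes u: "u \<in> W"
  shows "sobolev_norm p \<Omega> u \<le> (card {\<alpha> :: 'n multi_index. mi_order \<alpha> \<le> p} * emb) * en u"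
proof -
  have "sobolev_norm p \<Omega> u \<le> (\<Sum>\<alpha> | mi_order \<alpha> \<le> p. l2norm \<mu> (wd \<alpha> u))"
    unfolding sobolev_norm_L2_set by (rule L2_set_le_sum) (simp add: l2norm_nonneg)
  also have "\<dots> \<le> (\<Sum>\<alpha>\<in>{\<alpha> :: 'n multi_index. mi_order \<alpha> \<le> p}. emb * en u)" by (intro sum_mono emb_L2[OF u]) simp
  finally show ?thesis by simp
qed

lemma sobolev0_closed:
  assumes s: "\<And>n. s n \<in> W0" and u: "u \<in> W" and lim: "(\<lambda>n. en (\<lambda>x. s n x - u x)) \<longlonglongrightarrow> 0"
  shows "u \<in> W0"
  unfolding sobolev0_def
proof (intro CollectI conjI allI impI u)
  fix e :: real assume e: "e > 0"
  let ?K = "card {\<alpha> :: 'n multi_index. mi_order \<alpha> \<le> p} * emb"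
  have "(\<lambda>n. ?K * en (\<lambda>x. s n x - u x)) \<longlonglongrightarrow> ?K * 0" by (intro tendsto_intros lim)
  then have "\<forall>\<^sub>F n in sequentially. ?K * en (\<lambda>x. s n x - u x) < e / 2" using e by (intro order_tendstoD(2)) auto
  then obtain n where n: "?K * en (\<lambda>x. s n x - u x) < e / 2" by (auto simp: eventually_sequentially)
  have su: "(\<lambda>x. s n x - u x) \<in> W" by (intro sobolev_diff sobolev0D s u)
  have 1: "sobolev_norm p \<Omega> (\<lambda>x. s n x - u x) < e / 2" using sobolev_norm_le_en[OF su] n by simp
  obtain \<psi> where \<psi>: "\<psi> \<in> test_fun \<Omega>" "sobolev_norm p \<Omega> (\<lambda>x. s n x - \<psi> x) < e / 2"
    using sobolev0_approx[OF s, of "e / 2" n] e by auto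
  have "sobolev_norm p \<Omega> (\<lambda>x. (s n x - \<psi> x) + (-1) * (s n x - u x)) \<le> sobolev_norm p \<Omega> (\<lambda>x. s n x - \<psi> x) + sobolev_norm p \<Omega> (\<lambda>x. (-1) * (s n x - u x))"
    by (intro sobolev_norm_add sobolev_cmult su sobolev_diff sobolev0D s test_sobolev \<psi>(1))
  also have "\<dots> < e" using sobolev_norm_cmult[OF su, of "-1"] 1 \<psi>(2) by simp
  finally show "\<exists>\<psi>\<in>test_fun \<Omega>. sobolev_norm p \<Omega> (\<lambda>x. u x - \<psi> x) < e" using \<psi>(1) by (intro bexI[of _ \<psi>]) (simp_all add: algebra_simps)
qed

end

section \<open>The nonlinear operator\<close>

text \<open>What is used of smoothness up to the boundary: bounds on all derivatives that are
  uniform in \<open>x\<close> as long as the momentum stays bounded. The property is inherited by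
  partial derivatives.\<close>

definition strip_smooth :: "(real ^ 'n) set \<Rightarrow> ((real ^ 'n) \<times> (real ^ 'n) \<Rightarrow> real) \<Rightarrow> bool" where
  "strip_smooth \<Omega> F \<longleftrightarrow> smooth_on (\<Omega> \<times> UNIV) F \<and>
     (\<forall>bs R. set bs \<subseteq> Basis \<longrightarrow> (\<exists>B. \<forall>x\<in>\<Omega>. \<forall>q\<in>cball 0 R. \<bar>dir_derivs bs F (x, q)\<bar> \<le> B))"

lemma strip_smooth_closure:
  fixes \<Omega> :: "(real ^ 'n) set"
  assumes "bounded \<Omega>" "smooth_on_closure (\<Omega> \<times> UNIV) F"
  shows "strip_smooth \<Omega> F"
  unfolding strip_smooth_def
proof (intro conjI allI impI)
  show "smooth_on (\<Omega> \<times> UNIV) F" using assms(2) by (simp add: smooth_on_closure_def)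
  fix bs :: "((real ^ 'n) \<times> (real ^ 'n)) list" and R :: real assume "set bs \<subseteq> Basis"
  then obtain G where G: "continuous_on (closure (\<Omega> \<times> UNIV)) G" "\<And>z. z \<in> \<Omega> \<times> UNIV \<Longrightarrow> G z = dir_derivs bs F z"
    using assms(2) unfolding smooth_on_closure_def by blast
  have "bounded (G ` (closure \<Omega> \<times> cball 0 R))"
    using assms(1) G(1)
    by (intro compact_imp_bounded compact_continuous_image compact_Times) (auto simp: closure_Times intro: continuous_on_subset)
  then obtain B where B: "\<And>z. z \<in> closure \<Omega> \<times> cball 0 R \<Longrightarrow> \<bar>G z\<bar> \<le> B" by (auto simp: bounded_pos)
  have "\<bar>dir_derivs bs F (x, q)\<bar> \<le> B" if "x \<in> \<Omega>" "q \<in> cball 0 R" for x q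
    using B[of "(x, q)"] G(2)[of "(x, q)"] that closure_subset by fastforce
  then show "\<exists>B. \<forall>x\<in>\<Omega>. \<forall>q\<in>cball 0 R. \<bar>dir_derivs bs F (x, q)\<bar> \<le> B" by blast
qed

lemma strip_smooth_dir_deriv:
  assumes "strip_smooth \<Omega> F" "b \<in> Basis"
  shows "strip_smooth \<Omega> (dir_deriv b F)"
  unfolding strip_smooth_def
proof (intro conjI allI impI)
  show "smooth_on (\<Omega> \<times> UNIV) (dir_deriv b F)"
    using assms by (intro smooth_on_dir_deriv) (auto simp: strip_smooth_def)
  fix bs :: "((real ^ 'a) \<times> (real ^ 'a)) list" and R :: real assume "set bs \<subseteq> Basis"
  then have "set (bs @ [b]) \<subseteq> Basis" using assms(2) by simp
  then have "\<exists>B. \<forall>x\<in>\<Omega>. \<forall>q\<in>cball 0 R. \<bar>dir_derivs (bs @ [b]) F (x, q)\<bar> \<le> B"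
    using assms(1) unfolding strip_smooth_def by blast
  then show "\<exists>B. \<forall>x\<in>\<Omega>. \<forall>q\<in>cball 0 R. \<bar>dir_derivs bs (dir_deriv b F) (x, q)\<bar> \<le> B" by (simp add: dir_derivs_def)
qed

lemma strip_smooth_bounded:
  assumes "strip_smooth \<Omega> F"
  shows "\<exists>B\<ge>0. \<forall>x\<in>\<Omega>. \<forall>q\<in>cball 0 R. \<bar>F (x, q)\<bar> \<le> B"
proof -
  obtain B where "\<forall>x\<in>\<Omega>. \<forall>q\<in>cball 0 R. \<bar>dir_derivs [] F (x, q)\<bar> \<le> B"
    using assms unfolding strip_smooth_def by (metis empty_subsetI list.set(1))
  then show ?thesis by (intro exI[of _ "max 0 B"]) (force simp: dir_derivs_def le_max_iff_disj)
qed

lemma strip_smooth_has_derivative: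
  assumes "strip_smooth \<Omega> F" "open \<Omega>" "x \<in> \<Omega>"
  shows "(F has_derivative (\<lambda>h. \<Sum>b\<in>Basis. (h \<bullet> b) * dir_deriv b F (x, q))) (at (x, q))"
  using assms by (intro smooth_on_has_derivative[of "\<Omega> \<times> UNIV"]) (auto simp: strip_smooth_def open_Times)

lemma strip_smooth_continuous:
  assumes "strip_smooth \<Omega> F" "continuous_on \<Omega> P"
  shows "continuous_on \<Omega> (\<lambda>x. F (x, P x))"
proof -
  have "continuous_on (\<Omega> \<times> UNIV) F"
    using smooth_on_continuous[of "\<Omega> \<times> UNIV" F "[]"] assms(1) by (simp add: strip_smooth_def dir_derivs_def)
  moreover have "continuous_on \<Omega> (\<lambda>x. (x, P x))" by (intro continuous_intros assms(2))
  ultimately show ?thesis by (rule continuous_on_compose2) auto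
qed

text \<open>The mean value inequality is applied on the convex slice
  \<open>{x} \<times> cball 0 R\<close>, so the geometry of \<open>\<Omega>\<close> does not
  enter.\<close>

lemma strip_smooth_Lipschitz:
  fixes \<Omega> :: "(real ^ 'n) set"
  assumes F: "strip_smooth \<Omega> F" and "open \<Omega>"
  shows "\<exists>L\<ge>0. \<forall>x\<in>\<Omega>. \<forall>q\<in>cball 0 R. \<forall>q'\<in>cball 0 R. \<bar>F (x, q) - F (x, q')\<bar> \<le> L * norm (q - q')"
proof -
  have "\<forall>b\<in>Basis. \<exists>B\<ge>0. \<forall>x\<in>\<Omega>. \<forall>q\<in>cball 0 R. \<bar>dir_deriv b F (x, q)\<bar> \<le> B"
    using strip_smooth_bounded strip_smooth_dir_deriv[OF F] by blast
  from bchoice[OF this] obtain B where B: "\<And>b. b \<in> Basis \<Longrightarrow> 0 \<le> B b"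
    "\<And>b x q. b \<in> Basis \<Longrightarrow> x \<in> \<Omega> \<Longrightarrow> q \<in> cball 0 R \<Longrightarrow> \<bar>dir_deriv b F (x, q)\<bar> \<le> B b" by blast
  let ?S = "\<lambda>x. {x :: real ^ 'n} \<times> cball (0 :: real ^ 'n) R"
  have "\<bar>F (x, q) - F (x, q')\<bar> \<le> (\<Sum>b\<in>Basis. B b) * norm ((x, q) - (x, q'))"
    if x: "x \<in> \<Omega>" and q: "q \<in> cball 0 R" "q' \<in> cball 0 R" for x q q'
  proof (rule Lipschitz_by_partials[of "?S x" F "\<lambda>b. dir_deriv b F"])
    show "convex (?S x)" by (intro convex_Times convex_singleton convex_cball)
    show "(F has_derivative (\<lambda>h. \<Sum>b\<in>Basis. (h \<bullet> b) * dir_deriv b F z)) (at z)" if "z \<in> ?S x" for z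
      using strip_smooth_has_derivative[OF F assms(2) x, of "snd z"] that by auto
    show "(\<Sum>b\<in>Basis. \<bar>dir_deriv b F z\<bar>) \<le> (\<Sum>b\<in>Basis. B b)" if "z \<in> ?S x" for z
      using that x B(2) by (intro sum_mono) auto
  qed (use q in auto)
  then show ?thesis using B(1) by (intro exI[of _ "\<Sum>b\<in>Basis. B b"]) (auto simp: sum_nonneg norm_Pair)
qed

text \<open>Chain rule along the curve \<open>\<gamma>\<close> over a line parallel to the
  \<open>j\<close>-th axis; the inner functions contribute only their partial derivatives in that
  direction.\<close>

lemma strip_smooth_chain:
  fixes \<Omega> :: "(real ^ 'n) set"
  assumes F: "strip_smooth \<Omega> F" and "open \<Omega>" and c: "\<And>l. has_partial \<Omega> j (c l) (d l)"
  shows "has_partial \<Omega> j (\<lambda>x. F (x, \<chi> l. c l x))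
    (\<lambda>x. \<Sum>b\<in>Basis. ((axis j 1, \<chi> l. d l x) \<bullet> b) * dir_deriv b F (x, \<chi> l. c l x))"
  unfolding has_partial_def
proof
  fix x assume x: "x \<in> \<Omega>"
  define \<gamma> where "\<gamma> t = (x + t *\<^sub>R axis j 1, \<chi> l. c l (x + t *\<^sub>R axis j 1))" for t :: real
  let ?v = "(axis j 1, \<chi> l. d l x) :: (real ^ 'n) \<times> (real ^ 'n)"
  have "((\<lambda>t. \<chi> l. c l (x + t *\<^sub>R axis j 1)) has_derivative (\<lambda>t. t *\<^sub>R (\<chi> l. d l x))) (at 0)"
  proof (rule has_derivative_componentwise_within[THEN iffD2], rule ballI)
    fix b :: "real ^ 'n" assume "b \<in> Basis"
    then obtain l where b: "b = axis l 1" by (auto simp: Basis_vec_def)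
    have "((\<lambda>t. c l (x + t *\<^sub>R axis j 1)) has_derivative (\<lambda>t. d l x * t)) (at 0)"
      using c[of l] x unfolding has_partial_def has_field_derivative_def by blast
    then show "((\<lambda>t. (\<chi> l. c l (x + t *\<^sub>R axis j 1)) \<bullet> b) has_derivative (\<lambda>t. t *\<^sub>R (\<chi> l. d l x) \<bullet> b)) (at 0)"
      by (simp add: b inner_axis mult.commute)
  qed
  moreover have "((\<lambda>t::real. x + t *\<^sub>R axis j 1) has_derivative (\<lambda>t. t *\<^sub>R axis j 1)) (at 0)"
    by (auto intro!: derivative_eq_intros)
  ultimately have "(\<gamma> has_derivative (\<lambda>t. t *\<^sub>R ?v)) (at 0)"
    unfolding \<gamma>_def scaleR_Pair by (intro has_derivative_Pair)
  moreover have "\<gamma> 0 = (x, \<chi> l. c l x)" by (simp add: \<gamma>_def)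
  ultimately have "(F \<circ> \<gamma> has_derivative (\<lambda>h. \<Sum>b\<in>Basis. (h \<bullet> b) * dir_deriv b F (x, \<chi> l. c l x)) \<circ> (\<lambda>t. t *\<^sub>R ?v)) (at 0)"
    using strip_smooth_has_derivative[OF F assms(2) x] by (intro diff_chain_at) auto
  then show "((\<lambda>t. F (x + t *\<^sub>R axis j 1, \<chi> l. c l (x + t *\<^sub>R axis j 1))) has_real_derivative
      (\<Sum>b\<in>Basis. (?v \<bullet> b) * dir_deriv b F (x, \<chi> l. c l x))) (at 0)"
    unfolding has_field_derivative_def comp_def \<gamma>_def
    by (rule back_subst[of "\<lambda>g. (_ has_derivative g) (at 0)"])
      (simp add: fun_eq_iff sum_distrib_left mult_ac del: scaleR_Pair inner_Pair)
qed

lemma grad_p_component: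
  "grad_p H x q $ i = dir_deriv (0, axis i 1) (\<lambda>(x, p). H x p) (x, q)"
  by (simp add: grad_p_def dir_deriv_def)

text \<open>The mean value theorem asks for the derivative inside the interval and only for
  continuity at 0; the continuous extension \<open>G\<close> of the derivative bounds it up to
  0.\<close>

lemma smooth_half_line_Lipschitz:
  fixes g :: "real \<Rightarrow> real"
  assumes g: "smooth_on_closure {0<..} g"
  shows "continuous_on {0..} g"
    and "\<exists>L\<ge>0. \<forall>a\<in>{0..R}. \<forall>b\<in>{0..R}. \<bar>g a - g b\<bar> \<le> L * \<bar>a - b\<bar>"
proof -
  have cl: "closure {0<..} = {0::real..}" by simp
  show c: "continuous_on {0..} g" using g unfolding smooth_on_closure_def cl by blast
  have s: "smooth_on {0<..} g" using g unfolding smooth_on_closure_def by blast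
  obtain G where G: "continuous_on {0..} G" "\<And>x. x > 0 \<Longrightarrow> G x = dir_derivs [1] g x"
    using g unfolding smooth_on_closure_def cl by (metis Basis_real_def greaterThan_iff list.set(1) list.set(2) order_refl)
  have "bounded (G ` {0..R})" by (intro compact_imp_bounded compact_continuous_image continuous_on_subset[OF G(1)]) auto
  then obtain L where L: "L > 0" "\<And>x. x \<in> {0..R} \<Longrightarrow> \<bar>G x\<bar> \<le> L" by (auto simp: bounded_pos)
  have der: "(g has_real_derivative G x) (at x)" if "x > 0" for x
  proof -
    have "g differentiable (at x)" using smooth_on_differentiable[OF s, of "[]" x] that by (simp add: dir_derivs_def)
    from DERIV_line[OF this, of 1] have "((\<lambda>t. g (x + t)) has_real_derivative G x) (at 0)"
      using G(2)[OF that] by (simp add: dir_derivs_def)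
    then show ?thesis using DERIV_shift[of g "G x" 0 x] by (simp add: add.commute)
  qed
  have lt: "\<bar>g b - g a\<bar> \<le> L * \<bar>b - a\<bar>" if ab: "a < b" "0 \<le> a" "b \<le> R" for a b
  proof -
    have "\<exists>l z. a < z \<and> z < b \<and> (g has_real_derivative l) (at z) \<and> g b - g a = (b - a) * l"
      using ab by (intro MVT continuous_on_subset[OF c]) (auto intro!: real_differentiable_def[THEN iffD2, OF exI, OF der])
    then obtain l z where z: "a < z" "z < b" "(g has_real_derivative l) (at z)" "g b - g a = (b - a) * l" by blast
    have "l = G z" using DERIV_unique[OF z(3) der[of z]] z ab by simp
    then have "\<bar>l\<bar> \<le> L" using L(2)[of z] z ab by simp
    then show ?thesis using ab L(1) by (simp add: z(4) abs_mult mult.commute mult_left_mono)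
  qed
  have "\<bar>g a - g b\<bar> \<le> L * \<bar>a - b\<bar>" if "a \<in> {0..R}" "b \<in> {0..R}" for a b
    using lt[of a b] lt[of b a] that by (cases a b rule: linorder_cases) (auto simp: abs_minus_commute)
  then show "\<exists>L\<ge>0. \<forall>a\<in>{0..R}. \<forall>b\<in>{0..R}. \<bar>g a - g b\<bar> \<le> L * \<bar>a - b\<bar>" using L(1) by (intro exI[of _ L]) auto
qed

lemma (in bounded_open) integral_mult_bound:
  assumes "f \<in> borel_measurable \<mu>" "g \<in> borel_measurable \<mu>" "AE x in \<mu>. \<bar>f x\<bar> \<le> a" "AE x in \<mu>. \<bar>g x\<bar> \<le> b" "0 \<le> a" "0 \<le> b"
  shows "\<bar>\<integral>x. f x * g x \<partial>\<mu>\<bar> \<le> (l2norm \<mu> (\<lambda>_. 1))\<^sup>2 * a * b"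
proof -
  let ?K = "l2norm \<mu> (\<lambda>_. 1)"
  note f = finite_measure.sq_int_bounded[OF finite_dom assms(1,3)] and g = finite_measure.sq_int_bounded[OF finite_dom assms(2,4)]
  have "\<bar>\<integral>x. f x * g x \<partial>\<mu>\<bar> \<le> l2norm \<mu> f * l2norm \<mu> g" by (rule l2_Cauchy_Schwarz[OF f(1) g(1)])
  also have "\<dots> \<le> (\<bar>a\<bar> * ?K) * (\<bar>b\<bar> * ?K)" by (intro mult_mono f(2) g(2)) (auto simp: l2norm_nonneg)
  finally show ?thesis using assms(5,6) by (simp add: power2_eq_square mult_ac)
qed

text \<open>\<open>p_large\<close> is the embedding condition for derivatives of order two,
  \<open>2 * 2 + d < 2 * p\<close>.\<close>

locale mfg_operator = sobolev_space \<Omega> p for \<Omega> :: "(real ^ 'n) set" and p +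
  fixes H :: "real ^ 'n \<Rightarrow> real ^ 'n \<Rightarrow> real" and g :: "real \<Rightarrow> real" and V \<phi> :: "real ^ 'n \<Rightarrow> real"
  assumes p_large: "4 + CARD('n) < 2 * p"
    and H: "strip_smooth \<Omega> (\<lambda>(x, q). H x q)"
    and g: "smooth_on_closure {0<..} g"
    and V: "sq_int \<mu> V" and \<phi>: "sq_int \<mu> \<phi>"
begin

text \<open>The components of \<open>grad_p H\<close> as functions of the pair of position and
  momentum, so that \<open>strip_smooth\<close> applies to them.\<close>

definition Hp :: "'n \<Rightarrow> (real ^ 'n) \<times> (real ^ 'n) \<Rightarrow> real" where
  "Hp i = dir_deriv (0, axis i 1) (\<lambda>(x, q). H x q)"

definition flux :: "(real ^ 'n \<Rightarrow> real) \<Rightarrow> (real ^ 'n \<Rightarrow> real) \<Rightarrow> 'n \<Rightarrow> real ^ 'n \<Rightarrow> real" where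
  "flux m u i y = m y * Hp i (y, weak_grad \<Omega> u y)"

definition cgrad :: "(real ^ 'n \<Rightarrow> real) \<Rightarrow> real ^ 'n \<Rightarrow> real ^ 'n" where
  "cgrad u x = (\<chi> l. crep (mi_unit l) u x)"

lemma Hp: "strip_smooth \<Omega> (Hp i)"
  unfolding Hp_def by (rule strip_smooth_dir_deriv[OF H]) (auto simp: Basis_prod_def Basis_vec_def)

lemma unit_order: "mi_order (mi_unit i :: 'n multi_index) \<le> p" "2 * mi_order (mi_unit i :: 'n multi_index) + CARD('n) < 2 * p"
  using p_large by (auto simp: mi_order_unit)

lemma zero_order: "mi_order (\<lambda>_. 0 :: nat) = 0"
  by (simp add: mi_order_def)

lemma crep_zero:
  assumes u: "u \<in> W"
  shows "continuous_on \<Omega> (crep (\<lambda>_. 0) u)" "AE x in \<mu>. u x = crep (\<lambda>_. 0) u x" "x \<in> \<Omega> \<Longrightarrow> \<bar>crep (\<lambda>_. 0) u x\<bar> \<le> emb * en u"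
proof -
  have "2 * mi_order (\<lambda>_::'n. 0 :: nat) + CARD('n) < 2 * p" using p_large by (simp add: zero_order)
  note c = emb_crep[OF u this]
  show "continuous_on \<Omega> (crep (\<lambda>_. 0) u)" "x \<in> \<Omega> \<Longrightarrow> \<bar>crep (\<lambda>_. 0) u x\<bar> \<le> emb * en u" using c by blast+
  have "AE x in \<mu>. wd (\<lambda>_. 0) u x = u x" by (rule weak_deriv_eq(2)[OF weak_deriv_zero_index[OF sobolevD(1)[OF u]]])
  then show "AE x in \<mu>. u x = crep (\<lambda>_. 0) u x" using conjunct1[OF conjunct2[OF c]] by eventually_elim simp
qed

lemma AE_dom: "AE x in \<mu>. x \<in> \<Omega>"
  by (rule AE_I2) (simp add: space_restrict_space)

lemma cgrad:
  assumes u: "u \<in> W"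
  shows "continuous_on \<Omega> (cgrad u)" "AE x in \<mu>. weak_grad \<Omega> u x = cgrad u x" "x \<in> \<Omega> \<Longrightarrow> norm (cgrad u x) \<le> CARD('n) * (emb * en u)"
proof -
  note c = emb_crep[OF u unit_order(2)]
  show "continuous_on \<Omega> (cgrad u)" unfolding cgrad_def using c by (intro continuous_on_vec_lambda) blast
  have "AE x in \<mu>. \<forall>l. wd (mi_unit l) u x = crep (mi_unit l) u x" using c by (intro eventually_all_finite) blast
  then show "AE x in \<mu>. weak_grad \<Omega> u x = cgrad u x" by eventually_elim (simp add: weak_grad_def cgrad_def)
  assume x: "x \<in> \<Omega>"
  have "norm (cgrad u x) \<le> (\<Sum>l\<in>UNIV. \<bar>cgrad u x $ l\<bar>)" by (rule norm_le_l1_cart)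
  also have "\<dots> \<le> (\<Sum>l\<in>(UNIV :: 'n set). emb * en u)" using c x by (intro sum_mono) (auto simp: cgrad_def)
  finally show "norm (cgrad u x) \<le> CARD('n) * (emb * en u)" by simp
qed

lemma AE_bounds:
  assumes u: "u \<in> W"
  shows "AE x in \<mu>. \<bar>u x\<bar> \<le> emb * en u" "AE x in \<mu>. \<bar>wd (mi_unit i) u x\<bar> \<le> emb * en u"
    "AE x in \<mu>. norm (weak_grad \<Omega> u x) \<le> CARD('n) * (emb * en u)"
proof -
  show "AE x in \<mu>. \<bar>u x\<bar> \<le> emb * en u"
    using AE_dom crep_zero(2)[OF u] by eventually_elim (use crep_zero(3)[OF u] in auto)
  note c = emb_crep[OF u unit_order(2)[of i]]
  show "AE x in \<mu>. \<bar>wd (mi_unit i) u x\<bar> \<le> emb * en u"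
    using AE_dom conjunct1[OF conjunct2[OF c]] by eventually_elim (use c in auto)
  show "AE x in \<mu>. norm (weak_grad \<Omega> u x) \<le> CARD('n) * (emb * en u)"
    using AE_dom cgrad(2)[OF u] by eventually_elim (use cgrad(3)[OF u] in auto)
qed

lemma AE_eq_sq_int:
  assumes "AE x in \<mu>. u x = f x" "continuous_on \<Omega> f" "\<And>x. x \<in> \<Omega> \<Longrightarrow> \<bar>f x\<bar> \<le> B"
  shows "sq_int \<mu> u"
proof -
  have f: "sq_int \<mu> f" by (rule continuous_bounded_sq_int[OF assms(2,3)])
  have ae: "AE x in \<mu>. f x = u x" using assms(1) by eventually_elim simp
  show ?thesis by (rule sq_int_cong_AE[OF f AE_measurable[OF sq_int_measurable[OF f] ae] ae])
qed

lemma composition_sq_int: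
  assumes F: "strip_smooth \<Omega> F" and u: "u \<in> W"
  shows "sq_int \<mu> (\<lambda>x. F (x, weak_grad \<Omega> u x))"
proof -
  obtain B where B: "\<And>x q. x \<in> \<Omega> \<Longrightarrow> q \<in> cball 0 (CARD('n) * (emb * en u)) \<Longrightarrow> \<bar>F (x, q)\<bar> \<le> B"
    using strip_smooth_bounded[OF F] by blast
  show ?thesis
  proof (rule AE_eq_sq_int)
    show "AE x in \<mu>. F (x, weak_grad \<Omega> u x) = F (x, cgrad u x)" using cgrad(2)[OF u] by eventually_elim simp
    show "continuous_on \<Omega> (\<lambda>x. F (x, cgrad u x))" by (rule strip_smooth_continuous[OF F cgrad(1)[OF u]])
    show "\<bar>F (x, cgrad u x)\<bar> \<le> B" if "x \<in> \<Omega>" for x using B[OF that] cgrad(3)[OF u that] by simp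
  qed
qed

text \<open>In terms of continuous representatives, \<open>m\<close>, its first derivatives and the
  first and second derivatives of \<open>u\<close> are continuous and bounded, so the product and
  chain rules give a classical partial derivative \<open>?Y\<close>. Its existence is essential:
  otherwise the divergence in \<open>FP_part\<close> would be an arbitrary choice.\<close>

lemma flux_weak_deriv:
  assumes m: "m \<in> W" and u: "u \<in> W"
  shows "sq_int \<mu> (flux m u i)" "\<exists>Y. sq_int \<mu> Y \<and> has_weak_deriv \<Omega> (mi_unit i) (flux m u i) Y"
proof -
  let ?c = "crep (\<lambda>_. 0) m" and ?\<beta> = "\<lambda>l k. mi_unit l k + mi_unit i k :: nat"
  let ?w = "\<lambda>x. (axis i 1, \<chi> l. crep (?\<beta> l) u x) :: (real ^ 'n) \<times> (real ^ 'n)"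
  let ?Z = "\<lambda>x. \<Sum>b\<in>Basis. (?w x \<bullet> b) * dir_deriv b (Hp i) (x, cgrad u x)"
  let ?X = "\<lambda>x. ?c x * Hp i (x, cgrad u x)"
  let ?Y = "\<lambda>x. crep (mi_unit i) m x * Hp i (x, cgrad u x) + ?Z x * ?c x"
  let ?R = "CARD('n) * (emb * en u)"
  have o2: "2 * mi_order (?\<beta> l) + CARD('n) < 2 * p" for l
    using p_large mi_order_unit[of l] mi_order_unit[of i] by (simp add: mi_order_def sum.distrib)
  note c0 = crep_zero[OF m] and c1 = emb_crep[OF m unit_order(2)[of i]] and c2 = emb_crep[OF u o2]
  have pm: "has_partial \<Omega> i ?c (crep (mi_unit i) m)"
    using crep_partial[OF m, of "\<lambda>_. 0" i] p_large by (simp add: zero_order)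
  have pu: "has_partial \<Omega> i (crep (mi_unit l) u) (crep (?\<beta> l) u)" for l
    using crep_partial[OF u, of "mi_unit l" i] p_large by (simp add: mi_order_unit)
  have pH: "has_partial \<Omega> i (\<lambda>x. Hp i (x, cgrad u x)) ?Z"
    unfolding cgrad_def by (rule strip_smooth_chain[OF Hp open_dom pu])
  have part: "has_partial \<Omega> i ?X ?Y"
    using pm pH unfolding has_partial_def by (auto intro!: DERIV_mult[THEN DERIV_cong])
  have cw: "continuous_on \<Omega> ?w" using c2 by (intro continuous_on_Pair continuous_on_const continuous_on_vec_lambda) blast
  have cX: "continuous_on \<Omega> ?X"
    by (intro continuous_intros c0(1) strip_smooth_continuous[OF Hp cgrad(1)[OF u]])
  have cY: "continuous_on \<Omega> ?Y"
    using c1 by (intro continuous_intros cw c0(1) strip_smooth_continuous cgrad(1)[OF u] Hp strip_smooth_dir_deriv) auto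
  obtain B where B: "0 \<le> B" "\<And>x. x \<in> \<Omega> \<Longrightarrow> \<bar>Hp i (x, cgrad u x)\<bar> \<le> B"
    using strip_smooth_bounded[OF Hp[of i], of ?R] cgrad(3)[OF u] by auto
  have "\<forall>b\<in>Basis. \<exists>B. \<forall>x\<in>\<Omega>. \<bar>dir_deriv b (Hp i) (x, cgrad u x)\<bar> \<le> B"
  proof
    fix b :: "(real ^ 'n) \<times> (real ^ 'n)" assume "b \<in> Basis"
    from strip_smooth_bounded[OF strip_smooth_dir_deriv[OF Hp[of i] this], of ?R]
    obtain B where "\<And>x q. x \<in> \<Omega> \<Longrightarrow> q \<in> cball 0 ?R \<Longrightarrow> \<bar>dir_deriv b (Hp i) (x, q)\<bar> \<le> B" by blast
    then have "\<forall>x\<in>\<Omega>. \<bar>dir_deriv b (Hp i) (x, cgrad u x)\<bar> \<le> B" using cgrad(3)[OF u] by simp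
    then show "\<exists>B. \<forall>x\<in>\<Omega>. \<bar>dir_deriv b (Hp i) (x, cgrad u x)\<bar> \<le> B" by blast
  qed
  from bchoice[OF this] obtain D where D: "\<And>b x. b \<in> Basis \<Longrightarrow> x \<in> \<Omega> \<Longrightarrow> \<bar>dir_deriv b (Hp i) (x, cgrad u x)\<bar> \<le> D b"
    by blast
  define M where "M = emb * en m"
  have M: "0 \<le> M" by (simp add: M_def emb_nonneg en_nonneg)
  have bX: "\<bar>?X x\<bar> \<le> M * B" if "x \<in> \<Omega>" for x
    unfolding abs_mult M_def by (intro mult_mono c0(3) B that) (use M in \<open>auto simp: M_def\<close>)
  have bw: "norm (?w x) \<le> 1 + ?R" if x: "x \<in> \<Omega>" for x
  proof -
    have "norm (\<chi> l. crep (?\<beta> l) u x) \<le> (\<Sum>l\<in>UNIV. \<bar>crep (?\<beta> l) u x\<bar>)" using norm_le_l1_cart[of "\<chi> l. crep (?\<beta> l) u x"] by simp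
    also have "\<dots> \<le> (\<Sum>l\<in>(UNIV :: 'n set). emb * en u)" using c2 x by (intro sum_mono) auto
    finally have "norm (\<chi> l. crep (?\<beta> l) u x) \<le> ?R" by simp
    then show ?thesis using norm_Pair_le[of "axis i 1 :: real ^ 'n" "\<chi> l. crep (?\<beta> l) u x"] by simp
  qed
  have bZ: "\<bar>?Z x\<bar> \<le> sum D Basis * (1 + ?R)" if x: "x \<in> \<Omega>" for x
  proof -
    have "\<bar>?Z x\<bar> \<le> (\<Sum>b\<in>Basis. \<bar>dir_deriv b (Hp i) (x, cgrad u x)\<bar>) * norm (?w x)" by (rule sum_inner_mult_le_norm)
    also have "\<dots> \<le> sum D Basis * (1 + ?R)"
    proof (rule mult_mono[OF sum_mono bw[OF x]])
      show "\<bar>dir_deriv b (Hp i) (x, cgrad u x)\<bar> \<le> D b" if "b \<in> Basis" for b by (rule D[OF that x])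
      show "0 \<le> sum D Basis" by (rule sum_nonneg) (rule order_trans[OF abs_ge_zero D[OF _ x]])
    qed simp
    finally show ?thesis .
  qed
  have bY: "\<bar>?Y x\<bar> \<le> M * B + (sum D Basis * (1 + ?R)) * M" if x: "x \<in> \<Omega>" for x
  proof -
    have "\<bar>?Y x\<bar> \<le> \<bar>crep (mi_unit i) m x\<bar> * \<bar>Hp i (x, cgrad u x)\<bar> + \<bar>?Z x\<bar> * \<bar>?c x\<bar>"
      using abs_triangle_ineq unfolding abs_mult[symmetric] .
    also have "\<dots> \<le> M * B + (sum D Basis * (1 + ?R)) * M"
      using c1 x c0(3)[OF x] B(2)[OF x] bZ[OF x] M order_trans[OF abs_ge_zero bZ[OF x]]
      unfolding M_def by (intro add_mono mult_mono) auto
    finally show ?thesis .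
  qed
  have ae: "AE x in \<mu>. ?X x = flux m u i x"
    using cgrad(2)[OF u] c0(2) by eventually_elim (simp add: flux_def)
  note sX = continuous_bounded_sq_int[OF cX bX] and sY = continuous_bounded_sq_int[OF cY bY]
  show s: "sq_int \<mu> (flux m u i)"
    by (rule sq_int_cong_AE[OF sX AE_measurable[OF sq_int_measurable[OF sX] ae] ae])
  have "has_weak_deriv \<Omega> (mi_unit i) ?X ?Y" by (rule has_weak_deriv_classical[OF cX cY part bX bY])
  from has_weak_deriv_cong_AE[OF sX s sY sY this ae]
  show "\<exists>Y. sq_int \<mu> Y \<and> has_weak_deriv \<Omega> (mi_unit i) (flux m u i) Y" using sY by auto
qed

lemma FP_part_eq:
  "FP_part \<Omega> H \<phi> m u x = m x - (\<Sum>i\<in>UNIV. wd (mi_unit i) (flux m u i) x) - \<phi> x"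
proof -
  have "(\<lambda>y. (m y *\<^sub>R grad_p H y (weak_grad \<Omega> u y)) $ i) = flux m u i" for i
    by (simp add: fun_eq_iff flux_def Hp_def grad_p_component)
  then show ?thesis by (simp add: FP_part_def weak_div_def)
qed

lemma FP_sq_int:
  assumes "m \<in> W" "u \<in> W"
  shows "sq_int \<mu> (FP_part \<Omega> H \<phi> m u)"
proof -
  have "sq_int \<mu> (wd (mi_unit i) (flux m u i))" for i
    using flux_weak_deriv(2)[OF assms, of i] weak_deriv_sq_int by blast
  then show ?thesis
    unfolding FP_part_eq[abs_def] by (intro sq_int_diff sq_int_sum \<phi> sobolevD(1)[OF assms(1)])
qed

text \<open>The divergence is moved onto \<open>v\<close> without a boundary term, as
  \<open>v\<close> lies in \<open>sobolev0\<close>. What remains involves first derivatives only,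
  which makes the pairing easy to estimate.\<close>

lemma FP_integral:
  assumes m: "m \<in> W" and u: "u \<in> W" and v: "v \<in> W0"
  shows "(\<integral>x. FP_part \<Omega> H \<phi> m u x * v x \<partial>\<mu>)
    = (\<integral>x. (m x - \<phi> x) * v x \<partial>\<mu>) + (\<Sum>i\<in>UNIV. \<integral>x. flux m u i x * wd (mi_unit i) v x \<partial>\<mu>)"
proof -
  have vs: "sq_int \<mu> v" by (rule sobolevD(1)[OF sobolev0D[OF v]])
  let ?D = "\<lambda>i. wd (mi_unit i) (flux m u i)"
  have D: "sq_int \<mu> (?D i)" "has_weak_deriv \<Omega> (mi_unit i) (flux m u i) (?D i)" for i
    using flux_weak_deriv(2)[OF m u, of i] weak_deriv_sq_int weak_deriv_eq(1) by blast+
  have "(\<integral>x. FP_part \<Omega> H \<phi> m u x * v x \<partial>\<mu>) = (\<integral>x. (m x - \<phi> x) * v x - (\<Sum>i\<in>UNIV. ?D i x * v x) \<partial>\<mu>)"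
    by (simp add: FP_part_eq left_diff_distrib distrib_right diff_diff_eq add.commute sum_distrib_right)
  also have "\<dots> = (\<integral>x. (m x - \<phi> x) * v x \<partial>\<mu>) - (\<Sum>i\<in>UNIV. \<integral>x. ?D i x * v x \<partial>\<mu>)"
    using sq_int_mult[OF D(1) vs] sq_int_mult[OF sq_int_diff[OF sobolevD(1)[OF m] \<phi>] vs] by simp
  also have "\<dots> = (\<integral>x. (m x - \<phi> x) * v x \<partial>\<mu>) + (\<Sum>i\<in>UNIV. - (\<integral>x. ?D i x * v x \<partial>\<mu>))" by (simp add: sum_negf)
  also have "(\<lambda>i. - (\<integral>x. ?D i x * v x \<partial>\<mu>)) = (\<lambda>i. \<integral>x. flux m u i x * wd (mi_unit i) v x \<partial>\<mu>)"
    using weak_deriv_sobolev0[OF flux_weak_deriv(1)[OF m u] D v] p_pos by simp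
  finally show ?thesis .
qed

lemma g_sq_int:
  assumes m: "m \<in> W" and m0: "AE x in \<mu>. 0 \<le> m x"
  shows "sq_int \<mu> (\<lambda>x. g (m x))"
proof -
  note gc = smooth_half_line_Lipschitz(1)[OF g]
  have "bounded (g ` {0..emb * en m})" by (intro compact_imp_bounded compact_continuous_image continuous_on_subset[OF gc]) auto
  then obtain B where B: "\<And>t. t \<in> {0..emb * en m} \<Longrightarrow> \<bar>g t\<bar> \<le> B" unfolding bounded_pos by force
  show ?thesis
  proof (rule AE_eq_sq_int)
    \<comment> \<open>The positive part keeps the argument in the half line where \<open>g\<close>
      is continuous, at every point and not just almost everywhere.\<close>
    show "AE x in \<mu>. g (m x) = g (max 0 (crep (\<lambda>_. 0) m x))"
      using m0 crep_zero(2)[OF m] by eventually_elim simp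
    show "continuous_on \<Omega> (\<lambda>x. g (max 0 (crep (\<lambda>_. 0) m x)))"
      by (rule continuous_on_compose2[OF gc]) (auto intro!: continuous_intros crep_zero(1)[OF m])
    show "\<bar>g (max 0 (crep (\<lambda>_. 0) m x))\<bar> \<le> B" if "x \<in> \<Omega>" for x
      using B[of "max 0 (crep (\<lambda>_. 0) m x)"] crep_zero(3)[OF m that] by (auto simp: abs_le_iff)
  qed
qed

lemma HJ_sq_int:
  assumes "m \<in> W" "AE x in \<mu>. 0 \<le> m x" and u: "u \<in> W"
  shows "sq_int \<mu> (HJ_part \<Omega> H g V m u)"
proof -
  have "sq_int \<mu> (\<lambda>x. (-1) * u x - H x (weak_grad \<Omega> u x) + g (m x) - V x)"
    using composition_sq_int[OF H u] by (intro sq_int_diff sq_int_add sq_int_cmult g_sq_int assms V sobolevD(1)[OF u]) auto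
  then show ?thesis by (simp add: HJ_part_def[abs_def])
qed

end

context mfg_operator
begin

abbreviation "HJ \<equiv> HJ_part \<Omega> H g V"
abbreviation "FP \<equiv> FP_part \<Omega> H \<phi>"
abbreviation "F \<equiv> F_pairing \<Omega> H g V \<phi>"

lemma AE_weak_deriv_diff_bounds:
  assumes u: "u \<in> W" "u' \<in> W"
  shows "AE x in \<mu>. norm (weak_grad \<Omega> u x - weak_grad \<Omega> u' x) \<le> CARD('n) * (emb * en (\<lambda>x. u x - u' x))"
proof -
  have "AE x in \<mu>. \<forall>i. wd (mi_unit i) (\<lambda>x. u x - u' x) x = wd (mi_unit i) u x - wd (mi_unit i) u' x"
    using weak_deriv_diff[OF u unit_order(1)] by (intro eventually_all_finite) blast
  then show ?thesis
    using AE_bounds(3)[OF sobolev_diff[OF u]]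
    by eventually_elim (simp add: weak_grad_def vec_eq_iff minus_vec_def)
qed

text \<open>A pointwise Lipschitz bound on energy balls. \<open>m\<close> and \<open>m'\<close> are
  nonnegative, so that \<open>g\<close> is evaluated on a bounded interval of its domain.\<close>

definition Lipschitz_AE :: "real \<Rightarrow> real \<Rightarrow> ((real ^ 'n \<Rightarrow> real) \<Rightarrow> (real ^ 'n \<Rightarrow> real) \<Rightarrow> real ^ 'n \<Rightarrow> real) \<Rightarrow> bool" where
  "Lipschitz_AE R C G \<longleftrightarrow> 0 \<le> C \<and> (\<forall>m\<in>sobolev_nonneg p \<Omega>. \<forall>u\<in>W. \<forall>m'\<in>sobolev_nonneg p \<Omega>. \<forall>u'\<in>W.
    en m \<le> R \<longrightarrow> en m' \<le> R \<longrightarrow> en u \<le> R \<longrightarrow> en u' \<le> R \<longrightarrow>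
    (AE x in \<mu>. \<bar>G m u x - G m' u' x\<bar> \<le> C * (en (\<lambda>x. m x - m' x) + en (\<lambda>x. u x - u' x))))"

lemma flux_Lipschitz:
  assumes R: "0 \<le> R"
  shows "\<exists>C. Lipschitz_AE R C (\<lambda>m u. flux m u i)"
proof -
  let ?r = "CARD('n) * (emb * R)"
  obtain B where B: "0 \<le> B" "\<And>x q. x \<in> \<Omega> \<Longrightarrow> q \<in> cball 0 ?r \<Longrightarrow> \<bar>Hp i (x, q)\<bar> \<le> B"
    using strip_smooth_bounded[OF Hp[of i], of ?r] by blast
  obtain L where L: "0 \<le> L" "\<And>x q q'. x \<in> \<Omega> \<Longrightarrow> q \<in> cball 0 ?r \<Longrightarrow> q' \<in> cball 0 ?r \<Longrightarrow> \<bar>Hp i (x, q) - Hp i (x, q')\<bar> \<le> L * norm (q - q')"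
    using strip_smooth_Lipschitz[OF Hp[of i] open_dom, of ?r] by blast
  define C where "C = emb * B + emb * R * L * CARD('n) * emb"
  have C0: "0 \<le> emb * B" "0 \<le> emb * R * L * CARD('n) * emb" using emb_nonneg R B(1) L(1) by auto
  have "AE x in \<mu>. \<bar>flux m u i x - flux m' u' i x\<bar> \<le> C * (en (\<lambda>x. m x - m' x) + en (\<lambda>x. u x - u' x))"
    if m: "m \<in> W" "m' \<in> W" and u: "u \<in> W" "u' \<in> W"
      and le: "en m' \<le> R" "en u \<le> R" "en u' \<le> R" for m u m' u'
    using AE_dom AE_bounds(3)[OF u(1)] AE_bounds(3)[OF u(2)] AE_bounds(1)[OF m(2)] AE_bounds(1)[OF sobolev_diff[OF m]]
      AE_weak_deriv_diff_bounds[OF u]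
  proof eventually_elim
    case (elim x)
    let ?a = "en (\<lambda>x. m x - m' x)" and ?b = "en (\<lambda>x. u x - u' x)"
    let ?F = "Hp i (x, weak_grad \<Omega> u x)" and ?F' = "Hp i (x, weak_grad \<Omega> u' x)"
    have r: "CARD('n) * (emb * t) \<le> ?r" if "t \<le> R" for t by (intro mult_left_mono that emb_nonneg) auto
    have q: "weak_grad \<Omega> u x \<in> cball 0 ?r" "weak_grad \<Omega> u' x \<in> cball 0 ?r"
      using order_trans[OF elim(2) r[OF le(2)]] order_trans[OF elim(3) r[OF le(3)]] by simp_all
    have "\<bar>m' x\<bar> \<le> emb * R" using elim mult_left_mono[OF le(1) emb_nonneg] by simp
    moreover have "\<bar>?F - ?F'\<bar> \<le> L * (CARD('n) * (emb * ?b))"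
      using L(2)[OF elim(1) q] mult_left_mono[OF elim(6) L(1)] by simp
    ultimately have 2: "\<bar>m' x * (?F - ?F')\<bar> \<le> emb * R * L * CARD('n) * emb * ?b"
      using mult_mono[of "\<bar>m' x\<bar>" "emb * R" "\<bar>?F - ?F'\<bar>" "L * (CARD('n) * (emb * ?b))"] emb_nonneg R
      by (simp add: abs_mult mult.assoc)
    have 1: "\<bar>(m x - m' x) * ?F\<bar> \<le> emb * B * ?a"
      using mult_mono[OF elim(5) B(2)[OF elim(1) q(1)]] emb_nonneg en_nonneg by (simp add: abs_mult mult_ac)
    \<comment> \<open>One factor is varied at a time; the embedding bounds \<open>m'\<close> and
      both gradients.\<close>
    have "flux m u i x - flux m' u' i x = (m x - m' x) * ?F + m' x * (?F - ?F')" by (simp add: flux_def algebra_simps)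
    then have "\<bar>flux m u i x - flux m' u' i x\<bar> \<le> emb * B * ?a + emb * R * L * CARD('n) * emb * ?b" using 1 2 by linarith
    also have "\<dots> \<le> C * ?a + C * ?b"
      using C0 en_nonneg by (intro add_mono mult_right_mono) (auto simp: C_def)
    finally show ?case by (simp add: distrib_left)
  qed
  then show ?thesis using C0 by (intro exI[of _ C]) (auto simp: C_def Lipschitz_AE_def sobolev_nonneg_def)
qed

lemma HJ_Lipschitz:
  assumes R: "0 \<le> R"
  shows "\<exists>C. Lipschitz_AE R C (HJ)"
proof -
  let ?r = "CARD('n) * (emb * R)"
  obtain L where L: "0 \<le> L" "\<And>x q q'. x \<in> \<Omega> \<Longrightarrow> q \<in> cball 0 ?r \<Longrightarrow> q' \<in> cball 0 ?r \<Longrightarrow> \<bar>H x q - H x q'\<bar> \<le> L * norm (q - q')"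
    using strip_smooth_Lipschitz[OF H open_dom, of ?r] by auto
  obtain G where G: "0 \<le> G" "\<And>a b. a \<in> {0..emb * R} \<Longrightarrow> b \<in> {0..emb * R} \<Longrightarrow> \<bar>g a - g b\<bar> \<le> G * \<bar>a - b\<bar>"
    using smooth_half_line_Lipschitz(2)[OF g] by blast
  define C where "C = emb + L * (CARD('n) * emb) + G * emb"
  have C0: "0 \<le> emb" "0 \<le> L * (CARD('n) * emb)" "0 \<le> G * emb" using emb_nonneg L(1) G(1) by auto
  have "AE x in \<mu>. \<bar>HJ m u x - HJ m' u' x\<bar> \<le> C * (en (\<lambda>x. m x - m' x) + en (\<lambda>x. u x - u' x))"
    if m: "m \<in> W" "m' \<in> W" and u: "u \<in> W" "u' \<in> W"
      and pos: "AE x in \<mu>. 0 \<le> m x" "AE x in \<mu>. 0 \<le> m' x"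
      and le: "en m \<le> R" "en m' \<le> R" "en u \<le> R" "en u' \<le> R" for m u m' u'
    using AE_dom AE_bounds(3)[OF u(1)] AE_bounds(3)[OF u(2)] AE_bounds(1)[OF m(1)] AE_bounds(1)[OF m(2)]
      AE_bounds(1)[OF sobolev_diff[OF m]] AE_bounds(1)[OF sobolev_diff[OF u]] AE_weak_deriv_diff_bounds[OF u] pos
  proof eventually_elim
    case (elim x)
    let ?a = "en (\<lambda>x. m x - m' x)" and ?b = "en (\<lambda>x. u x - u' x)"
    have r: "CARD('n) * (emb * t) \<le> ?r" "emb * t \<le> emb * R" if "t \<le> R" for t
      by (intro mult_left_mono that emb_nonneg of_nat_0_le_iff)+
    have q: "weak_grad \<Omega> u x \<in> cball 0 ?r" "weak_grad \<Omega> u' x \<in> cball 0 ?r"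
      using order_trans[OF elim(2) r(1)[OF le(3)]] order_trans[OF elim(3) r(1)[OF le(4)]] by simp_all
    have mm: "m x \<in> {0..emb * R}" "m' x \<in> {0..emb * R}" using elim r[OF le(1)] r[OF le(2)] by auto
    have 1: "\<bar>H x (weak_grad \<Omega> u x) - H x (weak_grad \<Omega> u' x)\<bar> \<le> L * (CARD('n) * emb) * ?b"
      using L(2)[OF elim(1) q] mult_left_mono[OF elim(8) L(1)] by (simp add: mult.assoc)
    have 2: "\<bar>g (m x) - g (m' x)\<bar> \<le> G * emb * ?a"
      using G(2)[OF mm] mult_left_mono[OF elim(6) G(1)] by (simp add: mult.assoc)
    have "HJ m u x - HJ m' u' x
        = (g (m x) - g (m' x)) - (u x - u' x) - (H x (weak_grad \<Omega> u x) - H x (weak_grad \<Omega> u' x))"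
      by (simp add: HJ_part_def)
    then have "\<bar>HJ m u x - HJ m' u' x\<bar> \<le> G * emb * ?a + (emb + L * (CARD('n) * emb)) * ?b"
      using 1 2 elim(7) unfolding distrib_right by linarith
    also have "\<dots> \<le> C * ?a + C * ?b"
      using C0 en_nonneg by (intro add_mono mult_right_mono) (auto simp: C_def)
    finally show ?case by (simp add: distrib_left)
  qed
  then show ?thesis using C0 by (intro exI[of _ C]) (auto simp: C_def Lipschitz_AE_def sobolev_nonneg_def)
qed

text \<open>Supremum bounds for the differences of the coefficients and for the test functions are
  integrated over a domain of finite measure; \<open>?K\<close> is the measure of
  \<open>\<Omega>\<close>. The second test function lies in \<open>W0\<close> because
  \<open>FP_integral\<close> is applied to it.\<close>

lemma F_pairing_Lipschitz:
  assumes R: "0 \<le> R"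
  shows "\<exists>C\<ge>0. \<forall>m\<in>sobolev_nonneg p \<Omega>. \<forall>u\<in>W. \<forall>m'\<in>sobolev_nonneg p \<Omega>. \<forall>u'\<in>W.
    en m \<le> R \<longrightarrow> en m' \<le> R \<longrightarrow> en u \<le> R \<longrightarrow> en u' \<le> R \<longrightarrow> (\<forall>w\<in>W. \<forall>v\<in>W0.
    \<bar>F m u w v - F m' u' w v\<bar>
      \<le> C * (en (\<lambda>x. m x - m' x) + en (\<lambda>x. u x - u' x)) * (en w + en v))"
proof -
  obtain C1 where L1: "Lipschitz_AE R C1 (HJ)" using HJ_Lipschitz[OF R] by blast
  obtain C2 where L2: "\<And>i. Lipschitz_AE R (C2 i) (\<lambda>m u. flux m u i)" using flux_Lipschitz[OF R] by metis
  note C1 = L1[unfolded Lipschitz_AE_def, THEN conjunct1] L1[unfolded Lipschitz_AE_def, THEN conjunct2]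
  note C2 = L2[unfolded Lipschitz_AE_def, THEN conjunct1] L2[unfolded Lipschitz_AE_def, THEN conjunct2]
  let ?K = "(l2norm \<mu> (\<lambda>_. 1))\<^sup>2"
  define C where "C = ?K * emb * (C1 + emb + (\<Sum>i\<in>UNIV. C2 i))"
  have C0: "0 \<le> C" unfolding C_def by (intro mult_nonneg_nonneg add_nonneg_nonneg sum_nonneg emb_nonneg C1(1) C2(1)) auto
  have "\<bar>F m u w v - F m' u' w v\<bar>
      \<le> C * (en (\<lambda>x. m x - m' x) + en (\<lambda>x. u x - u' x)) * (en w + en v)"
    if nn: "m \<in> sobolev_nonneg p \<Omega>" "m' \<in> sobolev_nonneg p \<Omega>" and u: "u \<in> W" "u' \<in> W"
      and le: "en m \<le> R" "en m' \<le> R" "en u \<le> R" "en u' \<le> R" and w: "w \<in> W" and v: "v \<in> W0" for m u m' u' w v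
  proof -
    let ?s = "en (\<lambda>x. m x - m' x) + en (\<lambda>x. u x - u' x)"
    have s0: "0 \<le> ?s" by (intro add_nonneg_nonneg en_nonneg)
    have m: "m \<in> W" "m' \<in> W" "AE x in \<mu>. 0 \<le> m x" "AE x in \<mu>. 0 \<le> m' x"
      using nn by (auto simp: sobolev_nonneg_def)
    have vs: "v \<in> W" by (rule sobolev0D[OF v])
    note wS = sobolevD(1)[OF w] and vS = sobolevD(1)[OF vs] and vD = sobolevD(3)[OF vs unit_order(1)]
    note hj = HJ_sq_int[OF m(1,3) u(1)] HJ_sq_int[OF m(2,4) u(2)]
    note fl = flux_weak_deriv(1)[OF m(1) u(1)] flux_weak_deriv(1)[OF m(2) u(2)]
    note ms = sq_int_diff[OF sobolevD(1)[OF m(1)] \<phi>] sq_int_diff[OF sobolevD(1)[OF m(2)] \<phi>]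
    let ?I1 = "\<integral>x. (HJ m u x - HJ m' u' x) * w x \<partial>\<mu>"
    let ?I2 = "\<integral>x. (m x - m' x) * v x \<partial>\<mu>"
    let ?I3 = "\<lambda>i. \<integral>x. (flux m u i x - flux m' u' i x) * wd (mi_unit i) v x \<partial>\<mu>"
    have e1: "?I1 = (\<integral>x. HJ m u x * w x \<partial>\<mu>) - (\<integral>x. HJ m' u' x * w x \<partial>\<mu>)"
      using sq_int_mult[OF hj(1) wS] sq_int_mult[OF hj(2) wS] by (simp add: left_diff_distrib)
    have "?I2 = (\<integral>x. (m x - \<phi> x) * v x - (m' x - \<phi> x) * v x \<partial>\<mu>)" by (simp add: left_diff_distrib)
    then have e2: "?I2 = (\<integral>x. (m x - \<phi> x) * v x \<partial>\<mu>) - (\<integral>x. (m' x - \<phi> x) * v x \<partial>\<mu>)"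
      using sq_int_mult[OF ms(1) vS] sq_int_mult[OF ms(2) vS] by simp
    have e3: "?I3 i = (\<integral>x. flux m u i x * wd (mi_unit i) v x \<partial>\<mu>) - (\<integral>x. flux m' u' i x * wd (mi_unit i) v x \<partial>\<mu>)" for i
      using sq_int_mult[OF fl(1) vD] sq_int_mult[OF fl(2) vD] by (simp add: left_diff_distrib)
    have eq: "F m u w v - F m' u' w v = ?I1 + ?I2 + (\<Sum>i\<in>UNIV. ?I3 i)"
      unfolding F_pairing_def FP_integral[OF m(1) u(1) v] FP_integral[OF m(2) u(2) v] e1 e2 e3 sum_subtractf by simp
    have b1: "\<bar>?I1\<bar> \<le> ?K * (C1 * ?s) * (emb * en w)"
      using C1 nn u le s0 emb_nonneg en_nonneg sq_int_measurable[OF sq_int_diff[OF hj]] sq_int_measurable[OF wS] AE_bounds(1)[OF w]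
      by (intro integral_mult_bound mult_nonneg_nonneg) auto
    have b2: "\<bar>?I2\<bar> \<le> ?K * (emb * en (\<lambda>x. m x - m' x)) * (emb * en v)"
      by (intro integral_mult_bound sq_int_measurable sobolevD(1)[OF sobolev_diff[OF m(1,2)]] vS AE_bounds(1) sobolev_diff m vs mult_nonneg_nonneg emb_nonneg en_nonneg)
    have b3: "\<bar>?I3 i\<bar> \<le> ?K * (C2 i * ?s) * (emb * en v)" for i
      using C2 nn u le s0 emb_nonneg en_nonneg sq_int_measurable[OF sq_int_diff[OF fl]] sq_int_measurable[OF vD] AE_bounds(2)[OF vs]
      by (intro integral_mult_bound mult_nonneg_nonneg) auto
    have "\<bar>?I1 + ?I2 + (\<Sum>i\<in>UNIV. ?I3 i)\<bar> \<le> \<bar>?I1\<bar> + \<bar>?I2\<bar> + (\<Sum>i\<in>UNIV. \<bar>?I3 i\<bar>)"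
      using sum_abs[of ?I3 UNIV] by linarith
    also have "\<dots> \<le> ?K * (C1 * ?s) * (emb * (en w + en v)) + ?K * (emb * ?s) * (emb * (en w + en v)) + (\<Sum>i\<in>UNIV. ?K * (C2 i * ?s) * (emb * (en w + en v)))"
    proof (intro add_mono sum_mono)
      show "\<bar>?I1\<bar> \<le> ?K * (C1 * ?s) * (emb * (en w + en v))"
        by (rule order_trans[OF b1]) (intro mult_left_mono mult_nonneg_nonneg emb_nonneg C1(1) s0; simp add: en_nonneg)
      show "\<bar>?I2\<bar> \<le> ?K * (emb * ?s) * (emb * (en w + en v))"
        by (rule order_trans[OF b2], intro mult_mono mult_left_mono mult_nonneg_nonneg emb_nonneg s0) (simp_all add: en_nonneg emb_nonneg)
      show "\<bar>?I3 i\<bar> \<le> ?K * (C2 i * ?s) * (emb * (en w + en v))" for i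
        by (rule order_trans[OF b3]) (intro mult_left_mono mult_nonneg_nonneg emb_nonneg C2(1) s0; simp add: en_nonneg)
    qed
    also have "\<dots> = C * ?s * (en w + en v)"
      unfolding C_def by (simp add: sum_distrib_left sum_distrib_right distrib_left distrib_right mult_ac)
    finally show ?thesis unfolding eq .
  qed
  then show ?thesis using C0 by blast
qed

end

section \<open>Iterated Laplacians of smooth data; linearity and boundedness of the pairing\<close>

lemma dir_derivs_sum:
  fixes f :: "'i \<Rightarrow> 'a::euclidean_space \<Rightarrow> real"
  assumes S: "open S" and f: "\<And>i. i \<in> I \<Longrightarrow> smooth_on S (f i)" and bs: "set bs \<subseteq> Basis" and x: "x \<in> S"
  shows "dir_derivs bs (\<lambda>x. \<Sum>i\<in>I. f i x) x = (\<Sum>i\<in>I. dir_derivs bs (f i) x)"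
  using bs x
proof (induction bs arbitrary: x)
  case (Cons b bs)
  then have bs: "set bs \<subseteq> Basis" by simp
  \<comment> \<open>The induction hypothesis is available inside \<open>S\<close> only, so it is
    applied along the line for small \<open>t\<close>; the derivative at 0 depends on nothing
    else.\<close>
  have "\<forall>\<^sub>F t in nhds (0::real). x + t *\<^sub>R b \<in> S"
    using S Cons.prems(2) by (intro topological_tendstoD[where f = "\<lambda>t::real. x + t *\<^sub>R b" and l = x]) (auto intro!: tendsto_eq_intros filterlim_ident)
  then have "\<forall>\<^sub>F t in nhds 0. dir_derivs bs (\<lambda>x. \<Sum>i\<in>I. f i x) (x + t *\<^sub>R b) = (\<Sum>i\<in>I. dir_derivs bs (f i) (x + t *\<^sub>R b))"
    by eventually_elim (rule Cons.IH[OF bs])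
  then have "dir_derivs (b # bs) (\<lambda>x. \<Sum>i\<in>I. f i x) x = deriv (\<lambda>t. \<Sum>i\<in>I. dir_derivs bs (f i) (x + t *\<^sub>R b)) 0"
    by (simp add: dir_derivs_def dir_deriv_def deriv_cong_ev)
  also have "\<dots> = (\<Sum>i\<in>I. dir_derivs (b # bs) (f i) x)"
    using smooth_on_differentiable[OF f bs S Cons.prems(2)]
    by (intro DERIV_imp_deriv DERIV_sum) (simp add: dir_derivs_def DERIV_line)
  finally show ?case .
qed (simp add: dir_derivs_def)

lemma bounded_smooth_sum:
  assumes S: "open \<Omega>" and f: "\<And>i. i \<in> I \<Longrightarrow> bounded_smooth \<Omega> (f i)"
  shows "bounded_smooth \<Omega> (\<lambda>x. \<Sum>i\<in>I. f i x)"
proof -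
  have s: "\<And>i. i \<in> I \<Longrightarrow> smooth_on \<Omega> (f i)" using f by (simp add: bounded_smooth_def)
  have "dir_derivs bs (\<lambda>x. \<Sum>i\<in>I. f i x) differentiable_on \<Omega> \<and> (\<exists>B. \<forall>x\<in>\<Omega>. \<bar>dir_derivs bs (\<lambda>x. \<Sum>i\<in>I. f i x) x\<bar> \<le> B)"
    if bs: "set bs \<subseteq> Basis" for bs
  proof
    have eq: "dir_derivs bs (\<lambda>x. \<Sum>i\<in>I. f i x) x = (\<Sum>i\<in>I. dir_derivs bs (f i) x)" if "x \<in> \<Omega>" for x
      by (rule dir_derivs_sum[OF S s bs that])
    have d: "(\<lambda>x. \<Sum>i\<in>I. dir_derivs bs (f i) x) differentiable (at x)" if "x \<in> \<Omega>" for x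
      using smooth_on_differentiable[OF s bs S that] by (cases "finite I") (auto intro!: differentiable_sum)
    show "dir_derivs bs (\<lambda>x. \<Sum>i\<in>I. f i x) differentiable_on \<Omega>"
      unfolding differentiable_on_def
      by (rule ballI, rule differentiable_transform_within[OF differentiable_at_withinI[OF d] zero_less_one]) (simp_all add: eq)
    have "\<forall>i\<in>I. \<exists>B. \<forall>x\<in>\<Omega>. \<bar>dir_derivs bs (f i) x\<bar> \<le> B" using f bs by (simp add: bounded_smooth_def)
    from bchoice[OF this] obtain B where B: "\<And>i x. i \<in> I \<Longrightarrow> x \<in> \<Omega> \<Longrightarrow> \<bar>dir_derivs bs (f i) x\<bar> \<le> B i" by blast
    have "\<bar>dir_derivs bs (\<lambda>x. \<Sum>i\<in>I. f i x) x\<bar> \<le> sum B I" if "x \<in> \<Omega>" for x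
      unfolding eq[OF that] by (rule order_trans[OF sum_abs sum_mono[OF B[OF _ that]]])
    then show "\<exists>B. \<forall>x\<in>\<Omega>. \<bar>dir_derivs bs (\<lambda>x. \<Sum>i\<in>I. f i x) x\<bar> \<le> B" by blast
  qed
  then show ?thesis by (simp add: bounded_smooth_def smooth_on_def)
qed

lemma bounded_smooth_dir_derivs:
  assumes "bounded_smooth \<Omega> f" "set cs \<subseteq> Basis"
  shows "bounded_smooth \<Omega> (dir_derivs cs f)"
proof -
  have "dir_derivs bs (dir_derivs cs f) = dir_derivs (bs @ cs) f" for bs by (simp add: dir_derivs_def)
  then show ?thesis using assms by (simp add: bounded_smooth_def smooth_on_def)
qed

text \<open>Provides the square integrability of the source term built from
  \<open>\<xi>\<close>.\<close>

lemma bounded_smooth_laplacian: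
  fixes \<Omega> :: "(real ^ 'n) set"
  assumes "open \<Omega>" "bounded_smooth \<Omega> f"
  shows "bounded_smooth \<Omega> ((laplacian ^^ n) f)"
proof (induction n)
  case (Suc n)
  have "bounded_smooth \<Omega> (\<lambda>x. \<Sum>i\<in>UNIV. dir_derivs [axis i 1, axis i 1] ((laplacian ^^ n) f) x)"
    by (intro bounded_smooth_sum bounded_smooth_dir_derivs assms(1) Suc.IH) (auto simp: Basis_vec_def)
  then show ?case by (simp add: laplacian_def[abs_def])
qed (simp add: assms(2))

context mfg_operator
begin

lemma F_pairing_linear:
  assumes m: "m \<in> W" "AE x in \<mu>. 0 \<le> m x" and u: "u \<in> W"
    and w: "w \<in> W" "w' \<in> W" and v: "v \<in> W" "v' \<in> W"
  shows "F m u (\<lambda>x. a * w x + b * w' x) (\<lambda>x. a * v x + b * v' x)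
    = a * F m u w v + b * F m u w' v'"
proof -
  have "(\<integral>x. f x * (a * y x + b * y' x) \<partial>\<mu>) = a * (\<integral>x. f x * y x \<partial>\<mu>) + b * (\<integral>x. f x * y' x \<partial>\<mu>)"
    if f: "sq_int \<mu> f" and y: "y \<in> W" "y' \<in> W" for f y y'
  proof -
    have "(\<integral>x. f x * (a * y x + b * y' x) \<partial>\<mu>) = (\<integral>x. a * (f x * y x) + b * (f x * y' x) \<partial>\<mu>)" by (simp add: algebra_simps)
    also have "\<dots> = a * (\<integral>x. f x * y x \<partial>\<mu>) + b * (\<integral>x. f x * y' x \<partial>\<mu>)"
      using sq_int_mult[OF f sobolevD(1)[OF y(1)]] sq_int_mult[OF f sobolevD(1)[OF y(2)]] by simp
    finally show ?thesis .
  qed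
  note lin = this[OF HJ_sq_int[OF m u] w] this[OF FP_sq_int[OF m(1) u] v]
  show ?thesis unfolding F_pairing_def lin by (simp add: distrib_left)
qed

lemma F_pairing_bounded:
  assumes m: "m \<in> W" "AE x in \<mu>. 0 \<le> m x" and u: "u \<in> W"
    and w: "w \<in> W" and v: "v \<in> W"
  shows "\<bar>F m u w v\<bar> \<le> l2norm \<mu> (HJ m u) * en w + l2norm \<mu> (FP m u) * en v"
proof -
  have b: "\<bar>\<integral>x. f x * y x \<partial>\<mu>\<bar> \<le> l2norm \<mu> f * en y" if f: "sq_int \<mu> f" and y: "y \<in> W" for f y
    using l2_Cauchy_Schwarz[OF f sobolevD(1)[OF y]] mult_left_mono[OF l2norm_le_en(1) l2norm_nonneg, of \<mu> f y] by linarith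
  show ?thesis
    unfolding F_pairing_def using b[OF HJ_sq_int[OF m u] w] b[OF FP_sq_int[OF m(1) u] v] by linarith
qed

end

context sobolev_space
begin

lemma semi_inner_sobolev: "semi_inner (W) eform"
proof
  show "subspace (W)"
    by (auto simp: subspace_def plus_fun_def zero_fun_def scaleR_fun_def zero_sobolev sobolev_add sobolev_cmult)
  show "eform (x + y) z = eform x z + eform y z" if "x \<in> W" "y \<in> W" "z \<in> W" for x y z
    using eform_linear[OF that, of 1 1] by (simp add: plus_fun_def)
  show "eform (r *\<^sub>R x) z = r * eform x z" if "x \<in> W" "z \<in> W" for x z r
    using eform_linear[OF that(1,1,2), of r 0] by (simp add: scaleR_fun_def)
qed (auto simp: eform_nonneg eform_sym)

lemma semi_inner_sobolev_nrm: "semi_inner.nrm eform = en"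
  by (simp add: fun_eq_iff semi_inner.nrm_def[OF semi_inner_sobolev] en_def)

lemma eform_integral:
  assumes u: "u \<in> W" and v: "v \<in> W"
  shows "integrable \<mu> (\<lambda>x. u x * v x + (\<Sum>\<alpha>\<in>top. wd \<alpha> u x * wd \<alpha> v x))"
    and "(\<integral>x. u x * v x + (\<Sum>\<alpha>\<in>top. wd \<alpha> u x * wd \<alpha> v x) \<partial>\<mu>) = eform u v"
proof -
  have i: "integrable \<mu> (\<lambda>x. u x * v x)" "\<And>\<alpha>. \<alpha> \<in> top \<Longrightarrow> integrable \<mu> (\<lambda>x. wd \<alpha> u x * wd \<alpha> v x)"
    by (intro sq_int_mult sobolevD(1)[OF u] sobolevD(1)[OF v], intro sq_int_mult top_sq_int u v)
  show "integrable \<mu> (\<lambda>x. u x * v x + (\<Sum>\<alpha>\<in>top. wd \<alpha> u x * wd \<alpha> v x))"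
    by (intro Bochner_Integration.integrable_add Bochner_Integration.integrable_sum i)
  show "(\<integral>x. u x * v x + (\<Sum>\<alpha>\<in>top. wd \<alpha> u x * wd \<alpha> v x) \<partial>\<mu>) = eform u v"
    unfolding eform_def
    by (subst Bochner_Integration.integral_add[OF i(1) Bochner_Integration.integrable_sum[OF i(2)]], assumption,
        subst Bochner_Integration.integral_sum[OF i(2)]) auto
qed

text \<open>\<open>weak_solution\<close> contains differences of chosen weak derivatives, whereas
  the form contains the chosen weak derivative of the difference; these agree almost
  everywhere.\<close>

lemma eform_diff_integral:
  assumes m: "m \<in> W" and w: "w \<in> W"
  shows "(\<integral>x. \<epsilon> * m x * (w x - m x) + \<epsilon> * (\<Sum>\<alpha>\<in>top. wd \<alpha> m x * (wd \<alpha> w x - wd \<alpha> m x)) \<partial>\<mu>)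
    = \<epsilon> * eform m (\<lambda>x. w x - m x)"
proof -
  note d = sobolev_diff[OF w m]
  have "AE x in \<mu>. \<forall>\<alpha>\<in>top. wd \<alpha> (\<lambda>x. w x - m x) x = wd \<alpha> w x - wd \<alpha> m x"
    using weak_deriv_diff[OF w m] finite_top by (intro eventually_ball_finite) auto
  then have ae: "AE x in \<mu>. \<epsilon> * m x * (w x - m x) + \<epsilon> * (\<Sum>\<alpha>\<in>top. wd \<alpha> m x * (wd \<alpha> w x - wd \<alpha> m x))
      = \<epsilon> * (m x * (w x - m x) + (\<Sum>\<alpha>\<in>top. wd \<alpha> m x * wd \<alpha> (\<lambda>x. w x - m x) x))"
    by eventually_elim (simp add: distrib_left mult.assoc)
  note meas = sq_int_measurable[OF top_sq_int] sq_int_measurable[OF sobolevD(1)[of _ p]]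
  have "(\<integral>x. \<epsilon> * m x * (w x - m x) + \<epsilon> * (\<Sum>\<alpha>\<in>top. wd \<alpha> m x * (wd \<alpha> w x - wd \<alpha> m x)) \<partial>\<mu>)
      = (\<integral>x. \<epsilon> * (m x * (w x - m x) + (\<Sum>\<alpha>\<in>top. wd \<alpha> m x * wd \<alpha> (\<lambda>x. w x - m x) x)) \<partial>\<mu>)"
    by (rule integral_cong_AE[OF _ _ ae];
        intro borel_measurable_times borel_measurable_add borel_measurable_sum borel_measurable_diff borel_measurable_const
          meas m w d)
  also have "\<dots> = \<epsilon> * eform m (\<lambda>x. w x - m x)"
    unfolding eform_integral(2)[OF m d, symmetric] by (rule integral_mult_right_zero)
  finally show ?thesis .
qed

end

section \<open>The regularized problem\<close>

text \<open>\<open>\<zeta>\<close> stands for \<open>\<xi> + \<Delta>^(2k) \<xi>\<close>, which acts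
  as a fixed L2 source, and \<open>p\<close> for \<open>2 * k\<close>.\<close>

locale regularized_problem = mfg_operator \<Omega> p H g V \<phi>
  for \<Omega> :: "(real ^ 'n) set" and p H g V \<phi> +
  fixes h \<zeta> :: "real ^ 'n \<Rightarrow> real" and \<epsilon> :: real
  assumes h: "h \<in> sobolev p \<Omega>" and \<zeta>: "sq_int \<mu> \<zeta>" and \<epsilon>: "0 < \<epsilon>"
    and F_mono: "\<lbrakk>\<eta> \<in> sobolev_nonneg p \<Omega>; v \<in> sobolev_bdry p \<Omega> h; \<eta>' \<in> sobolev_nonneg p \<Omega>; v' \<in> sobolev_bdry p \<Omega> h\<rbrakk> \<Longrightarrow>
      F_pairing \<Omega> H g V \<phi> \<eta> v (\<lambda>x. \<eta> x - \<eta>' x) (\<lambda>x. v x - v' x)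
        - F_pairing \<Omega> H g V \<phi> \<eta>' v' (\<lambda>x. \<eta> x - \<eta>' x) (\<lambda>x. v x - v' x) \<ge> 0"
begin

definition lift :: "(real ^ 'n \<Rightarrow> real) \<Rightarrow> real ^ 'n \<Rightarrow> real" where
  "lift v = (\<lambda>x. h x + v x)"

definition D :: "((real ^ 'n \<Rightarrow> real) \<times> (real ^ 'n \<Rightarrow> real)) set" where
  "D = W \<times> W0"

definition K :: "((real ^ 'n \<Rightarrow> real) \<times> (real ^ 'n \<Rightarrow> real)) set" where
  "K = sobolev_nonneg p \<Omega> \<times> W0"

definition pform :: "(real ^ 'n \<Rightarrow> real) \<times> (real ^ 'n \<Rightarrow> real) \<Rightarrow> (real ^ 'n \<Rightarrow> real) \<times> (real ^ 'n \<Rightarrow> real) \<Rightarrow> real" where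
  "pform z w = eform (fst z) (fst w) + eform (snd z) (snd w)"

definition Aop :: "(real ^ 'n \<Rightarrow> real) \<times> (real ^ 'n \<Rightarrow> real) \<Rightarrow> (real ^ 'n \<Rightarrow> real) \<times> (real ^ 'n \<Rightarrow> real) \<Rightarrow> real" where
  "Aop z w = F (fst z) (lift (snd z)) (fst w) (snd w)
     + \<epsilon> * (eform (fst z) (fst w) + eform (lift (snd z)) (snd w)) + \<epsilon> * (\<integral>x. \<zeta> x * snd w x \<partial>\<mu>)"

sublocale S: semi_inner "W" eform
  rewrites "S.nrm = en"
  by (rule semi_inner_sobolev, rule semi_inner_sobolev_nrm)

sublocale P: semi_inner D pform
proof
  show "subspace D"
    by (auto simp: subspace_def D_def zero_prod_def plus_fun_def zero_fun_def scaleR_fun_def zero_sobolev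
        zero_sobolev0 sobolev_add sobolev_cmult sobolev0_add sobolev0_cmult)
  show "pform (x + y) z = pform x z + pform y z" if "x \<in> D" "y \<in> D" "z \<in> D" for x y z
    using that by (auto simp: pform_def D_def S.e_add sobolev0D)
  show "pform (r *\<^sub>R x) z = r * pform x z" if "x \<in> D" "z \<in> D" for x z r
    using that by (auto simp: pform_def D_def S.e_scale sobolev0D distrib_left)
qed (auto simp: pform_def eform_sym eform_nonneg)

lemma nrm_pair: "P.nrm z = sqrt ((en (fst z))\<^sup>2 + (en (snd z))\<^sup>2)"
  by (simp add: P.nrm_def pform_def en_def eform_nonneg)

lemma en_le_nrm: "en (fst z) \<le> P.nrm z" "en (snd z) \<le> P.nrm z"
  unfolding nrm_pair by (auto intro!: real_le_rsqrt)

lemma minus_fun_eq: "u - v = (\<lambda>x. u x - v x)" for u v :: "real ^ 'n \<Rightarrow> real"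
  by (simp add: fun_eq_iff)

lemma lift_sobolev: "v \<in> W \<Longrightarrow> lift v \<in> W"
  unfolding lift_def by (intro sobolev_add h)

lemma lift_bdry: "v \<in> W0 \<Longrightarrow> lift v \<in> sobolev_bdry p \<Omega> h"
  using lift_sobolev[OF sobolev0D] by (simp add: sobolev_bdry_def lift_def)

lemma lift_diff: "(\<lambda>x. lift v x - lift v' x) = (\<lambda>x. v x - v' x)"
  by (simp add: lift_def)

lemma KD: "K \<subseteq> D"
  by (auto simp: K_def D_def sobolev_nonneg_def)

lemma K_convex: "convex K"
  unfolding K_def
proof (rule convex_Times)
  show "convex (sobolev_nonneg p \<Omega>)"
  proof (rule convexI)
    fix a b and s t :: real
    assume ab: "a \<in> sobolev_nonneg p \<Omega>" "b \<in> sobolev_nonneg p \<Omega>" and st: "0 \<le> s" "0 \<le> t"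
    have "AE x in \<mu>. 0 \<le> a x" "AE x in \<mu>. 0 \<le> b x" using ab by (auto simp: sobolev_nonneg_def)
    then have "AE x in \<mu>. 0 \<le> s * a x + t * b x" by eventually_elim (use st in simp)
    then show "s *\<^sub>R a + t *\<^sub>R b \<in> sobolev_nonneg p \<Omega>"
      using ab by (auto simp: sobolev_nonneg_def plus_fun_def scaleR_fun_def sobolev_add sobolev_cmult)
  qed
  show "convex (W0)"
    by (rule convexI) (auto simp: plus_fun_def scaleR_fun_def sobolev0_add sobolev0_cmult)
qed

text \<open>Componentwise; the sign survives because energy limits are L2 limits, the boundary
  condition by \<open>sobolev0_closed\<close>.\<close>

lemma K_complete: "P.seq_complete K"
  unfolding P.seq_complete_def
proof (intro allI impI, elim conjE)
  fix s :: "nat \<Rightarrow> (real ^ 'n \<Rightarrow> real) \<times> (real ^ 'n \<Rightarrow> real)" assume sK: "\<forall>n. s n \<in> K" and Cauchy: "\<forall>r>0. \<exists>N. \<forall>m\<ge>N. \<forall>n\<ge>N. P.nrm (s m - s n) < r"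
  have s1: "fst (s n) \<in> W" "AE x in \<mu>. 0 \<le> fst (s n) x" and s0: "snd (s n) \<in> W0" for n
    using sK[rule_format, of n] by (auto simp: K_def sobolev_nonneg_def mem_Times_iff)
  have C: "\<exists>N. \<forall>i\<ge>N. \<forall>j\<ge>N. en (\<lambda>x. fst (s i) x - fst (s j) x) < e \<and> en (\<lambda>x. snd (s i) x - snd (s j) x) < e" if e: "e > 0" for e
  proof -
    obtain N where N: "\<And>m n. m \<ge> N \<Longrightarrow> n \<ge> N \<Longrightarrow> P.nrm (s m - s n) < e" using Cauchy e by meson
    have "en (fst (s i - s j)) < e \<and> en (snd (s i - s j)) < e" if "i \<ge> N" "j \<ge> N" for i j
      using le_less_trans[OF en_le_nrm(1) N[OF that]] le_less_trans[OF en_le_nrm(2) N[OF that]] ..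
    then show ?thesis by (intro exI[of _ N]) (simp add: minus_fun_eq)
  qed
  obtain m where m: "m \<in> W" "(\<lambda>n. en (\<lambda>x. fst (s n) x - m x)) \<longlonglongrightarrow> 0"
    using sobolev_complete[of "\<lambda>n. fst (s n)", OF s1(1)] C by meson
  obtain v where v: "v \<in> W" "(\<lambda>n. en (\<lambda>x. snd (s n) x - v x)) \<longlonglongrightarrow> 0"
    using sobolev_complete[of "\<lambda>n. snd (s n)", OF sobolev0D[OF s0]] C by meson
  have "(\<lambda>n. l2norm \<mu> (\<lambda>x. fst (s n) x - m x)) \<longlonglongrightarrow> 0"
    by (rule tendsto_sandwich[OF _ _ tendsto_const m(2)]) (simp_all add: l2norm_nonneg l2norm_le_en)
  from l2_limit_nonneg[OF sobolevD(1)[OF s1(1)] s1(2) sobolevD(1)[OF m(1)] this]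
  have l: "(m, v) \<in> K" using m(1) sobolev0_closed[OF s0 v] by (simp add: K_def sobolev_nonneg_def)
  have "(\<lambda>n. sqrt ((en (\<lambda>x. fst (s n) x - m x))\<^sup>2 + (en (\<lambda>x. snd (s n) x - v x))\<^sup>2)) \<longlonglongrightarrow> sqrt (0\<^sup>2 + 0\<^sup>2)"
    by (intro tendsto_intros m(2) v(2))
  then have "(\<lambda>n. P.nrm (s n - (m, v))) \<longlonglongrightarrow> 0" by (simp add: nrm_pair minus_fun_eq)
  then show "\<exists>l\<in>K. (\<lambda>n. P.nrm (s n - l)) \<longlonglongrightarrow> 0" using l by blast
qed

lemma Aop_bounded:
  assumes z: "z \<in> K"
  shows "\<exists>C. P.bounded_functional (Aop z) C"
proof -
  obtain m v where zmv: "z = (m, v)" by fastforce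
  have m: "m \<in> W" "AE x in \<mu>. 0 \<le> m x" and v: "v \<in> W0" using z by (auto simp: zmv K_def sobolev_nonneg_def)
  note u = lift_sobolev[OF sobolev0D[OF v]]
  have lin: "Aop z (a *\<^sub>R x + b *\<^sub>R y) = a * Aop z x + b * Aop z y" if "x \<in> D" "y \<in> D" for a b x y
  proof -
    obtain w1 v1 w2 v2 where xy: "x = (w1, v1)" "y = (w2, v2)" by fastforce
    have w: "w1 \<in> W" "w2 \<in> W" "v1 \<in> W" "v2 \<in> W"
      using that by (auto simp: xy D_def sobolev0D)
    have "(\<integral>x. \<zeta> x * (a * v1 x + b * v2 x) \<partial>\<mu>) = (\<integral>x. a * (\<zeta> x * v1 x) + b * (\<zeta> x * v2 x) \<partial>\<mu>)" by (simp add: algebra_simps)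
    also have "\<dots> = a * (\<integral>x. \<zeta> x * v1 x \<partial>\<mu>) + b * (\<integral>x. \<zeta> x * v2 x \<partial>\<mu>)"
      using sq_int_mult[OF \<zeta> sobolevD(1)[OF w(3)]] sq_int_mult[OF \<zeta> sobolevD(1)[OF w(4)]] by simp
    finally have 1: "(\<integral>x. \<zeta> x * (a * v1 x + b * v2 x) \<partial>\<mu>) = a * (\<integral>x. \<zeta> x * v1 x \<partial>\<mu>) + b * (\<integral>x. \<zeta> x * v2 x \<partial>\<mu>)" .
    have 2: "eform f (\<lambda>x. a * f1 x + b * f2 x) = a * eform f f1 + b * eform f f2"
      if "f \<in> W" "f1 \<in> W" "f2 \<in> W" for f f1 f2
      using eform_linear[OF that(2,3,1), of a b] by (simp add: eform_sym)
    show ?thesis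
      using F_pairing_linear[OF m u w, of a b] 2[OF m(1) w(1,2)] 2[OF u w(3,4)] 1
      by (simp add: Aop_def zmv xy plus_fun_def scaleR_fun_def algebra_simps)
  qed
  define C where "C = l2norm \<mu> (HJ m (lift v)) + l2norm \<mu> (FP m (lift v)) + \<epsilon> * en m + \<epsilon> * en (lift v) + \<epsilon> * l2norm \<mu> \<zeta>"
  have "\<bar>Aop z x\<bar> \<le> C * P.nrm x" if x: "x \<in> D" for x
  proof -
    obtain w1 v1 where xx: "x = (w1, v1)" by fastforce
    have w: "w1 \<in> W" "v1 \<in> W" using x by (auto simp: xx D_def sobolev0D)
    have n: "en w1 \<le> P.nrm x" "en v1 \<le> P.nrm x" using en_le_nrm[of x] by (auto simp: xx)
    have "\<bar>F m (lift v) w1 v1\<bar> \<le> l2norm \<mu> (HJ m (lift v)) * P.nrm x + l2norm \<mu> (FP m (lift v)) * P.nrm x"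
      by (rule order_trans[OF F_pairing_bounded[OF m u w]]) (intro add_mono mult_left_mono n l2norm_nonneg)
    moreover have "\<bar>\<epsilon> * eform m w1\<bar> \<le> \<epsilon> * (en m * P.nrm x)"
      using S.Cauchy_Schwarz[OF m(1) w(1)] mult_left_mono[OF n(1) en_nonneg[of m]] \<epsilon> by (simp add: abs_mult)
    moreover have "\<bar>\<epsilon> * eform (lift v) v1\<bar> \<le> \<epsilon> * (en (lift v) * P.nrm x)"
      using S.Cauchy_Schwarz[OF u w(2)] mult_left_mono[OF n(2) en_nonneg[of "lift v"]] \<epsilon> by (simp add: abs_mult)
    moreover have "\<bar>\<epsilon> * (\<integral>x. \<zeta> x * v1 x \<partial>\<mu>)\<bar> \<le> \<epsilon> * (l2norm \<mu> \<zeta> * P.nrm x)"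
      using l2_Cauchy_Schwarz[OF \<zeta> sobolevD(1)[OF w(2)]] mult_left_mono[OF order_trans[OF l2norm_le_en(1) n(2)] l2norm_nonneg[of \<mu> \<zeta>]] \<epsilon>
      by (simp add: abs_mult)
    ultimately show ?thesis unfolding C_def Aop_def zmv xx fst_conv snd_conv distrib_left distrib_right mult.assoc by linarith
  qed
  moreover have "Aop z (x + y) = Aop z x + Aop z y" if "x \<in> D" "y \<in> D" for x y using lin[OF that, of 1 1] by simp
  moreover have "Aop z (r *\<^sub>R x) = r * Aop z x" if "x \<in> D" for x r using lin[OF that that, of r 0] by simp
  ultimately show ?thesis unfolding P.bounded_functional_def by blast
qed

text \<open>The source term does not depend on the first argument, and the shift by \<open>h\<close>
  cancels in \<open>lift v - lift v'\<close>. The form contributes exactly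
  \<open>\<epsilon> * pform\<close>, the pairing a nonnegative amount.\<close>

lemma Aop_mono:
  assumes z: "z \<in> K" and w: "w \<in> K"
  shows "\<epsilon> * pform (z - w) (z - w) \<le> Aop z (z - w) - Aop w (z - w)"
proof -
  obtain m v m' v' where zw: "z = (m, v)" "w = (m', v')" by fastforce
  have m: "m \<in> sobolev_nonneg p \<Omega>" "m' \<in> sobolev_nonneg p \<Omega>" and v: "v \<in> W0" "v' \<in> W0"
    using z w by (auto simp: zw K_def)
  have ms: "m \<in> W" "m' \<in> W" using m by (auto simp: sobolev_nonneg_def)
  note vs = sobolev0D[OF v(1)] sobolev0D[OF v(2)]
  have "eform (m - m') (m - m') = eform m (m - m') - eform m' (m - m')" by (intro S.e_diff S.D_diff ms)
  moreover have "eform (v - v') (v - v') = eform (lift v) (v - v') - eform (lift v') (v - v')"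
    using S.e_diff[OF lift_sobolev[OF vs(1)] lift_sobolev[OF vs(2)] S.D_diff[OF vs]] by (simp add: minus_fun_eq lift_diff)
  moreover have "0 \<le> F m (lift v) (m - m') (v - v') - F m' (lift v') (m - m') (v - v')"
    using F_mono[OF m(1) lift_bdry[OF v(1)] m(2) lift_bdry[OF v(2)]] by (simp add: minus_fun_eq lift_diff)
  ultimately show ?thesis
    unfolding zw Aop_def pform_def diff_Pair fst_conv snd_conv distrib_left by (simp add: right_diff_distrib)
qed

lemma Aop_Lipschitz:
  "\<exists>L. \<forall>z\<in>K. \<forall>w\<in>K. P.nrm z \<le> R \<longrightarrow> P.nrm w \<le> R \<longrightarrow> (\<forall>d\<in>D. \<bar>Aop z d - Aop w d\<bar> \<le> L * P.nrm (z - w) * P.nrm d)"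
proof -
  \<comment> \<open>Radius for the shifted functions \<open>lift v\<close>, whose energy norm is at
    most \<open>en h + en v\<close>.\<close>
  let ?R = "en h + \<bar>R\<bar>"
  have "0 \<le> ?R" using en_nonneg by simp
  from F_pairing_Lipschitz[OF this] obtain C where C: "0 \<le> C" "\<forall>m\<in>sobolev_nonneg p \<Omega>. \<forall>u\<in>W. \<forall>m'\<in>sobolev_nonneg p \<Omega>. \<forall>u'\<in>W.
    en m \<le> ?R \<longrightarrow> en m' \<le> ?R \<longrightarrow> en u \<le> ?R \<longrightarrow> en u' \<le> ?R \<longrightarrow> (\<forall>w\<in>W. \<forall>v\<in>W0.
    \<bar>F m u w v - F m' u' w v\<bar>
      \<le> C * (en (\<lambda>x. m x - m' x) + en (\<lambda>x. u x - u' x)) * (en w + en v))" by blast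
  \<comment> \<open>The 4 comes from bounding the sum of two component norms by
    \<open>2 * P.nrm\<close>, once for \<open>z - w\<close> and once for \<open>d\<close>.\<close>
  have "\<bar>Aop z d - Aop w d\<bar> \<le> (4 * C + \<epsilon>) * P.nrm (z - w) * P.nrm d"
    if z: "z \<in> K" "P.nrm z \<le> R" and w: "w \<in> K" "P.nrm w \<le> R" and d: "d \<in> D" for z w d
  proof -
    obtain m v m' v' w1 v1 where eq: "z = (m, v)" "w = (m', v')" "d = (w1, v1)" by fastforce
    have m: "m \<in> sobolev_nonneg p \<Omega>" "m' \<in> sobolev_nonneg p \<Omega>" and v: "v \<in> W0" "v' \<in> W0"
      and d1: "w1 \<in> W" "v1 \<in> W0"
      using z w d by (auto simp: eq K_def D_def)
    have ms: "m \<in> W" "m' \<in> W" using m by (auto simp: sobolev_nonneg_def)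
    note vs = sobolev0D[OF v(1)] sobolev0D[OF v(2)] sobolev0D[OF d1(2)]
    note u = lift_sobolev[OF vs(1)] lift_sobolev[OF vs(2)]
    have le: "en m \<le> \<bar>R\<bar>" "en v \<le> \<bar>R\<bar>" "en m' \<le> \<bar>R\<bar>" "en v' \<le> \<bar>R\<bar>"
      using en_le_nrm[of z] en_le_nrm[of w] z(2) w(2) by (auto simp: eq)
    have lt: "en (lift f) \<le> en h + en f" if "f \<in> W" for f
      using S.nrm_triangle[OF h that] by (simp add: lift_def plus_fun_def)
    have nd: "en w1 + en v1 \<le> 2 * P.nrm d" using en_le_nrm[of d] by (simp add: eq)
    have nzw: "en (\<lambda>x. m x - m' x) + en (\<lambda>x. v x - v' x) \<le> 2 * P.nrm (z - w)"
      using en_le_nrm[of "z - w"] by (simp add: eq minus_fun_eq)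
    have b: "en m \<le> ?R" "en m' \<le> ?R" "en (lift v) \<le> ?R" "en (lift v') \<le> ?R"
      using le lt[OF vs(1)] lt[OF vs(2)] en_nonneg[of h] by linarith+
    have "\<bar>F m (lift v) w1 v1 - F m' (lift v') w1 v1\<bar>
        \<le> C * (en (\<lambda>x. m x - m' x) + en (\<lambda>x. v x - v' x)) * (en w1 + en v1)"
      by (rule C(2)[rule_format, OF m(1) u(1) m(2) u(2) b d1, unfolded lift_diff])
    also have "\<dots> \<le> C * (2 * P.nrm (z - w)) * (2 * P.nrm d)"
      using C(1) en_nonneg by (intro mult_mono mult_left_mono nzw nd) (auto simp: nrm_pair)
    finally have 1: "\<bar>F m (lift v) w1 v1 - F m' (lift v') w1 v1\<bar>
        \<le> 4 * C * P.nrm (z - w) * P.nrm d" by simp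
    have zD: "z \<in> D" "w \<in> D" using z w KD by auto
    have "eform (lift v) v1 - eform (lift v') v1 = eform (v - v') v1"
      using S.e_diff[OF u vs(3)] by (simp add: minus_fun_eq lift_diff)
    then have e: "Aop z d - Aop w d = F m (lift v) w1 v1 - F m' (lift v') w1 v1 + \<epsilon> * pform (z - w) d"
      using S.e_diff[OF ms d1(1)] unfolding Aop_def eq pform_def diff_Pair fst_conv snd_conv distrib_left
      by (simp only: right_diff_distrib flip: \<open>eform (lift v) v1 - eform (lift v') v1 = eform (v - v') v1\<close>)
    have "\<bar>\<epsilon> * pform (z - w) d\<bar> \<le> \<epsilon> * P.nrm (z - w) * P.nrm d"
      using P.Cauchy_Schwarz[OF P.D_diff[OF zD] d] \<epsilon> by (simp add: abs_mult mult.assoc)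
    then show ?thesis unfolding e distrib_right using 1 by linarith
  qed
  then show ?thesis by blast
qed

definition solution :: "(real ^ 'n \<Rightarrow> real) \<Rightarrow> (real ^ 'n \<Rightarrow> real) \<Rightarrow> bool" where
  "solution m u \<longleftrightarrow> m \<in> sobolev_nonneg p \<Omega> \<and> u \<in> sobolev_bdry p \<Omega> h \<and>
     (\<forall>w\<in>sobolev_nonneg p \<Omega>. 0 \<le> (\<integral>x. HJ m u x * (w x - m x) \<partial>\<mu>) + \<epsilon> * eform m (\<lambda>x. w x - m x)) \<and>
     (\<forall>v\<in>W0. (\<integral>x. FP m u x * v x \<partial>\<mu>) + \<epsilon> * eform u v + \<epsilon> * (\<integral>x. \<zeta> x * v x \<partial>\<mu>) = 0)"

lemma eform_zero: "u \<in> W \<Longrightarrow> eform u (\<lambda>_. 0) = 0"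
  using eform_linear[of u u u 0 0] by (simp add: eform_sym)

text \<open>Varying the first component alone gives the inequality for \<open>m\<close>. The second
  component ranges over a linear space, so the variations \<open>d\<close> and \<open>- d\<close>
  turn its inequality into an equation.\<close>

theorem solution_exists: "\<exists>m u. solution m u"
proof -
  have K0: "((\<lambda>_. 0), (\<lambda>_. 0)) \<in> K"
    by (simp add: K_def sobolev_nonneg_def zero_sobolev zero_sobolev0)
  have "\<forall>z\<in>K. \<exists>C. P.bounded_functional (Aop z) C" using Aop_bounded by blast
  from bchoice[OF this] obtain C where C: "\<And>z. z \<in> K \<Longrightarrow> P.bounded_functional (Aop z) (C z)" by blast
  obtain z where z: "z \<in> K" "\<And>w. w \<in> K \<Longrightarrow> 0 \<le> Aop z (w - z)"
    using P.vi_exists[OF KD K_convex _ K_complete C \<epsilon> Aop_mono Aop_Lipschitz] K0 by blast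
  obtain m v where eq: "z = (m, v)" by fastforce
  have m: "m \<in> sobolev_nonneg p \<Omega>" "m \<in> W" and v: "v \<in> W0" using z(1) by (auto simp: eq K_def sobolev_nonneg_def)
  note u = lift_sobolev[OF sobolev0D[OF v]]
  have "0 \<le> (\<integral>x. HJ m (lift v) x * (w x - m x) \<partial>\<mu>) + \<epsilon> * eform m (\<lambda>x. w x - m x)"
    if "w \<in> sobolev_nonneg p \<Omega>" for w
    using z(2)[of "(w, v)"] that v eform_zero[OF u] by (simp add: K_def eq Aop_def F_pairing_def minus_fun_eq zero_fun_def)
  moreover have "(\<integral>x. FP m (lift v) x * d x \<partial>\<mu>) + \<epsilon> * eform (lift v) d + \<epsilon> * (\<integral>x. \<zeta> x * d x \<partial>\<mu>) = 0"
    if d: "d \<in> W0" for d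
  proof -
    have "(0, d) \<in> D" using d by (simp add: D_def zero_fun_def zero_sobolev)
    then have "Aop z (- 1 *\<^sub>R (0, d)) = - 1 * Aop z (0, d)" using C[OF z(1)] unfolding P.bounded_functional_def by blast
    moreover have "(m, v + d) - z = (0, d)" "(m, v - d) - z = - 1 *\<^sub>R (0, d)" by (simp_all add: eq)
    moreover have "(m, v + d) \<in> K" "(m, v - d) \<in> K"
      using m v d by (auto simp: K_def plus_fun_def minus_fun_eq sobolev0_add sobolev0_diff)
    ultimately have "Aop z (0, d) = 0" using z(2)[of "(m, v + d)"] z(2)[of "(m, v - d)"] by simp
    then show ?thesis using eform_zero[OF m(2)] by (simp add: eq Aop_def F_pairing_def zero_fun_def distrib_left)
  qed
  ultimately have "solution m (lift v)" using m lift_bdry[OF v] by (simp add: solution_def)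
  then show ?thesis by blast
qed

text \<open>Each inequality is tested with the density of the other solution, and the equations with
  the difference of the value functions, which lies in \<open>W0\<close> since both have boundary
  data \<open>h\<close>. Together with the monotonicity of the pairing, the sum leaves
  \<open>\<epsilon>\<close> times the energy of the differences nonpositive.\<close>

theorem solution_unique:
  assumes "solution m u" "solution m' u'"
  shows "AE x in \<mu>. m' x = m x \<and> u' x = u x"
proof -
  have nn: "m \<in> sobolev_nonneg p \<Omega>" "m' \<in> sobolev_nonneg p \<Omega>" and bd: "u \<in> sobolev_bdry p \<Omega> h" "u' \<in> sobolev_bdry p \<Omega> h"
    using assms by (auto simp: solution_def)
  have m: "m \<in> W" "m' \<in> W" and u: "u \<in> W" "u' \<in> W"
    using nn bd by (auto simp: sobolev_nonneg_def sobolev_bdry_def)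
  let ?w = "\<lambda>x. m x - m' x" and ?v = "\<lambda>x. u x - u' x"
  have "(\<lambda>x. (u x - h x) - (u' x - h x)) \<in> W0" by (rule sobolev0_diff) (use bd in \<open>auto simp: sobolev_bdry_def\<close>)
  then have v: "?v \<in> W0" by simp
  have w: "?w \<in> W" by (intro sobolev_diff m)
  have neg: "eform m (\<lambda>x. m' x - m x) = - eform m ?w" "(\<integral>x. HJ m u x * (m' x - m x) \<partial>\<mu>) = - (\<integral>x. HJ m u x * ?w x \<partial>\<mu>)"
    using eform_linear[OF w w m(1), of "-1" 0] by (simp_all add: eform_sym flip: Bochner_Integration.integral_minus mult_minus_right)
  have 1: "0 \<le> - (\<integral>x. HJ m u x * ?w x \<partial>\<mu>) - \<epsilon> * eform m ?w"
  proof -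
    have "0 \<le> (\<integral>x. HJ m u x * (m' x - m x) \<partial>\<mu>) + \<epsilon> * eform m (\<lambda>x. m' x - m x)"
      using assms(1) nn(2) unfolding solution_def by blast
    then show ?thesis unfolding neg by linarith
  qed
  have 2: "0 \<le> (\<integral>x. HJ m' u' x * ?w x \<partial>\<mu>) + \<epsilon> * eform m' ?w"
    using assms(2) nn(1) unfolding solution_def by blast
  have 3: "(\<integral>x. FP m u x * ?v x \<partial>\<mu>) + \<epsilon> * eform u ?v = (\<integral>x. FP m' u' x * ?v x \<partial>\<mu>) + \<epsilon> * eform u' ?v"
    using assms v unfolding solution_def by fastforce
  have "\<epsilon> * (eform ?w ?w + eform ?v ?v) = \<epsilon> * eform m ?w - \<epsilon> * eform m' ?w + (\<epsilon> * eform u ?v - \<epsilon> * eform u' ?v)"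
    using S.e_diff[OF m w] S.e_diff[OF u sobolev0D[OF v]] by (simp add: minus_fun_eq distrib_left right_diff_distrib)
  also have "\<dots> \<le> 0"
    using 1 2 3 F_mono[OF nn(1) bd(1) nn(2) bd(2)] unfolding F_pairing_def by linarith
  finally have "eform ?w ?w + eform ?v ?v \<le> 0" using \<epsilon> by (simp add: mult_le_0_iff)
  then have "en ?w = 0" "en ?v = 0" using eform_nonneg[of ?w] eform_nonneg[of ?v] by (auto simp: en_def)
  then have "l2norm \<mu> ?w = 0" "l2norm \<mu> ?v = 0"
    using l2norm_le_en(1)[of ?w] l2norm_le_en(1)[of ?v] l2norm_nonneg[of \<mu>] by (auto intro: order_antisym)
  from l2norm_eq_0_AE[OF sobolevD(1)[OF w] this(1)] l2norm_eq_0_AE[OF sobolevD(1)[OF sobolev0D[OF v]] this(2)]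
  show ?thesis by eventually_elim simp
qed

lemma weak_solution_iff:
  assumes p: "p = 2 * k" and \<xi>: "\<And>x. \<zeta> x = \<xi> x + (laplacian ^^ (2 * k)) \<xi> x"
  shows "weak_solution \<Omega> k \<epsilon> H g V \<phi> \<xi> h m u \<longleftrightarrow> solution m u"
proof -
  have E2: "(\<integral>x. \<epsilon> * m x * (w x - m x) + \<epsilon> * (\<Sum>\<alpha> | mi_order \<alpha> = 2 * k. wd \<alpha> m x * (wd \<alpha> w x - wd \<alpha> m x)) \<partial>\<mu>)
      = \<epsilon> * eform m (\<lambda>x. w x - m x)" if "m \<in> W" "w \<in> sobolev_nonneg p \<Omega>" for w
    using eform_diff_integral[OF that(1), of w \<epsilon>] that(2) by (simp add: sobolev_nonneg_def p)
  have E3: "(\<integral>x. \<epsilon> * (u x * v x + (\<Sum>\<alpha> | mi_order \<alpha> = 2 * k. wd \<alpha> u x * wd \<alpha> v x))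
        + \<epsilon> * (\<xi> x + (laplacian ^^ (2 * k)) \<xi> x) * v x \<partial>\<mu>) = \<epsilon> * eform u v + \<epsilon> * (\<integral>x. \<zeta> x * v x \<partial>\<mu>)"
    if u: "u \<in> W" and v: "v \<in> W0" for v
  proof -
    note vs = sobolev0D[OF v]
    have "(\<integral>x. \<epsilon> * (u x * v x + (\<Sum>\<alpha>\<in>top. wd \<alpha> u x * wd \<alpha> v x)) + \<epsilon> * (\<zeta> x * v x) \<partial>\<mu>)
        = \<epsilon> * eform u v + \<epsilon> * (\<integral>x. \<zeta> x * v x \<partial>\<mu>)"
      unfolding eform_integral(2)[OF u vs, symmetric]
      by (subst Bochner_Integration.integral_add)
        (use eform_integral(1)[OF u vs] sq_int_mult[OF \<zeta> sobolevD(1)[OF vs]] in \<open>auto intro: integrable_mult_right\<close>)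
    then show ?thesis by (simp add: \<xi> p mult.assoc)
  qed
  show ?thesis
    unfolding weak_solution_def solution_def using E2 E3
    by (auto simp: p sobolev_nonneg_def sobolev_bdry_def add.assoc)
qed

end

theorem theorem1p5:
  fixes \<Omega> :: "(real ^ 'n) set"
    and \<gamma> \<epsilon> :: real and k :: nat
    and V \<phi> \<xi> h :: "real ^ 'n \<Rightarrow> real"
    and g :: "real \<Rightarrow> real"
    and H :: "real ^ 'n \<Rightarrow> real ^ 'n \<Rightarrow> real"
  assumes "open \<Omega>" and "bounded \<Omega>" and "smooth_boundary \<Omega>"
    and "\<gamma> > 1"
    and "2 * real k > real CARD('n) / 2 + 2"
    and "0 < \<epsilon>" and "\<epsilon> < 1"
    and "smooth_on_closure \<Omega> V" and "smooth_on_closure \<Omega> \<phi>"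
    and "smooth_on_closure \<Omega> \<xi>" and "smooth_on_closure \<Omega> h"
    and "smooth_on_closure {0<..} g"
    and "smooth_on_closure (\<Omega> \<times> UNIV) (\<lambda>(x, p). H x p)"
    and "mono_on {0..} g"
    and "\<forall>x\<in>\<Omega>. \<phi> x \<ge> 0"
    and "(\<integral>x. \<phi> x \<partial>lebesgue_on \<Omega>) = 1"
    and A1: "\<exists>C1>0. \<forall>x\<in>\<Omega>. \<forall>p. - H x p + grad_p H x p \<bullet> p \<ge> 1 / C1 * norm p powr \<gamma> - C1"
    and A2: "\<exists>C2>0. \<forall>x\<in>\<Omega>. \<forall>p. H x p \<ge> 1 / C2 * norm p powr \<gamma> - C2"
    and A3: "\<exists>C3>0. \<forall>x\<in>\<Omega>. \<forall>p. norm (grad_p H x p) \<le> C3 * norm p powr (\<gamma> - 1) + C3"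
    (* In A4 and A5, m g(m) has an integrable negative part. If m g(m) is not integrable, its
       integral is + infinity and the inequality holds trivially, hence the guard. *)
    and A4: "\<forall>\<delta>>0. \<exists>C\<delta>>0. \<forall>m.
        integrable (lebesgue_on \<Omega>) m \<and> (AE x in lebesgue_on \<Omega>. m x \<ge> 0) \<and>
        integrable (lebesgue_on \<Omega>) (\<lambda>x. m x * g (m x)) \<longrightarrow>
        max (\<integral>x. \<bar>g (m x)\<bar> \<partial>lebesgue_on \<Omega>) (\<integral>x. m x \<partial>lebesgue_on \<Omega>)
          \<le> \<delta> * (\<integral>x. m x * g (m x) \<partial>lebesgue_on \<Omega>) + C\<delta>"
    and A5: "\<exists>C5>0. \<forall>m.
        integrable (lebesgue_on \<Omega>) m \<and> (AE x in lebesgue_on \<Omega>. m x \<ge> 0) \<and>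
        integrable (lebesgue_on \<Omega>) (\<lambda>x. m x * g (m x)) \<longrightarrow>
        (\<integral>x. m x * g (m x) \<partial>lebesgue_on \<Omega>) \<ge> - C5"
    and A6: "\<forall>\<eta>1 \<in> sobolev_nonneg (2 * k) \<Omega>. \<forall>v1 \<in> sobolev_bdry (2 * k) \<Omega> h.
             \<forall>\<eta>2 \<in> sobolev_nonneg (2 * k) \<Omega>. \<forall>v2 \<in> sobolev_bdry (2 * k) \<Omega> h.
        F_pairing \<Omega> H g V \<phi> \<eta>1 v1 (\<lambda>x. \<eta>1 x - \<eta>2 x) (\<lambda>x. v1 x - v2 x)
      - F_pairing \<Omega> H g V \<phi> \<eta>2 v2 (\<lambda>x. \<eta>1 x - \<eta>2 x) (\<lambda>x. v1 x - v2 x) \<ge> 0"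
  shows "\<exists>m u. weak_solution \<Omega> k \<epsilon> H g V \<phi> \<xi> h m u \<and>
           (\<forall>m' u'. weak_solution \<Omega> k \<epsilon> H g V \<phi> \<xi> h m' u' \<longrightarrow>
              (AE x in lebesgue_on \<Omega>. m' x = m x \<and> u' x = u x))"
proof -
  define p where "p = 2 * k"
  \<comment> \<open>With \<open>p = 2k\<close> the assumption \<open>2k > d/2 + 2\<close>, doubled,
    is the embedding condition for second derivatives.\<close>
  have p: "4 + CARD('n) < 2 * p" using \<open>2 * real k > real CARD('n) / 2 + 2\<close> unfolding p_def by linarith
  interpret bounded_open \<Omega> by unfold_locales fact+
  have b: "bounded_smooth \<Omega> f" if "smooth_on_closure \<Omega> f" for f by (rule bounded_smooth_closure[OF bounded_dom that])
  have sq: "sq_int \<mu> f" if "bounded_smooth \<Omega> f" for f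
    using bounded_smooth_derivs_sq_int[OF that, of "[]"] by (simp add: dir_derivs_def)
  interpret regularized_problem \<Omega> p H g V \<phi> h "\<lambda>x. \<xi> x + (laplacian ^^ (2 * k)) \<xi> x" \<epsilon>
  proof unfold_locales
    show "smooth_boundary \<Omega>" by fact
    show "0 < p" using p by simp
    show "strip_smooth \<Omega> (\<lambda>(x, q). H x q)" by (rule strip_smooth_closure[OF bounded_dom]) fact
    show "sq_int \<mu> V" "sq_int \<mu> \<phi>" by (intro sq b; fact)+
    show "h \<in> sobolev p \<Omega>" by (rule bounded_smooth_sobolev[OF b]) fact
    show "sq_int \<mu> (\<lambda>x. \<xi> x + (laplacian ^^ (2 * k)) \<xi> x)"
      by (intro sq_int_add sq bounded_smooth_laplacian open_dom b) fact+
  qed (use p A6 assms in \<open>auto simp: p_def\<close>)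
  note iff = weak_solution_iff[OF p_def refl]
  obtain m u where "solution m u" using solution_exists by blast
  then show ?thesis unfolding iff using solution_unique by blast
qed

end
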